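(* Let $M^{m+1}$ be a connected Riemannian manifold with $m\geq 2$. Then $M^{m+1}$ is a space form (i.e., has constant sectional curvature) if and only if, for every regular $C^2$ curve $\alpha$ lying on a geodesic sphere of sufficiently small radius, there exist constants $a_1,\dots,a_m$ such that $$\sum_{i=1}^m a_i\kappa_i(s)=H(s),\qquad \xi=\sum_{i=1}^m a_i\,\mathbf{n}_i\quad\text{along }\alpha,$$ where $H(s)$ is the mean curvature, at $\alpha(s)$, of the geodesic sphere containing $\alpha$, $\xi$ is a unit vector field normal to that geodesic sphere, and $\kappa_1,\dots,\kappa_m$ are the curvatures associated with a rotation minimizing frame $\{\mathbf{t}=\alpha',\mathbf{n}_1,\dots,\mathbf{n}_m\}$ along $\alpha$.
   Context: $M^{m+1}$ is an $(m+1)$-dimensional Riemannian manifold (of class at least $C^3$) with metric $\langle\cdot,\cdot\rangle$ and Levi-Civita connection $\nabla$. Curves are parametrized by arc-length $s$. For $p\in M$ and sufficiently small $R>0$, the geodesic sphere with center $p$ and radius $R$ is the hypersurface $G(p,R)=\{\exp_p(RV): V\in T_pM,\ \Vert V\Vert=1\}$ ("sufficiently small radius" means: for each $p$ there is $R_0(p)>0$ such that the condition is imposed for all $0<R<R_0(p)$, where $G(p,R)$ is a smooth hypersurface). A unit vector field $\mathbf{x}$ along $\alpha$, normal to $\alpha'$, is rotation minimizing (RM) if $\nabla_{\alpha'}\mathbf{x}=\lambda\,\alpha'$ for some function $\lambda$. An RM frame along $\alpha$ is an orthonormal frame $\{\alpha',\mathbf{n}_1,\dots,\mathbf{n}_m\}$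 along $\alpha$ with each $\mathbf{n}_i$ RM; its curvatures $\kappa_i$ are defined by $\nabla_{\alpha'}\alpha'=\sum_{i=1}^m\kappa_i\mathbf{n}_i$ and $\nabla_{\alpha'}\mathbf{n}_i=-\kappa_i\alpha'$. RM frames along $\alpha$ are unique up to a constant orthogonal transformation of the normal vectors. The mean curvature is $H=\frac1m\mathrm{tr}(S)$, where $S(X)=-\nabla_X\xi$ is the shape operator with respect to $\xi$. *)

theory Defs
  imports "HOL-Analysis.Analysis"
begin

section \<open>Differentiability classes\<close>

text \<open>
  \<open>S\<close> is meant to be an open set, or a subset of the reals in which every point has a
  neighbourhood relative to \<open>S\<close> that is a nondegenerate interval (at end points of such an
  interval the derivatives are one-sided); on such \<open>S\<close> the derivative is unique.
\<close>

primrec Ck_on :: "nat \<Rightarrow> ('a::real_normed_vector \<Rightarrow> 'b::real_normed_vector) \<Rightarrow> 'a set \<Rightarrow> bool" where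
  "Ck_on 0 f S \<longleftrightarrow> continuous_on S f"
| "Ck_on (Suc k) f S \<longleftrightarrow>
     (\<forall>x\<in>S. f differentiable (at x within S)) \<and>
     (\<forall>v. Ck_on k (\<lambda>x. frechet_derivative f (at x within S) v) S)"

definition partial :: "'n \<Rightarrow> (real^'n \<Rightarrow> real) \<Rightarrow> real^'n::finite \<Rightarrow> real" where
  "partial i f x = frechet_derivative f (at x) (axis i 1)"


section \<open>Riemannian manifolds\<close>

text \<open>
  A tangent vector at a point \<open>p\<close> is represented by the family of its components in all charts
  around \<open>p\<close>; these families are related by the differentials of the transition maps. The
  components in all other charts are set to \<open>0\<close>, so that equal vectors are equal families.
  Linear operations on tangent vectors are componentwise.
\<close>

type_synonym ('a, 'n) chart = "'a set \<times> ('a \<Rightarrow> real^'n)"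
type_synonym ('a, 'n) tvec = "('a, 'n) chart \<Rightarrow> real^'n"

record ('a, 'n) riemannian =
  mtop :: "'a topology"
  atlas :: "('a, 'n) chart set"
  inn :: "'a \<Rightarrow> ('a, 'n) tvec \<Rightarrow> ('a, 'n) tvec \<Rightarrow> real"

definition chart_inv :: "('a, 'n::finite) chart \<Rightarrow> real^'n \<Rightarrow> 'a" where
  "chart_inv c = inv_into (fst c) (snd c)"

definition lin_comb :: "'i set \<Rightarrow> ('i \<Rightarrow> real) \<Rightarrow> ('i \<Rightarrow> ('a, 'n::finite) tvec) \<Rightarrow> ('a, 'n) tvec" where
  "lin_comb J a v = (\<lambda>c. \<Sum>i\<in>J. a i *\<^sub>R v i c)"

definition scale_vec :: "real \<Rightarrow> ('a, 'n::finite) tvec \<Rightarrow> ('a, 'n) tvec" where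
  "scale_vec r v = (\<lambda>c. r *\<^sub>R v c)"

definition zero_vec :: "('a, 'n::finite) tvec" where
  "zero_vec = (\<lambda>c. 0)"

text \<open>The tangent vector at \<open>p\<close> whose components in the chart \<open>c\<close> are \<open>u\<close>.\<close>

definition chart_vec ::
  "('a, 'n::finite) riemannian \<Rightarrow> ('a, 'n) chart \<Rightarrow> 'a \<Rightarrow> real^'n \<Rightarrow> ('a, 'n) tvec" where
  "chart_vec M c p u = (\<lambda>c'. if c' \<in> atlas M \<and> p \<in> fst c'
     then frechet_derivative (snd c' \<circ> chart_inv c) (at (snd c p)) u else 0)"

definition tangent_space :: "('a, 'n::finite) riemannian \<Rightarrow> 'a \<Rightarrow> ('a, 'n) tvec set" where
  "tangent_space M p = {chart_vec M c p u | c u. c \<in> atlas M \<and> p \<in> fst c}"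

definition chart_inn ::
  "('a, 'n::finite) riemannian \<Rightarrow> ('a, 'n) chart \<Rightarrow> real^'n \<Rightarrow> real^'n \<Rightarrow> real^'n \<Rightarrow> real" where
  "chart_inn M c x u v =
     inn M (chart_inv c x) (chart_vec M c (chart_inv c x) u) (chart_vec M c (chart_inv c x) v)"

text \<open>
  The dimension is \<open>CARD('n)\<close>. The differentiability class is \<open>C\<^sup>3\<close>, hence \<open>C\<^sup>2\<close> for the metric
  tensor; manifolds of any higher class are included. The atlas need not be maximal.
\<close>

definition riemannian_manifold :: "('a, 'n::finite) riemannian \<Rightarrow> bool" where
  "riemannian_manifold M \<longleftrightarrow>
     Hausdorff_space (mtop M) \<and> second_countable (mtop M) \<and>
     topspace (mtop M) = (\<Union>c\<in>atlas M. fst c) \<and>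
     (\<forall>c\<in>atlas M. openin (mtop M) (fst c) \<and> open (snd c ` fst c) \<and>
        homeomorphic_map (subtopology (mtop M) (fst c)) (top_of_set (snd c ` fst c)) (snd c)) \<and>
     (\<forall>c\<in>atlas M. \<forall>c'\<in>atlas M. Ck_on 3 (snd c' \<circ> chart_inv c) (snd c ` (fst c \<inter> fst c'))) \<and>
     (\<forall>c\<in>atlas M. \<forall>x\<in>snd c ` fst c.
        bilinear (chart_inn M c x) \<and>
        (\<forall>u v. chart_inn M c x u v = chart_inn M c x v u) \<and>
        (\<forall>u. u \<noteq> 0 \<longrightarrow> chart_inn M c x u u > 0)) \<and>
     (\<forall>c\<in>atlas M. \<forall>u v. Ck_on 2 (\<lambda>x. chart_inn M c x u v) (snd c ` fst c))"


section \<open>Levi-Civita connection and sectional curvature\<close>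

definition gram :: "('a, 'n::finite) riemannian \<Rightarrow> ('a, 'n) chart \<Rightarrow> real^'n \<Rightarrow> real^'n^'n" where
  "gram M c x = (\<chi> i j. chart_inn M c x (axis i 1) (axis j 1))"

text \<open>\<open>christoffel M c k i j x\<close> is the symbol \<open>\<Gamma>\<close> with upper index \<open>k\<close> and lower indices \<open>i j\<close>.\<close>

definition christoffel ::
  "('a, 'n::finite) riemannian \<Rightarrow> ('a, 'n) chart \<Rightarrow> 'n \<Rightarrow> 'n \<Rightarrow> 'n \<Rightarrow> real^'n \<Rightarrow> real" where
  "christoffel M c k i j x = (1/2) * (\<Sum>l\<in>UNIV. matrix_inv (gram M c x) $ k $ l *
     (partial i (\<lambda>y. gram M c y $ j $ l) x + partial j (\<lambda>y. gram M c y $ i $ l) x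
       - partial l (\<lambda>y. gram M c y $ i $ j) x))"

text \<open>
  \<open>riem M c l i j k x\<close> is the \<open>l\<close>-th component of \<open>R(\<partial>i, \<partial>j) \<partial>k\<close>, where
  \<open>R(X, Y) Z = \<nabla>X \<nabla>Y Z - \<nabla>Y \<nabla>X Z - \<nabla>[X, Y] Z\<close>.
\<close>

definition riem ::
  "('a, 'n::finite) riemannian \<Rightarrow> ('a, 'n) chart \<Rightarrow> 'n \<Rightarrow> 'n \<Rightarrow> 'n \<Rightarrow> 'n \<Rightarrow> real^'n \<Rightarrow> real" where
  "riem M c l i j k x =
     partial i (christoffel M c l j k) x - partial j (christoffel M c l i k) x +
     (\<Sum>q\<in>UNIV. christoffel M c l i q x * christoffel M c q j k x
              - christoffel M c l j q x * christoffel M c q i k x)"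

definition curvature ::
  "('a, 'n::finite) riemannian \<Rightarrow> 'a \<Rightarrow> ('a, 'n) tvec \<Rightarrow> ('a, 'n) tvec \<Rightarrow> ('a, 'n) tvec \<Rightarrow> ('a, 'n) tvec"
  where
  "curvature M p u v w = (\<lambda>c. if c \<in> atlas M \<and> p \<in> fst c
     then \<chi> l. \<Sum>i\<in>UNIV. \<Sum>j\<in>UNIV. \<Sum>k\<in>UNIV.
       riem M c l i j k (snd c p) * (u c $ i) * (v c $ j) * (w c $ k)
     else 0)"

definition sectional_curvature ::
  "('a, 'n::finite) riemannian \<Rightarrow> 'a \<Rightarrow> ('a, 'n) tvec \<Rightarrow> ('a, 'n) tvec \<Rightarrow> real" where
  "sectional_curvature M p u v =
     inn M p (curvature M p u v v) u / (inn M p u u * inn M p v v - (inn M p u v)\<^sup>2)"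

definition constant_sectional_curvature :: "('a, 'n::finite) riemannian \<Rightarrow> bool" where
  "constant_sectional_curvature M \<longleftrightarrow>
     (\<exists>K. \<forall>p\<in>topspace (mtop M). \<forall>u\<in>tangent_space M p. \<forall>v\<in>tangent_space M p.
        (\<forall>a b. (\<forall>c. a *\<^sub>R u c + b *\<^sub>R v c = 0) \<longrightarrow> a = 0 \<and> b = 0) \<longrightarrow>
        sectional_curvature M p u v = K)"


section \<open>Curves and vector fields along curves\<close>

definition velocity ::
  "('a, 'n::finite) riemannian \<Rightarrow> real set \<Rightarrow> (real \<Rightarrow> 'a) \<Rightarrow> real \<Rightarrow> ('a, 'n) tvec" where
  "velocity M I \<alpha> s = (\<lambda>c. if c \<in> atlas M \<and> \<alpha> s \<in> fst c
     then vector_derivative (\<lambda>t. snd c (\<alpha> t)) (at s within I) else 0)"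

definition Ck_curve ::
  "('a, 'n::finite) riemannian \<Rightarrow> nat \<Rightarrow> real set \<Rightarrow> (real \<Rightarrow> 'a) \<Rightarrow> bool" where
  "Ck_curve M k I \<alpha> \<longleftrightarrow>
     is_interval I \<and> (\<exists>s\<in>I. \<exists>t\<in>I. s < t) \<and>
     continuous_map (top_of_set I) (mtop M) \<alpha> \<and>
     (\<forall>c\<in>atlas M. Ck_on k (\<lambda>t. snd c (\<alpha> t)) {t\<in>I. \<alpha> t \<in> fst c})"

definition C1_field_along ::
  "('a, 'n::finite) riemannian \<Rightarrow> real set \<Rightarrow> (real \<Rightarrow> 'a) \<Rightarrow> (real \<Rightarrow> ('a, 'n) tvec) \<Rightarrow> bool" where
  "C1_field_along M I \<alpha> X \<longleftrightarrow>
     (\<forall>s\<in>I. X s \<in> tangent_space M (\<alpha> s)) \<and>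
     (\<forall>c\<in>atlas M. Ck_on 1 (\<lambda>t. X t c) {t\<in>I. \<alpha> t \<in> fst c})"

text \<open>\<open>cov_deriv M I \<alpha> X s\<close> is the covariant derivative of \<open>X\<close> in direction \<open>\<alpha>'\<close> at \<open>s\<close>.\<close>

definition cov_deriv ::
  "('a, 'n::finite) riemannian \<Rightarrow> real set \<Rightarrow> (real \<Rightarrow> 'a) \<Rightarrow> (real \<Rightarrow> ('a, 'n) tvec) \<Rightarrow> real
     \<Rightarrow> ('a, 'n) tvec" where
  "cov_deriv M I \<alpha> X s = (\<lambda>c. if c \<in> atlas M \<and> \<alpha> s \<in> fst c
     then \<chi> k. vector_derivative (\<lambda>t. X t c) (at s within I) $ k +
       (\<Sum>i\<in>UNIV. \<Sum>j\<in>UNIV.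
          christoffel M c k i j (snd c (\<alpha> s)) * (velocity M I \<alpha> s c $ i) * (X s c $ j))
     else 0)"

definition unit_speed_C2_curve ::
  "('a, 'n::finite) riemannian \<Rightarrow> real set \<Rightarrow> (real \<Rightarrow> 'a) \<Rightarrow> bool" where
  "unit_speed_C2_curve M I \<alpha> \<longleftrightarrow>
     Ck_curve M 2 I \<alpha> \<and> (\<forall>s\<in>I. inn M (\<alpha> s) (velocity M I \<alpha> s) (velocity M I \<alpha> s) = 1)"


section \<open>Rotation minimizing frames\<close>

definition RM_field ::
  "('a, 'n::finite) riemannian \<Rightarrow> real set \<Rightarrow> (real \<Rightarrow> 'a) \<Rightarrow> (real \<Rightarrow> ('a, 'n) tvec) \<Rightarrow> bool" where
  "RM_field M I \<alpha> X \<longleftrightarrow>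
     C1_field_along M I \<alpha> X \<and>
     (\<forall>s\<in>I. inn M (\<alpha> s) (X s) (X s) = 1 \<and> inn M (\<alpha> s) (X s) (velocity M I \<alpha> s) = 0) \<and>
     (\<exists>l. \<forall>s\<in>I. cov_deriv M I \<alpha> X s = scale_vec (l s) (velocity M I \<alpha> s))"

text \<open>
  For a unit speed curve in a manifold of dimension \<open>m + 1\<close>, these fields together with \<open>\<alpha>'\<close>
  form an orthonormal frame along \<open>\<alpha>\<close>.
\<close>

definition RM_frame ::
  "('a, 'n::finite) riemannian \<Rightarrow> nat \<Rightarrow> real set \<Rightarrow> (real \<Rightarrow> 'a) \<Rightarrow> (nat \<Rightarrow> real \<Rightarrow> ('a, 'n) tvec)
     \<Rightarrow> bool" where
  "RM_frame M m I \<alpha> n \<longleftrightarrow>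
     (\<forall>i\<in>{1..m}. RM_field M I \<alpha> (n i)) \<and>
     (\<forall>s\<in>I. \<forall>i\<in>{1..m}. \<forall>j\<in>{1..m}. i \<noteq> j \<longrightarrow> inn M (\<alpha> s) (n i s) (n j s) = 0)"

definition RM_curvatures ::
  "('a, 'n::finite) riemannian \<Rightarrow> nat \<Rightarrow> real set \<Rightarrow> (real \<Rightarrow> 'a) \<Rightarrow> (nat \<Rightarrow> real \<Rightarrow> ('a, 'n) tvec)
     \<Rightarrow> (nat \<Rightarrow> real \<Rightarrow> real) \<Rightarrow> bool" where
  "RM_curvatures M m I \<alpha> n \<kappa> \<longleftrightarrow>
     (\<forall>s\<in>I. cov_deriv M I \<alpha> (velocity M I \<alpha>) s = lin_comb {1..m} (\<lambda>i. \<kappa> i s) (\<lambda>i. n i s) \<and>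
        (\<forall>i\<in>{1..m}. cov_deriv M I \<alpha> (n i) s = scale_vec (- \<kappa> i s) (velocity M I \<alpha> s)))"


section \<open>Geodesic spheres\<close>

definition geodesic :: "('a, 'n::finite) riemannian \<Rightarrow> real set \<Rightarrow> (real \<Rightarrow> 'a) \<Rightarrow> bool" where
  "geodesic M I \<gamma> \<longleftrightarrow>
     Ck_curve M 2 I \<gamma> \<and> (\<forall>t\<in>I. cov_deriv M I \<gamma> (velocity M I \<gamma>) t = zero_vec)"

text \<open>Meaningful only if there is a geodesic on \<open>{0..1}\<close> with initial velocity \<open>v\<close>.\<close>

definition exp_map :: "('a, 'n::finite) riemannian \<Rightarrow> 'a \<Rightarrow> ('a, 'n) tvec \<Rightarrow> 'a" where
  "exp_map M p v =
     (THE q. \<exists>\<gamma>. geodesic M {0..1} \<gamma> \<and> \<gamma> 0 = p \<and> velocity M {0..1} \<gamma> 0 = v \<and> \<gamma> 1 = q)"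

definition geodesic_sphere :: "('a, 'n::finite) riemannian \<Rightarrow> 'a \<Rightarrow> real \<Rightarrow> 'a set" where
  "geodesic_sphere M p R =
     {exp_map M p (scale_vec R v) | v. v \<in> tangent_space M p \<and> inn M p v v = 1}"


section \<open>Hypersurfaces and mean curvature\<close>

text \<open>
  Embedded hypersurfaces, as local regular level sets. The class \<open>C\<^sup>2\<close> is the one for which the
  shape operator is defined, and the one that geodesic spheres have for a \<open>C\<^sup>2\<close> metric.
\<close>

definition hypersurface :: "('a, 'n::finite) riemannian \<Rightarrow> 'a set \<Rightarrow> bool" where
  "hypersurface M N \<longleftrightarrow>
     N \<subseteq> topspace (mtop M) \<and>
     (\<forall>q\<in>N. \<exists>c\<in>atlas M. q \<in> fst c \<and>
        (\<exists>W F. open W \<and> snd c q \<in> W \<and> W \<subseteq> snd c ` fst c \<and> Ck_on 2 (F :: real^'n \<Rightarrow> real) W \<and>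
           (\<forall>x\<in>W. \<exists>u. frechet_derivative F (at x) u \<noteq> 0) \<and>
           snd c ` (N \<inter> fst c) \<inter> W = {x\<in>W. F x = 0}))"

definition curve_in_through ::
  "('a, 'n::finite) riemannian \<Rightarrow> 'a set \<Rightarrow> 'a \<Rightarrow> ('a, 'n) tvec \<Rightarrow> real \<Rightarrow> (real \<Rightarrow> 'a) \<Rightarrow> bool" where
  "curve_in_through M N q v e \<beta> \<longleftrightarrow>
     e > 0 \<and> Ck_curve M 1 {-e<..<e} \<beta> \<and> \<beta> ` {-e<..<e} \<subseteq> N \<and> \<beta> 0 = q \<and>
     velocity M {-e<..<e} \<beta> 0 = v"

definition tangent_space_of :: "('a, 'n::finite) riemannian \<Rightarrow> 'a set \<Rightarrow> 'a \<Rightarrow> ('a, 'n) tvec set" where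
  "tangent_space_of M N q = {v. \<exists>e \<beta>. curve_in_through M N q v e \<beta>}"

text \<open>A map on \<open>N\<close> is \<open>C\<^sup>1\<close> if locally it is the restriction of a \<open>C\<^sup>1\<close> map on an open set.\<close>

definition unit_normal_field ::
  "('a, 'n::finite) riemannian \<Rightarrow> 'a set \<Rightarrow> ('a \<Rightarrow> ('a, 'n) tvec) \<Rightarrow> bool" where
  "unit_normal_field M N \<xi> \<longleftrightarrow>
     (\<forall>q\<in>N. \<xi> q \<in> tangent_space M q \<and> inn M q (\<xi> q) (\<xi> q) = 1 \<and>
        (\<forall>v\<in>tangent_space_of M N q. inn M q (\<xi> q) v = 0)) \<and>
     (\<forall>c\<in>atlas M. \<forall>q\<in>N \<inter> fst c. \<exists>W F. open W \<and> snd c q \<in> W \<and> Ck_on 1 F W \<and>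
        (\<forall>q'\<in>N \<inter> fst c. snd c q' \<in> W \<longrightarrow> \<xi> q' c = F (snd c q')))"

text \<open>
  The shape operator \<open>X \<mapsto> - \<nabla>X \<xi>\<close>: the derivative of \<open>\<xi>\<close> in direction \<open>X\<close> is computed along
  any curve in \<open>N\<close> with velocity \<open>X\<close>, and does not depend on that curve.
\<close>

definition shape_operator ::
  "('a, 'n::finite) riemannian \<Rightarrow> 'a set \<Rightarrow> ('a \<Rightarrow> ('a, 'n) tvec) \<Rightarrow> 'a \<Rightarrow> ('a, 'n) tvec \<Rightarrow> ('a, 'n) tvec"
  where
  "shape_operator M N \<xi> q X = (THE Y. \<exists>e \<beta>. curve_in_through M N q X e \<beta> \<and>
     Y = scale_vec (-1) (cov_deriv M {-e<..<e} \<beta> (\<lambda>t. \<xi> (\<beta> t)) 0))"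

definition orthonormal_basis ::
  "('a, 'n::finite) riemannian \<Rightarrow> 'a \<Rightarrow> ('a, 'n) tvec set \<Rightarrow> nat \<Rightarrow> (nat \<Rightarrow> ('a, 'n) tvec) \<Rightarrow> bool"
  where
  "orthonormal_basis M q T m e \<longleftrightarrow>
     (\<forall>i\<in>{1..m}. e i \<in> T) \<and>
     (\<forall>i\<in>{1..m}. \<forall>j\<in>{1..m}. inn M q (e i) (e j) = (if i = j then 1 else 0)) \<and>
     (\<forall>v\<in>T. \<exists>a. v = lin_comb {1..m} a e)"

text \<open>
  The trace of the shape operator is computed in an arbitrary orthonormal basis of the tangent
  space of the hypersurface, which has dimension \<open>CARD('n) - 1\<close>.
\<close>

definition mean_curvature ::
  "('a, 'n::finite) riemannian \<Rightarrow> 'a set \<Rightarrow> ('a \<Rightarrow> ('a, 'n) tvec) \<Rightarrow> 'a \<Rightarrow> real" where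
  "mean_curvature M N \<xi> q =
     (let m = CARD('n) - 1;
          e = (SOME e. orthonormal_basis M q (tangent_space_of M N q) m e)
      in (1 / real m) * (\<Sum>i=1..m. inn M q (shape_operator M N \<xi> q (e i)) (e i)))"

end

theory Submission
  imports Defs
begin

text \<open>
  By the Gauss lemma, the unit normals of the geodesic sphere of radius \<open>R\<close> about \<open>p\<close> are \<open>\<xi> = \<plusminus> N / R\<close>, where
  \<open>N\<close> is the radial field \<open>E y \<mapsto> V y\<close>, the velocity at time 1 of the geodesic from \<open>p\<close> with initial velocity \<open>y\<close>.

  If the curvature is constant and \<open>f'' = - K f\<close>, then \<open>f J' - f' J\<close> is parallel along the radial geodesics for
  every Jacobi field \<open>J\<close> that vanishes at \<open>p\<close> and is normal to them. Hence \<open>\<nabla>\<^sub>X \<xi>\<close> is a fixed multiple of \<open>X\<close>, the sphere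
  is umbilic, the products \<open>\<langle>\<xi>, n\<^sub>i\<rangle>\<close> are constant along every curve on the sphere, and they are the \<open>a\<^sub>i\<close>.

  Conversely, every unit tangent vector of a sphere is the velocity of a curve on it that carries a rotation
  minimizing frame. Differentiating \<open>\<xi> = \<Sum> a\<^sub>i n\<^sub>i\<close> along it gives \<open>\<nabla>\<xi> = - (\<Sum> a\<^sub>i \<kappa>\<^sub>i) \<alpha>'\<close>, so all small spheres are
  umbilic. Then \<open>J'\<close> is a multiple of \<open>J\<close> for the Jacobi fields above, and in the limit at \<open>p\<close> the vector \<open>R(u,y)y\<close> is a
  multiple of \<open>u\<close> whenever \<open>u\<close> is normal to \<open>y\<close>. In dimension at least 3 this makes the sectional curvature at \<open>p\<close>
  independent of the plane, and Schur's lemma makes it independent of \<open>p\<close>.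
\<close>

section \<open>Ordinary differential equations\<close>

text \<open>The manifold is only of class C^3, so the Christoffel symbols are C^1 and the curvature
  is merely continuous. This shapes everything: the exponential map and the radial field are C^1,
  with derivatives given by the variational equation of the geodesic flow; the squared radius is C^2
  only because its gradient is twice the radial field; and Schur's lemma cannot differentiate the
  curvature. Proportionality factors such as that of \<open>Sh\<close> to \<open>E'\<close> are not
  known to be continuous, so they are eliminated before anything is differentiated or passed to the
  limit. Calculations take place in a Euclidean space with a family of scalar products and bilinear
  maps \<Gamma>; indices occur only where the coordinate definitions are matched with this setting,
  and results return to the manifold because transition maps are isometries. Differential equations
  are solved on intervals so short that contraction and Gronwall need no exponential weight;
  rescaling velocities turns such an interval into unit time.\<close>

lemma picard_global:
  fixes f :: "real \<Rightarrow> 'a::euclidean_space \<Rightarrow> 'a"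
  assumes T: "0 \<le> T" and cont: "continuous_on ({0..T} \<times> UNIV) (\<lambda>(t,z). f t z)"
    and lip: "\<And>t x y. t \<in> {0..T} \<Longrightarrow> norm (f t x - f t y) \<le> L * norm (x - y)"
    and L: "0 \<le> L" "L * T < 1"
  obtains x where "x 0 = z0"
    "\<And>t. t \<in> {0..T} \<Longrightarrow> (x has_vector_derivative f t (x t)) (at t within {0..T})"
proof -
  \<comment> \<open>Time is clamped to \<open>{0..T}\<close>, so that the Picard operator yields
    bounded continuous functions on the whole line, a complete space. There its contraction factor
    is \<open>L * T\<close>.\<close>
  define cl where "cl t = max 0 (min T t)" for t :: real
  have cl: "cl t \<in> {0..T}" for t using T by (auto simp: cl_def)
  have cl_id: "cl t = t" if "t \<in> {0..T}" for t using that by (auto simp: cl_def)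
  have contcl: "continuous_on UNIV cl" unfolding cl_def by (intro continuous_intros)
  have contf: "continuous_on {0..T} (\<lambda>s. f s (x s))" if "continuous_on {0..T} x" for x
  proof -
    have "continuous_on {0..T} ((\<lambda>(t,z). f t z) \<circ> (\<lambda>s. (s, x s)))"
      by (rule continuous_on_compose) (auto intro!: continuous_intros that continuous_on_subset[OF cont])
    then show ?thesis by (simp add: o_def)
  qed
  have bc: "(\<lambda>t. z0 + integral {0..cl t} (\<lambda>s. f s (x s))) \<in> bcontfun"
    if x: "continuous_on {0..T} x" for x
  proof -
    let ?I = "\<lambda>t. z0 + integral {0..t} (\<lambda>s. f s (x s))"
    have I: "continuous_on {0..T} ?I"
      by (intro continuous_intros indefinite_integral_continuous_1 integrable_continuous_real contf x)
    have 1: "continuous_on UNIV (?I \<circ> cl)"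
      by (rule continuous_on_compose[OF contcl]) (rule continuous_on_subset[OF I], use cl in auto)
    have "bounded (?I ` {0..T})"
      using I compact_continuous_image compact_imp_bounded by blast
    then have 2: "bounded (range (?I \<circ> cl))"
      by (rule bounded_subset) (use cl in auto)
    show ?thesis using 1 2 unfolding bcontfun_def by (simp add: o_def)
  qed
  define Ph :: "(real \<Rightarrow>\<^sub>C 'a) \<Rightarrow> (real \<Rightarrow>\<^sub>C 'a)" where
    "Ph x = Bcontfun (\<lambda>t. z0 + integral {0..cl t} (\<lambda>s. f s (apply_bcontfun x s)))" for x
  have cx: "continuous_on A (apply_bcontfun x)" for x :: "real \<Rightarrow>\<^sub>C 'a" and A
    by (rule continuous_on_subset[OF _ subset_UNIV]) (use apply_bcontfun[of x] in \<open>simp add: bcontfun_def\<close>)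
  have Ph: "apply_bcontfun (Ph x) t = z0 + integral {0..cl t} (\<lambda>s. f s (apply_bcontfun x s))" for x t
    unfolding Ph_def by (simp add: Bcontfun_inverse[OF bc[OF cx]])
  have "\<exists>!x. Ph x = x"
  proof (rule banach_fix_type)
    show "0 \<le> L * T" "L * T < 1" using T L by auto
    show "\<forall>x y. dist (Ph x) (Ph y) \<le> L * T * dist x y"
    proof (intro allI dist_bound)
      fix x y :: "real \<Rightarrow>\<^sub>C 'a" and t
      have int: "(\<lambda>s. f s (apply_bcontfun x s)) integrable_on {0..cl t}" for x
        by (rule integrable_continuous_real, rule continuous_on_subset[OF contf[OF cx]]) (use cl[of t] in auto)
      have "norm (integral {0..cl t} (\<lambda>s. f s (apply_bcontfun x s)) - integral {0..cl t} (\<lambda>s. f s (apply_bcontfun y s)))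
          = norm (integral {0..cl t} (\<lambda>s. f s (apply_bcontfun x s) - f s (apply_bcontfun y s)))"
        by (simp add: integral_diff int)
      also have "\<dots> \<le> L * dist x y * (cl t - 0)"
      proof (rule integral_bound)
        show "0 \<le> cl t" using cl by auto
        show "continuous_on {0..cl t} (\<lambda>s. f s (apply_bcontfun x s) - f s (apply_bcontfun y s))"
          by (intro continuous_intros continuous_on_subset[OF contf[OF cx]]) (use cl[of t] in auto)
        fix s assume "s \<in> {0..cl t}"
        then have "s \<in> {0..T}" using cl[of t] by auto
        then have "norm (f s (apply_bcontfun x s) - f s (apply_bcontfun y s)) \<le> L * dist (apply_bcontfun x s) (apply_bcontfun y s)"
          using lip by (simp add: dist_norm)
        also have "\<dots> \<le> L * dist x y" by (intro mult_left_mono L dist_bounded)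
        finally show "norm (f s (apply_bcontfun x s) - f s (apply_bcontfun y s)) \<le> L * dist x y" .
      qed
      also have "\<dots> \<le> L * dist x y * T"
        using cl[of t] L by (intro mult_left_mono) auto
      finally show "dist (apply_bcontfun (Ph x) t) (apply_bcontfun (Ph y) t) \<le> L * T * dist x y"
        by (simp add: Ph dist_norm algebra_simps)
    qed
  qed
  then obtain x where x: "Ph x = x" by blast
  have eq: "apply_bcontfun x t = z0 + integral {0..t} (\<lambda>s. f s (apply_bcontfun x s))" if "t \<in> {0..T}" for t
    using Ph[of x t] that by (simp add: x cl_id)
  show ?thesis
  proof
    show "apply_bcontfun x 0 = z0" using eq[of 0] T by simp
    fix t assume t: "t \<in> {0..T}"
    have "((\<lambda>u. integral {0..u} (\<lambda>s. f s (apply_bcontfun x s))) has_vector_derivative f t (apply_bcontfun x t)) (at t within {0..T})"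
      by (rule integral_has_vector_derivative[OF contf[OF cx] t])
    then have "((\<lambda>u. z0 + integral {0..u} (\<lambda>s. f s (apply_bcontfun x s))) has_vector_derivative 0 + f t (apply_bcontfun x t)) (at t within {0..T})"
      by (intro derivative_intros)
    then show "(apply_bcontfun x has_vector_derivative f t (apply_bcontfun x t)) (at t within {0..T})"
      by (rule has_vector_derivative_transform[rotated 2, THEN has_vector_derivative_eq_rhs])
         (use t eq in auto)
  qed
qed

lemma vector_derivative_norm_bound:
  fixes z :: "real \<Rightarrow> 'a::real_normed_vector"
  assumes z: "\<And>t. t \<in> {0..T} \<Longrightarrow> (z has_vector_derivative z' t) (at t within {0..T})"
    and b: "\<And>t. t \<in> {0..T} \<Longrightarrow> norm (z' t) \<le> B" and t: "t \<in> {0..T}"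
  shows "norm (z t - z 0) \<le> B * t"
proof -
  have "norm (z t - z 0) \<le> B * norm (t - 0)"
  proof (rule differentiable_bound[of "{0..T}" z "\<lambda>t h. h *\<^sub>R z' t"])
    fix s assume s: "s \<in> {0..T}"
    show "(z has_derivative (\<lambda>h. h *\<^sub>R z' s)) (at s within {0..T})"
      using z[OF s] by (simp add: has_vector_derivative_def)
    show "onorm (\<lambda>h. h *\<^sub>R z' s) \<le> B"
      by (rule onorm_le) (use b[OF s] mult_right_mono[OF b[OF s] abs_ge_zero] in \<open>simp add: mult.commute\<close>)
  qed (use t in auto)
  with t show ?thesis by auto
qed

text \<open>Gronwall's inequality without the exponential: on a short interval the supremum absorbs itself.\<close>

lemma short_gronwall:
  fixes z :: "real \<Rightarrow> 'a::real_normed_vector"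
  assumes z: "\<And>t. t \<in> {0..T} \<Longrightarrow> (z has_vector_derivative z' t) (at t within {0..T})"
    and b: "\<And>t. t \<in> {0..T} \<Longrightarrow> norm (z' t) \<le> L * norm (z t) + c"
    and L: "0 \<le> L" "L * T \<le> 1/2" and t: "t \<in> {0..T}" and c: "0 \<le> c"
  shows "norm (z t) \<le> 2 * (norm (z 0) + c * T)"
proof -
  have T: "0 \<le> T" using t by auto
  have "continuous_on {0..T} (\<lambda>t. norm (z t))"
    using z by (intro continuous_intros continuous_on_vector_derivative)
  then obtain s where s: "s \<in> {0..T}" and max: "\<And>t. t \<in> {0..T} \<Longrightarrow> norm (z t) \<le> norm (z s)"
    using continuous_attains_sup[of "{0..T}" "\<lambda>t. norm (z t)"] T by fastforce
  have "norm (z s - z 0) \<le> (L * norm (z s) + c) * s"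
  proof (rule vector_derivative_norm_bound[OF z _ s])
    fix t assume t: "t \<in> {0..T}"
    have "norm (z' t) \<le> L * norm (z t) + c" by (rule b[OF t])
    also have "\<dots> \<le> L * norm (z s) + c" using max[OF t] L by (simp add: mult_left_mono)
    finally show "norm (z' t) \<le> L * norm (z s) + c" .
  qed
  also have "\<dots> \<le> (L * norm (z s) + c) * T" using s L c by (intro mult_left_mono) auto
  also have "\<dots> = (L * T) * norm (z s) + c * T" by (simp add: algebra_simps)
  also have "\<dots> \<le> (1/2) * norm (z s) + c * T"
    using L by (intro add_right_mono mult_right_mono) auto
  finally have "norm (z s) \<le> norm (z 0) + ((1/2) * norm (z s) + c * T)"
    using norm_triangle_sub[of "z s" "z 0"] by linarith
  then have "norm (z s) \<le> 2 * (norm (z 0) + c * T)" by simp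
  with max[OF t] show ?thesis by linarith
qed

text \<open>The factor 2 is that of \<open>short_gronwall\<close> with \<open>c = 0\<close>. Equal
  initial values give uniqueness; different ones give Lipschitz dependence on the initial value. The
  set \<open>C\<close> confines the Lipschitz condition to the region that the solutions
  visit.\<close>

lemma ode_unique:
  fixes f :: "real \<Rightarrow> 'a::real_normed_vector \<Rightarrow> 'a"
  assumes lip: "\<And>t x y. t \<in> {0..T} \<Longrightarrow> x \<in> C \<Longrightarrow> y \<in> C \<Longrightarrow> norm (f t x - f t y) \<le> L * norm (x - y)"
    and L: "0 \<le> L" "L * T \<le> 1/2"
    and x: "\<And>t. t \<in> {0..T} \<Longrightarrow> (x has_vector_derivative f t (x t)) (at t within {0..T})" "\<And>t. t \<in> {0..T} \<Longrightarrow> x t \<in> C"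
    and y: "\<And>t. t \<in> {0..T} \<Longrightarrow> (y has_vector_derivative f t (y t)) (at t within {0..T})" "\<And>t. t \<in> {0..T} \<Longrightarrow> y t \<in> C"
    and t: "t \<in> {0..T}"
  shows "norm (x t - y t) \<le> 2 * norm (x 0 - y 0)"
proof -
  have "norm ((\<lambda>t. x t - y t) t) \<le> 2 * (norm ((\<lambda>t. x t - y t) 0) + 0 * T)"
    by (rule short_gronwall[where L=L and z'="\<lambda>t. f t (x t) - f t (y t)"])
       (use lip L x y t in \<open>auto intro!: derivative_intros\<close>)
  then show ?thesis by simp
qed

text \<open>Composition with the nearest-point projection onto the ball, which is 1-Lipschitz, makes
  the right-hand side global. The speed bound \<open>M\<close> keeps the solution inside the ball,
  where the projection is the identity.\<close>

lemma picard_cball: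
  fixes f :: "real \<Rightarrow> 'a::euclidean_space \<Rightarrow> 'a"
  assumes T: "0 \<le> T" and rho: "0 \<le> \<rho>" and cont: "continuous_on ({0..T} \<times> cball a \<rho>) (\<lambda>(t,z). f t z)"
    and lip: "\<And>t x y. t \<in> {0..T} \<Longrightarrow> x \<in> cball a \<rho> \<Longrightarrow> y \<in> cball a \<rho> \<Longrightarrow> norm (f t x - f t y) \<le> L * norm (x - y)"
    and L: "0 \<le> L" "L * T < 1"
    and M: "\<And>t x. t \<in> {0..T} \<Longrightarrow> x \<in> cball a \<rho> \<Longrightarrow> norm (f t x) \<le> M" "norm (z - a) + M * T \<le> \<rho>"
  shows "\<exists>x. x 0 = z \<and> (\<forall>t\<in>{0..T}. x t \<in> cball a \<rho> \<and> (x has_vector_derivative f t (x t)) (at t within {0..T}))"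
proof -
  let ?P = "closest_point (cball a \<rho>)"
  have P: "?P x \<in> cball a \<rho>" for x
    by (rule closest_point_in_set) (use rho in auto)
  have P_id: "?P x = x" if "x \<in> cball a \<rho>" for x
    using that by (rule closest_point_self)
  have Plip: "norm (?P x - ?P y) \<le> norm (x - y)" for x y
    using closest_point_lipschitz[of "cball a \<rho>" x y] rho by (simp add: dist_norm)
  have contP: "continuous_on A ?P" for A
    by (rule continuous_on_closest_point) (use rho in auto)
  have "continuous_on ({0..T} \<times> UNIV) ((\<lambda>(t,z). f t z) \<circ> (\<lambda>p. (fst p, ?P (snd p))))"
    by (rule continuous_on_compose)
       (use P in \<open>auto intro!: continuous_intros continuous_on_compose2[OF contP] continuous_on_subset[OF cont]\<close>)
  then have c: "continuous_on ({0..T} \<times> UNIV) (\<lambda>(t,z). f t (?P z))"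
    by (simp add: o_def case_prod_beta)
  obtain x where x0: "x 0 = z" and
    dx: "\<And>t. t \<in> {0..T} \<Longrightarrow> (x has_vector_derivative f t (?P (x t))) (at t within {0..T})"
  proof (rule picard_global[OF T c _ L])
    fix t :: real and x y assume "t \<in> {0..T}"
    then have "norm (f t (?P x) - f t (?P y)) \<le> L * norm (?P x - ?P y)" using lip P by blast
    also have "\<dots> \<le> L * norm (x - y)" by (intro mult_left_mono Plip L)
    finally show "norm (f t (?P x) - f t (?P y)) \<le> L * norm (x - y)" .
  qed blast
  have xin: "x t \<in> cball a \<rho>" if t: "t \<in> {0..T}" for t
  proof -
    have "norm (x t - x 0) \<le> M * t"
      by (rule vector_derivative_norm_bound[OF dx _ t]) (use M P in auto)
    also have "\<dots> \<le> M * T"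
      using t order_trans[OF norm_ge_zero M(1)[OF t P]] by (intro mult_left_mono) auto
    finally have "norm (x t - a) \<le> \<rho>"
      using M(2) norm_triangle_ineq[of "x t - z" "z - a"] x0 by simp
    then show ?thesis by (simp add: dist_norm norm_minus_commute)
  qed
  have "(x has_vector_derivative f t (x t)) (at t within {0..T})" if "t \<in> {0..T}" for t
    using dx[OF that] P_id[OF xin[OF that]] by simp
  then show ?thesis using x0 xin by blast
qed

text \<open>In finite dimension, continuity of \<open>f' z v\<close> in \<open>z\<close> for every
  fixed \<open>v\<close> is continuity in the operator norm; compactness then gives boundedness and
  uniform continuity.\<close>

lemma operator_family_bounds:
  fixes f' :: "'a::euclidean_space \<Rightarrow> 'b::euclidean_space \<Rightarrow> 'c::euclidean_space"
  assumes K: "compact K" and lin: "\<And>z. z \<in> K \<Longrightarrow> linear (f' z)"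
    and cont: "\<And>v. continuous_on K (\<lambda>z. f' z v)"
  shows "\<exists>C>0. \<forall>z\<in>K. \<forall>v. norm (f' z v) \<le> C * norm v"
    and "\<eta> > 0 \<Longrightarrow> \<exists>\<delta>>0. \<forall>x\<in>K. \<forall>y\<in>K. dist x y < \<delta> \<longrightarrow> (\<forall>v. norm (f' x v - f' y v) \<le> \<eta> * norm v)"
proof -
  define F where "F z = Blinfun (f' z)" for z
  have F: "blinfun_apply (F z) v = f' z v" if "z \<in> K" for z v
    using lin[OF that] by (simp add: F_def bounded_linear_Blinfun_apply linear_conv_bounded_linear)
  have cF: "continuous_on K F"
  proof (rule continuous_on_blinfun_componentwise)
    fix i :: 'b
    show "continuous_on K (\<lambda>x. blinfun_apply (F x) i)"
      using cont[of i] by (rule continuous_on_eq) (simp add: F)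
  qed
  have "bounded (F ` K)" using compact_continuous_image[OF cF K] compact_imp_bounded by blast
  then obtain C where C: "C > 0" "\<And>z. z \<in> K \<Longrightarrow> norm (F z) \<le> C"
    unfolding bounded_pos by auto
  have "norm (f' z v) \<le> C * norm v" if "z \<in> K" for z v
  proof -
    have "norm (f' z v) \<le> norm (F z) * norm v" using norm_blinfun[of "F z" v] F[OF that] by simp
    also have "\<dots> \<le> C * norm v" using C(2)[OF that] by (rule mult_right_mono) simp
    finally show ?thesis .
  qed
  then show "\<exists>C>0. \<forall>z\<in>K. \<forall>v. norm (f' z v) \<le> C * norm v" using C(1) by blast
  assume "\<eta> > 0"
  then obtain \<delta> where d: "\<delta> > 0" "\<And>x y. x \<in> K \<Longrightarrow> y \<in> K \<Longrightarrow> dist y x < \<delta> \<Longrightarrow> dist (F y) (F x) < \<eta>"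
    using compact_uniformly_continuous[OF cF K] unfolding uniformly_continuous_on_def by meson
  have "norm (f' x v - f' y v) \<le> \<eta> * norm v" if "x \<in> K" "y \<in> K" "dist x y < \<delta>" for x y v
  proof -
    have "norm (f' x v - f' y v) \<le> norm (F x - F y) * norm v"
      using norm_blinfun[of "F x - F y" v] F that by (simp add: blinfun.diff_left)
    also have "\<dots> \<le> \<eta> * norm v" using d(2)[OF that(2,1,3)] by (intro mult_right_mono) (auto simp: dist_norm)
    finally show ?thesis .
  qed
  then show "\<exists>\<delta>>0. \<forall>x\<in>K. \<forall>y\<in>K. dist x y < \<delta> \<longrightarrow> (\<forall>v. norm (f' x v - f' y v) \<le> \<eta> * norm v)"
    using d(1) by blast
qed

text \<open>The constant 1/2 on unit time makes one contraction and one use of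
  \<open>short_gronwall\<close> suffice. Since \<open>f\<close> vanishes at \<open>q\<close>, the
  speed on the ball is at most \<rho>/2, so a solution that starts in the half ball cannot leave the
  ball. \<open>W\<close> solves the variational equation and turns out to be the derivative of the
  flow in the initial value.\<close>

lemma C1_flow_half:
  fixes f :: "'a::euclidean_space \<Rightarrow> 'a"
  assumes rho: "\<rho> > 0" and df: "\<And>z. z \<in> cball q \<rho> \<Longrightarrow> (f has_derivative f' z) (at z)"
    and cf: "\<And>v. continuous_on (cball q \<rho>) (\<lambda>z. f' z v)" and f0: "f q = 0"
    and half: "\<And>z v. z \<in> cball q \<rho> \<Longrightarrow> norm (f' z v) \<le> 1/2 * norm v"
  obtains \<phi> W where
    "\<And>z. z \<in> ball q (\<rho>/2) \<Longrightarrow> \<phi> 0 z = z"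
    "\<And>z t. z \<in> ball q (\<rho>/2) \<Longrightarrow> t \<in> {0..1} \<Longrightarrow> \<phi> t z \<in> cball q \<rho>"
    "\<And>z t. z \<in> ball q (\<rho>/2) \<Longrightarrow> t \<in> {0..1} \<Longrightarrow>
       ((\<lambda>t. \<phi> t z) has_vector_derivative f (\<phi> t z)) (at t within {0..1})"
    "\<And>x t. x 0 \<in> ball q (\<rho>/2) \<Longrightarrow> (\<And>t. t \<in> {0..1} \<Longrightarrow> x t \<in> cball q \<rho>) \<Longrightarrow>
       (\<And>t. t \<in> {0..1} \<Longrightarrow> (x has_vector_derivative f (x t)) (at t within {0..1})) \<Longrightarrow>
       t \<in> {0..1} \<Longrightarrow> x t = \<phi> t (x 0)"
    "\<And>z t. z \<in> ball q (\<rho>/2) \<Longrightarrow> t \<in> {0..1} \<Longrightarrow> (\<phi> t has_derivative W t z) (at z)"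
    "\<And>z h. z \<in> ball q (\<rho>/2) \<Longrightarrow> W 0 z h = h"
    "\<And>z t h. z \<in> ball q (\<rho>/2) \<Longrightarrow> t \<in> {0..1} \<Longrightarrow>
       ((\<lambda>t. W t z h) has_vector_derivative f' (\<phi> t z) (W t z h)) (at t within {0..1})"
    "\<And>t h. t \<in> {0..1} \<Longrightarrow> continuous_on (ball q (\<rho>/2)) (\<lambda>z. W t z h)"
proof -
  let ?C = "cball q \<rho>" and ?B = "ball q (\<rho>/2)"
  have lin: "linear (f' z)" if "z \<in> ?C" for z
    using df[OF that] has_derivative_linear by blast
  have lip: "norm (f x - f y) \<le> 1/2 * norm (x - y)" if "x \<in> ?C" "y \<in> ?C" for x y
  proof (rule differentiable_bound[of ?C f f'])
    fix z assume z: "z \<in> ?C"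
    show "(f has_derivative f' z) (at z within ?C)" using df[OF z] by (rule has_derivative_at_withinI)
    show "onorm (f' z) \<le> 1/2" by (rule onorm_le[OF half[OF z]])
  qed (use that in auto)
  have contf: "continuous_on ?C f"
    by (meson df continuous_at_imp_continuous_on has_derivative_continuous)
  have "\<exists>x. x 0 = z \<and> (\<forall>t\<in>{0..1}. x t \<in> ?C \<and> (x has_vector_derivative f (x t)) (at t within {0..1}))"
    if z: "z \<in> ?B" for z
  proof (rule picard_cball[where T=1 and L="1/2" and M="\<rho>/2" and f="\<lambda>t. f" and a=q and \<rho>=\<rho> and z=z])
      show "continuous_on ({0..1} \<times> ?C) (\<lambda>(t, z). f z)"
        unfolding case_prod_beta by (rule continuous_on_compose2[OF contf]) (auto intro!: continuous_intros)
      fix x assume x: "x \<in> ?C"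
      have "norm (f x - f q) \<le> 1/2 * norm (x - q)" by (rule lip) (use x rho in auto)
      then show "norm (f x) \<le> \<rho>/2" using x f0 by (simp add: dist_norm norm_minus_commute)
    qed (use rho z lip in \<open>auto simp: dist_norm norm_minus_commute\<close>)
  then obtain X where X: "\<And>z. z \<in> ?B \<Longrightarrow> X z 0 = z" "\<And>z t. z \<in> ?B \<Longrightarrow> t \<in> {0..1} \<Longrightarrow> X z t \<in> ?C"
    "\<And>z t. z \<in> ?B \<Longrightarrow> t \<in> {0..1} \<Longrightarrow> (X z has_vector_derivative f (X z t)) (at t within {0..1})"
    by metis
  have contX: "continuous_on {0..1} (X z)" if "z \<in> ?B" for z
    using X(3)[OF that] by (rule continuous_on_vector_derivative)
  have Xlip: "norm (X z t - X z' t) \<le> 2 * norm (z - z')" if "z \<in> ?B" "z' \<in> ?B" "t \<in> {0..1}" for z z' t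
    using ode_unique[of 1 ?C "\<lambda>t. f" "1/2" "X z" "X z'" t] lip X that by auto
  have uniq: "x t = X (x 0) t"
    if "x 0 \<in> ?B" "\<And>t. t \<in> {0..1} \<Longrightarrow> x t \<in> ?C"
      "\<And>t. t \<in> {0..1} \<Longrightarrow> (x has_vector_derivative f (x t)) (at t within {0..1})" "t \<in> {0..1}" for x t
    using ode_unique[of 1 ?C "\<lambda>t. f" "1/2" x "X (x 0)" t] lip X that by auto
  have contf'X: "continuous_on {0..1} (\<lambda>t. f' (X z t) v)" if "z \<in> ?B" for z v
    by (rule continuous_on_compose2[OF cf contX[OF that]]) (use X that in auto)
  have "\<exists>w. w 0 = h \<and> (\<forall>t\<in>{0..1}. (w has_vector_derivative f' (X z t) (w t)) (at t within {0..1}))"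
    if z: "z \<in> ?B" for z h
  proof -
    obtain w where "w 0 = h"
      "\<And>t. t \<in> {0..1} \<Longrightarrow> (w has_vector_derivative f' (X z t) (w t)) (at t within {0..1})"
    proof (rule picard_global[where T=1 and L="1/2" and f="\<lambda>t w. f' (X z t) w"])
      have "continuous_on ({0..1} \<times> UNIV) (\<lambda>p. \<Sum>b\<in>Basis. (snd p \<bullet> b) *\<^sub>R f' (X z (fst p)) b)"
        by (intro continuous_intros continuous_on_compose2[OF contf'X[OF z]]) auto
      then show "continuous_on ({0..1} \<times> UNIV) (\<lambda>(t, w). f' (X z t) w)"
      proof (rule continuous_on_eq)
        fix p :: "real \<times> 'a" assume "p \<in> {0..1} \<times> UNIV"
        then have l: "linear (f' (X z (fst p)))" using lin X z by auto
        show "(\<Sum>b\<in>Basis. (snd p \<bullet> b) *\<^sub>R f' (X z (fst p)) b) = (case p of (t, w) \<Rightarrow> f' (X z t) w)"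
          using linear_sum[OF l, of "\<lambda>b. (snd p \<bullet> b) *\<^sub>R b" Basis]
          by (simp add: case_prod_beta euclidean_representation linear_scale[OF l])
      qed
      fix t :: real and x y :: 'a assume "t \<in> {0..1}"
      then have "X z t \<in> ?C" using X z by auto
      then show "norm (f' (X z t) x - f' (X z t) y) \<le> 1/2 * norm (x - y)"
        using half[of "X z t" "x - y"] linear_diff[OF lin] by simp
    qed auto
    then show ?thesis by blast
  qed
  then obtain W0 where W0: "\<And>z h. z \<in> ?B \<Longrightarrow> W0 z h 0 = h"
    "\<And>z h t. z \<in> ?B \<Longrightarrow> t \<in> {0..1} \<Longrightarrow> (W0 z h has_vector_derivative f' (X z t) (W0 z h t)) (at t within {0..1})"
    by metis
  have Wuniq: "norm (w t) \<le> 2 * norm (w 0)"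
    if "z \<in> ?B" "\<And>t. t \<in> {0..1} \<Longrightarrow> (w has_vector_derivative f' (X z t) (w t)) (at t within {0..1})" "t \<in> {0..1}" for z w t
    using short_gronwall[of 1 w "\<lambda>t. f' (X z t) (w t)" "1/2" 0 t] that half X by auto
  have Wlin: "linear (\<lambda>h. W0 z h t)" if z: "z \<in> ?B" and t: "t \<in> {0..1}" for z t
  proof
    fix h k :: 'a and r :: real
    note l = linear_add[OF lin[OF X(2)[OF z]]] linear_diff[OF lin[OF X(2)[OF z]]] linear_scale[OF lin[OF X(2)[OF z]]]
    have "((\<lambda>t. W0 z (h + k) t - (W0 z h t + W0 z k t)) has_vector_derivative
        f' (X z s) (W0 z (h + k) s - (W0 z h s + W0 z k s))) (at s within {0..1})" if s: "s \<in> {0..1}" for s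
      using has_vector_derivative_diff[OF W0(2)[OF z s, of "h+k"] has_vector_derivative_add[OF W0(2)[OF z s, of h] W0(2)[OF z s, of k]]]
      by (simp only: l s)
    from Wuniq[OF z this t] show "W0 z (h + k) t = W0 z h t + W0 z k t" using W0(1)[OF z] by simp
    have "((\<lambda>t. W0 z (r *\<^sub>R h) t - r *\<^sub>R W0 z h t) has_vector_derivative
        f' (X z s) (W0 z (r *\<^sub>R h) s - r *\<^sub>R W0 z h s)) (at s within {0..1})" if s: "s \<in> {0..1}" for s
      using has_vector_derivative_diff[OF W0(2)[OF z s, of "r *\<^sub>R h"] bounded_linear.has_vector_derivative[OF bounded_linear_scaleR_right W0(2)[OF z s, of h]]]
      by (simp only: l s)
    from Wuniq[OF z this t] show "W0 z (r *\<^sub>R h) t = r *\<^sub>R W0 z h t" using W0(1)[OF z] by simp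
  qed
  have W2: "norm (W0 z h t) \<le> 2 * norm h" if "z \<in> ?B" "t \<in> {0..1}" for z h t
    using Wuniq[OF that(1) W0(2)[OF that(1)] that(2), of h] W0(1)[OF that(1)] by simp
  have unif: "\<exists>\<delta>>0. \<forall>x\<in>?C. \<forall>y\<in>?C. dist x y < \<delta> \<longrightarrow> (\<forall>v. norm (f' x v - f' y v) \<le> \<eta> * norm v)" if "\<eta> > 0" for \<eta>
    by (rule operator_family_bounds(2)[OF compact_cball lin cf that])
  have deriv: "((\<lambda>z. X z t) has_derivative (\<lambda>h. W0 z h t)) (at z)" if z: "z \<in> ?B" and t: "t \<in> {0..1}" for z t
    unfolding has_derivative_at_alt
  proof (intro conjI allI impI)
    show "bounded_linear (\<lambda>h. W0 z h t)" using Wlin[OF z t] linear_conv_bounded_linear by blast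
    fix e :: real assume e: "e > 0"
    \<comment> \<open>One factor 2 comes from Gronwall, the other from \<open>Xlip\<close>:
      solutions separate at most by the factor 2. The latter is also why the radius below is
      \<delta>/2.\<close>
    define \<eta> where "\<eta> = e / 4"
    have eta: "\<eta> > 0" using e by (simp add: \<eta>_def)
    obtain \<delta> where d: "\<delta> > 0" "\<And>x y v. x \<in> ?C \<Longrightarrow> y \<in> ?C \<Longrightarrow> dist x y < \<delta> \<Longrightarrow> norm (f' x v - f' y v) \<le> \<eta> * norm v"
      using unif[OF eta] by blast
    \<comment> \<open>The mean value inequality for \<open>f\<close> minus its linearization at
      \<open>b\<close> makes the first-order error uniform in the base point, hence uniform along
      the whole trajectory.\<close>
    have lin_est: "norm (f a - f b - f' b (a - b)) \<le> \<eta> * norm (a - b)" if ab: "a \<in> ?C" "b \<in> ?C" "dist a b < \<delta>" for a b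
    proof -
      have "norm ((\<lambda>x. f x - f' b x) a - (\<lambda>x. f x - f' b x) b) \<le> \<eta> * norm (a - b)"
      proof (rule differentiable_bound[of "?C \<inter> ball b \<delta>" "\<lambda>x. f x - f' b x" "\<lambda>x h. f' x h - f' b h"])
        fix x assume x: "x \<in> ?C \<inter> ball b \<delta>"
        have "bounded_linear (f' b)" using lin[OF ab(2)] linear_conv_bounded_linear by blast
        from has_derivative_diff[OF has_derivative_at_withinI[OF df] bounded_linear_imp_has_derivative[OF this]]
        show "((\<lambda>x. f x - f' b x) has_derivative (\<lambda>h. f' x h - f' b h)) (at x within ?C \<inter> ball b \<delta>)"
          using x by blast
        show "onorm (\<lambda>h. f' x h - f' b h) \<le> \<eta>"
          using d(2)[of x b] x ab by (intro onorm_le) (auto simp: dist_commute)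
      qed (use ab d(1) in \<open>auto simp: dist_commute intro: convex_Int\<close>)
      then show ?thesis by (simp add: linear_diff[OF lin[OF ab(2)]] algebra_simps)
    qed
    obtain r where r: "r > 0" "ball z r \<subseteq> ?B" using z open_ball openE by blast
    show "\<exists>d>0. \<forall>y. norm (y - z) < d \<longrightarrow> norm (X y t - X z t - W0 z (y - z) t) \<le> e * norm (y - z)"
    proof (intro exI[of _ "min r (\<delta>/2)"] conjI allI impI)
      show "0 < min r (\<delta>/2)" using r d by simp
      fix y assume y: "norm (y - z) < min r (\<delta>/2)"
      then have yB: "y \<in> ?B" using r by (auto simp: dist_norm norm_minus_commute subset_eq)
      let ?q = "\<lambda>t. X y t - X z t - W0 z (y - z) t"
      have "norm (?q t) \<le> 2 * (norm (?q 0) + (2 * \<eta> * norm (y - z)) * 1)"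
      proof (rule short_gronwall[where L="1/2" and z'="\<lambda>t. f (X y t) - f (X z t) - f' (X z t) (W0 z (y - z) t)"])
        fix t :: real assume t: "t \<in> {0..1}"
        show "(?q has_vector_derivative f (X y t) - f (X z t) - f' (X z t) (W0 z (y - z) t)) (at t within {0..1})"
          by (intro derivative_intros X(3) W0(2) z yB t)
        have l: "norm (X y t - X z t) \<le> 2 * norm (y - z)" by (rule Xlip[OF yB z t])
        have "norm (f (X y t) - f (X z t) - f' (X z t) (X y t - X z t)) \<le> \<eta> * norm (X y t - X z t)"
          by (rule lin_est) (use l y X t yB z in \<open>auto simp: dist_norm\<close>)
        also have "\<dots> \<le> \<eta> * (2 * norm (y - z))" using l eta by (intro mult_left_mono) auto
        finally have 1: "norm (f (X y t) - f (X z t) - f' (X z t) (X y t - X z t)) \<le> 2 * \<eta> * norm (y - z)" by simp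
        have 2: "norm (f' (X z t) (?q t)) \<le> 1/2 * norm (?q t)" by (rule half) (use X z t in auto)
        have "f (X y t) - f (X z t) - f' (X z t) (W0 z (y - z) t)
            = (f (X y t) - f (X z t) - f' (X z t) (X y t - X z t)) + f' (X z t) (?q t)"
          using linear_diff[OF lin[OF X(2)[OF z t]]] by simp
        then show "norm (f (X y t) - f (X z t) - f' (X z t) (W0 z (y - z) t)) \<le> 1/2 * norm (?q t) + 2 * \<eta> * norm (y - z)"
          using 1 2 norm_triangle_ineq by (smt (verit))
      qed (use t eta in auto)
      also have "\<dots> = e * norm (y - z)" using X W0 yB z by (simp add: \<eta>_def)
      finally show "norm (?q t) \<le> e * norm (y - z)" .
    qed
  qed
  have Wcont: "continuous_on ?B (\<lambda>z. W0 z h t)" if t: "t \<in> {0..1}" for h t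
    unfolding continuous_on_iff
  proof (intro ballI allI impI)
    fix z and e :: real assume z: "z \<in> ?B" and e: "e > 0"
    \<comment> \<open>The Gronwall bound below is \<open>4 * \<eta> * norm h\<close>, so this choice
      leaves at most \<open>e / 2\<close>; the summand 1 covers \<open>h = 0\<close>.\<close>
    define \<eta> where "\<eta> = e / (8 * (norm h + 1))"
    have eta: "\<eta> > 0" using e by (simp add: \<eta>_def add_nonneg_pos)
    obtain \<delta> where d: "\<delta> > 0" "\<And>x y v. x \<in> ?C \<Longrightarrow> y \<in> ?C \<Longrightarrow> dist x y < \<delta> \<Longrightarrow> norm (f' x v - f' y v) \<le> \<eta> * norm v"
      using unif[OF eta] by blast
    have "dist (W0 y h t) (W0 z h t) < e" if y: "y \<in> ?B" "dist y z < \<delta>/2" for y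
    proof -
      let ?q = "\<lambda>t. W0 y h t - W0 z h t"
      have "norm (?q t) \<le> 2 * (norm (?q 0) + (2 * \<eta> * norm h) * 1)"
      proof (rule short_gronwall[where L="1/2" and z'="\<lambda>t. f' (X y t) (W0 y h t) - f' (X z t) (W0 z h t)"])
        fix t :: real assume t: "t \<in> {0..1}"
        show "(?q has_vector_derivative f' (X y t) (W0 y h t) - f' (X z t) (W0 z h t)) (at t within {0..1})"
          by (intro derivative_intros W0(2) z y t)
        have "norm (X y t - X z t) \<le> 2 * norm (y - z)" by (rule Xlip[OF y(1) z t])
        then have "norm (f' (X y t) (W0 z h t) - f' (X z t) (W0 z h t)) \<le> \<eta> * norm (W0 z h t)"
          by (intro d(2)) (use y X z t in \<open>auto simp: dist_norm\<close>)
        also have "\<dots> \<le> \<eta> * (2 * norm h)" using W2[OF z t] eta by (intro mult_left_mono) auto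
        finally have 1: "norm (f' (X y t) (W0 z h t) - f' (X z t) (W0 z h t)) \<le> 2 * \<eta> * norm h" by simp
        have 2: "norm (f' (X y t) (?q t)) \<le> 1/2 * norm (?q t)" by (rule half) (use X y t in auto)
        have "f' (X y t) (W0 y h t) - f' (X z t) (W0 z h t)
            = f' (X y t) (?q t) + (f' (X y t) (W0 z h t) - f' (X z t) (W0 z h t))"
          using linear_diff[OF lin[OF X(2)[OF y(1) t]]] by simp
        then show "norm (f' (X y t) (W0 y h t) - f' (X z t) (W0 z h t)) \<le> 1/2 * norm (?q t) + 2 * \<eta> * norm h"
          using 1 2 norm_triangle_ineq by (smt (verit))
      qed (use t eta in auto)
      also have "\<dots> = 4 * \<eta> * norm h" using W0 y z by simp
      also have "\<dots> \<le> 4 * \<eta> * (norm h + 1)" using eta by simp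
      also have "\<dots> = e / 2" by (simp add: \<eta>_def add_nonneg_eq_0_iff field_simps)
      finally show ?thesis using e by (simp add: dist_norm)
    qed
    then show "\<exists>d>0. \<forall>x'\<in>?B. dist x' z < d \<longrightarrow> dist (W0 x' h t) (W0 z h t) < e"
      using d(1) by (intro exI[of _ "\<delta>/2"]) auto
  qed
  show ?thesis
  proof (rule that[of "\<lambda>t z. X z t" "\<lambda>t z h. W0 z h t"])
    fix x :: "real \<Rightarrow> 'a" and t :: real assume x: "x 0 \<in> ?B" "\<And>t. t \<in> {0..1} \<Longrightarrow> x t \<in> ?C"
      "\<And>t. t \<in> {0..1} \<Longrightarrow> (x has_vector_derivative f (x t)) (at t within {0..1})" "t \<in> {0..1}"
    show "x t = X (x 0) t" by (rule uniq[OF x])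
  qed (rule X W0 deriv Wcont; assumption)+
qed

lemma integral_curve_exists:
  fixes X :: "'a::euclidean_space \<Rightarrow> 'a"
  assumes S: "open S" "p \<in> S" and dX: "\<And>z. z \<in> S \<Longrightarrow> (X has_derivative X' z) (at z)"
    and cX: "\<And>v. continuous_on S (\<lambda>z. X' z v)"
  obtains T x where "T > 0" "x 0 = p" "\<And>t. t \<in> {0..T} \<Longrightarrow> x t \<in> S"
    "\<And>t. t \<in> {0..T} \<Longrightarrow> (x has_vector_derivative X (x t)) (at t within {0..T})"
proof -
  obtain \<rho> where rho: "\<rho> > 0" "cball p \<rho> \<subseteq> S" using S open_contains_cball by blast
  let ?C = "cball p \<rho>"
  have "\<exists>C>0. \<forall>z\<in>?C. \<forall>v. norm (X' z v) \<le> C * norm v"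
  proof (rule operator_family_bounds(1))
    show "continuous_on ?C (\<lambda>z. X' z v)" for v using cX rho(2) by (rule continuous_on_subset)
    show "linear (X' z)" if "z \<in> ?C" for z using dX[of z] that rho has_derivative_linear by blast
  qed auto
  then obtain L where L: "L > 0" "\<And>z v. z \<in> ?C \<Longrightarrow> norm (X' z v) \<le> L * norm v" by blast
  have contX: "continuous_on ?C X"
    by (rule continuous_at_imp_continuous_on) (use dX rho has_derivative_continuous in blast)
  then have "bounded (X ` ?C)" by (simp add: compact_continuous_image compact_imp_bounded)
  then obtain M where M: "M > 0" "\<And>z. z \<in> ?C \<Longrightarrow> norm (X z) \<le> M" unfolding bounded_pos by auto
  \<comment> \<open>The first bound makes the Picard operator a contraction, the second keeps the
    solution in the ball of radius \<rho>.\<close>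
  define T where "T = min (1 / (2 * L)) (\<rho> / M)"
  have T: "T > 0" "L * T < 1" "M * T \<le> \<rho>"
    using rho L M by (auto simp: T_def min_def field_simps)
  have "\<exists>x. x 0 = p \<and> (\<forall>t\<in>{0..T}. x t \<in> ?C \<and> (x has_vector_derivative X (x t)) (at t within {0..T}))"
  proof (rule picard_cball[where L=L and M=M and f="\<lambda>t. X"])
    show "continuous_on ({0..T} \<times> ?C) (\<lambda>(t, z). X z)"
      unfolding case_prod_beta by (rule continuous_on_compose2[OF contX]) (auto intro!: continuous_intros)
    fix x y assume xy: "x \<in> ?C" "y \<in> ?C"
    show "norm (X x - X y) \<le> L * norm (x - y)"
    proof (rule differentiable_bound[of ?C X X'])
      fix z assume z: "z \<in> ?C"
      show "(X has_derivative X' z) (at z within ?C)" using dX z rho has_derivative_at_withinI by blast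
      show "onorm (X' z) \<le> L" using L z by (intro onorm_le) auto
    qed (use xy in auto)
  qed (use T rho L M in auto)
  then show ?thesis using that T(1) rho(2) by blast
qed

text \<open>A linear right-hand side is globally Lipschitz with a constant that does not depend on
  the initial value, so a single interval \<open>{0..e}\<close> serves all \<open>h\<close>. This
  lets the members of a frame share one domain.\<close>

lemma linear_ode_exists:
  fixes A :: "real \<Rightarrow> 'a::euclidean_space \<Rightarrow> 'a"
  assumes T: "T > 0" and lin: "\<And>t. t \<in> {0..T} \<Longrightarrow> linear (A t)"
    and cont: "\<And>v. continuous_on {0..T} (\<lambda>t. A t v)"
  obtains e where "0 < e" "e \<le> T"
    "\<And>h. \<exists>w. w 0 = h \<and> (\<forall>t\<in>{0..e}. (w has_vector_derivative A t (w t)) (at t within {0..e}))"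
proof -
  have "\<exists>C>0. \<forall>z\<in>{0..T}. \<forall>v. norm (A z v) \<le> C * norm v"
    by (rule operator_family_bounds(1)) (use lin cont in auto)
  then obtain L where L: "L > 0" "\<And>z v. z \<in> {0..T} \<Longrightarrow> norm (A z v) \<le> L * norm v" by blast
  define e where "e = min T (1 / (2 * L))"
  have e: "0 < e" "e \<le> T" "L * e < 1" using T L by (auto simp: e_def min_def field_simps)
  have "\<exists>w. w 0 = h \<and> (\<forall>t\<in>{0..e}. (w has_vector_derivative A t (w t)) (at t within {0..e}))" for h
  proof (rule picard_global[where T=e and L=L and f=A])
    have "continuous_on ({0..e} \<times> UNIV) (\<lambda>p. \<Sum>b\<in>Basis. (snd p \<bullet> b) *\<^sub>R A (fst p) b)"
      using e by (intro continuous_intros continuous_on_compose2[OF cont]) auto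
    then show "continuous_on ({0..e} \<times> UNIV) (\<lambda>(t, w). A t w)"
    proof (rule continuous_on_eq)
      fix p :: "real \<times> 'a" assume "p \<in> {0..e} \<times> UNIV"
      then have l: "linear (A (fst p))" using lin e by auto
      show "(\<Sum>b\<in>Basis. (snd p \<bullet> b) *\<^sub>R A (fst p) b) = (case p of (t, w) \<Rightarrow> A t w)"
        using linear_sum[OF l, of "\<lambda>b. (snd p \<bullet> b) *\<^sub>R b" Basis]
        by (simp add: case_prod_beta euclidean_representation linear_scale[OF l])
    qed
    fix t :: real and x y :: 'a assume "t \<in> {0..e}"
    then show "norm (A t x - A t y) \<le> L * norm (x - y)"
      using L(2)[of t "x - y"] linear_diff[OF lin] e by simp
  qed (use e L in auto)
  then show ?thesis using that e by blast
qed

section \<open>Differential calculus\<close>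

lemma has_vector_derivative_chain:
  assumes f: "(f has_derivative f') (at (x s))" and x: "(x has_vector_derivative x') (at s within S)"
  shows "((\<lambda>t. f (x t)) has_vector_derivative f' x') (at s within S)"
  using has_derivative_compose[OF x[unfolded has_vector_derivative_def] f]
  by (simp add: has_vector_derivative_def linear_scale[OF has_derivative_linear[OF f]])

text \<open>Two applications of the mean value theorem, first in \<open>u\<close>, then in
  \<open>v\<close>. The second difference on the left is symmetric in \<open>u\<close> and
  \<open>v\<close>, so evaluating it in both orders compares the two mixed derivatives at nearby
  points.\<close>

lemma double_difference:
  fixes f :: "'a::real_normed_vector \<Rightarrow> real"
  assumes s: "s > 0" and B: "\<And>\<sigma> \<tau>. \<sigma> \<in> {0..s} \<Longrightarrow> \<tau> \<in> {0..s} \<Longrightarrow> x + \<sigma> *\<^sub>R u + \<tau> *\<^sub>R v \<in> S"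
    and df: "\<And>y. y \<in> S \<Longrightarrow> (f has_derivative f' y) (at y)"
    and dfu: "\<And>y. y \<in> S \<Longrightarrow> ((\<lambda>y. f' y u) has_derivative F y) (at y)"
  obtains \<sigma> \<tau> where "\<sigma> \<in> {0..s}" "\<tau> \<in> {0..s}"
    "f (x + s *\<^sub>R u + s *\<^sub>R v) - f (x + s *\<^sub>R u) - f (x + s *\<^sub>R v) + f x = s * s * F (x + \<sigma> *\<^sub>R u + \<tau> *\<^sub>R v) v"
proof -
  have 1: "((\<lambda>\<sigma>. f (x + \<sigma> *\<^sub>R u + \<tau> *\<^sub>R v)) has_derivative (\<lambda>h. f' (x + \<sigma> *\<^sub>R u + \<tau> *\<^sub>R v) (h *\<^sub>R u))) (at \<sigma>)"
    if "\<sigma> \<in> {0..s}" "\<tau> \<in> {0..s}" for \<sigma> \<tau>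
    by (rule has_derivative_compose[where f="\<lambda>\<sigma>. x + \<sigma> *\<^sub>R u + \<tau> *\<^sub>R v" and g=f])
       (use df[OF B[OF that]] in \<open>auto intro!: derivative_eq_intros\<close>)
  have "\<exists>z. 0 < z \<and> z < s \<and> (\<lambda>\<sigma>. f (x + \<sigma> *\<^sub>R u + s *\<^sub>R v) - f (x + \<sigma> *\<^sub>R u)) s -
      (\<lambda>\<sigma>. f (x + \<sigma> *\<^sub>R u + s *\<^sub>R v) - f (x + \<sigma> *\<^sub>R u)) 0 =
      (s - 0) * (f' (x + z *\<^sub>R u + s *\<^sub>R v) u - f' (x + z *\<^sub>R u) u)"
  proof (rule MVT2[OF s])
    fix z :: real assume z: "0 \<le> z" "z \<le> s"
    have l: "linear (f' (x + z *\<^sub>R u + \<tau> *\<^sub>R v))" if "\<tau> \<in> {0..s}" for \<tau>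
      using df[OF B[of z \<tau>]] z that has_derivative_linear by auto
    show "((\<lambda>\<sigma>. f (x + \<sigma> *\<^sub>R u + s *\<^sub>R v) - f (x + \<sigma> *\<^sub>R u)) has_real_derivative
        f' (x + z *\<^sub>R u + s *\<^sub>R v) u - f' (x + z *\<^sub>R u) u) (at z)"
      unfolding has_field_derivative_def
      by (rule has_derivative_eq_rhs[OF has_derivative_diff[OF 1[of z s] 1[of z 0, simplified]]])
         (use z s linear_scale[OF l[of s]] linear_scale[OF l[of 0, simplified]] in \<open>auto simp: fun_eq_iff algebra_simps\<close>)
  qed
  then obtain \<sigma> where \<sigma>: "0 < \<sigma>" "\<sigma> < s" and
    e1: "f (x + s *\<^sub>R u + s *\<^sub>R v) - f (x + s *\<^sub>R u) - (f (x + s *\<^sub>R v) - f x) = s * (f' (x + \<sigma> *\<^sub>R u + s *\<^sub>R v) u - f' (x + \<sigma> *\<^sub>R u) u)"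
    by auto
  have "\<exists>z. 0 < z \<and> z < s \<and> (\<lambda>\<tau>. f' (x + \<sigma> *\<^sub>R u + \<tau> *\<^sub>R v) u) s - (\<lambda>\<tau>. f' (x + \<sigma> *\<^sub>R u + \<tau> *\<^sub>R v) u) 0
      = (s - 0) * F (x + \<sigma> *\<^sub>R u + z *\<^sub>R v) v"
  proof (rule MVT2[OF s])
    fix z :: real assume z: "0 \<le> z" "z \<le> s"
    have B': "x + \<sigma> *\<^sub>R u + z *\<^sub>R v \<in> S" using B z \<sigma> by auto
    have "((\<lambda>\<tau>. f' (x + \<sigma> *\<^sub>R u + \<tau> *\<^sub>R v) u) has_derivative (\<lambda>h. F (x + \<sigma> *\<^sub>R u + z *\<^sub>R v) (h *\<^sub>R v))) (at z)"
      by (rule has_derivative_compose[where f="\<lambda>\<tau>. x + \<sigma> *\<^sub>R u + \<tau> *\<^sub>R v" and g="\<lambda>y. f' y u"])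
         (use dfu[OF B'] in \<open>auto intro!: derivative_eq_intros\<close>)
    moreover have "linear (F (x + \<sigma> *\<^sub>R u + z *\<^sub>R v))" using dfu[OF B'] has_derivative_linear by blast
    ultimately show "((\<lambda>\<tau>. f' (x + \<sigma> *\<^sub>R u + \<tau> *\<^sub>R v) u) has_real_derivative F (x + \<sigma> *\<^sub>R u + z *\<^sub>R v) v) (at z)"
      by (simp add: has_field_derivative_def linear_scale mult_commute_abs)
  qed
  then obtain \<tau> where \<tau>: "0 < \<tau>" "\<tau> < s"
    "f' (x + \<sigma> *\<^sub>R u + s *\<^sub>R v) u - f' (x + \<sigma> *\<^sub>R u) u = s * F (x + \<sigma> *\<^sub>R u + \<tau> *\<^sub>R v) v" by auto
  show ?thesis by (rule that[of \<sigma> \<tau>]) (use \<sigma> \<tau> e1 in auto)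
qed

lemma second_derivative_symmetric_real:
  fixes f :: "'a::real_normed_vector \<Rightarrow> real"
  assumes S: "open S" "x \<in> S" and df: "\<And>y. y \<in> S \<Longrightarrow> (f has_derivative f' y) (at y)"
    and dfu: "\<And>y. y \<in> S \<Longrightarrow> ((\<lambda>y. f' y u) has_derivative F y) (at y)"
    and dfv: "\<And>y. y \<in> S \<Longrightarrow> ((\<lambda>y. f' y v) has_derivative G y) (at y)"
    and cont: "continuous_on S (\<lambda>y. F y v)" "continuous_on S (\<lambda>y. G y u)"
  shows "F x v = G x u"
proof -
  have "\<bar>F x v - G x u\<bar> \<le> 2 * e" if e: "e > 0" for e
  proof -
    have "\<forall>\<^sub>F y in nhds x. \<bar>F y v - F x v\<bar> < e \<and> \<bar>G y u - G x u\<bar> < e \<and> y \<in> S"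
    proof (intro eventually_conj)
      have "isCont (\<lambda>y. F y v) x" "isCont (\<lambda>y. G y u) x" using cont S continuous_on_eq_continuous_at by blast+
      then show "\<forall>\<^sub>F y in nhds x. \<bar>F y v - F x v\<bar> < e" "\<forall>\<^sub>F y in nhds x. \<bar>G y u - G x u\<bar> < e"
        using e tendstoD[of "\<lambda>y. F y v" "F x v" "nhds x" e] tendstoD[of "\<lambda>y. G y u" "G x u" "nhds x" e]
        by (auto simp: tendsto_nhds_iff dist_real_def isCont_def)
      show "\<forall>\<^sub>F y in nhds x. y \<in> S" using S eventually_nhds by blast
    qed
    then obtain d where d: "d > 0" "\<And>y. dist y x < d \<Longrightarrow> \<bar>F y v - F x v\<bar> < e \<and> \<bar>G y u - G x u\<bar> < e \<and> y \<in> S"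
      unfolding eventually_nhds_metric by blast
    define s where "s = d / (2 * (norm u + norm v + 1))"
    have s: "s > 0" using d by (simp add: s_def add_nonneg_pos)
    have near: "dist (x + \<sigma> *\<^sub>R u + \<tau> *\<^sub>R v) x < d" if "\<sigma> \<in> {0..s}" "\<tau> \<in> {0..s}" for \<sigma> \<tau>
    proof -
      have "norm (\<sigma> *\<^sub>R u + \<tau> *\<^sub>R v) \<le> s * norm u + s * norm v"
        using that by (intro norm_triangle_le add_mono) (auto simp: mult_right_mono)
      also have "\<dots> \<le> s * (norm u + norm v + 1)" using s by (simp add: algebra_simps)
      also have "\<dots> = d / 2" by (simp add: s_def field_simps add_nonneg_eq_0_iff)
      also have "\<dots> < d" using d by simp
      finally show ?thesis by (simp add: dist_norm add.assoc)
    qed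
    obtain a b where ab: "a \<in> {0..s}" "b \<in> {0..s}"
      "f (x + s *\<^sub>R u + s *\<^sub>R v) - f (x + s *\<^sub>R u) - f (x + s *\<^sub>R v) + f x = s * s * F (x + a *\<^sub>R u + b *\<^sub>R v) v"
      by (rule double_difference[OF s _ df dfu, of x v]) (use near d in auto)
    have near': "dist (x + \<sigma> *\<^sub>R v + \<tau> *\<^sub>R u) x < d" if "\<sigma> \<in> {0..s}" "\<tau> \<in> {0..s}" for \<sigma> \<tau>
      using near[OF that(2,1)] by (simp add: algebra_simps)
    obtain a' b' where ab': "a' \<in> {0..s}" "b' \<in> {0..s}"
      "f (x + s *\<^sub>R v + s *\<^sub>R u) - f (x + s *\<^sub>R v) - f (x + s *\<^sub>R u) + f x = s * s * G (x + a' *\<^sub>R v + b' *\<^sub>R u) u"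
      by (rule double_difference[OF s _ df dfv, of x u]) (use near' d in auto)
    have "s * s * F (x + a *\<^sub>R u + b *\<^sub>R v) v = s * s * G (x + a' *\<^sub>R v + b' *\<^sub>R u) u"
      using ab(3) ab'(3) by (simp add: algebra_simps)
    then have "F (x + a *\<^sub>R u + b *\<^sub>R v) v = G (x + a' *\<^sub>R v + b' *\<^sub>R u) u" using s by simp
    then show ?thesis using d(2)[OF near[OF ab(1,2)]] d(2)[OF near'[OF ab'(1,2)]] by linarith
  qed
  \<comment> \<open>With a quarter of the discrepancy as \<open>e\<close>, the discrepancy would be
    at most half of itself.\<close>
  from this[of "\<bar>F x v - G x u\<bar> / 4"] show ?thesis by (cases "F x v = G x u") auto
qed

lemma second_derivative_symmetric:
  fixes f :: "'a::real_normed_vector \<Rightarrow> 'b::euclidean_space"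
  assumes S: "open S" "x \<in> S" and df: "\<And>y. y \<in> S \<Longrightarrow> (f has_derivative f' y) (at y)"
    and dfu: "\<And>y. y \<in> S \<Longrightarrow> ((\<lambda>y. f' y u) has_derivative F y) (at y)"
    and dfv: "\<And>y. y \<in> S \<Longrightarrow> ((\<lambda>y. f' y v) has_derivative G y) (at y)"
    and cont: "continuous_on S (\<lambda>y. F y v)" "continuous_on S (\<lambda>y. G y u)"
  shows "F x v = G x u"
proof (rule euclidean_eqI)
  fix b :: 'b
  show "F x v \<bullet> b = G x u \<bullet> b"
    by (rule second_derivative_symmetric_real[OF S, of "\<lambda>y. f y \<bullet> b" "\<lambda>y h. f' y h \<bullet> b" u "\<lambda>y h. F y h \<bullet> b" v "\<lambda>y h. G y h \<bullet> b"])
       (intro has_derivative_inner_left df dfu dfv continuous_intros cont; assumption)+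
qed

lemma tendsto_linear_family:
  fixes u :: "'t \<Rightarrow> 'a::euclidean_space" and A :: "'t \<Rightarrow> 'a \<Rightarrow> 'b::real_normed_vector"
  assumes A: "\<And>v. ((\<lambda>t. A t v) \<longlongrightarrow> A0 v) F" and u: "(u \<longlongrightarrow> u0) F"
    and lin: "\<forall>\<^sub>F t in F. linear (A t)" "linear A0"
  shows "((\<lambda>t. A t (u t)) \<longlongrightarrow> A0 u0) F"
proof -
  have exp: "(\<Sum>i\<in>Basis. (v \<bullet> i) *\<^sub>R L i) = L v" if "linear L" for L :: "'a \<Rightarrow> 'b" and v
    using linear_sum[OF that, of "\<lambda>i. (v \<bullet> i) *\<^sub>R i" Basis] by (simp add: euclidean_representation linear_scale[OF that])
  have "((\<lambda>t. \<Sum>i\<in>Basis. (u t \<bullet> i) *\<^sub>R A t i) \<longlongrightarrow> (\<Sum>i\<in>Basis. (u0 \<bullet> i) *\<^sub>R A0 i)) F"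
    by (intro tendsto_intros A u)
  then show ?thesis unfolding exp[OF lin(2)]
    by (rule Lim_transform_eventually) (use lin(1) in eventually_elim, simp add: exp)
qed

lemma continuous_on_linear_family:
  fixes u :: "'t::topological_space \<Rightarrow> 'a::euclidean_space" and A :: "'t \<Rightarrow> 'a \<Rightarrow> 'b::real_normed_vector"
  assumes A: "\<And>v. continuous_on S (\<lambda>t. A t v)" and u: "continuous_on S u"
    and lin: "\<And>t. t \<in> S \<Longrightarrow> linear (A t)"
  shows "continuous_on S (\<lambda>t. A t (u t))"
  unfolding continuous_on_def
proof
  fix t assume t: "t \<in> S"
  show "((\<lambda>t. A t (u t)) \<longlongrightarrow> A t (u t)) (at t within S)"
    by (rule tendsto_linear_family)
       (use A u lin t in \<open>auto simp: continuous_on_def eventually_at_filter\<close>)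
qed

text \<open>Differentiability is assumed only for fixed arguments \<open>u\<close>,
  \<open>v\<close>. Expanding both arguments in the basis reduces the claim to the product rule for
  finitely many coefficient functions, and the sum is folded back afterwards.\<close>

lemma has_derivative_bilinear_family:
  fixes B :: "'a::real_normed_vector \<Rightarrow> 'b::euclidean_space \<Rightarrow> 'c::euclidean_space \<Rightarrow> 'd::real_normed_vector"
  assumes U: "open U" "x s \<in> U" and bil: "\<And>y. y \<in> U \<Longrightarrow> bilinear (B y)"
    and dB: "\<And>u v. ((\<lambda>y. B y u v) has_derivative (\<lambda>h. DB h u v)) (at (x s))"
    and dx: "(x has_derivative x') (at s within S)" and du: "(u has_derivative u') (at s within S)"
    and dv: "(v has_derivative v') (at s within S)" and s: "s \<in> S"
  shows "((\<lambda>t. B (x t) (u t) (v t)) has_derivative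
    (\<lambda>h. DB (x' h) (u s) (v s) + B (x s) (u' h) (v s) + B (x s) (u s) (v' h))) (at s within S)"
proof -
  have exp: "B y a b = (\<Sum>i\<in>Basis. \<Sum>j\<in>Basis. (a \<bullet> i) *\<^sub>R (b \<bullet> j) *\<^sub>R B y i j)" if "y \<in> U" for y a b
    using bilinear_sum[OF bil[OF that], where f="\<lambda>i. (a \<bullet> i) *\<^sub>R i" and g="\<lambda>j. (b \<bullet> j) *\<^sub>R j" and S=Basis and T=Basis]
    by (simp add: euclidean_representation sum.cartesian_product mult.commute bilinear_lmul[OF bil[OF that]] bilinear_rmul[OF bil[OF that]])
  have expD: "DB h a b = (\<Sum>i\<in>Basis. \<Sum>j\<in>Basis. (a \<bullet> i) *\<^sub>R (b \<bullet> j) *\<^sub>R DB h i j)" for h a b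
  proof -
    have "((\<lambda>y. \<Sum>i\<in>Basis. \<Sum>j\<in>Basis. (a \<bullet> i) *\<^sub>R (b \<bullet> j) *\<^sub>R B y i j) has_derivative
       (\<lambda>h. \<Sum>i\<in>Basis. \<Sum>j\<in>Basis. (a \<bullet> i) *\<^sub>R (b \<bullet> j) *\<^sub>R DB h i j)) (at (x s))"
      by (intro has_derivative_sum has_derivative_scaleR_right dB)
    then have "((\<lambda>y. B y a b) has_derivative
       (\<lambda>h. \<Sum>i\<in>Basis. \<Sum>j\<in>Basis. (a \<bullet> i) *\<^sub>R (b \<bullet> j) *\<^sub>R DB h i j)) (at (x s))"
      by (rule has_derivative_transform_within_open[OF _ U]) (simp add: exp)
    from has_derivative_unique[OF dB this] show ?thesis by meson
  qed
  have xU: "\<forall>\<^sub>F t in at s within S. x t \<in> U"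
    using topological_tendstoD[OF has_derivative_continuous[OF dx, unfolded continuous_within] U] .
  have "((\<lambda>t. \<Sum>i\<in>Basis. \<Sum>j\<in>Basis. (u t \<bullet> i) *\<^sub>R (v t \<bullet> j) *\<^sub>R B (x t) i j) has_derivative
     (\<lambda>h. \<Sum>i\<in>Basis. \<Sum>j\<in>Basis. (u s \<bullet> i) *\<^sub>R ((v s \<bullet> j) *\<^sub>R DB (x' h) i j + (v' h \<bullet> j) *\<^sub>R B (x s) i j) +
         (u' h \<bullet> i) *\<^sub>R (v s \<bullet> j) *\<^sub>R B (x s) i j)) (at s within S)"
    by (intro has_derivative_sum has_derivative_scaleR has_derivative_inner_left du dv
        has_derivative_compose[OF dx, of _ "\<lambda>h. DB h i j" for i j] dB)
  moreover have "(\<Sum>i\<in>Basis. \<Sum>j\<in>Basis. (u s \<bullet> i) *\<^sub>R ((v s \<bullet> j) *\<^sub>R DB (x' h) i j + (v' h \<bullet> j) *\<^sub>R B (x s) i j) +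
         (u' h \<bullet> i) *\<^sub>R (v s \<bullet> j) *\<^sub>R B (x s) i j) =
      DB (x' h) (u s) (v s) + B (x s) (u' h) (v s) + B (x s) (u s) (v' h)" for h
    unfolding expD[of "x' h" "u s" "v s"] exp[OF U(2), of "u' h"] exp[OF U(2), of "u s"]
    by (simp add: sum.distrib algebra_simps)
  ultimately have "((\<lambda>t. \<Sum>i\<in>Basis. \<Sum>j\<in>Basis. (u t \<bullet> i) *\<^sub>R (v t \<bullet> j) *\<^sub>R B (x t) i j) has_derivative
     (\<lambda>h. DB (x' h) (u s) (v s) + B (x s) (u' h) (v s) + B (x s) (u s) (v' h))) (at s within S)"
    by simp
  then show ?thesis
  proof (rule has_derivative_transform_eventually)
    show "\<forall>\<^sub>F t in at s within S. (\<Sum>i\<in>Basis. \<Sum>j\<in>Basis. (u t \<bullet> i) *\<^sub>R (v t \<bullet> j) *\<^sub>R B (x t) i j) = B (x t) (u t) (v t)"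
      using xU by eventually_elim (simp add: exp)
  qed (use exp U s in auto)
qed

lemma has_vector_derivative_bilinear_family:
  fixes B :: "'a::real_normed_vector \<Rightarrow> 'b::euclidean_space \<Rightarrow> 'c::euclidean_space \<Rightarrow> 'd::real_normed_vector"
  assumes U: "open U" "x s \<in> U" and bil: "\<And>y. y \<in> U \<Longrightarrow> bilinear (B y)"
    and dB: "\<And>u v. ((\<lambda>y. B y u v) has_derivative (\<lambda>h. DB h u v)) (at (x s))"
    and d: "(x has_vector_derivative x') (at s within S)" "(u has_vector_derivative u') (at s within S)"
      "(v has_vector_derivative v') (at s within S)" and s: "s \<in> S"
  shows "((\<lambda>t. B (x t) (u t) (v t)) has_vector_derivative
    DB x' (u s) (v s) + B (x s) u' (v s) + B (x s) (u s) v') (at s within S)"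
  unfolding has_vector_derivative_def
  by (rule has_derivative_eq_rhs[OF has_derivative_bilinear_family[OF U bil dB d[unfolded has_vector_derivative_def] s]])
     (simp_all add: fun_eq_iff linear_scale[OF has_derivative_linear[OF dB]] bilinear_lmul[OF bil[OF U(2)]] bilinear_rmul[OF bil[OF U(2)]] scaleR_add_right)

lemma has_derivative_linear_family:
  fixes A :: "'a::real_normed_vector \<Rightarrow> 'b::euclidean_space \<Rightarrow> 'd::real_normed_vector"
  assumes U: "open U" "x s \<in> U" and lin: "\<And>y. y \<in> U \<Longrightarrow> linear (A y)"
    and dA: "\<And>u. ((\<lambda>y. A y u) has_derivative (\<lambda>h. DA h u)) (at (x s))"
    and dx: "(x has_derivative x') (at s within S)" and du: "(u has_derivative u') (at s within S)" and s: "s \<in> S"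
  shows "((\<lambda>t. A (x t) (u t)) has_derivative (\<lambda>h. DA (x' h) (u s) + A (x s) (u' h))) (at s within S)"
proof -
  \<comment> \<open>A linear family is a bilinear one with a real second argument, here held at the
    constant 1.\<close>
  have "((\<lambda>t. (\<lambda>y u (r::real). r *\<^sub>R A y u) (x t) (u t) ((\<lambda>_. 1) t)) has_derivative
    (\<lambda>h. (\<lambda>h u r. r *\<^sub>R DA h u) (x' h) (u s) ((\<lambda>_. 1) s) + (\<lambda>y u r. r *\<^sub>R A y u) (x s) (u' h) ((\<lambda>_. 1) s)
      + (\<lambda>y u r. r *\<^sub>R A y u) (x s) (u s) 0)) (at s within S)"
  proof (rule has_derivative_bilinear_family[OF U _ _ dx du _ s])
    show "bilinear (\<lambda>u (r::real). r *\<^sub>R A y u)" if "y \<in> U" for y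
      unfolding bilinear_def using lin[OF that]
      by (auto intro!: linearI simp: linear_add linear_scale algebra_simps)
  qed (auto intro!: derivative_intros dA)
  then show ?thesis by simp
qed

section \<open>Functions of class C^k\<close>

text \<open>The condition under which a derivative within \<open>S\<close> is unique. It covers open
  sets as well as nondegenerate intervals with their end points, the two kinds of domain on which
  \<open>Ck_on\<close> is used.\<close>

definition rich :: "'a::euclidean_space set \<Rightarrow> bool" where
  "rich S \<longleftrightarrow> (\<forall>x\<in>S. \<forall>i\<in>Basis. \<forall>e>0. \<exists>d. 0 < \<bar>d\<bar> \<and> \<bar>d\<bar> < e \<and> x + d *\<^sub>R i \<in> S)"

lemma rich_unique:
  fixes f :: "'a::euclidean_space \<Rightarrow> 'b::real_normed_vector"
  assumes "rich S" "x \<in> S" "(f has_derivative f') (at x within S)" "(f has_derivative f'') (at x within S)"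
  shows "f' = f''"
  using assms frechet_derivative_unique_within[of f f' x S f''] unfolding rich_def by blast

lemma rich_open: "open S \<Longrightarrow> rich S"
  unfolding rich_def
proof (intro ballI allI impI)
  fix x i :: 'a and e :: real assume S: "open S" "x \<in> S" and i: "i \<in> Basis" and e: "e > 0"
  obtain r where r: "r > 0" "ball x r \<subseteq> S" using S open_contains_ball by blast
  show "\<exists>d. 0 < \<bar>d\<bar> \<and> \<bar>d\<bar> < e \<and> x + d *\<^sub>R i \<in> S"
    by (rule exI[of _ "min (e/2) (r/2)"]) (use e r i in \<open>auto simp: subset_eq dist_norm\<close>)
qed

lemma rich_interval_Int:
  fixes I :: "real set"
  assumes I: "is_interval I" "a \<in> I" "b \<in> I" "a < b" and Q: "open Q"
  shows "rich (I \<inter> Q)"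
  unfolding rich_def
proof (intro ballI allI impI)
  fix x i e :: real assume x: "x \<in> I \<inter> Q" and i: "i \<in> Basis" and e: "e > 0"
  obtain r where r: "r > 0" "ball x r \<subseteq> Q" using Q x open_contains_ball by blast
  have i1: "i = 1" using i by simp
  have conv: "z \<in> I" if "u \<in> I" "v \<in> I" "u \<le> z" "z \<le> v" for u v z
    using I(1) that unfolding is_interval_1 by blast
  \<comment> \<open>Half the length of the segment from \<open>a\<close> to \<open>b\<close> fits on
    at least one side of \<open>x\<close>, so the step goes to the right from the left half and to
    the left otherwise.\<close>
  define \<mu> where "\<mu> = min (e/2) (min (r/2) ((b - a)/2))"
  have mu: "\<mu> > 0" "\<mu> < e" "\<mu> < r" "\<mu> \<le> (b-a)/2" using e r I by (auto simp: \<mu>_def min_def)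
  show "\<exists>d. 0 < \<bar>d\<bar> \<and> \<bar>d\<bar> < e \<and> x + d *\<^sub>R i \<in> I \<inter> Q"
  proof (cases "x \<le> (a + b)/2")
    case True
    have "x + \<mu> \<in> I" by (rule conv[of x b]) (use x I True mu in \<open>auto simp: field_simps\<close>)
    then show ?thesis using mu r by (intro exI[of _ \<mu>]) (auto simp: i1 subset_eq dist_real_def)
  next
    case False
    have "x - \<mu> \<in> I" by (rule conv[of a x]) (use x I False mu in \<open>auto simp: field_simps\<close>)
    then show ?thesis using mu r by (intro exI[of _ "-\<mu>"]) (auto simp: i1 subset_eq dist_real_def)
  qed
qed

lemma frechet_derivative_within_eq:
  fixes f :: "'a::euclidean_space \<Rightarrow> 'b::real_normed_vector"
  assumes "rich S" "x \<in> S" "(f has_derivative f') (at x within S)"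
  shows "frechet_derivative f (at x within S) = f'"
  using rich_unique[OF assms(1,2) _ assms(3)] assms(3) differentiableI frechet_derivative_works by blast

lemma has_derivative_within_cong:
  assumes "\<And>x. x \<in> S \<Longrightarrow> f x = g x" "x \<in> S"
  shows "(f has_derivative f') (at x within S) \<longleftrightarrow> (g has_derivative f') (at x within S)"
  using assms by (auto elim!: has_derivative_transform[rotated 2])

lemma Ck_on_cong:
  assumes "\<And>x. x \<in> S \<Longrightarrow> f x = g x"
  shows "Ck_on k f S \<longleftrightarrow> Ck_on k g S"
  using assms
proof (induction k arbitrary: f g)
  case 0 then show ?case by (auto intro: continuous_on_cong[THEN iffD1, rotated 2])
next
  case (Suc k)
  have "frechet_derivative f (at x within S) = frechet_derivative g (at x within S)" if "x \<in> S" for x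
    unfolding frechet_derivative_def using has_derivative_within_cong[of S f g x] Suc.prems that by simp
  moreover have "f differentiable (at x within S) \<longleftrightarrow> g differentiable (at x within S)" if "x \<in> S" for x
    unfolding differentiable_def using has_derivative_within_cong[of S f g x] Suc.prems that by simp
  ultimately show ?case using Suc.IH[of "\<lambda>x. frechet_derivative f (at x within S) v" "\<lambda>x. frechet_derivative g (at x within S) v" for v]
    by simp
qed

lemma Ck_on_SucI:
  fixes f :: "'a::euclidean_space \<Rightarrow> 'b::real_normed_vector"
  assumes "rich S" "\<And>x. x \<in> S \<Longrightarrow> (f has_derivative f' x) (at x within S)" "\<And>v. Ck_on k (\<lambda>x. f' x v) S"
  shows "Ck_on (Suc k) f S"
proof -
  have "Ck_on k (\<lambda>x. frechet_derivative f (at x within S) v) S" for v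
    using assms(3)[of v] Ck_on_cong[of S "\<lambda>x. f' x v" "\<lambda>x. frechet_derivative f (at x within S) v" k]
      frechet_derivative_within_eq[OF assms(1) _ assms(2)] by simp
  then show ?thesis by (auto intro: differentiableI[OF assms(2)])
qed

lemma Ck_on_SucD:
  assumes "Ck_on (Suc k) f S"
  obtains f' where "\<And>x. x \<in> S \<Longrightarrow> (f has_derivative f' x) (at x within S)" "\<And>v. Ck_on k (\<lambda>x. f' x v) S"
  using that[of "\<lambda>x. frechet_derivative f (at x within S)"] assms frechet_derivative_works by auto

lemma Ck_on_Suc_lower: "Ck_on (Suc k) f S \<Longrightarrow> Ck_on k f S"
proof (induction k arbitrary: f)
  case 0 then show ?case by (auto simp: continuous_on_eq_continuous_within differentiable_imp_continuous_within)
next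
  case (Suc k)
  from Suc.prems have d: "\<forall>x\<in>S. f differentiable (at x within S)" and
     c: "\<And>v. Ck_on (Suc k) (\<lambda>x. frechet_derivative f (at x within S) v) S" unfolding Ck_on.simps(2)[of "Suc k"] by auto
  show ?case unfolding Ck_on.simps(2)[of k] using d Suc.IH[OF c] by auto
qed

lemma Ck_on_subset:
  fixes f :: "'a::euclidean_space \<Rightarrow> 'b::real_normed_vector"
  assumes "rich T" "T \<subseteq> S"
  shows "Ck_on k f S \<Longrightarrow> Ck_on k f T"
proof (induction k arbitrary: f)
  case 0 then show ?case using assms continuous_on_subset by auto
next
  case (Suc k)
  obtain f' where f': "\<And>x. x \<in> S \<Longrightarrow> (f has_derivative f' x) (at x within S)" "\<And>v. Ck_on k (\<lambda>x. f' x v) S"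
    by (rule Ck_on_SucD[OF Suc.prems]) blast
  show ?case
    by (rule Ck_on_SucI[OF assms(1), of _ f']) (use f' assms Suc.IH has_derivative_subset in blast)+
qed

lemma Ck_on_const:
  fixes c :: "'b::real_normed_vector"
  shows "rich (S :: 'a::euclidean_space set) \<Longrightarrow> Ck_on k (\<lambda>x. c) S"
proof (induction k arbitrary: c)
  case (Suc k)
  show ?case by (rule Ck_on_SucI[of _ _ "\<lambda>_ _. 0"]) (use Suc in auto)
qed simp

lemma Ck_on_add:
  fixes f g :: "'a::euclidean_space \<Rightarrow> 'b::real_normed_vector"
  assumes "rich S"
  shows "Ck_on k f S \<Longrightarrow> Ck_on k g S \<Longrightarrow> Ck_on k (\<lambda>x. f x + g x) S"
proof (induction k arbitrary: f g)
  case (Suc k)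
  obtain f' where f': "\<And>x. x \<in> S \<Longrightarrow> (f has_derivative f' x) (at x within S)" "\<And>v. Ck_on k (\<lambda>x. f' x v) S"
    by (rule Ck_on_SucD[OF Suc.prems(1)]) blast
  obtain g' where g': "\<And>x. x \<in> S \<Longrightarrow> (g has_derivative g' x) (at x within S)" "\<And>v. Ck_on k (\<lambda>x. g' x v) S"
    by (rule Ck_on_SucD[OF Suc.prems(2)]) blast
  show ?case by (rule Ck_on_SucI[OF assms has_derivative_add[OF f'(1) g'(1)] Suc.IH[OF f'(2) g'(2)]])
qed (auto intro: continuous_intros)

lemma Ck_on_sum:
  fixes f :: "'i \<Rightarrow> 'a::euclidean_space \<Rightarrow> 'b::real_normed_vector"
  assumes "rich S" "\<And>i. i \<in> A \<Longrightarrow> Ck_on k (f i) S"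
  shows "Ck_on k (\<lambda>x. \<Sum>i\<in>A. f i x) S"
  using assms(2)
proof (induction A rule: infinite_finite_induct)
  case (insert a A) then show ?case using Ck_on_add[OF assms(1)] by auto
qed (auto intro: Ck_on_const assms(1))

lemma Ck_on_bounded_linear:
  fixes f :: "'a::euclidean_space \<Rightarrow> 'b::real_normed_vector"
  assumes "rich S" "bounded_linear L"
  shows "Ck_on k f S \<Longrightarrow> Ck_on k (\<lambda>x. L (f x)) S"
proof (induction k arbitrary: f)
  case (Suc k)
  obtain f' where f': "\<And>x. x \<in> S \<Longrightarrow> (f has_derivative f' x) (at x within S)" "\<And>v. Ck_on k (\<lambda>x. f' x v) S"
    by (rule Ck_on_SucD[OF Suc.prems(1)]) blast
  show ?case
    by (rule Ck_on_SucI[OF assms(1) bounded_linear.has_derivative[OF assms(2) f'(1)] Suc.IH[OF f'(2)]])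
qed (use assms bounded_linear.continuous_on in auto)

lemma Ck_on_bilinear:
  fixes f :: "'a::euclidean_space \<Rightarrow> 'b::real_normed_vector" and g :: "'a \<Rightarrow> 'c::real_normed_vector"
  assumes S: "rich S" and p: "bounded_bilinear p"
  shows "Ck_on k f S \<Longrightarrow> Ck_on k g S \<Longrightarrow> Ck_on k (\<lambda>x. p (f x) (g x)) S"
proof (induction k arbitrary: f g)
  case 0 then show ?case using bounded_bilinear.continuous_on[OF p] by auto
next
  case (Suc k)
  obtain f' where f': "\<And>x. x \<in> S \<Longrightarrow> (f has_derivative f' x) (at x within S)" "\<And>v. Ck_on k (\<lambda>x. f' x v) S"
    by (rule Ck_on_SucD[OF Suc.prems(1)]) blast
  obtain g' where g': "\<And>x. x \<in> S \<Longrightarrow> (g has_derivative g' x) (at x within S)" "\<And>v. Ck_on k (\<lambda>x. g' x v) S"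
    by (rule Ck_on_SucD[OF Suc.prems(2)]) blast
  show ?case
    by (rule Ck_on_SucI[OF S bounded_bilinear.FDERIV[OF p f'(1) g'(1)]], assumption, assumption)
       (intro Ck_on_add S Suc.IH Suc.prems[THEN Ck_on_Suc_lower] f' g')
qed

lemmas Ck_on_scaleR = Ck_on_bilinear[OF _ bounded_bilinear_scaleR]
  and Ck_on_mult = Ck_on_bilinear[OF _ bounded_bilinear_mult]
  and Ck_on_inner_left = Ck_on_bounded_linear[OF _ bounded_linear_inner_left]
  and Ck_on_uminus = Ck_on_bounded_linear[OF _ bounded_linear_minus[OF bounded_linear_ident]]
  and Ck_on_scaleR_right = Ck_on_bounded_linear[OF _ bounded_linear_scaleR_right]

lemma Ck_on_diff:
  fixes f g :: "'a::euclidean_space \<Rightarrow> 'b::real_normed_vector"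
  shows "rich S \<Longrightarrow> Ck_on k f S \<Longrightarrow> Ck_on k g S \<Longrightarrow> Ck_on k (\<lambda>x. f x - g x) S"
  using Ck_on_add[of S k f "\<lambda>x. - g x"] Ck_on_uminus by auto

lemma Ck_on_prod:
  fixes f :: "'i \<Rightarrow> 'a::euclidean_space \<Rightarrow> real"
  assumes "rich S" "\<And>i. i \<in> A \<Longrightarrow> Ck_on k (f i) S"
  shows "Ck_on k (\<lambda>x. \<Prod>i\<in>A. f i x) S"
  using assms(2)
proof (induction A rule: infinite_finite_induct)
  case (insert a A) then show ?case using Ck_on_mult[OF assms(1)] by auto
qed (auto intro: Ck_on_const assms(1))

lemma linear_Basis_expand:
  fixes L :: "'a::euclidean_space \<Rightarrow> 'b::real_normed_vector"
  assumes "linear L"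
  shows "L v = (\<Sum>i\<in>Basis. (v \<bullet> i) *\<^sub>R L i)"
  using linear_sum[OF assms, of "\<lambda>i. (v \<bullet> i) *\<^sub>R i" Basis] by (simp add: euclidean_representation linear_scale[OF assms])

lemma Ck_on_compose:
  fixes g :: "'b::euclidean_space \<Rightarrow> 'c::real_normed_vector" and f :: "'a::euclidean_space \<Rightarrow> 'b"
  assumes S: "rich S" and V: "open V" "f ` S \<subseteq> V"
  shows "Ck_on k g V \<Longrightarrow> Ck_on k f S \<Longrightarrow> Ck_on k (\<lambda>x. g (f x)) S"
proof (induction k arbitrary: g)
  case 0 then show ?case using V continuous_on_compose2 by auto
next
  case (Suc k)
  obtain f' where f': "\<And>x. x \<in> S \<Longrightarrow> (f has_derivative f' x) (at x within S)" "\<And>v. Ck_on k (\<lambda>x. f' x v) S"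
    by (rule Ck_on_SucD[OF Suc.prems(2)]) blast
  obtain g' where g': "\<And>x. x \<in> V \<Longrightarrow> (g has_derivative g' x) (at x within V)" "\<And>v. Ck_on k (\<lambda>x. g' x v) V"
    by (rule Ck_on_SucD[OF Suc.prems(1)]) blast
  \<comment> \<open>\<open>Ck_on\<close> controls derivatives in fixed directions only, whereas the
    chain rule inserts the varying vector \<open>f' x h\<close>. The basis expansion restores fixed
    directions.\<close>
  have d: "((\<lambda>x. g (f x)) has_derivative (\<lambda>h. \<Sum>i\<in>Basis. (f' x h \<bullet> i) *\<^sub>R g' (f x) i)) (at x within S)" if "x \<in> S" for x
  proof -
    have fx: "f x \<in> V" using V that by auto
    then have g1: "(g has_derivative g' (f x)) (at (f x))" using g'(1) V(1) at_within_open by metis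
    show ?thesis using has_derivative_compose[OF f'(1)[OF that] g1]
      by (simp add: linear_Basis_expand[OF has_derivative_linear[OF g1], symmetric])
  qed
  show ?case
    by (rule Ck_on_SucI[OF S d], assumption)
       (intro Ck_on_sum Ck_on_scaleR Ck_on_inner_left S f' Suc.IH[OF g'(2) Ck_on_Suc_lower[OF Suc.prems(2)]])
qed

lemma open_Ck_on_SucD:
  assumes "Ck_on (Suc k) f S" "open S"
  obtains f' where "\<And>x. x \<in> S \<Longrightarrow> (f has_derivative f' x) (at x)" "\<And>v. Ck_on k (\<lambda>x. f' x v) S"
  using assms(1)
proof (rule Ck_on_SucD)
  fix f' assume "\<And>x. x \<in> S \<Longrightarrow> (f has_derivative f' x) (at x within S)" "\<And>v. Ck_on k (\<lambda>x. f' x v) S"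
  then show thesis using that[of f'] assms(2) at_within_open by metis
qed

lemma open_Ck_on_SucI:
  fixes f :: "'a::euclidean_space \<Rightarrow> 'b::real_normed_vector"
  assumes "open S" "\<And>x. x \<in> S \<Longrightarrow> (f has_derivative f' x) (at x)" "\<And>v. Ck_on k (\<lambda>x. f' x v) S"
  shows "Ck_on (Suc k) f S"
  by (rule Ck_on_SucI[OF rich_open[OF assms(1)] has_derivative_at_withinI[OF assms(2)] assms(3)])

lemma Ck_on_inverse:
  fixes f :: "'a::euclidean_space \<Rightarrow> real"
  assumes "rich S" "Ck_on k f S" "\<And>x. x \<in> S \<Longrightarrow> f x \<noteq> 0"
  shows "Ck_on k (\<lambda>x. inverse (f x)) S"
proof -
  have V: "open (- {0::real})" by auto
  have "Ck_on k inverse (- {0::real})"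
  proof (induction k)
    case 0 show ?case by (auto intro!: continuous_intros)
  next
    case (Suc k)
    show ?case
    proof (rule open_Ck_on_SucI[OF V])
      show "(inverse has_derivative (\<lambda>h. - (inverse x * h * inverse x))) (at x)" if "x \<in> - {0}" for x :: real
        by (rule has_derivative_inverse') (use that in auto)
      show "Ck_on k (\<lambda>x. - (inverse x * v * inverse x)) (- {0::real})" for v
        by (intro Ck_on_uminus Ck_on_mult Suc Ck_on_const rich_open V)
    qed
  qed
  from Ck_on_compose[OF assms(1) V _ this assms(2)] assms(3) show ?thesis by fastforce
qed

lemma Ck_on_vector_SucI:
  fixes f :: "real \<Rightarrow> 'b::real_normed_vector"
  assumes "rich S" "\<And>x. x \<in> S \<Longrightarrow> (f has_vector_derivative f' x) (at x within S)" "Ck_on k f' S"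
  shows "Ck_on (Suc k) f S"
  by (rule Ck_on_SucI[of _ _ "\<lambda>x h. h *\<^sub>R f' x"])
     (use assms Ck_on_scaleR_right in \<open>auto simp: has_vector_derivative_def\<close>)

lemma Ck_on_vector_SucD:
  fixes f :: "real \<Rightarrow> 'b::real_normed_vector"
  assumes "Ck_on (Suc k) f S"
  obtains f' where "\<And>x. x \<in> S \<Longrightarrow> (f has_vector_derivative f' x) (at x within S)" "Ck_on k f' S"
  using assms
proof (rule Ck_on_SucD)
  fix f' assume f': "\<And>x. x \<in> S \<Longrightarrow> (f has_derivative f' x) (at x within S)" "\<And>v. Ck_on k (\<lambda>x. f' x v) S"
  show thesis
  proof (rule that[of "\<lambda>x. f' x 1"])
    fix x assume x: "x \<in> S"
    have "f' x h = h *\<^sub>R f' x 1" for h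
      using linear_scale[OF has_derivative_linear[OF f'(1)[OF x]], of h 1] by simp
    then show "(f has_vector_derivative f' x 1) (at x within S)"
      unfolding has_vector_derivative_def by (intro has_derivative_eq_rhs[OF f'(1)[OF x]] ext)
  qed (rule f'(2))
qed

section \<open>Riemannian metrics in a coordinate domain\<close>

text \<open>A metric and its Levi-Civita connection without indices: \<open>\<Gamma>_sym\<close>
  says that the connection is torsion free, \<open>dg\<close> that it is metric.
  \<open>D\<Gamma> x h u v\<close> is the derivative of \<Gamma> in direction \<open>h\<close>;
  continuity is all that a metric of class C^2 provides for it.\<close>

locale local_metric =
  fixes U :: "'e::euclidean_space set" and g :: "'e \<Rightarrow> 'e \<Rightarrow> 'e \<Rightarrow> real"
    and \<Gamma> :: "'e \<Rightarrow> 'e \<Rightarrow> 'e \<Rightarrow> 'e" and D\<Gamma> :: "'e \<Rightarrow> 'e \<Rightarrow> 'e \<Rightarrow> 'e \<Rightarrow> 'e"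
  assumes open_U: "open U"
    and g_bil: "x \<in> U \<Longrightarrow> bilinear (g x)"
    and g_sym: "x \<in> U \<Longrightarrow> g x u v = g x v u"
    and g_pos: "x \<in> U \<Longrightarrow> u \<noteq> 0 \<Longrightarrow> g x u u > 0"
    and \<Gamma>_bil: "x \<in> U \<Longrightarrow> bilinear (\<Gamma> x)"
    and \<Gamma>_sym: "x \<in> U \<Longrightarrow> \<Gamma> x u v = \<Gamma> x v u"
    and dg: "x \<in> U \<Longrightarrow> ((\<lambda>x. g x u v) has_derivative (\<lambda>h. g x (\<Gamma> x h u) v + g x u (\<Gamma> x h v))) (at x)"
    and d\<Gamma>: "x \<in> U \<Longrightarrow> ((\<lambda>x. \<Gamma> x u v) has_derivative (\<lambda>h. D\<Gamma> x h u v)) (at x)"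
    and cont_D\<Gamma>: "continuous_on U (\<lambda>x. D\<Gamma> x h u v)"
begin

lemma g_add: "x \<in> U \<Longrightarrow> g x (u + v) w = g x u w + g x v w" "x \<in> U \<Longrightarrow> g x w (u + v) = g x w u + g x w v"
  and g_diff: "x \<in> U \<Longrightarrow> g x (u - v) w = g x u w - g x v w" "x \<in> U \<Longrightarrow> g x w (u - v) = g x w u - g x w v"
  and g_scale: "x \<in> U \<Longrightarrow> g x (r *\<^sub>R u) w = r * g x u w" "x \<in> U \<Longrightarrow> g x w (r *\<^sub>R u) = r * g x w u"
  and g_minus: "x \<in> U \<Longrightarrow> g x (- u) w = - g x u w" "x \<in> U \<Longrightarrow> g x w (- u) = - g x w u"
  and g_zero: "x \<in> U \<Longrightarrow> g x 0 w = 0" "x \<in> U \<Longrightarrow> g x w 0 = 0"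
  using bilinear_ladd[OF g_bil] bilinear_radd[OF g_bil] bilinear_lsub[OF g_bil] bilinear_rsub[OF g_bil]
    bilinear_lmul[OF g_bil] bilinear_rmul[OF g_bil] bilinear_lneg[OF g_bil] bilinear_rneg[OF g_bil]
    bilinear_lzero[OF g_bil] bilinear_rzero[OF g_bil] by auto

lemma g_linear: "x \<in> U \<Longrightarrow> linear (g x u)" "x \<in> U \<Longrightarrow> linear (\<lambda>u. g x u v)"
  using g_bil unfolding bilinear_def by auto

lemma g_sum: "x \<in> U \<Longrightarrow> g x (\<Sum>i\<in>A. f i) v = (\<Sum>i\<in>A. g x (f i) v)"
  "x \<in> U \<Longrightarrow> g x v (\<Sum>i\<in>A. f i) = (\<Sum>i\<in>A. g x v (f i))"
  using linear_sum[OF g_linear(2)] linear_sum[OF g_linear(1)] by auto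

lemma g_nondegenerate:
  assumes "x \<in> U" "\<And>w. g x u w = g x v w"
  shows "u = v"
proof (rule ccontr)
  assume "u \<noteq> v"
  then have "g x (u - v) (u - v) > 0" using g_pos assms(1) by simp
  then show False using assms g_diff by simp
qed

lemma g_zero_iff: "x \<in> U \<Longrightarrow> g x u u = 0 \<longleftrightarrow> u = 0"
  using g_pos[of x u] g_zero by (cases "u = 0") auto

lemma g_nonneg: "x \<in> U \<Longrightarrow> g x u u \<ge> 0"
  using g_pos[of x u] g_zero by (cases "u = 0") auto

lemma \<Gamma>_add: "x \<in> U \<Longrightarrow> \<Gamma> x (u + v) w = \<Gamma> x u w + \<Gamma> x v w" "x \<in> U \<Longrightarrow> \<Gamma> x w (u + v) = \<Gamma> x w u + \<Gamma> x w v"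
  and \<Gamma>_diff: "x \<in> U \<Longrightarrow> \<Gamma> x (u - v) w = \<Gamma> x u w - \<Gamma> x v w" "x \<in> U \<Longrightarrow> \<Gamma> x w (u - v) = \<Gamma> x w u - \<Gamma> x w v"
  and \<Gamma>_scale: "x \<in> U \<Longrightarrow> \<Gamma> x (r *\<^sub>R u) w = r *\<^sub>R \<Gamma> x u w" "x \<in> U \<Longrightarrow> \<Gamma> x w (r *\<^sub>R u) = r *\<^sub>R \<Gamma> x w u"
  and \<Gamma>_minus: "x \<in> U \<Longrightarrow> \<Gamma> x (- u) w = - \<Gamma> x u w" "x \<in> U \<Longrightarrow> \<Gamma> x w (- u) = - \<Gamma> x w u"
  and \<Gamma>_zero: "x \<in> U \<Longrightarrow> \<Gamma> x 0 w = 0" "x \<in> U \<Longrightarrow> \<Gamma> x w 0 = 0"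
  using bilinear_ladd[OF \<Gamma>_bil] bilinear_radd[OF \<Gamma>_bil] bilinear_lsub[OF \<Gamma>_bil] bilinear_rsub[OF \<Gamma>_bil]
    bilinear_lmul[OF \<Gamma>_bil] bilinear_rmul[OF \<Gamma>_bil] bilinear_lneg[OF \<Gamma>_bil] bilinear_rneg[OF \<Gamma>_bil]
    bilinear_lzero[OF \<Gamma>_bil] bilinear_rzero[OF \<Gamma>_bil] by auto

lemma D\<Gamma>_linear1: "x \<in> U \<Longrightarrow> linear (\<lambda>h. D\<Gamma> x h u v)"
  using has_derivative_linear[OF d\<Gamma>] .

text \<open>Uniqueness of the derivative transfers every algebraic identity of \<Gamma> to
  \<open>D\<Gamma>\<close>.\<close>

lemma D\<Gamma>_eqI:
  assumes "x \<in> U" "\<And>y. y \<in> U \<Longrightarrow> \<Gamma> y u v = G y" "(G has_derivative G') (at x)"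
  shows "D\<Gamma> x h u v = G' h"
proof -
  have "((\<lambda>x. \<Gamma> x u v) has_derivative G') (at x)"
    using has_derivative_transform_within_open[OF assms(3) open_U assms(1)] assms(2) by metis
  from has_derivative_unique[OF d\<Gamma>[OF assms(1)] this] show ?thesis by meson
qed

lemma D\<Gamma>_sym: "x \<in> U \<Longrightarrow> D\<Gamma> x h u v = D\<Gamma> x h v u"
  by (rule D\<Gamma>_eqI[OF _ _ d\<Gamma>]) (auto simp: \<Gamma>_sym)

lemma D\<Gamma>_linear2:
  assumes x: "x \<in> U" shows "linear (\<lambda>u. D\<Gamma> x h u v)"
proof
  fix a b :: 'e and r :: real
  show "D\<Gamma> x h (a + b) v = D\<Gamma> x h a v + D\<Gamma> x h b v"
    by (rule D\<Gamma>_eqI[OF x _ has_derivative_add[OF d\<Gamma>[OF x] d\<Gamma>[OF x]]]) (simp add: \<Gamma>_add)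
  show "D\<Gamma> x h (r *\<^sub>R a) v = r *\<^sub>R D\<Gamma> x h a v"
    by (rule D\<Gamma>_eqI[OF x _ has_derivative_scaleR_right[OF d\<Gamma>[OF x]]]) (simp add: \<Gamma>_scale)
qed

lemma D\<Gamma>_linear3: "x \<in> U \<Longrightarrow> linear (\<lambda>v. D\<Gamma> x h u v)"
  using D\<Gamma>_linear2[of x h u] D\<Gamma>_sym[of x h u] by simp

text \<open>The curvature R(u,v)w computed with constant coordinate fields, whose Lie brackets
  vanish.\<close>

definition Rm :: "'e \<Rightarrow> 'e \<Rightarrow> 'e \<Rightarrow> 'e \<Rightarrow> 'e" where
  "Rm x u v w = D\<Gamma> x u v w - D\<Gamma> x v u w + \<Gamma> x u (\<Gamma> x v w) - \<Gamma> x v (\<Gamma> x u w)"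

lemma Rm_linear:
  assumes x: "x \<in> U"
  shows "linear (\<lambda>u. Rm x u v w)" "linear (\<lambda>v. Rm x u v w)" "linear (\<lambda>w. Rm x u v w)"
  by (auto intro!: linearI simp: Rm_def \<Gamma>_add[OF x] \<Gamma>_scale[OF x] algebra_simps
      linear_add[OF D\<Gamma>_linear1[OF x]] linear_scale[OF D\<Gamma>_linear1[OF x]] linear_add[OF D\<Gamma>_linear2[OF x]]
      linear_scale[OF D\<Gamma>_linear2[OF x]] linear_add[OF D\<Gamma>_linear3[OF x]] linear_scale[OF D\<Gamma>_linear3[OF x]])

lemma Rm_antisym: "Rm x u v w = - Rm x v u w"
  by (simp add: Rm_def)

lemma Rm_bianchi: "x \<in> U \<Longrightarrow> Rm x u v w + Rm x v w u + Rm x w u v = 0"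
  unfolding Rm_def using D\<Gamma>_sym[of x u v w] D\<Gamma>_sym[of x v w u] D\<Gamma>_sym[of x w u v]
    \<Gamma>_sym[of x v w] \<Gamma>_sym[of x u w] \<Gamma>_sym[of x u v] by simp

lemma cont_g: "continuous_on U (\<lambda>x. g x u v)"
  by (rule continuous_at_imp_continuous_on) (use has_derivative_continuous[OF dg] in blast)

lemma cont_\<Gamma>: "continuous_on U (\<lambda>x. \<Gamma> x u v)"
  by (rule continuous_at_imp_continuous_on) (use has_derivative_continuous[OF d\<Gamma>] in blast)

lemma continuous_on_g:
  assumes "continuous_on S x" "continuous_on S u" "continuous_on S v" "\<And>t. t \<in> S \<Longrightarrow> x t \<in> U"
  shows "continuous_on S (\<lambda>t. g (x t) (u t) (v t))"
  by (intro continuous_on_linear_family[of S "\<lambda>t v. g (x t) (u t) v" v] continuous_on_linear_family[of S "\<lambda>t u. g (x t) u w" u for w]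
        continuous_on_compose2[OF cont_g assms(1)] assms(2,3) g_linear) (use assms(4) in auto)

lemma continuous_on_\<Gamma>:
  assumes "continuous_on S x" "continuous_on S u" "continuous_on S v" "\<And>t. t \<in> S \<Longrightarrow> x t \<in> U"
  shows "continuous_on S (\<lambda>t. \<Gamma> (x t) (u t) (v t))"
  by (intro continuous_on_linear_family[of S "\<lambda>t v. \<Gamma> (x t) (u t) v" v] continuous_on_linear_family[of S "\<lambda>t u. \<Gamma> (x t) u w" u for w]
        continuous_on_compose2[OF cont_\<Gamma> assms(1)] assms(2,3)) (use assms(4) \<Gamma>_bil bilinear_def in blast)+

lemma continuous_on_D\<Gamma>:
  assumes "continuous_on S x" "continuous_on S h" "continuous_on S u" "continuous_on S v" "\<And>t. t \<in> S \<Longrightarrow> x t \<in> U"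
  shows "continuous_on S (\<lambda>t. D\<Gamma> (x t) (h t) (u t) (v t))"
  by (intro continuous_on_linear_family[of S "\<lambda>t v. D\<Gamma> (x t) (h t) (u t) v" v]
        continuous_on_linear_family[of S "\<lambda>t u. D\<Gamma> (x t) (h t) u w" u for w]
        continuous_on_linear_family[of S "\<lambda>t h. D\<Gamma> (x t) h u w" h for u w]
        continuous_on_compose2[OF cont_D\<Gamma> assms(1)] assms(2,3,4) D\<Gamma>_linear1 D\<Gamma>_linear2 D\<Gamma>_linear3) (use assms(5) in auto)

lemma continuous_on_Rm:
  assumes "continuous_on S x" "continuous_on S u" "continuous_on S v" "continuous_on S w" "\<And>t. t \<in> S \<Longrightarrow> x t \<in> U"
  shows "continuous_on S (\<lambda>t. Rm (x t) (u t) (v t) (w t))"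
  unfolding Rm_def by (intro continuous_intros continuous_on_\<Gamma> continuous_on_D\<Gamma> assms)

lemma has_derivative_\<Gamma>:
  assumes "x s \<in> U" "(x has_derivative x') (at s within S)" "(u has_derivative u') (at s within S)"
    "(v has_derivative v') (at s within S)" "s \<in> S"
  shows "((\<lambda>t. \<Gamma> (x t) (u t) (v t)) has_derivative
    (\<lambda>h. D\<Gamma> (x s) (x' h) (u s) (v s) + \<Gamma> (x s) (u' h) (v s) + \<Gamma> (x s) (u s) (v' h))) (at s within S)"
  by (rule has_derivative_bilinear_family[OF open_U assms(1) \<Gamma>_bil d\<Gamma>[OF assms(1)] assms(2-5)])

lemma has_vector_derivative_\<Gamma>:
  assumes "x s \<in> U" "(x has_vector_derivative x') (at s within S)" "(u has_vector_derivative u') (at s within S)"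
    "(v has_vector_derivative v') (at s within S)" "s \<in> S"
  shows "((\<lambda>t. \<Gamma> (x t) (u t) (v t)) has_vector_derivative
    D\<Gamma> (x s) x' (u s) (v s) + \<Gamma> (x s) u' (v s) + \<Gamma> (x s) (u s) v') (at s within S)"
  by (rule has_vector_derivative_bilinear_family[OF open_U assms(1) \<Gamma>_bil d\<Gamma>[OF assms(1)] assms(2-5)])

text \<open>The derivative of the metric splits over its two arguments by \<open>dg\<close>, so each
  argument contributes its covariant derivative. In this form every product rule below can be read
  invariantly.\<close>

lemma has_derivative_g:
  assumes "x s \<in> U" "(x has_derivative x') (at s within S)" "(u has_derivative u') (at s within S)"
    "(v has_derivative v') (at s within S)" "s \<in> S"
  shows "((\<lambda>t. g (x t) (u t) (v t)) has_derivative
    (\<lambda>h. g (x s) (u' h + \<Gamma> (x s) (x' h) (u s)) (v s) + g (x s) (u s) (v' h + \<Gamma> (x s) (x' h) (v s)))) (at s within S)"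
  by (rule has_derivative_eq_rhs[OF has_derivative_bilinear_family[OF open_U assms(1) g_bil dg[OF assms(1)] assms(2-5)]])
     (simp_all add: fun_eq_iff g_add assms)

lemma has_vector_derivative_g:
  assumes "x s \<in> U" "(x has_vector_derivative x') (at s within S)" "(u has_vector_derivative u') (at s within S)"
    "(v has_vector_derivative v') (at s within S)" "s \<in> S"
  shows "((\<lambda>t. g (x t) (u t) (v t)) has_vector_derivative
    g (x s) (u' + \<Gamma> (x s) x' (u s)) (v s) + g (x s) (u s) (v' + \<Gamma> (x s) x' (v s))) (at s within S)"
  by (rule has_vector_derivative_eq_rhs[OF has_vector_derivative_bilinear_family[OF open_U assms(1) g_bil dg[OF assms(1)] assms(2-5)]])
     (simp_all add: g_add assms)

text \<open>The second derivatives of the function \<open>y \<mapsto> g y w z\<close>, for constant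
  \<open>w\<close> and \<open>z\<close>, commute. Writing both orders with covariant derivatives
  cancels the mixed products and leaves exactly the skew symmetry.\<close>

lemma Rm_skew:
  assumes x: "x \<in> U"
  shows "g x (Rm x u v w) z = - g x w (Rm x u v z)"
proof -
  define H where "H y h k = g y (D\<Gamma> y h k w + \<Gamma> y h (\<Gamma> y k w)) z + g y (\<Gamma> y k w) (\<Gamma> y h z)
      + (g y (\<Gamma> y h w) (\<Gamma> y k z) + g y w (D\<Gamma> y h k z + \<Gamma> y h (\<Gamma> y k z)))" for y h k
  have d2: "((\<lambda>y. g y (\<Gamma> y k w) z + g y w (\<Gamma> y k z)) has_derivative (\<lambda>h. H y h k)) (at y)" if y: "y \<in> U" for y k
    using has_derivative_add[OF has_derivative_g[OF _ has_derivative_ident d\<Gamma>[OF y, of k w] has_derivative_const[of z]]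
       has_derivative_g[OF _ has_derivative_ident has_derivative_const[of w] d\<Gamma>[OF y, of k z]]] y
    by (simp add: H_def)
  have c: "continuous_on U (\<lambda>y. H y h k)" for h k unfolding H_def
    by (intro continuous_intros continuous_on_g continuous_on_\<Gamma> continuous_on_D\<Gamma>)
  have "H x v u = H x u v"
    by (rule second_derivative_symmetric_real[OF open_U x, where f="\<lambda>y. g y w z" and u=u and v=v
        and f'="\<lambda>y h. g y (\<Gamma> y h w) z + g y w (\<Gamma> y h z)" and F="\<lambda>y h. H y h u" and G="\<lambda>y h. H y h v"])
       (rule dg d2 c, assumption?)+
  then show ?thesis unfolding H_def Rm_def
    by (simp add: g_add g_diff x algebra_simps)
qed

text \<open>The classical octahedron argument: the four cyclic Bianchi identities are combined by
  means of the two skew symmetries.\<close>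

lemma Rm_pair_sym:
  assumes x: "x \<in> U"
  shows "g x (Rm x u v w) z = g x (Rm x w z u) v"
proof -
  define T where "T a b c d = g x (Rm x a b c) d" for a b c d
  have 1: "T a b c d = - T b a c d" for a b c d
    unfolding T_def using Rm_antisym[of x a b c] g_minus[OF x] by simp
  have 2: "T a b c d = - T a b d c" for a b c d
    unfolding T_def using Rm_skew[OF x, of a b c d] g_sym[OF x, of c "Rm x a b d"] by simp
  have 3: "T a b c d + T b c a d + T c a b d = 0" for a b c d
    unfolding T_def using Rm_bianchi[OF x, of a b c] by (metis g_add(1)[OF x] g_zero(1)[OF x])
  have "T u v w z = T w z u v"
  proof -
    have "T v w z u = - T v w u z" "T w z v u = - T w z u v" "T z u v w = - T z u w v" "T u v z w = - T u v w z"
      by (rule 2)+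
    moreover have "T u w z v = T w u v z" "T v z u w = T z v w u"
      using 1[of u w z v] 2[of w u z v] 1[of v z u w] 2[of z v u w] by simp_all
    ultimately show ?thesis using 3[of u v w z] 3[of v w z u] 3[of w z u v] 3[of z u v w] by linarith
  qed
  then show ?thesis by (simp add: T_def)
qed

text \<open>\<open>J\<close> and \<eta> solve the linearized geodesic system. The covariant
  derivative J' is \<open>\<eta> + \<Gamma> v J\<close>, and the conclusion is the Jacobi equation
  J'' = R(v,J)v. The terms with \<open>D\<Gamma>\<close> combine to the curvature because \<Gamma>
  is symmetric.\<close>

lemma jacobi:
  assumes s: "s \<in> S" "x s \<in> U" and x: "(x has_vector_derivative v s) (at s within S)"
    and v: "(v has_vector_derivative - \<Gamma> (x s) (v s) (v s)) (at s within S)"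
    and J: "(J has_vector_derivative \<eta> s) (at s within S)"
    and \<eta>: "(\<eta> has_vector_derivative - (D\<Gamma> (x s) (J s) (v s) (v s) + 2 *\<^sub>R \<Gamma> (x s) (\<eta> s) (v s))) (at s within S)"
  shows "((\<lambda>t. \<eta> t + \<Gamma> (x t) (v t) (J t)) has_vector_derivative
     (Rm (x s) (v s) (J s) (v s) - \<Gamma> (x s) (v s) (\<eta> s + \<Gamma> (x s) (v s) (J s)))) (at s within S)"
proof (rule has_vector_derivative_eq_rhs[OF has_vector_derivative_add[OF \<eta> has_vector_derivative_\<Gamma>[OF s(2) x v J s(1)]]])
  note U = s(2)
  show "- (D\<Gamma> (x s) (J s) (v s) (v s) + 2 *\<^sub>R \<Gamma> (x s) (\<eta> s) (v s)) +
    (D\<Gamma> (x s) (v s) (v s) (J s) + \<Gamma> (x s) (- \<Gamma> (x s) (v s) (v s)) (J s) + \<Gamma> (x s) (v s) (\<eta> s)) =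
    Rm (x s) (v s) (J s) (v s) - \<Gamma> (x s) (v s) (\<eta> s + \<Gamma> (x s) (v s) (J s))"
    unfolding Rm_def D\<Gamma>_sym[OF U, of "v s" "v s" "J s"] \<Gamma>_sym[OF U, of "\<eta> s" "v s"] \<Gamma>_sym[OF U, of "- \<Gamma> (x s) (v s) (v s)" "J s"]
      \<Gamma>_sym[OF U, of "J s" "v s"]
    by (simp add: \<Gamma>_add[OF U] \<Gamma>_minus[OF U] scaleR_2)
qed

end

section \<open>The geodesic equation as a first-order system\<close>

context local_metric
begin

definition spray :: "'e \<times> 'e \<Rightarrow> 'e \<times> 'e" where
  "spray z = (snd z, - \<Gamma> (fst z) (snd z) (snd z))"

definition spray' :: "'e \<times> 'e \<Rightarrow> 'e \<times> 'e \<Rightarrow> 'e \<times> 'e" where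
  "spray' z k = (snd k, - (D\<Gamma> (fst z) (fst k) (snd z) (snd z) + 2 *\<^sub>R \<Gamma> (fst z) (snd k) (snd z)))"

lemma has_derivative_spray:
  assumes "fst z \<in> U" shows "(spray has_derivative spray' z) (at z)"
proof -
  have "((\<lambda>z. \<Gamma> (fst z) (snd z) (snd z)) has_derivative
    (\<lambda>h. D\<Gamma> (fst z) (fst h) (snd z) (snd z) + \<Gamma> (fst z) (snd h) (snd z) + \<Gamma> (fst z) (snd z) (snd h))) (at z)"
    by (rule has_derivative_\<Gamma>) (auto intro!: derivative_intros assms)
  then have "((\<lambda>z. (snd z, - \<Gamma> (fst z) (snd z) (snd z))) has_derivative
    (\<lambda>h. (snd h, - (D\<Gamma> (fst z) (fst h) (snd z) (snd z) + \<Gamma> (fst z) (snd h) (snd z) + \<Gamma> (fst z) (snd z) (snd h))))) (at z)"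
    by (intro derivative_intros)
  then show ?thesis
    by (simp add: spray_def[abs_def] spray'_def[abs_def] \<Gamma>_sym[OF assms, of "snd z"] scaleR_2 add.assoc)
qed

lemma continuous_on_spray':
  assumes "\<And>z. z \<in> K \<Longrightarrow> fst z \<in> U"
  shows "continuous_on K (\<lambda>z. spray' z k)"
  unfolding spray'_def by (intro continuous_intros continuous_on_\<Gamma> continuous_on_D\<Gamma>) (use assms in auto)

lemma spray_lipschitz:
  assumes "fst q \<in> U"
  obtains \<rho> L where "\<rho> > 0" "L > 0" "\<And>z. z \<in> cball q \<rho> \<Longrightarrow> fst z \<in> U"
    "\<And>x y. x \<in> cball q \<rho> \<Longrightarrow> y \<in> cball q \<rho> \<Longrightarrow> norm (spray x - spray y) \<le> L * norm (x - y)"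
    "\<And>z v. z \<in> cball q \<rho> \<Longrightarrow> norm (spray' z v) \<le> L * norm v"
proof -
  obtain \<rho> where rho: "\<rho> > 0" "cball (fst q) \<rho> \<subseteq> U" using open_U assms open_contains_cball by blast
  have inU: "fst z \<in> U" if "z \<in> cball q \<rho>" for z
    using that rho dist_fst_le[of q z] by (auto simp: subset_eq)
  have "\<exists>C>0. \<forall>z\<in>cball q \<rho>. \<forall>v. norm (spray' z v) \<le> C * norm v"
    by (rule operator_family_bounds(1)) (use has_derivative_linear[OF has_derivative_spray] inU in \<open>blast intro: continuous_on_spray' compact_cball\<close>)+
  then obtain L where L: "L > 0" "\<And>z v. z \<in> cball q \<rho> \<Longrightarrow> norm (spray' z v) \<le> L * norm v" by blast
  have "norm (spray x - spray y) \<le> L * norm (x - y)" if xy: "x \<in> cball q \<rho>" "y \<in> cball q \<rho>" for x y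
  proof (rule differentiable_bound[of "cball q \<rho>" spray spray'])
    fix z assume z: "z \<in> cball q \<rho>"
    show "(spray has_derivative spray' z) (at z within cball q \<rho>)"
      by (rule has_derivative_at_withinI[OF has_derivative_spray[OF inU[OF z]]])
    show "onorm (spray' z) \<le> L" by (rule onorm_le[OF L(2)[OF z]])
  qed (use xy in auto)
  then show ?thesis using that rho(1) L inU by blast
qed

text \<open>Continuity confines both solutions for a short time to a ball on which
  \<open>spray\<close> is Lipschitz; after a shift of time to 0, \<open>ode_unique\<close> applies.
  Agreement for some positive time is enough, since \<open>geodesic_unique\<close> continues
  it.\<close>

lemma geodesic_locally_unique:
  assumes ab: "a < b" and aU: "x a \<in> U" "y a = x a" "w a = v a"
    and x: "\<And>t. t \<in> {a..b} \<Longrightarrow> (x has_vector_derivative v t) (at t within {a..b})"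
      "\<And>t. t \<in> {a..b} \<Longrightarrow> (v has_vector_derivative - \<Gamma> (x t) (v t) (v t)) (at t within {a..b})"
    and y: "\<And>t. t \<in> {a..b} \<Longrightarrow> (y has_vector_derivative w t) (at t within {a..b})"
      "\<And>t. t \<in> {a..b} \<Longrightarrow> (w has_vector_derivative - \<Gamma> (y t) (w t) (w t)) (at t within {a..b})"
  obtains d where "d > 0" "a + d \<le> b" "\<And>t. t \<in> {a..a+d} \<Longrightarrow> x t = y t \<and> v t = w t"
proof -
  have "fst (x a, v a) \<in> U" using aU by simp
  then obtain \<rho> L where rho: "\<rho> > 0" "L > 0" and
    lip: "\<And>p q. p \<in> cball (x a, v a) \<rho> \<Longrightarrow> q \<in> cball (x a, v a) \<rho> \<Longrightarrow> norm (spray p - spray q) \<le> L * norm (p - q)"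
    by (rule spray_lipschitz) blast
  have near: "\<exists>d>0. \<forall>t\<in>{a..b}. t < a + d \<longrightarrow> (f t, h t) \<in> cball (x a, v a) \<rho>"
    if "continuous_on {a..b} f" "continuous_on {a..b} h" "f a = x a" "h a = v a" for f h
  proof -
    have "continuous_on {a..b} (\<lambda>t. (f t, h t))" by (intro continuous_intros that)
    from this[unfolded continuous_on_iff, rule_format, of a \<rho>]
    obtain d where "d > 0" "\<And>t. t \<in> {a..b} \<Longrightarrow> dist t a < d \<Longrightarrow> dist (f t, h t) (f a, h a) < \<rho>"
      using ab rho by auto
    then show ?thesis using that by (intro exI[of _ d]) (auto simp: dist_real_def dist_commute less_imp_le)
  qed
  have c: "continuous_on {a..b} x" "continuous_on {a..b} v" "continuous_on {a..b} y" "continuous_on {a..b} w"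
    by (rule continuous_on_vector_derivative[OF x(1)] continuous_on_vector_derivative[OF x(2)]
        continuous_on_vector_derivative[OF y(1)] continuous_on_vector_derivative[OF y(2)]; assumption)+
  obtain d1 where d1: "d1 > 0" "\<And>t. t \<in> {a..b} \<Longrightarrow> t < a + d1 \<Longrightarrow> (x t, v t) \<in> cball (x a, v a) \<rho>"
    using near[OF c(1,2)] by blast
  obtain d2 where d2: "d2 > 0" "\<And>t. t \<in> {a..b} \<Longrightarrow> t < a + d2 \<Longrightarrow> (y t, w t) \<in> cball (x a, v a) \<rho>"
    using near[OF c(3,4)] aU by blast
  note d = d1(1) d2(1) d1(2) d2(2)
  define d where "d = min (min (d1/2) (d2/2)) (min (b - a) (1 / (2 * L)))"
  have "d \<le> b - a" "d \<le> 1 / (2 * L)" "d \<le> d1/2" "d \<le> d2/2"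
    by (simp_all only: d_def min_le_iff_disj order_refl simp_thms)
  moreover have "d > 0" using d(1,2) ab rho by (simp add: d_def)
  ultimately have dd: "d > 0" "d < d1" "d < d2" "a + d \<le> b" "L * d \<le> 1/2"
    using d(1,2) rho mult_left_mono[of d "1 / (2 * L)" L] by auto
  have shift: "((\<lambda>s. f (a + s)) has_vector_derivative f') (at s within {0..d})"
    if "(f has_vector_derivative f') (at (a + s) within {a..b})" "s \<in> {0..d}" for f :: "real \<Rightarrow> 'e" and f' s
  proof -
    have "(((\<lambda>t. f t) \<circ> (\<lambda>s. a + s)) has_vector_derivative 1 *\<^sub>R f') (at s within {0..d})"
    proof (rule vector_diff_chain_within)
      show "((+) a has_vector_derivative 1) (at s within {0..d})" by (auto intro!: derivative_eq_intros)
      show "((\<lambda>t. f t) has_vector_derivative f') (at (a + s) within (+) a ` {0..d})"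
        using that(1) by (rule has_vector_derivative_within_subset) (use dd in auto)
    qed
    then show ?thesis by (simp add: o_def)
  qed
  have "norm ((x (a + s), v (a + s)) - (y (a + s), w (a + s))) \<le> 2 * norm ((x (a + 0), v (a + 0)) - (y (a + 0), w (a + 0)))"
    if s: "s \<in> {0..d}" for s
  proof (rule ode_unique[of d "cball (x a, v a) \<rho>" "\<lambda>t. spray" L "\<lambda>s. (x (a + s), v (a + s))" "\<lambda>s. (y (a + s), w (a + s))"])
    fix t assume t: "t \<in> {0..d}"
    then have t': "a + t \<in> {a..b}" using dd by auto
    show "((\<lambda>s. (x (a + s), v (a + s))) has_vector_derivative spray (x (a + t), v (a + t))) (at t within {0..d})"
      using has_vector_derivative_Pair[OF shift[OF x(1)[OF t'] t] shift[OF x(2)[OF t'] t]] by (simp add: spray_def)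
    show "((\<lambda>s. (y (a + s), w (a + s))) has_vector_derivative spray (y (a + t), w (a + t))) (at t within {0..d})"
      using has_vector_derivative_Pair[OF shift[OF y(1)[OF t'] t] shift[OF y(2)[OF t'] t]] by (simp add: spray_def)
    show "(x (a + t), v (a + t)) \<in> cball (x a, v a) \<rho>" "(y (a + t), w (a + t)) \<in> cball (x a, v a) \<rho>"
      using d(3,4)[OF t'] t dd by auto
  qed (use lip rho dd s in auto)
  then have "x (a + s) = y (a + s) \<and> v (a + s) = w (a + s)" if "s \<in> {0..d}" for s
    using that aU by (auto simp: zero_prod_def)
  from this[of "t - a" for t] have "x t = y t \<and> v t = w t" if "t \<in> {a..a+d}" for t using that by auto
  then show ?thesis using that dd by blast
qed

end

section \<open>Geodesic balls\<close>

text \<open>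
  \<open>E\<close> is the exponential map at \<open>p\<close>, read in the coordinates, and \<open>F\<close> is its inverse. \<open>V y\<close> is the velocity at
  time 1 of the geodesic \<open>t \<mapsto> E (t y)\<close>, so \<open>V \<circ> F\<close> is the radial field. \<open>\<eta> y u\<close> is the coordinate derivative
  of the Jacobi field \<open>t \<mapsto> t E' (t y) u\<close>.
\<close>

locale exp_ball = local_metric U g \<Gamma> D\<Gamma>
  for U :: "'e::euclidean_space set" and g \<Gamma> D\<Gamma> +
  fixes p :: 'e and E V F :: "'e \<Rightarrow> 'e" and E' V' F' :: "'e \<Rightarrow> 'e \<Rightarrow> 'e"
    and vel :: "'e \<Rightarrow> real \<Rightarrow> 'e" and \<eta> :: "'e \<Rightarrow> 'e \<Rightarrow> real \<Rightarrow> 'e" and r :: real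
  assumes r: "r > 0" and E_0: "E 0 = p"
    and E_U: "y \<in> ball 0 r \<Longrightarrow> E y \<in> U"
    and dE: "y \<in> ball 0 r \<Longrightarrow> (E has_derivative E' y) (at y)"
    and dV: "y \<in> ball 0 r \<Longrightarrow> (V has_derivative V' y) (at y)"
    and cont_E': "continuous_on (ball 0 r) (\<lambda>y. E' y u)"
    and cont_V': "continuous_on (ball 0 r) (\<lambda>y. V' y u)"
    and geo_x: "y \<in> ball 0 r \<Longrightarrow> t \<in> {0..1} \<Longrightarrow> ((\<lambda>t. E (t *\<^sub>R y)) has_vector_derivative vel y t) (at t within {0..1})"
    and geo_v: "y \<in> ball 0 r \<Longrightarrow> t \<in> {0..1} \<Longrightarrow>
      (vel y has_vector_derivative - \<Gamma> (E (t *\<^sub>R y)) (vel y t) (vel y t)) (at t within {0..1})"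
    and vel_0: "y \<in> ball 0 r \<Longrightarrow> vel y 0 = y"
    and V_vel: "y \<in> ball 0 r \<Longrightarrow> t \<in> {0..1} \<Longrightarrow> V (t *\<^sub>R y) = t *\<^sub>R vel y t"
    and jac_J: "y \<in> ball 0 r \<Longrightarrow> t \<in> {0..1} \<Longrightarrow>
      ((\<lambda>t. t *\<^sub>R E' (t *\<^sub>R y) u) has_vector_derivative \<eta> y u t) (at t within {0..1})"
    and jac_\<eta>: "y \<in> ball 0 r \<Longrightarrow> t \<in> {0..1} \<Longrightarrow> (\<eta> y u has_vector_derivative
       - (D\<Gamma> (E (t *\<^sub>R y)) (t *\<^sub>R E' (t *\<^sub>R y) u) (vel y t) (vel y t) + 2 *\<^sub>R \<Gamma> (E (t *\<^sub>R y)) (\<eta> y u t) (vel y t))) (at t within {0..1})"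
    and \<eta>_0: "y \<in> ball 0 r \<Longrightarrow> \<eta> y u 0 = u"
    and \<eta>_V': "y \<in> ball 0 r \<Longrightarrow> t \<in> {0<..1} \<Longrightarrow> V' (t *\<^sub>R y) u = \<eta> y u t"
    and open_E: "open (E ` ball 0 r)"
    and F_E: "y \<in> ball 0 r \<Longrightarrow> F (E y) = y"
    and dF: "x \<in> E ` ball 0 r \<Longrightarrow> (F has_derivative F' x) (at x)"
    and F'_E': "y \<in> ball 0 r \<Longrightarrow> F' (E y) (E' y u) = u" "y \<in> ball 0 r \<Longrightarrow> E' y (F' (E y) u) = u"
    and cont_F': "continuous_on (E ` ball 0 r) (\<lambda>x. F' x u)"

section \<open>Construction of a normal ball\<close>

context local_metric
begin

text \<open>The state \<open>(p, 0)\<close> is an equilibrium of the spray, so its flow exists up to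
  any fixed time for small initial velocities. The Jacobi fields are components of the derivative of
  the flow, and the inverse function theorem at 0 supplies \<open>F\<close>.\<close>

lemma exp_ball_exists:
  assumes p: "p \<in> U"
  shows "\<exists>E V F E' V' F' vel \<eta> r. exp_ball U g \<Gamma> D\<Gamma> p E V F E' V' F' vel \<eta> r"
proof -
  define q where "q = (p, 0::'e)"
  have "fst q \<in> U" using p by (simp add: q_def)
  then obtain \<rho> L where rho: "\<rho> > 0" "L > 0" and inU: "\<And>z. z \<in> cball q \<rho> \<Longrightarrow> fst z \<in> U"
    and bnd: "\<And>z v. z \<in> cball q \<rho> \<Longrightarrow> norm (spray' z v) \<le> L * norm v"
    by (rule spray_lipschitz) blast
  \<comment> \<open>The factor brings the Lipschitz constant of the spray down to 1/2. Multiplying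
    the spray by \<epsilon> slows time by \<epsilon>.\<close>
  define \<epsilon> where "\<epsilon> = 1 / (2 * L)"
  have eps: "\<epsilon> > 0" using rho by (simp add: \<epsilon>_def)
  let ?f = "\<lambda>z. \<epsilon> *\<^sub>R spray z" and ?f' = "\<lambda>z h. \<epsilon> *\<^sub>R spray' z h" and ?B = "ball q (\<rho>/2)"
  obtain \<phi> W where
    ph0: "\<And>z. z \<in> ?B \<Longrightarrow> \<phi> 0 z = z" and
    phC: "\<And>z t. z \<in> ?B \<Longrightarrow> t \<in> {0..1} \<Longrightarrow> \<phi> t z \<in> cball q \<rho>" and
    phd: "\<And>z t. z \<in> ?B \<Longrightarrow> t \<in> {0..1} \<Longrightarrow> ((\<lambda>t. \<phi> t z) has_vector_derivative ?f (\<phi> t z)) (at t within {0..1})" and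
    phu: "\<And>x t. x 0 \<in> ?B \<Longrightarrow> (\<And>t. t \<in> {0..1} \<Longrightarrow> x t \<in> cball q \<rho>) \<Longrightarrow>
       (\<And>t. t \<in> {0..1} \<Longrightarrow> (x has_vector_derivative ?f (x t)) (at t within {0..1})) \<Longrightarrow>
       t \<in> {0..1} \<Longrightarrow> x t = \<phi> t (x 0)" and
    phW: "\<And>z t. z \<in> ?B \<Longrightarrow> t \<in> {0..1} \<Longrightarrow> (\<phi> t has_derivative W t z) (at z)" and
    W0: "\<And>z h. z \<in> ?B \<Longrightarrow> W 0 z h = h" and
    Wd: "\<And>z t h. z \<in> ?B \<Longrightarrow> t \<in> {0..1} \<Longrightarrow> ((\<lambda>t. W t z h) has_vector_derivative ?f' (\<phi> t z) (W t z h)) (at t within {0..1})" and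
    Wc: "\<And>t h. t \<in> {0..1} \<Longrightarrow> continuous_on ?B (\<lambda>z. W t z h)"
  proof (rule C1_flow_half[of \<rho> q ?f ?f'])
    show "(?f has_derivative ?f' z) (at z)" if "z \<in> cball q \<rho>" for z
      by (intro has_derivative_scaleR_right has_derivative_spray inU that)
    show "continuous_on (cball q \<rho>) (\<lambda>z. ?f' z v)" for v
      by (intro continuous_intros continuous_on_spray' inU)
    show "?f q = 0" using p by (simp add: spray_def q_def \<Gamma>_zero zero_prod_def)
    show "norm (?f' z v) \<le> 1/2 * norm v" if "z \<in> cball q \<rho>" for z v
      using mult_left_mono[OF bnd[OF that, of v], of \<epsilon>] eps rho by (simp add: \<epsilon>_def)
  qed (use rho in auto)
  \<comment> \<open>The initial velocity is enlarged by 1/\<epsilon> to compensate for the slower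
    time, so that unit time of the scaled flow is unit time of the geodesic with velocity
    \<open>y\<close>. Velocities read off from \<phi> are multiplied by \<epsilon> for the same
    reason.\<close>
  define Z where "Z y = (p, (1/\<epsilon>) *\<^sub>R y)" for y :: 'e
  define r0 where "r0 = \<epsilon> * \<rho> / 2"
  have r0: "r0 > 0" using eps rho by (simp add: r0_def)
  let ?D = "ball (0::'e) r0"
  have ZB: "Z y \<in> ?B" if "y \<in> ?D" for y
  proof -
    have "dist q (Z y) = norm ((1/\<epsilon>) *\<^sub>R y)" unfolding q_def Z_def dist_Pair_Pair by simp
    also have "\<dots> = norm y / \<epsilon>" using eps by simp
    also have "\<dots> < \<rho> / 2" using that eps by (simp add: r0_def field_simps)
    finally show ?thesis by simp
  qed
  have scD: "t *\<^sub>R y \<in> ?D" if "y \<in> ?D" "t \<in> {0..1}" for t y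
    using that mult_left_le_one_le[of "norm y" t] by (auto intro: le_less_trans)
  have dZ: "(Z has_derivative (\<lambda>u. (0, (1/\<epsilon>) *\<^sub>R u))) (at y)" for y
    unfolding Z_def by (auto intro!: derivative_eq_intros)
  define E where "E y = fst (\<phi> 1 (Z y))" for y
  define V where "V y = \<epsilon> *\<^sub>R snd (\<phi> 1 (Z y))" for y
  define E' where "E' y u = fst (W 1 (Z y) (0, (1/\<epsilon>) *\<^sub>R u))" for y u
  define V' where "V' y u = \<epsilon> *\<^sub>R snd (W 1 (Z y) (0, (1/\<epsilon>) *\<^sub>R u))" for y u
  define vel where "vel y t = \<epsilon> *\<^sub>R snd (\<phi> t (Z y))" for y t
  define \<eta> where "\<eta> y u t = \<epsilon> *\<^sub>R snd (W t (Z y) (0, (1/\<epsilon>) *\<^sub>R u))" for y u t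
  have d\<phi>: "((\<lambda>y. \<phi> t (Z y)) has_derivative (\<lambda>u. W t (Z y) (0, (1/\<epsilon>) *\<^sub>R u))) (at y)"
    if "y \<in> ?D" "t \<in> {0..1}" for y t
    by (rule has_derivative_compose[OF dZ phW[OF ZB[OF that(1)] that(2)]])
  \<comment> \<open>Homogeneity of geodesics: running the curve \<open>t\<close> times slower and
    multiplying its velocity by \<open>t\<close> gives another solution, because \<Gamma> is
    quadratic in the velocity.\<close>
  have hom: "\<phi> 1 (Z (t *\<^sub>R y)) = (fst (\<phi> t (Z y)), t *\<^sub>R snd (\<phi> t (Z y)))" if y: "y \<in> ?D" and t: "t \<in> {0..1}" for y t
  proof -
    let ?x = "\<lambda>s. (fst (\<phi> (t * s) (Z y)), t *\<^sub>R snd (\<phi> (t * s) (Z y)))"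
    have x0: "?x 0 = Z (t *\<^sub>R y)" using ph0[OF ZB[OF y]] by (simp add: Z_def)
    have ts: "t * s \<in> {0..1}" if "s \<in> {0..1}" for s using that t mult_le_one[of t s] by auto
    have "?x 1 = \<phi> 1 (?x 0)"
    proof (rule phu)
      show "?x 0 \<in> ?B" unfolding x0 using scD[OF y t] ZB by blast
      fix s :: real assume s: "s \<in> {0..1}"
      let ?z = "\<phi> (t * s) (Z y)"
      have zC: "?z \<in> cball q \<rho>" by (rule phC[OF ZB[OF y] ts[OF s]])
      have "norm (t *\<^sub>R snd ?z) \<le> norm (snd ?z)" using t by (simp add: mult_left_le_one_le)
      then have "dist q (?x s) \<le> dist q ?z"
        unfolding q_def dist_prod_def by (auto intro!: real_sqrt_le_mono power_mono)
      then show "?x s \<in> cball q \<rho>" using zC by auto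
      have "(((\<lambda>t. \<phi> t (Z y)) \<circ> (\<lambda>s. t * s)) has_vector_derivative t *\<^sub>R ?f ?z) (at s within {0..1})"
      proof (rule vector_diff_chain_within)
        show "((\<lambda>s. t * s) has_vector_derivative t) (at s within {0..1})" by (auto intro!: derivative_eq_intros)
        show "((\<lambda>t. \<phi> t (Z y)) has_vector_derivative ?f ?z) (at (t * s) within (\<lambda>s. t * s) ` {0..1})"
          by (rule has_vector_derivative_within_subset[OF phd[OF ZB[OF y] ts[OF s]]]) (use ts in auto)
      qed
      then have d: "((\<lambda>s. \<phi> (t * s) (Z y)) has_vector_derivative t *\<^sub>R ?f ?z) (at s within {0..1})" by (simp add: o_def)
      have "(?x has_vector_derivative (fst (t *\<^sub>R ?f ?z), t *\<^sub>R snd (t *\<^sub>R ?f ?z))) (at s within {0..1})"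
        by (intro has_vector_derivative_Pair bounded_linear.has_vector_derivative[OF bounded_linear_fst d]
           bounded_linear.has_vector_derivative[OF bounded_linear_scaleR_right]
           bounded_linear.has_vector_derivative[OF bounded_linear_snd d])
      then show "(?x has_vector_derivative ?f (?x s)) (at s within {0..1})"
        by (rule has_vector_derivative_eq_rhs) (simp add: spray_def \<Gamma>_scale[OF inU[OF zC]])
    qed auto
    then show ?thesis using x0 by simp
  qed
  have Et: "E (t *\<^sub>R y) = fst (\<phi> t (Z y))" and Vt: "V (t *\<^sub>R y) = t *\<^sub>R vel y t" if "y \<in> ?D" "t \<in> {0..1}" for y t
    using hom[OF that] by (simp_all add: E_def V_def vel_def)
  have EU: "E y \<in> U" if "y \<in> ?D" for y unfolding E_def by (rule inU[OF phC[OF ZB[OF that]]]) auto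
  have dE: "(E has_derivative E' y) (at y)" if "y \<in> ?D" for y
    unfolding E_def[abs_def] E'_def[abs_def] by (intro has_derivative_fst d\<phi> that) auto
  have dV: "(V has_derivative V' y) (at y)" if "y \<in> ?D" for y
    unfolding V_def[abs_def] V'_def[abs_def] by (intro has_derivative_scaleR_right has_derivative_snd d\<phi> that) auto
  have contZ: "continuous_on ?D Z" unfolding Z_def by (intro continuous_intros)
  have cE: "continuous_on ?D (\<lambda>y. E' y u)" and cV: "continuous_on ?D (\<lambda>y. V' y u)" for u
    unfolding E'_def V'_def using ZB by (auto intro!: continuous_intros continuous_on_compose2[OF Wc contZ])
  have geo_x: "((\<lambda>t. E (t *\<^sub>R y)) has_vector_derivative vel y t) (at t within {0..1})" if "y \<in> ?D" "t \<in> {0..1}" for y t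
  proof (rule has_vector_derivative_transform[OF that(2)])
    show "((\<lambda>t. fst (\<phi> t (Z y))) has_vector_derivative vel y t) (at t within {0..1})"
      using bounded_linear.has_vector_derivative[OF bounded_linear_fst phd[OF ZB[OF that(1)] that(2)]]
      by (simp add: vel_def spray_def)
  qed (use Et that in auto)
  have geo_v: "(vel y has_vector_derivative - \<Gamma> (E (t *\<^sub>R y)) (vel y t) (vel y t)) (at t within {0..1})"
    if "y \<in> ?D" "t \<in> {0..1}" for y t
    unfolding vel_def[abs_def] Et[OF that]
    using bounded_linear.has_vector_derivative[OF bounded_linear_scaleR_right[of \<epsilon>]
       bounded_linear.has_vector_derivative[OF bounded_linear_snd phd[OF ZB[OF that(1)] that(2)]]]
    by (rule has_vector_derivative_eq_rhs) (simp add: spray_def \<Gamma>_scale[OF inU[OF phC[OF ZB[OF that(1)] that(2)]]])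
  \<comment> \<open>The homogeneity relations are differentiated in \<open>y\<close>. Both sides of
    the second identity carry the factor \<open>t\<close>, and it can be cancelled only for positive
    \<open>t\<close>.\<close>
  have Jt: "t *\<^sub>R E' (t *\<^sub>R y) u = fst (W t (Z y) (0, (1/\<epsilon>) *\<^sub>R u))"
    and nt: "t *\<^sub>R V' (t *\<^sub>R y) u = t *\<^sub>R \<eta> y u t" if y: "y \<in> ?D" and t: "t \<in> {0..1}" for y t u
  proof -
    have sc: "((\<lambda>y. t *\<^sub>R y) has_derivative (\<lambda>u. t *\<^sub>R u)) (at y)" by (auto intro!: derivative_eq_intros)
    have 1: "((\<lambda>y. E (t *\<^sub>R y)) has_derivative (\<lambda>u. E' (t *\<^sub>R y) (t *\<^sub>R u))) (at y)"
      by (rule has_derivative_compose[OF sc dE[OF scD[OF y t]]])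
    have 2: "((\<lambda>y. V (t *\<^sub>R y)) has_derivative (\<lambda>u. V' (t *\<^sub>R y) (t *\<^sub>R u))) (at y)"
      by (rule has_derivative_compose[OF sc dV[OF scD[OF y t]]])
    have "((\<lambda>y. E (t *\<^sub>R y)) has_derivative (\<lambda>u. fst (W t (Z y) (0, (1/\<epsilon>) *\<^sub>R u)))) (at y)"
      by (rule has_derivative_transform_within_open[OF has_derivative_fst[OF d\<phi>[OF y t]], of ?D]) (use Et t y in auto)
    from has_derivative_unique[OF 1 this]
    show "t *\<^sub>R E' (t *\<^sub>R y) u = fst (W t (Z y) (0, (1/\<epsilon>) *\<^sub>R u))"
      using linear_scale[OF has_derivative_linear[OF dE[OF scD[OF y t]]], of t u] by metis
    have "((\<lambda>y. V (t *\<^sub>R y)) has_derivative (\<lambda>u. t *\<^sub>R \<epsilon> *\<^sub>R snd (W t (Z y) (0, (1/\<epsilon>) *\<^sub>R u)))) (at y)"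
      by (rule has_derivative_transform_within_open[OF has_derivative_scaleR_right[OF has_derivative_scaleR_right[OF has_derivative_snd[OF d\<phi>[OF y t]]]], of ?D])
         (use Vt t y vel_def in auto)
    from has_derivative_unique[OF 2 this]
    show "t *\<^sub>R V' (t *\<^sub>R y) u = t *\<^sub>R \<eta> y u t"
      using linear_scale[OF has_derivative_linear[OF dV[OF scD[OF y t]]], of t u] unfolding \<eta>_def by metis
  qed
  have jac_J: "((\<lambda>t. t *\<^sub>R E' (t *\<^sub>R y) u) has_vector_derivative \<eta> y u t) (at t within {0..1})"
    if "y \<in> ?D" "t \<in> {0..1}" for y t u
  proof (rule has_vector_derivative_transform[OF that(2)])
    show "((\<lambda>t. fst (W t (Z y) (0, (1/\<epsilon>) *\<^sub>R u))) has_vector_derivative \<eta> y u t) (at t within {0..1})"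
      using bounded_linear.has_vector_derivative[OF bounded_linear_fst Wd[OF ZB[OF that(1)] that(2)]]
      by (simp add: \<eta>_def spray'_def)
  qed (use Jt that in auto)
  have jac_\<eta>: "(\<eta> y u has_vector_derivative
       - (D\<Gamma> (E (t *\<^sub>R y)) (t *\<^sub>R E' (t *\<^sub>R y) u) (vel y t) (vel y t) + 2 *\<^sub>R \<Gamma> (E (t *\<^sub>R y)) (\<eta> y u t) (vel y t))) (at t within {0..1})"
    if "y \<in> ?D" "t \<in> {0..1}" for y t u
  proof -
    note i = inU[OF phC[OF ZB[OF that(1)] that(2)]]
    show ?thesis unfolding \<eta>_def[abs_def] Et[OF that] Jt[OF that] vel_def
      using bounded_linear.has_vector_derivative[OF bounded_linear_scaleR_right[of \<epsilon>]
         bounded_linear.has_vector_derivative[OF bounded_linear_snd Wd[OF ZB[OF that(1)] that(2)]]]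
      by (rule has_vector_derivative_eq_rhs)
         (simp add: spray'_def \<Gamma>_scale[OF i] linear_scale[OF D\<Gamma>_linear2[OF i]] linear_scale[OF D\<Gamma>_linear3[OF i]] scaleR_add_right scaleR_diff_right mult.commute)
  qed
  have vel0: "vel y 0 = y" and eta0: "\<eta> y u 0 = u" if "y \<in> ?D" for y u
    using ph0[OF ZB[OF that]] W0[OF ZB[OF that]] eps by (simp_all add: vel_def \<eta>_def Z_def)
  have E0: "E 0 = p" using Et[of 0 0] ph0[OF ZB[of 0]] r0 by (simp add: Z_def)
  \<comment> \<open>Along the constant geodesic \<open>y = 0\<close> the Jacobi field is the linear
    function with slope \<open>E' 0 u\<close>, while its initial derivative is
    \<open>u\<close>.\<close>
  have E'0: "E' 0 u = u" for u
  proof -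
    have "((\<lambda>t. t *\<^sub>R E' 0 u) has_vector_derivative \<eta> 0 u 0) (at 0 within cbox 0 1)"
      using jac_J[of 0 0 u] r0 by simp
    moreover have "((\<lambda>t. t *\<^sub>R E' 0 u) has_vector_derivative E' 0 u) (at 0 within cbox 0 1)"
      by (auto intro!: derivative_eq_intros)
    ultimately show ?thesis
      using vector_derivative_unique_within_closed_interval[of 0 1 0] eta0[of 0] r0 by fastforce
  qed
  have linE: "linear (E' y)" if "y \<in> ?D" for y using dE[OF that] has_derivative_linear by blast
  have sub: "cball (0::'e) (r0/2) \<subseteq> ?D" using r0 by auto
  \<comment> \<open>Near 0 the derivative of \<open>E\<close> differs from the identity by at most
    1/2, hence stretches vectors by at least 1/2. This bound controls the inverse derivatives
    uniformly.\<close>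
  have "\<exists>d>0. \<forall>x\<in>cball 0 (r0/2). \<forall>y\<in>cball 0 (r0/2). dist x y < d \<longrightarrow> (\<forall>v. norm (E' x v - E' y v) \<le> 1/2 * norm v)"
    by (rule operator_family_bounds(2)) (use linE sub continuous_on_subset[OF cE sub] in auto)
  then obtain d where d: "d > 0" "\<And>x v. x \<in> cball 0 (r0/2) \<Longrightarrow> dist x 0 < d \<Longrightarrow> norm (E' x v - v) \<le> 1/2 * norm v"
    using r0 E'0 by (metis centre_in_cball half_gt_zero less_imp_le)
  have low: "norm v \<le> 2 * norm (E' x v)" if "x \<in> cball 0 (r0/2)" "dist x 0 < d" for x v
    using d(2)[OF that, of v] norm_triangle_ineq2[of v "E' x v"] by (simp add: norm_minus_commute)
  define r1 where "r1 = min d (r0/2)"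
  have r1: "r1 > 0" using d r0 by (simp add: r1_def)
  have r1D: "ball 0 r1 \<subseteq> ?D" using r0 by (auto simp: r1_def)
  have low1: "norm v \<le> 2 * norm (E' x v)" if "x \<in> ball 0 r1" for x v
    by (rule low) (use that in \<open>auto simp: r1_def\<close>)
  have appE: "blinfun_apply (Blinfun (E' y)) = E' y" if "y \<in> ?D" for y
    using linE[OF that] by (simp add: bounded_linear_Blinfun_apply linear_conv_bounded_linear)
  have contB: "continuous_on (ball 0 r1) (\<lambda>y. Blinfun (E' y))"
  proof (rule continuous_on_blinfun_componentwise)
    fix i :: 'e
    show "continuous_on (ball 0 r1) (\<lambda>y. blinfun_apply (Blinfun (E' y)) i)"
      by (rule continuous_on_eq[OF continuous_on_subset[OF cE[of i] r1D]]) (use appE r1D in auto)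
  qed
  obtain U' Y G G' where U': "open U'" "U' \<subseteq> ball 0 r1" "0 \<in> U'" and Y: "open Y" "homeomorphism U' Y E G"
    and G: "\<And>y. y \<in> Y \<Longrightarrow> (G has_derivative G' y) (at y)"
    "\<And>y. y \<in> Y \<Longrightarrow> G' y = inv (blinfun_apply (Blinfun (E' (G y))))"
    "\<And>y. y \<in> Y \<Longrightarrow> bij (blinfun_apply (Blinfun (E' (G y))))"
  proof (rule inverse_function_theorem[of "ball 0 r1" E "\<lambda>y. Blinfun (E' y)" 0 id_blinfun])
    show "(E has_derivative blinfun_apply (Blinfun (E' x))) (at x)" if "x \<in> ball 0 r1" for x
      using dE appE that r1D by auto
    show "id_blinfun o\<^sub>L Blinfun (E' 0) = id_blinfun"
      by (rule blinfun_eqI) (use appE[of 0] r0 E'0 in simp)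
  qed (use contB r1 in auto)
  obtain r where r: "r > 0" "ball 0 r \<subseteq> U'" using U' open_contains_ball by blast
  have rD: "ball 0 r \<subseteq> ?D" using r U' r1D by auto
  have EY: "E y \<in> Y" "G (E y) = y" if "y \<in> ball 0 r" for y
    using Y(2) r that unfolding homeomorphism_def by auto
  have bijE: "bij (E' y)" if "y \<in> ball 0 r" for y
    using G(3)[OF EY(1)[OF that]] EY(2)[OF that] appE that rD by auto
  have G'E: "G' (E y) = inv (E' y)" if "y \<in> ball 0 r" for y
    using G(2)[OF EY(1)[OF that]] EY(2)[OF that] appE that rD by auto
  have inv1: "G' (E y) (E' y u) = u" "E' y (G' (E y) u) = u" if "y \<in> ball 0 r" for y u
    using bijE[OF that] unfolding G'E[OF that] by (auto simp: bij_is_inj bij_is_surj surj_f_inv_f)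
  have "openin (top_of_set Y) (E ` ball 0 r)"
    by (rule homeomorphism_imp_open_map[OF Y(2)]) (use r in \<open>auto intro!: open_subset\<close>)
  then have openE: "open (E ` ball 0 r)" using Y(1) openin_open_trans by blast
  have cG': "continuous_on (E ` ball 0 r) (\<lambda>x. G' x u)" for u
    unfolding continuous_on_def
  proof
    fix x0 assume "x0 \<in> E ` ball 0 r"
    then obtain y0 where y0: "y0 \<in> ball 0 r" "x0 = E y0" by auto
    let ?Q = "at x0 within E ` ball 0 r"
    have contG: "(G \<longlongrightarrow> y0) ?Q"
      using G(1)[OF EY(1)[OF y0(1)]] has_derivative_continuous EY(2)[OF y0(1)] y0(2)
      by (metis continuous_within isCont_def tendsto_within_subset subset_UNIV)
    have ev: "\<forall>\<^sub>F x in ?Q. \<exists>y\<in>ball 0 r. x = E y" by (auto simp: eventually_at intro: exI[of _ 1])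
    have "((\<lambda>x. E' (G x) (G' x0 u)) \<longlongrightarrow> E' y0 (G' x0 u)) ?Q"
    proof (rule continuous_on_tendsto_compose[OF continuous_on_subset[OF cE rD] contG y0(1)])
      show "\<forall>\<^sub>F x in ?Q. G x \<in> ball 0 r" using ev by eventually_elim (use EY in auto)
    qed
    then have lim: "((\<lambda>x. 2 * norm (E' y0 (G' x0 u) - E' (G x) (G' x0 u))) \<longlongrightarrow> 2 * norm (E' y0 (G' x0 u) - E' y0 (G' x0 u))) ?Q"
      by (intro tendsto_intros)
    have "((\<lambda>x. G' x u - G' x0 u) \<longlongrightarrow> 0) ?Q"
    proof (rule Lim_null_comparison)
      show "\<forall>\<^sub>F x in ?Q. norm (G' x u - G' x0 u) \<le> 2 * norm (E' y0 (G' x0 u) - E' (G x) (G' x0 u))"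
        using ev
      proof eventually_elim
        case (elim x)
        then obtain y where y: "y \<in> ball 0 r" "x = E y" by auto
        have "norm (G' x u - G' x0 u) \<le> 2 * norm (E' y (G' x u - G' x0 u))"
          by (rule low1) (use y r U' in blast)
        \<comment> \<open>Both inverse derivatives are carried back by \<open>E' y\<close>:
          \<open>E' y (G' x u)\<close> and \<open>E' y0 (G' x0 u)\<close> both equal
          \<open>u\<close>. The difference then involves \<open>E'\<close> on a fixed vector only,
          where continuity is known.\<close>
        also have "E' y (G' x u - G' x0 u) = E' y0 (G' x0 u) - E' (G x) (G' x0 u)"
          using y y0 rD inv1 EY by (simp add: linear_diff[OF linE] subset_eq)
        finally show ?case .
      qed
      show "((\<lambda>x. 2 * norm (E' y0 (G' x0 u) - E' (G x) (G' x0 u))) \<longlongrightarrow> 0) ?Q" using lim by simp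
    qed
    then show "((\<lambda>x. G' x u) \<longlongrightarrow> G' x0 u) ?Q" by (simp add: LIM_zero_iff)
  qed
  have "exp_ball U g \<Gamma> D\<Gamma> p E V G E' V' G' vel \<eta> r"
  proof (unfold_locales)
    fix y u :: 'e assume y: "y \<in> ball 0 r"
    then have yD: "y \<in> ?D" using rD by auto
    show "E y \<in> U" "(E has_derivative E' y) (at y)" "(V has_derivative V' y) (at y)" "vel y 0 = y" "\<eta> y u 0 = u" "G (E y) = y"
      using EU dE dV vel0 eta0 EY yD y by auto
    show "G' (E y) (E' y u) = u" "E' y (G' (E y) u) = u" using inv1[OF y] by auto
    fix t :: real assume "t \<in> {0<..1}"
    then show "V' (t *\<^sub>R y) u = \<eta> y u t" using nt[OF yD, of t u] by auto
  next
    fix y u :: 'e and t :: real assume y: "y \<in> ball 0 r" and t: "t \<in> {0..1}"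
    then have yD: "y \<in> ?D" using rD by auto
    show "((\<lambda>t. E (t *\<^sub>R y)) has_vector_derivative vel y t) (at t within {0..1})"
      "(vel y has_vector_derivative - \<Gamma> (E (t *\<^sub>R y)) (vel y t) (vel y t)) (at t within {0..1})"
      "V (t *\<^sub>R y) = t *\<^sub>R vel y t"
      "((\<lambda>t. t *\<^sub>R E' (t *\<^sub>R y) u) has_vector_derivative \<eta> y u t) (at t within {0..1})"
      "(\<eta> y u has_vector_derivative
       - (D\<Gamma> (E (t *\<^sub>R y)) (t *\<^sub>R E' (t *\<^sub>R y) u) (vel y t) (vel y t) + 2 *\<^sub>R \<Gamma> (E (t *\<^sub>R y)) (\<eta> y u t) (vel y t))) (at t within {0..1})"
      by (rule geo_x geo_v Vt jac_J jac_\<eta>; use yD t in blast)+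
  next
    fix u :: 'e
    show "continuous_on (ball 0 r) (\<lambda>y. E' y u)" "continuous_on (ball 0 r) (\<lambda>y. V' y u)"
      using cE cV rD continuous_on_subset by blast+
    show "continuous_on (E ` ball 0 r) (\<lambda>x. G' x u)" by (rule cG')
  next
    fix x assume "x \<in> E ` ball 0 r"
    then have "x \<in> Y" using EY(1) by blast
    then show "(G has_derivative G' x) (at x)" by (rule G(1))
  qed (use r E0 openE in auto)
  then show ?thesis by blast
qed

end

section \<open>Jacobi fields, the Gauss lemma and umbilic spheres in coordinates\<close>

context exp_ball
begin

text \<open>The covariant derivative of the radial field in direction \<open>E' y u\<close>.\<close>

definition Sh :: "'e \<Rightarrow> 'e \<Rightarrow> 'e" where
  "Sh y u = V' y u + \<Gamma> (E y) (E' y u) (V y)"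

text \<open>The covariant derivative J' of the Jacobi field
  \<open>t \<mapsto> t *\<^sub>R E' (t *\<^sub>R y) u\<close> along the radial geodesic.\<close>

definition J1 :: "'e \<Rightarrow> 'e \<Rightarrow> real \<Rightarrow> 'e" where
  "J1 y u t = \<eta> y u t + \<Gamma> (E (t *\<^sub>R y)) (vel y t) (t *\<^sub>R E' (t *\<^sub>R y) u)"

lemma scale_in_ball: "y \<in> ball 0 r \<Longrightarrow> t \<in> {0..1} \<Longrightarrow> t *\<^sub>R y \<in> ball (0::'e) r"
  using mult_left_le_one_le[of "norm y" t] by (auto intro: le_less_trans)

lemma Et_U: "y \<in> ball 0 r \<Longrightarrow> t \<in> {0..1} \<Longrightarrow> E (t *\<^sub>R y) \<in> U"
  using E_U scale_in_ball by blast

lemma p_U: "p \<in> U"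
  using E_U[of 0] r E_0 by simp

lemma E'_linear: "y \<in> ball 0 r \<Longrightarrow> linear (E' y)"
  using dE has_derivative_linear by blast

lemma V_eq_vel: "y \<in> ball 0 r \<Longrightarrow> V y = vel y 1"
  using V_vel[of y 1] by simp

lemma constant_on_unit:
  fixes f :: "real \<Rightarrow> 'x::real_normed_vector"
  assumes "\<And>t. t \<in> {0..1} \<Longrightarrow> (f has_vector_derivative 0) (at t within {0..1})" "t \<in> {0..1}"
  shows "f t = f 0"
  using has_vector_derivative_zero_constant[of "{0..1}" f] assms by (metis atLeastAtMost_iff convex_real_interval(5) order_refl zero_le_one)

lemma speed:
  assumes y: "y \<in> ball 0 r" and t: "t \<in> {0..1}"
  shows "g (E (t *\<^sub>R y)) (vel y t) (vel y t) = g p y y"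
proof -
  have "g (E (t *\<^sub>R y)) (vel y t) (vel y t) = g (E (0 *\<^sub>R y)) (vel y 0) (vel y 0)"
  proof (rule constant_on_unit[OF _ t])
    fix t :: real assume t: "t \<in> {0..1}"
    show "((\<lambda>t. g (E (t *\<^sub>R y)) (vel y t) (vel y t)) has_vector_derivative 0) (at t within {0..1})"
      by (rule has_vector_derivative_eq_rhs[OF has_vector_derivative_g[OF _ geo_x[OF y t] geo_v[OF y t] geo_v[OF y t]]])
         (use t Et_U[OF y t] in \<open>auto simp: g_zero\<close>)
  qed
  then show ?thesis using vel_0[OF y] E_0 by simp
qed

lemma V_norm: "y \<in> ball 0 r \<Longrightarrow> g (E y) (V y) (V y) = g p y y"
  using speed[of y 1] V_eq_vel by simp

lemma J1_deriv:
  assumes y: "y \<in> ball 0 r" and t: "t \<in> {0..1}"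
  shows "(J1 y u has_vector_derivative Rm (E (t *\<^sub>R y)) (vel y t) (t *\<^sub>R E' (t *\<^sub>R y) u) (vel y t)
     - \<Gamma> (E (t *\<^sub>R y)) (vel y t) (J1 y u t)) (at t within {0..1})"
  unfolding J1_def[abs_def]
  by (rule jacobi[OF t Et_U[OF y t] geo_x[OF y t] geo_v[OF y t] jac_J[OF y t] jac_\<eta>[OF y t]])

lemma J1_0: "y \<in> ball 0 r \<Longrightarrow> J1 y u 0 = u"
  using Et_U[of y 0] by (simp add: J1_def \<eta>_0 \<Gamma>_zero)

text \<open>Covariant differentiation along the geodesic and along the variation may be exchanged,
  so J' is also the covariant derivative of the radial field. The centre is excluded: there the
  field \<open>E' 0 u\<close> and the Jacobi field differ by the factor
  \<open>t = 0\<close>.\<close>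

lemma J1_Sh:
  assumes y: "y \<in> ball 0 r" and t: "t \<in> {0<..1}"
  shows "J1 y u t = Sh (t *\<^sub>R y) u"
proof -
  have U: "E (t *\<^sub>R y) \<in> U" using Et_U[OF y] t by auto
  show ?thesis using \<eta>_V'[OF y t] V_vel[OF y, of t] t
    by (simp add: J1_def Sh_def \<Gamma>_scale[OF U] \<Gamma>_sym[OF U, of "vel y t"])
qed

text \<open>The velocity is parallel, and R(v,J)v is orthogonal to \<open>v\<close> by skew
  symmetry, so the product of \<open>v\<close> and J' is constant along the geodesic.\<close>

lemma cov_J_inner:
  assumes y: "y \<in> ball 0 r" and t: "t \<in> {0..1}"
  shows "g (E (t *\<^sub>R y)) (vel y t) (J1 y u t) = g p y u"
proof -
  have "g (E (t *\<^sub>R y)) (vel y t) (J1 y u t) = g (E (0 *\<^sub>R y)) (vel y 0) (J1 y u 0)"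
  proof (rule constant_on_unit[OF _ t])
    fix t :: real assume t: "t \<in> {0..1}"
    note U = Et_U[OF y t]
    have "g (E (t *\<^sub>R y)) (vel y t) (Rm (E (t *\<^sub>R y)) (vel y t) (t *\<^sub>R E' (t *\<^sub>R y) u) (vel y t)) = 0"
      using Rm_skew[OF U, of "vel y t" "t *\<^sub>R E' (t *\<^sub>R y) u" "vel y t" "vel y t"]
      by (simp add: g_sym[OF U])
    then show "((\<lambda>t. g (E (t *\<^sub>R y)) (vel y t) (J1 y u t)) has_vector_derivative 0) (at t within {0..1})"
      by (intro has_vector_derivative_eq_rhs[OF has_vector_derivative_g[OF _ geo_x[OF y t] geo_v[OF y t] J1_deriv[OF y t]]])
         (use t U in \<open>auto simp: g_zero\<close>)
  qed
  then show ?thesis using vel_0[OF y] E_0 J1_0[OF y] by simp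
qed

text \<open>The integrated form of \<open>cov_J_inner\<close>; its value at \<open>t = 1\<close> is
  the Gauss lemma.\<close>

lemma J_inner:
  assumes y: "y \<in> ball 0 r" and t: "t \<in> {0..1}"
  shows "g (E (t *\<^sub>R y)) (vel y t) (t *\<^sub>R E' (t *\<^sub>R y) u) = t * g p y u"
proof -
  have "g (E (t *\<^sub>R y)) (vel y t) (t *\<^sub>R E' (t *\<^sub>R y) u) - t * g p y u
     = g (E (0 *\<^sub>R y)) (vel y 0) (0 *\<^sub>R E' (0 *\<^sub>R y) u) - 0 * g p y u"
  proof (rule constant_on_unit[OF _ t])
    fix t :: real assume t: "t \<in> {0..1}"
    note U = Et_U[OF y t]
    show "((\<lambda>t. g (E (t *\<^sub>R y)) (vel y t) (t *\<^sub>R E' (t *\<^sub>R y) u) - t * g p y u) has_vector_derivative 0) (at t within {0..1})"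
      by (rule has_vector_derivative_eq_rhs[OF has_vector_derivative_diff[OF has_vector_derivative_g[OF U geo_x[OF y t] geo_v[OF y t] jac_J[OF y t] t]
            has_vector_derivative_mult_left[OF has_vector_derivative_id]]])
         (use cov_J_inner[OF y t, of u] in \<open>simp add: g_zero U J1_def\<close>)
  qed
  then show ?thesis using p_U by (simp add: g_zero E_0)
qed

lemma gauss: "y \<in> ball 0 r \<Longrightarrow> g (E y) (V y) (E' y u) = g p y u"
  using J_inner[of y 1 u] V_eq_vel by simp

text \<open>In constant curvature the combination \<open>f J' - f' J\<close> is parallel and vanishes at the centre.\<close>

lemma constant_curvature_umbilic:
  assumes K: "\<And>x u v w. x \<in> U \<Longrightarrow> Rm x u v w = K *\<^sub>R (g x v w *\<^sub>R u - g x u w *\<^sub>R v)"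
    and y: "y \<in> ball 0 r" and u: "g p y u = 0"
    and f: "f 0 = 0" "\<And>t. t \<in> {0..1} \<Longrightarrow> (f has_vector_derivative f' t) (at t within {0..1})"
      "\<And>t. t \<in> {0..1} \<Longrightarrow> (f' has_vector_derivative - (K * g p y y) * f t) (at t within {0..1})"
  shows "f 1 *\<^sub>R Sh y u = f' 1 *\<^sub>R E' y u"
proof -
  define J where "J t = t *\<^sub>R E' (t *\<^sub>R y) u" for t
  define A where "A t = f t *\<^sub>R J1 y u t - f' t *\<^sub>R J t" for t
  have dA: "(A has_vector_derivative - \<Gamma> (E (t *\<^sub>R y)) (vel y t) (A t)) (at t within {0..1})" if t: "t \<in> {0..1}" for t
  proof -
    note U = Et_U[OF y t]
    have R: "Rm (E (t *\<^sub>R y)) (vel y t) (J t) (vel y t) = - (K * g p y y) *\<^sub>R J t"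
      using K[OF U, of "vel y t" "J t" "vel y t"] speed[OF y t] J_inner[OF y t, of u] u g_sym[OF U, of "J t" "vel y t"]
      by (simp add: J_def)
    have dJ1: "(J1 y u has_vector_derivative - (K * g p y y) *\<^sub>R J t - \<Gamma> (E (t *\<^sub>R y)) (vel y t) (J1 y u t)) (at t within {0..1})"
      using J1_deriv[OF y t, of u] R unfolding J_def by simp
    have dJ: "(J has_vector_derivative \<eta> y u t) (at t within {0..1})"
      unfolding J_def[abs_def] by (rule jac_J[OF y t])
    have e: "\<eta> y u t = J1 y u t - \<Gamma> (E (t *\<^sub>R y)) (vel y t) (J t)" by (simp add: J1_def J_def)
    have "(A has_vector_derivative (f t *\<^sub>R (- (K * g p y y) *\<^sub>R J t - \<Gamma> (E (t *\<^sub>R y)) (vel y t) (J1 y u t)) + f' t *\<^sub>R J1 y u t)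
        - (f' t *\<^sub>R \<eta> y u t + (- (K * g p y y) * f t) *\<^sub>R J t)) (at t within {0..1})"
      unfolding A_def[abs_def]
      by (intro has_vector_derivative_diff has_vector_derivative_scaleR dJ1 dJ f(2,3)[OF t, THEN has_real_derivative_iff_has_vector_derivative[THEN iffD2]])
    then show ?thesis
      by (rule has_vector_derivative_eq_rhs)
         (simp add: A_def e \<Gamma>_diff[OF U] \<Gamma>_scale[OF U] scaleR_diff_right algebra_simps)
  qed
  have "g (E (1 *\<^sub>R y)) (A 1) (A 1) = g (E (0 *\<^sub>R y)) (A 0) (A 0)"
  proof (rule constant_on_unit)
    fix t :: real assume t: "t \<in> {0..1}"
    show "((\<lambda>t. g (E (t *\<^sub>R y)) (A t) (A t)) has_vector_derivative 0) (at t within {0..1})"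
      by (rule has_vector_derivative_eq_rhs[OF has_vector_derivative_g[OF _ geo_x[OF y t] dA[OF t] dA[OF t]]])
         (use t Et_U[OF y t] in \<open>auto simp: g_zero\<close>)
  qed auto
  moreover have "A 0 = 0" by (simp add: A_def J_def f)
  ultimately have "A 1 = 0" using Et_U[OF y, of 1] g_zero_iff[of "E y" "A 1"] g_zero p_U E_0 by simp
  then show ?thesis using J1_Sh[OF y, of 1 u] by (simp add: A_def J_def)
qed

text \<open>The factor in \<open>par\<close> may be irregular in \<open>t\<close> and unbounded at
  the centre. Parallelism is therefore expressed twice without a factor: by the vanishing of
  \<open>Q\<close>, which can be differentiated, and by 2x2 minors, which pass to the limit. The
  conclusion says that all such minors of R(y,u)y and \<open>u\<close> vanish.\<close>

lemma umbilic_curvature: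
  assumes y: "y \<in> ball 0 r" and par: "\<And>t. t \<in> {0<..1} \<Longrightarrow> \<exists>h. Sh (t *\<^sub>R y) u = h *\<^sub>R E' (t *\<^sub>R y) u"
    and b: "b1 \<in> Basis" "b2 \<in> Basis"
  shows "(Rm p y u y \<bullet> b1) * (u \<bullet> b2) = (Rm p y u y \<bullet> b2) * (u \<bullet> b1)"
proof -
  define J where "J t = t *\<^sub>R E' (t *\<^sub>R y) u" for t
  define x where "x t = E (t *\<^sub>R y)" for t
  define v where "v = vel y"
  define R where "R t = Rm (x t) (v t) (J t) (v t)" for t
  \<comment> \<open>Up to the factor |J|^2, \<open>Q\<close> is the component of J' orthogonal to
    \<open>J\<close>. It vanishes exactly because J' is a multiple of \<open>J\<close>.\<close>
  define Q where "Q t = g (x t) (J t) (J t) *\<^sub>R J1 y u t - g (x t) (J1 y u t) (J t) *\<^sub>R J t" for t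
  have U: "x t \<in> U" if "t \<in> {0..1}" for t using Et_U[OF y that] by (simp add: x_def)
  have pJ: "\<exists>h. J1 y u t = h *\<^sub>R J t" if t: "t \<in> {0<..1}" for t
  proof -
    obtain h where "Sh (t *\<^sub>R y) u = h *\<^sub>R E' (t *\<^sub>R y) u" using par[OF t] by blast
    then show ?thesis using J1_Sh[OF y t, of u] t by (intro exI[of _ "h / t"]) (simp add: J_def)
  qed
  have Q0: "Q t = 0" if t: "t \<in> {0..1}" for t
  proof (cases "t = 0")
    case False
    then obtain h where "J1 y u t = h *\<^sub>R J t" using pJ t by fastforce
    then show ?thesis by (simp add: Q_def g_scale[OF U[OF t]])
  qed (use U[of 0] in \<open>simp add: Q_def J_def g_zero\<close>)
  have main: "\<exists>k. R t = k *\<^sub>R J t" if t: "t \<in> {0<..1}" for t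
  proof -
    have t': "t \<in> {0..1}" using t by auto
    note Ut = U[OF t']
    have dJ1: "(J1 y u has_vector_derivative R t - \<Gamma> (x t) (v t) (J1 y u t)) (at t within {0..1})"
      using J1_deriv[OF y t', of u] by (simp add: R_def x_def J_def v_def)
    have dx: "(x has_vector_derivative v t) (at t within {0..1})"
      using geo_x[OF y t'] by (simp add: x_def[abs_def] v_def)
    have dJ: "(J has_vector_derivative J1 y u t - \<Gamma> (x t) (v t) (J t)) (at t within {0..1})"
      using jac_J[OF y t', of u] by (simp add: J_def[abs_def] J1_def x_def v_def)
    have d1: "((\<lambda>t. g (x t) (J t) (J t)) has_vector_derivative 2 * g (x t) (J1 y u t) (J t)) (at t within {0..1})"
      by (rule has_vector_derivative_eq_rhs[OF has_vector_derivative_g[OF Ut dx dJ dJ t']]) (simp add: g_sym[OF Ut, of "J t"])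
    have d2: "((\<lambda>t. g (x t) (J1 y u t) (J t)) has_vector_derivative g (x t) (R t) (J t) + g (x t) (J1 y u t) (J1 y u t)) (at t within {0..1})"
      by (rule has_vector_derivative_eq_rhs[OF has_vector_derivative_g[OF Ut dx dJ1 dJ t']]) simp
    let ?Q' = "(g (x t) (J t) (J t) *\<^sub>R (R t - \<Gamma> (x t) (v t) (J1 y u t)) + (2 * g (x t) (J1 y u t) (J t)) *\<^sub>R J1 y u t)
        - (g (x t) (J1 y u t) (J t) *\<^sub>R (J1 y u t - \<Gamma> (x t) (v t) (J t)) + (g (x t) (R t) (J t) + g (x t) (J1 y u t) (J1 y u t)) *\<^sub>R J t)"
    have "(Q has_vector_derivative ?Q') (at t within {0..1})"
      unfolding Q_def[abs_def]
      by (intro has_vector_derivative_diff has_vector_derivative_scaleR dJ1 dJ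
          has_real_derivative_iff_has_vector_derivative[THEN iffD2] d1 d2)
    moreover have "(Q has_vector_derivative 0) (at t within {0..1})"
      by (rule has_vector_derivative_transform[OF t' _ has_vector_derivative_const[of 0]]) (use Q0 in auto)
    ultimately have Q': "?Q' = 0"
      using vector_derivative_unique_within_closed_interval[of 0 1 t Q] t' by fastforce
    obtain h where h: "J1 y u t = h *\<^sub>R J t" using pJ[OF t] by blast
    \<comment> \<open>After the substitution J' = h J the connection terms cancel, and so do the
      terms quadratic in \<open>h\<close>; only the curvature term of the derivative of
      \<open>Q\<close> survives.\<close>
    have e: "g (x t) (J t) (J t) *\<^sub>R R t = g (x t) (R t) (J t) *\<^sub>R J t"
    proof -
      have "(h * (h * (2 * g (x t) (J t) (J t)))) *\<^sub>R J t = (h * (h * g (x t) (J t) (J t))) *\<^sub>R J t + (h * (h * g (x t) (J t) (J t))) *\<^sub>R J t"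
        by (simp add: scaleR_left_distrib[symmetric])
      then show ?thesis using Q' by (simp add: h \<Gamma>_scale[OF Ut] g_scale[OF Ut] algebra_simps)
    qed
    show ?thesis
    proof (cases "J t = 0")
      case True then show ?thesis by (simp add: R_def linear_0[OF Rm_linear(2)[OF Ut]])
    next
      case False
      then have "g (x t) (J t) (J t) \<noteq> 0" using g_zero_iff[OF Ut] by blast
      then have "R t = (g (x t) (R t) (J t) / g (x t) (J t) (J t)) *\<^sub>R J t"
        using e by (metis divide_inverse_commute eq_vector_fraction_iff scaleR_scaleR)
      then show ?thesis by blast
    qed
  qed
  \<comment> \<open>\<open>E' (t *\<^sub>R y) u\<close> takes the place of \<open>J t\<close>, which
    vanishes at 0: after division by \<open>t\<close> the minor keeps a meaningful value at the
    centre.\<close>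
  define P where "P t = (Rm (x t) (v t) (E' (t *\<^sub>R y) u) (v t) \<bullet> b1) * (E' (t *\<^sub>R y) u \<bullet> b2)
     - (Rm (x t) (v t) (E' (t *\<^sub>R y) u) (v t) \<bullet> b2) * (E' (t *\<^sub>R y) u \<bullet> b1)" for t
  have P0: "P t = 0" if t: "t \<in> {0<..1}" for t
  proof -
    have t': "t \<in> {0..1}" using t by auto
    obtain k where "R t = k *\<^sub>R J t" using main[OF t] by blast
    then have "t *\<^sub>R Rm (x t) (v t) (E' (t *\<^sub>R y) u) (v t) = t *\<^sub>R (k *\<^sub>R E' (t *\<^sub>R y) u)"
      by (simp add: R_def J_def linear_scale[OF Rm_linear(2)[OF U[OF t']]] mult.commute)
    then have "Rm (x t) (v t) (E' (t *\<^sub>R y) u) (v t) = k *\<^sub>R E' (t *\<^sub>R y) u" using t by (metis greaterThanAtMost_iff less_irrefl scaleR_left_imp_eq scaleR_scaleR)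
    then show ?thesis by (simp add: P_def)
  qed
  have cx: "continuous_on {0..1} x" unfolding x_def[abs_def]
    by (rule continuous_on_vector_derivative[OF geo_x[OF y]])
  have cv: "continuous_on {0..1} v" unfolding v_def by (rule continuous_on_vector_derivative[OF geo_v[OF y]])
  have cE: "continuous_on {0..1} (\<lambda>t. E' (t *\<^sub>R y) u)"
    by (rule continuous_on_compose2[OF cont_E']) (use scale_in_ball[OF y] in \<open>auto intro!: continuous_intros\<close>)
  have "continuous_on {0..1} P" unfolding P_def
    by (intro continuous_intros continuous_on_Rm cx cv cE U)
  then have "continuous (at 0 within {0..1}) P" by (simp add: continuous_on_eq_continuous_within)
  then have lim: "(P \<longlongrightarrow> P 0) (at_right 0)"
    unfolding continuous_within using at_within_Icc_at_right[of 0 "1::real"] by simp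
  have "\<forall>\<^sub>F t in at_right 0. P t = 0"
    using eventually_at_right_less[of "0::real"] eventually_at_right[of 0 1 "\<lambda>t. P t = 0"] P0
    by (metis (no_types, lifting) eventually_at_right greaterThanAtMost_iff less_eq_real_def zero_less_one)
  then have "(P \<longlongrightarrow> 0) (at_right 0)" by (rule tendsto_eventually)
  then have "P 0 = 0" using lim tendsto_unique trivial_limit_at_right_real by blast
  moreover have "E' 0 u = u"
  proof -
    have "((\<lambda>t. t *\<^sub>R E' 0 u) has_vector_derivative \<eta> 0 u 0) (at 0 within cbox 0 1)"
      using jac_J[of 0 0 u] r by simp
    moreover have "((\<lambda>t. t *\<^sub>R E' 0 u) has_vector_derivative E' 0 u) (at 0 within cbox 0 1)"
      by (auto intro!: derivative_eq_intros)
    ultimately show ?thesis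
      using vector_derivative_unique_within_closed_interval[of 0 1 0] \<eta>_0[of 0] r by fastforce
  qed
  ultimately show ?thesis
    using vel_0[OF y] E_0 by (simp add: P_def x_def v_def)
qed

lemma F_range: "x \<in> E ` ball 0 r \<Longrightarrow> F x \<in> ball 0 r \<and> E (F x) = x"
  using F_E by auto

definition N :: "'e \<Rightarrow> 'e" where "N x = V (F x)"
definition N' :: "'e \<Rightarrow> 'e \<Rightarrow> 'e" where "N' x h = V' (F x) (F' x h)"

lemma dN: "x \<in> E ` ball 0 r \<Longrightarrow> (N has_derivative N' x) (at x)"
  unfolding N_def[abs_def] N'_def[abs_def]
  by (rule has_derivative_compose[OF dF dV]) (use F_range in auto)

lemma cont_F: "continuous_on (E ` ball 0 r) F"
  by (rule continuous_at_imp_continuous_on) (use has_derivative_continuous[OF dF] in blast)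

lemma cont_N': "continuous_on (E ` ball 0 r) (\<lambda>x. N' x h)"
  unfolding N'_def
  by (rule continuous_on_linear_family[OF continuous_on_compose2[OF cont_V' cont_F] cont_F'])
     (use F_range has_derivative_linear[OF dV] in auto)

lemma gauss_N:
  assumes x: "x \<in> E ` ball 0 r" shows "g x (N x) h = g p (F x) (F' x h)"
  using gauss[of "F x" "F' x h"] F_range[OF x] F'_E'(2)[of "F x" h] by (simp add: N_def)

lemma N_norm: "x \<in> E ` ball 0 r \<Longrightarrow> g x (N x) (N x) = g p (F x) (F x)"
  using V_norm[of "F x"] F_range[of x] by (simp add: N_def)

lemma cov_N:
  assumes x: "x \<in> E ` ball 0 r" shows "N' x h + \<Gamma> x h (N x) = Sh (F x) (F' x h)"
  using F_range[OF x] F'_E'(2)[of "F x" h] by (simp add: N'_def N_def Sh_def)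

text \<open>The Gauss lemma once more: the gradient of the squared radius is twice the radial field.
  So the derivative is expressed through \<open>N\<close>, which is C^1, although \<open>F\<close>
  itself is only C^1.\<close>

lemma d_radius:
  assumes x: "x \<in> E ` ball 0 r"
  shows "((\<lambda>x. g p (F x) (F x)) has_derivative (\<lambda>h. 2 * g x (N x) h)) (at x)"
proof -
  have bl: "bounded_bilinear (g p)" using g_bil[OF p_U] bilinear_conv_bounded_bilinear by blast
  show ?thesis
    by (rule has_derivative_eq_rhs[OF bounded_bilinear.FDERIV[OF bl dF[OF x] dF[OF x]]])
       (simp add: fun_eq_iff gauss_N[OF x] g_sym[OF p_U, of "F' x _"])
qed

text \<open>The minimum of the quadratic form \<open>g p\<close> on the Euclidean unit sphere
  compares the two norms. The bound is uniform in \<open>R\<close>, so the vectors of length at most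
  \<open>R\<close> lie in the domain of \<open>E\<close> along with those of length
  \<open>R\<close>.\<close>

lemma small_radius: "\<exists>R0>0. \<forall>R y. R < R0 \<longrightarrow> 0 \<le> R \<longrightarrow> g p y y \<le> R\<^sup>2 \<longrightarrow> y \<in> ball 0 r"
proof -
  have "continuous_on (sphere 0 1) (\<lambda>y. g p y y)"
    by (rule continuous_on_g) (use p_U in \<open>auto intro!: continuous_intros\<close>)
  moreover have "sphere (0::'e) 1 \<noteq> {}" by simp
  ultimately obtain z where z: "z \<in> sphere 0 1" "\<And>y. y \<in> sphere 0 1 \<Longrightarrow> g p z z \<le> g p y y"
    using continuous_attains_inf[of "sphere 0 1" "\<lambda>y. g p y y"] by auto
  have pos: "g p z z > 0" using g_pos[OF p_U, of z] z(1) by force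
  have low: "g p z z * (norm y)\<^sup>2 \<le> g p y y" for y
  proof (cases "y = 0")
    case False
    have "g p z z \<le> g p ((1 / norm y) *\<^sub>R y) ((1 / norm y) *\<^sub>R y)" by (rule z(2)) (use False in simp)
    also have "\<dots> = g p y y / (norm y)\<^sup>2" by (simp add: g_scale[OF p_U] power2_eq_square)
    finally show ?thesis using False by (simp add: field_simps)
  qed (simp add: g_zero[OF p_U])
  have "y \<in> ball 0 r" if "R < r * sqrt (g p z z)" "0 \<le> R" "g p y y \<le> R\<^sup>2" for R y
  proof -
    have "R\<^sup>2 < (r * sqrt (g p z z))\<^sup>2" using that by (intro power_strict_mono) auto
    also have "\<dots> = r\<^sup>2 * g p z z" using pos by (simp add: power_mult_distrib)
    finally have "g p z z * (norm y)\<^sup>2 < r\<^sup>2 * g p z z"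
      using low[of y] that(3) by linarith
    then have "g p z z * (norm y)\<^sup>2 < g p z z * r\<^sup>2" using low[of y] that(3) by (simp only: mult.commute)
    then have "(norm y)\<^sup>2 < r\<^sup>2" using pos by simp
    then have "norm y < r" using r by (simp add: power2_less_imp_less)
    then show ?thesis by simp
  qed
  then show ?thesis using r pos by (intro exI[of _ "r * sqrt (g p z z)"]) auto
qed

end

section \<open>Pointwise criteria for a curvature tensor of constant curvature type\<close>

lemma real_functional_inner:
  fixes f :: "'e::euclidean_space \<Rightarrow> real"
  assumes "linear f" shows "f u = (\<Sum>i\<in>Basis. f i *\<^sub>R i) \<bullet> u"
  by (subst linear_Basis_expand[OF assms, of u]) (simp add: inner_sum_left inner_commute[of u] mult.commute)

context local_metric
begin

text \<open>The difference \<open>T\<close> of the two sides, with its fourth argument, has all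
  symmetries of a curvature tensor. Polarizing \<open>T u v v u = 0\<close> in the outer slots and
  then in the inner ones makes \<open>T\<close> skew in every neighbouring pair, and the Bianchi
  identity becomes \<open>3 * T = 0\<close>.\<close>

lemma constant_curvature_polarize:
  assumes x: "x \<in> U" and sec: "\<And>u v. g x (Rm x u v v) u = K * (g x u u * g x v v - (g x u v)\<^sup>2)"
  shows "Rm x u v w = K *\<^sub>R (g x v w *\<^sub>R u - g x u w *\<^sub>R v)"
proof -
  define T where "T a b c d = g x (Rm x a b c) d - K * (g x b c * g x a d - g x a c * g x b d)" for a b c d
  note s = g_sym[OF x] and ga = g_add[OF x]
  have add1: "T (a + a') b c d = T a b c d + T a' b c d"
   and add2: "T a (b + b') c d = T a b c d + T a b' c d"
   and add3: "T a b (c + c') d = T a b c d + T a b c' d"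
   and add4: "T a b c (d + d') = T a b c d + T a b c d'" for a a' b b' c c' d d'
    by (simp_all add: T_def ga linear_add[OF Rm_linear(1)[OF x]] linear_add[OF Rm_linear(2)[OF x]]
        linear_add[OF Rm_linear(3)[OF x]] algebra_simps)
  have anti1: "T a b c d = - T b a c d" for a b c d
    using Rm_antisym[of x a b c] by (simp add: T_def g_minus[OF x] algebra_simps)
  have anti2: "T a b c d = - T a b d c" for a b c d
    using Rm_skew[OF x, of a b c d] s[of c "Rm x a b d"] by (simp add: T_def algebra_simps)
  have pair: "T a b c d = T c d a b" for a b c d
    using Rm_pair_sym[OF x, of a b c d] s[of b c] s[of a d] s[of a c] s[of b d] by (simp add: T_def algebra_simps)
  have bianchi: "T a b c d + T b c a d + T c a b d = 0" for a b c d
  proof -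
    have "g x (Rm x a b c) d + g x (Rm x b c a) d + g x (Rm x c a b) d = 0"
      using Rm_bianchi[OF x, of a b c] by (metis ga(1) g_zero(1)[OF x])
    then show ?thesis using s[of a b] s[of b c] s[of a c] by (simp add: T_def algebra_simps)
  qed
  have z: "T u v v u = 0" for u v
    using sec[of u v] s[of v u] by (simp add: T_def power2_eq_square algebra_simps)
  have z1: "T u v v w = 0" for u v w
  proof -
    have "T u v v u + T w v v u + (T u v v w + T w v v w) = 0"
      using z[of "u + w" v] by (simp only: add1 add4)
    then have "T u v v w + T w v v u = 0" by (simp add: z)
    moreover have "T w v v u = T u v v w"
      using pair[of w v v u] anti1[of v u w v] anti2[of u v w v] by simp
    ultimately show ?thesis by simp
  qed
  have z2: "T u v z w = - T u z v w" for u v z w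
  proof -
    have "T u v v w + T u z v w + (T u v z w + T u z z w) = 0"
      using z1[of u "v + z" w] by (simp only: add2 add3)
    then show ?thesis by (simp add: z1)
  qed
  have "T u v w d = 0" for d
    using bianchi[of u v w d] z2[of v w u d] anti1[of v u w d] anti1[of w u v d] z2[of u w v d] by linarith
  then have "g x (Rm x u v w) d = g x (K *\<^sub>R (g x v w *\<^sub>R u - g x u w *\<^sub>R v)) d" for d
    unfolding T_def by (simp add: g_scale[OF x] g_diff[OF x])
  then show ?thesis by (rule g_nondegenerate[OF x])
qed

text \<open>Every vector orthogonal to \<open>v\<close> is an eigenvector of
  \<open>u \<mapsto> Rm x u v v\<close>, so this map is a scalar \<open>k v * g x v v\<close> on the
  complement of \<open>v\<close>. The scalars of different \<open>v\<close> are linked through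
  vectors orthogonal to both.\<close>

lemma isotropic_constant:
  assumes x: "x \<in> U" and dim: "DIM('e) \<ge> 3"
    and par: "\<And>y u b1 b2. g x y u = 0 \<Longrightarrow> b1 \<in> Basis \<Longrightarrow> b2 \<in> Basis \<Longrightarrow>
       (Rm x y u y \<bullet> b1) * (u \<bullet> b2) = (Rm x y u y \<bullet> b2) * (u \<bullet> b1)"
  shows "\<exists>K. \<forall>u v w. Rm x u v w = K *\<^sub>R (g x v w *\<^sub>R u - g x u w *\<^sub>R v)"
proof -
  note s = g_sym[OF x] and L = linear_add[OF Rm_linear(1)[OF x]] linear_scale[OF Rm_linear(1)[OF x]]
  \<comment> \<open>This is where the dimension enters: two vectors have a common nonzero orthogonal
    vector only because the dimension is at least 3.\<close>
  have ortho: "\<exists>u. u \<noteq> 0 \<and> g x u v = 0 \<and> g x u v' = 0" for v v'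
  proof -
    let ?a = "\<lambda>v. \<Sum>i\<in>Basis. g x v i *\<^sub>R i"
    have "dim {?a v, ?a v'} \<le> card {?a v, ?a v'}" by (rule dim_le_card') simp
    also have "\<dots> \<le> 2" by (simp add: card_insert_if)
    finally have "dim {?a v, ?a v'} < DIM('e)" using dim by simp
    then obtain u where u: "u \<noteq> 0" "\<And>y. y \<in> span {?a v, ?a v'} \<Longrightarrow> orthogonal u y"
      using orthogonal_to_subspace_exists by blast
    have "orthogonal u (?a v)" "orthogonal u (?a v')" by (rule u(2), rule span_base, simp)+
    then have "?a v \<bullet> u = 0" "?a v' \<bullet> u = 0" by (simp_all only: orthogonal_def inner_commute[of u])
    with u(1) show ?thesis using real_functional_inner[OF g_linear(1)[OF x], of v u] real_functional_inner[OF g_linear(1)[OF x], of v' u] s by metis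
  qed
  have eig: "\<exists>k. Rm x u v v = k *\<^sub>R u" if o: "g x u v = 0" for u v
  proof (cases "u = 0")
    case True then show ?thesis by (simp add: linear_0[OF Rm_linear(1)[OF x]])
  next
    case False
    then obtain b where b: "b \<in> Basis" "u \<bullet> b \<noteq> 0" using euclidean_all_zero_iff by blast
    let ?k = "(Rm x v u v \<bullet> b) / (u \<bullet> b)"
    have "Rm x v u v = ?k *\<^sub>R u"
    proof (rule euclidean_eqI)
      fix b1 :: 'e assume "b1 \<in> Basis"
      then have "(Rm x v u v \<bullet> b1) * (u \<bullet> b) = (Rm x v u v \<bullet> b) * (u \<bullet> b1)" using par[of v u b1 b] b o s by simp
      then show "Rm x v u v \<bullet> b1 = ?k *\<^sub>R u \<bullet> b1" using b by (simp add: field_simps)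
    qed
    then show ?thesis using Rm_antisym[of x u v v] by (intro exI[of _ "- ?k"]) simp
  qed
  \<comment> \<open>The eigenvalues of \<open>u\<close>, \<open>u0\<close> and \<open>u + u0\<close>
    are compared: either they agree or \<open>u\<close> is a multiple of \<open>u0\<close>. Division
    by \<open>g x v v\<close> makes \<open>k\<close> the sectional curvature of the planes through
    \<open>v\<close>.\<close>
  have eig1: "\<exists>k. \<forall>u. g x u v = 0 \<longrightarrow> Rm x u v v = (k * g x v v) *\<^sub>R u" if v: "v \<noteq> 0" for v
  proof -
    obtain u0 where u0: "u0 \<noteq> 0" "g x u0 v = 0" using ortho by blast
    obtain k0 where k0: "Rm x u0 v v = k0 *\<^sub>R u0" using eig[OF u0(2)] by blast
    have "Rm x u v v = k0 *\<^sub>R u" if o: "g x u v = 0" for u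
    proof -
      obtain k where k: "Rm x u v v = k *\<^sub>R u" using eig[OF o] by blast
      have "g x (u + u0) v = 0" using o u0 g_add[OF x] by simp
      then obtain k' where k': "Rm x (u + u0) v v = k' *\<^sub>R (u + u0)" using eig by blast
      have e: "(k' - k) *\<^sub>R u = (k0 - k') *\<^sub>R u0" using k k' k0 L(1)[of u u0 v v] by (simp add: algebra_simps)
      show ?thesis
      proof (cases "k' = k")
        case True then have "k0 = k'" using e u0 by simp
        then show ?thesis using k True by simp
      next
        case False
        then have "u = ((k0 - k') / (k' - k)) *\<^sub>R u0" using e by (metis divide_inverse_commute eq_iff_diff_eq_0 eq_vector_fraction_iff scaleR_scaleR)
        then show ?thesis using k0 L(2)[of "(k0 - k') / (k' - k)" u0 v v] by (metis scaleR_left_commute)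
      qed
    qed
    then show ?thesis using g_zero_iff[OF x, of v] v by (intro exI[of _ "k0 / g x v v"]) simp
  qed
  then obtain k where k: "\<And>v u. v \<noteq> 0 \<Longrightarrow> g x u v = 0 \<Longrightarrow> Rm x u v v = (k v * g x v v) *\<^sub>R u" by metis
  \<comment> \<open>For orthogonal \<open>u\<close> and \<open>v\<close> both factors are the
    sectional curvature of the plane they span; pair symmetry exchanges their roles.\<close>
  have ksym: "k u = k v" if "u \<noteq> 0" "v \<noteq> 0" "g x u v = 0" for u v
  proof -
    have "k v * g x v v * g x u u = g x (Rm x u v v) u" using k[OF that(2,3)] by (simp add: g_scale[OF x])
    also have "\<dots> = g x (Rm x v u u) v" by (rule Rm_pair_sym[OF x])
    also have "\<dots> = k u * g x u u * g x v v" using k[OF that(1), of v] that(3) s by (simp add: g_scale[OF x])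
    finally show ?thesis using g_zero_iff[OF x] that by simp
  qed
  have kconst: "k v = k v'" if "v \<noteq> 0" "v' \<noteq> 0" for v v'
    using ortho[of v v'] ksym that by metis
  obtain v0 :: 'e where v0: "v0 \<noteq> 0" using ortho by blast
  have "g x (Rm x u v v) u = k v0 * (g x u u * g x v v - (g x u v)\<^sup>2)" for u v
  proof (cases "v = 0")
    case True then show ?thesis by (simp add: linear_0[OF Rm_linear(2)[OF x]] g_zero[OF x])
  next
    case False
    \<comment> \<open>Removal of the component along \<open>v\<close>, on which the curvature
      vanishes, reduces the general case to the orthogonal one.\<close>
    define c where "c = g x u v / g x v v"
    have vv: "g x v v \<noteq> 0" using False g_zero_iff[OF x] by simp
    have o: "g x (u - c *\<^sub>R v) v = 0" using vv by (simp add: c_def g_diff[OF x] g_scale[OF x])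
    have "Rm x v v v = 0" by (simp add: Rm_def)
    then have R: "Rm x u v v = (k v0 * g x v v) *\<^sub>R (u - c *\<^sub>R v)"
      using k[OF False o] kconst[OF False v0] linear_diff[OF Rm_linear(1)[OF x], of u "c *\<^sub>R v" v v] L(2)[of c v v v] by simp
    have "g x (u - c *\<^sub>R v) u = g x u u - c * g x u v" using s[of v u] by (simp add: g_diff[OF x] g_scale[OF x])
    also have "g x v v * \<dots> = g x u u * g x v v - (g x u v)\<^sup>2" using vv by (simp add: c_def power2_eq_square field_simps)
    finally show ?thesis unfolding R by (simp add: g_scale[OF x])
  qed
  from constant_curvature_polarize[OF x this] show ?thesis by blast
qed

end

section \<open>Schur's lemma\<close>

text \<open>The curvature is only continuous, so the differential Bianchi identity is replaced by its integral over the
  boundary of small cubes.\<close>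

definition sq :: "real \<Rightarrow> 'e::euclidean_space \<Rightarrow> 'e \<Rightarrow> 'e \<Rightarrow> ('e \<Rightarrow> real) \<Rightarrow> real" where
  "sq \<epsilon> y u v f = integral (cbox (0,0) (\<epsilon>,\<epsilon>)) (\<lambda>(s,t). f (y + s *\<^sub>R u + t *\<^sub>R v))"

abbreviation in_square :: "real \<Rightarrow> 'e::euclidean_space \<Rightarrow> 'e \<Rightarrow> 'e \<Rightarrow> 'e set \<Rightarrow> bool" where
  "in_square \<epsilon> y u v C \<equiv> (\<forall>s\<in>{0..\<epsilon>}. \<forall>t\<in>{0..\<epsilon>}. y + s *\<^sub>R u + t *\<^sub>R v \<in> C)"

lemma in_square_swap: "in_square \<epsilon> y u v C \<Longrightarrow> in_square \<epsilon> y v u C"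
proof (intro ballI)
  fix s t assume "in_square \<epsilon> y u v C" "s \<in> {0..\<epsilon>}" "t \<in> {0..\<epsilon>}"
  then have "y + t *\<^sub>R u + s *\<^sub>R v \<in> C" by blast
  then show "y + s *\<^sub>R v + t *\<^sub>R u \<in> C" by (simp add: algebra_simps)
qed

lemma continuous_on_square:
  assumes "continuous_on C f" "in_square \<epsilon> y u v C"
  shows "continuous_on (cbox (0,0) (\<epsilon>,\<epsilon>)) (\<lambda>(s,t). f (y + s *\<^sub>R u + t *\<^sub>R v))"
  unfolding case_prod_beta
  by (rule continuous_on_compose2[OF assms(1)]) (use assms(2) in \<open>auto intro!: continuous_intros\<close>)

lemma sq_swap:
  assumes "continuous_on C f" "in_square \<epsilon> y u v C"
  shows "sq \<epsilon> y u v f = sq \<epsilon> y v u f"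
proof -
  have "sq \<epsilon> y u v f = integral (cbox (0,0) (\<epsilon>,\<epsilon>)) (\<lambda>(s,t). f (y + t *\<^sub>R u + s *\<^sub>R v))"
    unfolding sq_def
    using integral_swap_2dim[OF continuous_on_square[OF assms]] by simp
  then show ?thesis by (simp add: sq_def add.commute add.left_commute)
qed

lemma sq_iterated:
  assumes "continuous_on C f" "in_square \<epsilon> y u v C"
  shows "sq \<epsilon> y u v f = integral {0..\<epsilon>} (\<lambda>s. integral {0..\<epsilon>} (\<lambda>t. f (y + s *\<^sub>R u + t *\<^sub>R v)))"
  unfolding sq_def using integral_prod_continuous[OF continuous_on_square[OF assms]] by simp

lemma sq_bound:
  assumes "continuous_on C f" "in_square \<epsilon> y u v C" "0 \<le> \<epsilon>"
    and "\<And>s t. s \<in> {0..\<epsilon>} \<Longrightarrow> t \<in> {0..\<epsilon>} \<Longrightarrow> \<bar>f (y + s *\<^sub>R u + t *\<^sub>R v)\<bar> \<le> B"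
  shows "\<bar>sq \<epsilon> y u v f\<bar> \<le> B * \<epsilon>\<^sup>2"
proof -
  have "0 \<le> B" using assms(4)[of 0 0] assms(3) by (smt (verit) atLeastAtMost_iff)
  moreover have "(((\<lambda>(s,t). f (y + s *\<^sub>R u + t *\<^sub>R v))) has_integral sq \<epsilon> y u v f) (cbox (0,0) (\<epsilon>,\<epsilon>))"
    unfolding sq_def by (rule integrable_integral[OF integrable_continuous[OF continuous_on_square[OF assms(1,2)]]])
  ultimately have "norm (sq \<epsilon> y u v f) \<le> B * measure lborel (cbox (0::real,0::real) (\<epsilon>,\<epsilon>))"
    by (rule has_integral_bound) (use assms(4) in auto)
  then show ?thesis using assms(3) by (simp add: content_Pair power2_eq_square)
qed

lemma sq_diff:
  assumes "continuous_on C f" "continuous_on C h" "in_square \<epsilon> y u v C"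
  shows "sq \<epsilon> y u v (\<lambda>x. f x - h x) = sq \<epsilon> y u v f - sq \<epsilon> y u v h"
  unfolding sq_def case_prod_beta
  by (rule integral_diff[OF integrable_continuous[OF continuous_on_square[OF assms(1,3)]]
        integrable_continuous[OF continuous_on_square[OF assms(2,3)]], unfolded case_prod_beta])

lemma sq_cmult: "sq \<epsilon> y u v (\<lambda>x. c * f x) = c * sq \<epsilon> y u v f"
  unfolding sq_def case_prod_beta by simp

lemma sq_const: "0 \<le> \<epsilon> \<Longrightarrow> sq \<epsilon> y u v (\<lambda>x. c) = c * \<epsilon>\<^sup>2"
  unfolding sq_def case_prod_beta by (simp add: content_Pair power2_eq_square)

lemma sq_shift: "sq \<epsilon> (y + w) u v f = sq \<epsilon> y u v (\<lambda>x. f (x + w))"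
  unfolding sq_def by (simp add: algebra_simps)

text \<open>By Fubini the direction \<open>u\<close> of the derivative is integrated first, and the
  fundamental theorem leaves the difference of the integrals of \<beta> over two opposite
  edges.\<close>

lemma sq_circulation:
  assumes eps: "0 \<le> \<epsilon>" and C: "in_square \<epsilon> y u v C"
    and d: "\<And>x. x \<in> C \<Longrightarrow> (\<beta> has_derivative \<beta>' x) (at x)" and c: "continuous_on C (\<lambda>x. \<beta>' x u)"
  shows "sq \<epsilon> y u v (\<lambda>x. \<beta>' x u) = integral {0..\<epsilon>} (\<lambda>t. \<beta> (y + \<epsilon> *\<^sub>R u + t *\<^sub>R v)) - integral {0..\<epsilon>} (\<lambda>t. \<beta> (y + t *\<^sub>R v))"
proof -
  have C': "in_square \<epsilon> y v u C" using C by (rule in_square_swap)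
  have contb: "continuous_on C \<beta>"
    by (rule continuous_at_imp_continuous_on) (use has_derivative_continuous[OF d] in blast)
  have ftc: "integral {0..\<epsilon>} (\<lambda>s. \<beta>' (y + t *\<^sub>R v + s *\<^sub>R u) u) = \<beta> (y + \<epsilon> *\<^sub>R u + t *\<^sub>R v) - \<beta> (y + t *\<^sub>R v)"
    if t: "t \<in> {0..\<epsilon>}" for t
  proof -
    have "((\<lambda>s. \<beta>' (y + t *\<^sub>R v + s *\<^sub>R u) u) has_integral \<beta> (y + t *\<^sub>R v + \<epsilon> *\<^sub>R u) - \<beta> (y + t *\<^sub>R v + 0 *\<^sub>R u)) {0..\<epsilon>}"
    proof (rule fundamental_theorem_of_calculus[OF eps])
      fix s assume s: "s \<in> {0..\<epsilon>}"
      have x: "y + t *\<^sub>R v + s *\<^sub>R u \<in> C" using C' s t by blast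
      have "((\<lambda>s. \<beta> (y + t *\<^sub>R v + s *\<^sub>R u)) has_derivative (\<lambda>h. \<beta>' (y + t *\<^sub>R v + s *\<^sub>R u) (h *\<^sub>R u))) (at s within {0..\<epsilon>})"
        by (rule has_derivative_compose[where f="\<lambda>s. y + t *\<^sub>R v + s *\<^sub>R u" and g=\<beta>, OF _ d[OF x]]) (auto intro!: derivative_eq_intros)
      then show "((\<lambda>s. \<beta> (y + t *\<^sub>R v + s *\<^sub>R u)) has_vector_derivative \<beta>' (y + t *\<^sub>R v + s *\<^sub>R u) u) (at s within {0..\<epsilon>})"
        using linear_scale[OF has_derivative_linear[OF d[OF x]], of _ u] by (simp add: has_vector_derivative_def)
    qed
    then show ?thesis by (simp add: integral_unique algebra_simps)
  qed
  have "sq \<epsilon> y u v (\<lambda>x. \<beta>' x u) = integral {0..\<epsilon>} (\<lambda>t. integral {0..\<epsilon>} (\<lambda>s. \<beta>' (y + t *\<^sub>R v + s *\<^sub>R u) u))"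
    using sq_swap[OF c C] sq_iterated[OF c C'] by simp
  also have "\<dots> = integral {0..\<epsilon>} (\<lambda>t. \<beta> (y + \<epsilon> *\<^sub>R u + t *\<^sub>R v) - \<beta> (y + t *\<^sub>R v))"
    by (rule integral_cong) (rule ftc)
  also have "\<dots> = integral {0..\<epsilon>} (\<lambda>t. \<beta> (y + \<epsilon> *\<^sub>R u + t *\<^sub>R v)) - integral {0..\<epsilon>} (\<lambda>t. \<beta> (y + t *\<^sub>R v))"
  proof (rule integral_diff)
    have "y + t *\<^sub>R v \<in> C" if "t \<in> {0..\<epsilon>}" for t using C that eps by (metis add.right_neutral atLeastAtMost_iff order_refl scaleR_zero_left)
    then show "(\<lambda>t. \<beta> (y + \<epsilon> *\<^sub>R u + t *\<^sub>R v)) integrable_on {0..\<epsilon>}" "(\<lambda>t. \<beta> (y + t *\<^sub>R v)) integrable_on {0..\<epsilon>}"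
      using C eps by (auto intro!: integrable_continuous_real continuous_on_compose2[OF contb] continuous_intros)
  qed
  finally show ?thesis .
qed

text \<open>Here \<gamma> is a 1-form given by its values on \<open>a\<close>, \<open>b\<close>,
  \<open>c\<close>, and \<open>W\<close> is its exterior derivative. By
  \<open>sq_circulation\<close> each face contributes integrals over its edges, and each edge of the
  cube occurs in two faces with opposite signs. This is the identity dd = 0 for forms that can be
  differentiated only once.\<close>

lemma closed_boundary_integral:
  fixes a b c :: "'e::euclidean_space"
  assumes eps: "0 \<le> \<epsilon>"
    and cube: "\<And>r s t. r \<in> {0..\<epsilon>} \<Longrightarrow> s \<in> {0..\<epsilon>} \<Longrightarrow> t \<in> {0..\<epsilon>} \<Longrightarrow> x + r *\<^sub>R a + s *\<^sub>R b + t *\<^sub>R c \<in> C"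
    and d: "\<And>w x. w \<in> {a,b,c} \<Longrightarrow> x \<in> C \<Longrightarrow> (\<gamma> w has_derivative \<gamma>' w x) (at x)"
    and cont: "\<And>w v. continuous_on C (\<lambda>x. \<gamma>' w x v)"
  defines "W \<equiv> \<lambda>u v x. \<gamma>' v x u - \<gamma>' u x v"
  shows "(sq \<epsilon> (x + \<epsilon> *\<^sub>R c) a b (W a b) - sq \<epsilon> x a b (W a b)) + (sq \<epsilon> (x + \<epsilon> *\<^sub>R a) b c (W b c) - sq \<epsilon> x b c (W b c))
     + (sq \<epsilon> (x + \<epsilon> *\<^sub>R b) c a (W c a) - sq \<epsilon> x c a (W c a)) = 0"
proof -
  define P where "P v y = integral {0..\<epsilon>} (\<lambda>t. \<gamma> v (y + t *\<^sub>R v))" for v y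
  have W: "sq \<epsilon> y u v (W u v) = (P v (y + \<epsilon> *\<^sub>R u) - P v y) - (P u (y + \<epsilon> *\<^sub>R v) - P u y)"
    if C: "in_square \<epsilon> y u v C" and uv: "u \<in> {a,b,c}" "v \<in> {a,b,c}" for y u v
  proof -
    have C': "in_square \<epsilon> y v u C" using C by (rule in_square_swap)
    have "sq \<epsilon> y u v (W u v) = sq \<epsilon> y u v (\<lambda>x. \<gamma>' v x u) - sq \<epsilon> y u v (\<lambda>x. \<gamma>' u x v)"
      unfolding W_def by (rule sq_diff[OF cont cont C])
    also have "sq \<epsilon> y u v (\<lambda>x. \<gamma>' v x u) = P v (y + \<epsilon> *\<^sub>R u) - P v y"
      unfolding P_def by (rule sq_circulation[OF eps C d[OF uv(2)] cont])
    also have "sq \<epsilon> y u v (\<lambda>x. \<gamma>' u x v) = P u (y + \<epsilon> *\<^sub>R v) - P u y"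
      unfolding sq_swap[OF cont C] P_def by (rule sq_circulation[OF eps C' d[OF uv(1)] cont])
    finally show ?thesis .
  qed
  have z: "(0::real) \<in> {0..\<epsilon>}" "\<epsilon> \<in> {0..\<epsilon>}" using eps by auto
  have c4: "in_square \<epsilon> (x + \<epsilon> *\<^sub>R c) a b C" "in_square \<epsilon> x a b C" "in_square \<epsilon> (x + \<epsilon> *\<^sub>R a) b c C"
    "in_square \<epsilon> x b c C" and c6: "in_square \<epsilon> (x + \<epsilon> *\<^sub>R b) a c C" "in_square \<epsilon> x a c C"
    using cube[OF _ _ z(1)] cube[OF _ _ z(2)] cube[OF z(1)] cube[OF z(2)] cube[OF _ z(1)] cube[OF _ z(2)]
    by (auto simp: algebra_simps)
  note c2 = in_square_swap[OF c6(1)] in_square_swap[OF c6(2)]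
  note W[OF c4(1)] W[OF c4(2)] W[OF c4(3)] W[OF c4(4)] W[OF c2(1)] W[OF c2(2)]
  moreover have "x + \<epsilon> *\<^sub>R c + \<epsilon> *\<^sub>R a = x + \<epsilon> *\<^sub>R a + \<epsilon> *\<^sub>R c" "x + \<epsilon> *\<^sub>R c + \<epsilon> *\<^sub>R b = x + \<epsilon> *\<^sub>R b + \<epsilon> *\<^sub>R c"
     "x + \<epsilon> *\<^sub>R b + \<epsilon> *\<^sub>R a = x + \<epsilon> *\<^sub>R a + \<epsilon> *\<^sub>R b" by simp_all
  ultimately show ?thesis by simp
qed

text \<open>The increment of the integral of \<open>K * \<tau> - Q\<close> under a shift by
  \<open>\<epsilon> *\<^sub>R w\<close>, up to an error that is small against \<epsilon>^3. The
  function \<open>K\<close> is only continuous, so its increment has to remain as a difference with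
  the weight \<tau> frozen at \<open>x\<close>; the differentiable \<tau> and \<open>Q\<close>
  contribute their derivatives times the volume of the cube.\<close>

lemma square_increment_estimate:
  fixes K \<tau> Q :: "'e::euclidean_space \<Rightarrow> real"
  assumes \<rho>: "\<rho> > 0" and nrm: "norm u = 1" "norm v = 1" "norm w = 1"
    and contK: "continuous_on (cball p \<rho>) K"
    and d\<tau>: "\<And>x. x \<in> cball p \<rho> \<Longrightarrow> (\<tau> has_derivative \<tau>' x) (at x)" and c\<tau>: "\<And>h. continuous_on (cball p \<rho>) (\<lambda>x. \<tau>' x h)"
    and dQ: "\<And>x. x \<in> cball p \<rho> \<Longrightarrow> (Q has_derivative Q' x) (at x)" and cQ: "\<And>h. continuous_on (cball p \<rho>) (\<lambda>x. Q' x h)"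
    and \<mu>: "\<mu> > 0"
  shows "\<exists>\<delta>>0. \<forall>x\<in>cball p (\<rho>/2). \<forall>\<epsilon>. 0 < \<epsilon> \<longrightarrow> \<epsilon> < \<delta> \<longrightarrow>
    \<bar>(sq \<epsilon> (x + \<epsilon> *\<^sub>R w) u v (\<lambda>y. K y * \<tau> y - Q y) - sq \<epsilon> x u v (\<lambda>y. K y * \<tau> y - Q y))
      - \<tau> x * (sq \<epsilon> (x + \<epsilon> *\<^sub>R w) u v K - sq \<epsilon> x u v K) - \<epsilon> * \<epsilon>\<^sup>2 * (K x * \<tau>' x w - Q' x w)\<bar> \<le> \<mu> * \<epsilon> * \<epsilon>\<^sup>2"
proof -
  let ?C = "cball p \<rho>"
  have lin\<tau>: "linear (\<tau>' x)" and linQ: "linear (Q' x)" if "x \<in> ?C" for x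
    using d\<tau> dQ has_derivative_linear that by blast+
  have "\<exists>L>0. \<forall>z\<in>?C. \<forall>v. norm (\<tau>' z v) \<le> L * norm v"
    by (rule operator_family_bounds(1)[OF compact_cball lin\<tau> c\<tau>])
  then obtain L where L: "L > 0" "\<And>z v. z \<in> ?C \<Longrightarrow> norm (\<tau>' z v) \<le> L * norm v" by blast
  have "bounded (K ` ?C)" using contK by (simp add: compact_continuous_image compact_imp_bounded)
  then obtain M where M: "M > 0" "\<And>z. z \<in> ?C \<Longrightarrow> \<bar>K z\<bar> \<le> M" unfolding bounded_pos by auto
  \<comment> \<open>Chosen for the final sum: two terms \<open>3 * L\<close> from the oscillation of
    \<open>K\<close> against that of \<tau>, one term \<open>M\<close> from \<tau>, and one term 1
    from \<open>Q\<close>.\<close>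
  define \<kappa> where "\<kappa> = \<mu> / (6 * L + M + 1)"
  have kap: "\<kappa> > 0" using \<mu> L M by (simp add: \<kappa>_def)
  obtain d1 where d1: "d1 > 0" "\<And>x y. x \<in> ?C \<Longrightarrow> y \<in> ?C \<Longrightarrow> dist x y < d1 \<Longrightarrow> \<bar>K x - K y\<bar> < \<kappa>"
    using compact_uniformly_continuous[OF contK compact_cball] kap unfolding uniformly_continuous_on_def dist_real_def
    by metis
  have "\<exists>d>0. \<forall>x\<in>?C. \<forall>y\<in>?C. dist x y < d \<longrightarrow> (\<forall>v. norm (\<tau>' x v - \<tau>' y v) \<le> \<kappa> * norm v)"
    by (rule operator_family_bounds(2)[OF compact_cball lin\<tau> c\<tau> kap])
  then obtain d2 where d2: "d2 > 0" "\<And>x y v. x \<in> ?C \<Longrightarrow> y \<in> ?C \<Longrightarrow> dist x y < d2 \<Longrightarrow> norm (\<tau>' x v - \<tau>' y v) \<le> \<kappa> * norm v" by blast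
  have "\<exists>d>0. \<forall>x\<in>?C. \<forall>y\<in>?C. dist x y < d \<longrightarrow> (\<forall>v. norm (Q' x v - Q' y v) \<le> \<kappa> * norm v)"
    by (rule operator_family_bounds(2)[OF compact_cball linQ cQ kap])
  then obtain d3 where d3: "d3 > 0" "\<And>x y v. x \<in> ?C \<Longrightarrow> y \<in> ?C \<Longrightarrow> dist x y < d3 \<Longrightarrow> norm (Q' x v - Q' y v) \<le> \<kappa> * norm v" by blast
  \<comment> \<open>All points that occur, including the shifted ones, lie within 3 \<epsilon> of
    \<open>x\<close>; the divisor 4 leaves strict inequalities.\<close>
  define \<delta> where "\<delta> = min (\<rho>/2) (min d1 (min d2 d3)) / 4"
  have del: "\<delta> > 0" using \<rho> d1 d2 d3 by (simp add: \<delta>_def)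
  have del': "4 * \<delta> \<le> \<rho>/2" "4 * \<delta> \<le> d1" "4 * \<delta> \<le> d2" "4 * \<delta> \<le> d3" by (simp_all add: \<delta>_def min_le_iff_disj)
  have incr: "\<bar>f (y + \<epsilon> *\<^sub>R w) - f y - \<epsilon> * f' x w\<bar> \<le> \<kappa> * \<epsilon>"
    if df: "\<And>x. x \<in> ?C \<Longrightarrow> (f has_derivative f' x) (at x)"
      and near: "\<And>z. z \<in> closed_segment y (y + \<epsilon> *\<^sub>R w) \<Longrightarrow> z \<in> ?C \<and> norm (f' z w - f' x w) \<le> \<kappa> * norm w"
      and e: "0 < \<epsilon>" for f f' x y \<epsilon>
  proof -
    have "norm ((\<lambda>t. f (y + t *\<^sub>R w) - t * f' x w) \<epsilon> - (\<lambda>t. f (y + t *\<^sub>R w) - t * f' x w) 0) \<le> \<kappa> * \<epsilon>"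
    proof (rule vector_derivative_norm_bound[where T=\<epsilon> and z'="\<lambda>t. f' (y + t *\<^sub>R w) w - f' x w"])
      fix t assume t: "t \<in> {0..\<epsilon>}"
      have "y + t *\<^sub>R w = (1 - t/\<epsilon>) *\<^sub>R y + (t/\<epsilon>) *\<^sub>R (y + \<epsilon> *\<^sub>R w)" using e by (simp add: algebra_simps)
      then have "y + t *\<^sub>R w \<in> closed_segment y (y + \<epsilon> *\<^sub>R w)" unfolding in_segment using t e by (intro exI[of _ "t/\<epsilon>"]) auto
      then have n: "y + t *\<^sub>R w \<in> ?C" "norm (f' (y + t *\<^sub>R w) w - f' x w) \<le> \<kappa> * norm w" using near by auto
      then show "norm (f' (y + t *\<^sub>R w) w - f' x w) \<le> \<kappa>" using nrm by simp
      have "((\<lambda>t. f (y + t *\<^sub>R w)) has_derivative (\<lambda>h. f' (y + t *\<^sub>R w) (h *\<^sub>R w))) (at t within {0..\<epsilon>})"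
        by (rule has_derivative_compose[where f="\<lambda>t. y + t *\<^sub>R w" and g=f, OF _ df[OF n(1)]]) (auto intro!: derivative_eq_intros)
      then have "((\<lambda>t. f (y + t *\<^sub>R w)) has_vector_derivative f' (y + t *\<^sub>R w) w) (at t within {0..\<epsilon>})"
        using linear_scale[OF has_derivative_linear[OF df[OF n(1)]], of _ w] by (simp add: has_vector_derivative_def)
      then show "((\<lambda>t. f (y + t *\<^sub>R w) - t * f' x w) has_vector_derivative f' (y + t *\<^sub>R w) w - f' x w) (at t within {0..\<epsilon>})"
        by (intro has_vector_derivative_diff) (auto intro!: derivative_eq_intros has_vector_derivative_mult_left[THEN has_vector_derivative_eq_rhs])
    qed (use e in auto)
    then show ?thesis by (simp add: algebra_simps)
  qed
  have main: "\<bar>(sq \<epsilon> (x + \<epsilon> *\<^sub>R w) u v (\<lambda>y. K y * \<tau> y - Q y) - sq \<epsilon> x u v (\<lambda>y. K y * \<tau> y - Q y))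
      - \<tau> x * (sq \<epsilon> (x + \<epsilon> *\<^sub>R w) u v K - sq \<epsilon> x u v K) - \<epsilon> * \<epsilon>\<^sup>2 * (K x * \<tau>' x w - Q' x w)\<bar> \<le> \<mu> * \<epsilon> * \<epsilon>\<^sup>2"
    if x: "x \<in> cball p (\<rho>/2)" and e: "0 < \<epsilon>" "\<epsilon> < \<delta>" for x \<epsilon>
  proof -
    have near: "dist x z \<le> 3 * \<epsilon> \<Longrightarrow> z \<in> ?C \<and> dist z x < d1 \<and> dist z x < d2 \<and> dist z x < d3" for z
      using dist_triangle[of p z x] x e del' by (auto simp: dist_commute)
    have xC: "x \<in> ?C" using near[of x] e by auto
    let ?S = "cball x (2 * \<epsilon>)"
    have yS: "in_square \<epsilon> x u v ?S"
    proof (intro ballI)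
      fix s t assume "s \<in> {0..\<epsilon>}" "t \<in> {0..\<epsilon>}"
      then have "norm (s *\<^sub>R u + t *\<^sub>R v) \<le> \<epsilon> + \<epsilon>" by (intro norm_triangle_le add_mono) (auto simp: nrm)
      then have "dist (x + s *\<^sub>R u + t *\<^sub>R v) x \<le> 2 * \<epsilon>" by (simp add: dist_norm add.assoc)
      then show "x + s *\<^sub>R u + t *\<^sub>R v \<in> ?S" by (simp add: dist_commute)
    qed
    have S3: "dist x y \<le> 3 * \<epsilon>" "dist x (y + \<epsilon> *\<^sub>R w) \<le> 3 * \<epsilon>" if "y \<in> ?S" for y
    proof -
      show "dist x y \<le> 3 * \<epsilon>" using that e by simp
      have "dist y (y + \<epsilon> *\<^sub>R w) = \<epsilon>" using e nrm by (simp add: dist_norm)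
      then show "dist x (y + \<epsilon> *\<^sub>R w) \<le> 3 * \<epsilon>" using dist_triangle[of x "y + \<epsilon> *\<^sub>R w" y] that by simp
    qed
    have cont\<tau>: "continuous_on ?C \<tau>" and contQ: "continuous_on ?C Q"
      using d\<tau> dQ has_derivative_continuous continuous_at_imp_continuous_on by metis+
    have SC: "?S \<subseteq> ?C" "(\<lambda>y. y + \<epsilon> *\<^sub>R w) ` ?S \<subseteq> ?C" using S3 near by blast+
    let ?h = "\<lambda>y. K y * \<tau> y - Q y"
    have conth: "continuous_on ?C ?h" by (intro continuous_intros contK cont\<tau> contQ)
    have sh: "continuous_on ?S (\<lambda>y. f (y + \<epsilon> *\<^sub>R w))" if "continuous_on ?C f" for f :: "'e \<Rightarrow> real"
      by (rule continuous_on_compose2[OF that]) (use SC in \<open>auto intro!: continuous_intros\<close>)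
    note cS = continuous_on_subset[OF contK SC(1)] continuous_on_subset[OF conth SC(1)] sh[OF contK] sh[OF conth]
    let ?k = "\<epsilon> * (K x * \<tau>' x w - Q' x w)"
    let ?G = "\<lambda>y. ((?h (y + \<epsilon> *\<^sub>R w) - ?h y) - \<tau> x * (K (y + \<epsilon> *\<^sub>R w) - K y)) - ?k"
    have "sq \<epsilon> x u v ?G = (sq \<epsilon> (x + \<epsilon> *\<^sub>R w) u v ?h - sq \<epsilon> x u v ?h)
      - \<tau> x * (sq \<epsilon> (x + \<epsilon> *\<^sub>R w) u v K - sq \<epsilon> x u v K) - ?k * \<epsilon>\<^sup>2"
    proof -
      have "sq \<epsilon> x u v ?G = sq \<epsilon> x u v (\<lambda>y. (?h (y + \<epsilon> *\<^sub>R w) - ?h y) - \<tau> x * (K (y + \<epsilon> *\<^sub>R w) - K y)) - sq \<epsilon> x u v (\<lambda>y. ?k)"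
        by (rule sq_diff[of ?S]) (intro continuous_intros cS yS)+
      also have "sq \<epsilon> x u v (\<lambda>y. (?h (y + \<epsilon> *\<^sub>R w) - ?h y) - \<tau> x * (K (y + \<epsilon> *\<^sub>R w) - K y))
          = sq \<epsilon> x u v (\<lambda>y. ?h (y + \<epsilon> *\<^sub>R w) - ?h y) - sq \<epsilon> x u v (\<lambda>y. \<tau> x * (K (y + \<epsilon> *\<^sub>R w) - K y))"
        by (rule sq_diff[of ?S]) (intro continuous_intros cS yS)+
      also have "sq \<epsilon> x u v (\<lambda>y. ?h (y + \<epsilon> *\<^sub>R w) - ?h y) = sq \<epsilon> x u v (\<lambda>y. ?h (y + \<epsilon> *\<^sub>R w)) - sq \<epsilon> x u v ?h"
        by (rule sq_diff[of ?S, OF cS(4,2) yS])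
      also have "sq \<epsilon> x u v (\<lambda>y. \<tau> x * (K (y + \<epsilon> *\<^sub>R w) - K y)) = \<tau> x * (sq \<epsilon> x u v (\<lambda>y. K (y + \<epsilon> *\<^sub>R w)) - sq \<epsilon> x u v K)"
        unfolding sq_cmult by (simp add: sq_diff[of ?S, OF cS(3,1) yS])
      finally show ?thesis using e by (simp add: sq_const sq_shift)
    qed
    moreover have "\<bar>sq \<epsilon> x u v ?G\<bar> \<le> (\<mu> * \<epsilon>) * \<epsilon>\<^sup>2"
    proof (rule sq_bound[of ?S])
      show "continuous_on ?S ?G" by (intro continuous_intros cS)
      fix s t assume "s \<in> {0..\<epsilon>}" "t \<in> {0..\<epsilon>}"
      then have yS: "x + s *\<^sub>R u + t *\<^sub>R v \<in> ?S" using yS by blast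
      define y where "y = x + s *\<^sub>R u + t *\<^sub>R v"
      define y' where "y' = y + \<epsilon> *\<^sub>R w"
      have y: "y \<in> ?S" using yS by (simp add: y_def)
      note ny = near[OF S3(1)[OF y]] and ny' = near[OF S3(2)[OF y], folded y'_def]
      have lip: "\<bar>\<tau> z - \<tau> x\<bar> \<le> L * (3 * \<epsilon>)" if "dist x z \<le> 3 * \<epsilon>" for z
      proof -
        have "norm (\<tau> z - \<tau> x) \<le> L * norm (z - x)"
        proof (rule differentiable_bound[of ?C \<tau> \<tau>'])
          fix q assume q: "q \<in> ?C"
          show "(\<tau> has_derivative \<tau>' q) (at q within ?C)" by (rule has_derivative_at_withinI[OF d\<tau>[OF q]])
          show "onorm (\<tau>' q) \<le> L" by (rule onorm_le[OF L(2)[OF q]])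
        qed (use near[OF that] xC in auto)
        also have "\<dots> \<le> L * (3 * \<epsilon>)" using that L by (intro mult_left_mono) (auto simp: dist_norm norm_minus_commute)
        finally show ?thesis by simp
      qed
      have seg: "dist x z \<le> 3 * \<epsilon>" if "z \<in> closed_segment y (y + \<epsilon> *\<^sub>R w)" for z
      proof -
        have "closed_segment y (y + \<epsilon> *\<^sub>R w) \<subseteq> cball x (3 * \<epsilon>)"
          by (rule closed_segment_subset) (use S3[OF y] in auto)
        then show ?thesis using that by auto
      qed
      have i1: "\<bar>\<tau> y' - \<tau> y - \<epsilon> * \<tau>' x w\<bar> \<le> \<kappa> * \<epsilon>" unfolding y'_def
        by (rule incr[OF d\<tau> _ e(1)]) (use near[OF seg] d2(2)[OF _ xC, of _ w] in blast)+
      have i2: "\<bar>Q y' - Q y - \<epsilon> * Q' x w\<bar> \<le> \<kappa> * \<epsilon>" unfolding y'_def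
        by (rule incr[OF dQ _ e(1)]) (use near[OF seg] d3(2)[OF _ xC, of _ w] in blast)+
      have "\<bar>?G y\<bar> = \<bar>(K y' - K x) * (\<tau> y' - \<tau> x) - (K y - K x) * (\<tau> y - \<tau> x)
          + K x * (\<tau> y' - \<tau> y - \<epsilon> * \<tau>' x w) - (Q y' - Q y - \<epsilon> * Q' x w)\<bar>"
        unfolding y'_def by (simp add: algebra_simps)
      also have "\<dots> \<le> \<kappa> * (L * (3 * \<epsilon>)) + \<kappa> * (L * (3 * \<epsilon>)) + M * (\<kappa> * \<epsilon>) + \<kappa> * \<epsilon>"
      proof -
        have "\<bar>(K y' - K x) * (\<tau> y' - \<tau> x)\<bar> \<le> \<kappa> * (L * (3 * \<epsilon>))"
          unfolding abs_mult using d1(2)[of y' x] ny' xC kap lip[of y'] S3(2)[OF y] y'_def by (intro mult_mono) auto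
        moreover have "\<bar>(K y - K x) * (\<tau> y - \<tau> x)\<bar> \<le> \<kappa> * (L * (3 * \<epsilon>))"
          unfolding abs_mult using d1(2)[of y x] ny xC kap lip[of y] S3(1)[OF y] by (intro mult_mono) auto
        moreover have "\<bar>K x * (\<tau> y' - \<tau> y - \<epsilon> * \<tau>' x w)\<bar> \<le> M * (\<kappa> * \<epsilon>)"
          unfolding abs_mult using M(2)[OF xC] i1 M(1) by (intro mult_mono) auto
        ultimately show ?thesis using i2 by linarith
      qed
      also have "\<dots> = (\<kappa> * (6 * L + M + 1)) * \<epsilon>" by (simp add: algebra_simps)
      also have "\<kappa> * (6 * L + M + 1) = \<mu>" using L M by (simp add: \<kappa>_def)
      finally show "\<bar>?G (x + s *\<^sub>R u + t *\<^sub>R v)\<bar> \<le> \<mu> * \<epsilon>" by (simp only: y_def)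
    qed (use yS e in auto)
    ultimately show ?thesis by (simp add: algebra_simps)
  qed
  then show ?thesis using del by blast
qed

section \<open>The curvature factor is locally constant\<close>

context local_metric
begin

text \<open>\<open>K\<close> is the sectional curvature of one coordinate plane, a quotient of
  continuous functions whose denominator is a nonzero Gram determinant.\<close>

lemma curvature_factor_continuous:
  assumes dim: "DIM('e) \<ge> 3"
    and R: "\<And>x u v w. x \<in> U \<Longrightarrow> Rm x u v w = K x *\<^sub>R (g x v w *\<^sub>R u - g x u w *\<^sub>R v)"
  shows "continuous_on U K"
proof -
  have "card (Basis :: 'e set) \<ge> 2" using dim by simp
  then obtain a b :: 'e where ab: "a \<in> Basis" "b \<in> Basis" "a \<noteq> b"
    by (metis card_2_iff' ex_card subset_eq)
  let ?d = "\<lambda>x. g x b b * g x a a - g x a b * g x b a"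
  have nz: "?d x \<noteq> 0" if x: "x \<in> U" for x
  proof
    assume d: "?d x = 0"
    let ?z = "g x b b *\<^sub>R a - g x a b *\<^sub>R b"
    have "g x ?z ?z = g x b b * ?d x"
      using g_sym[OF x, of a b] by (simp add: g_diff[OF x] g_scale[OF x] algebra_simps)
    then have "?z = 0" using d g_zero_iff[OF x] by simp
    then have "?z \<bullet> a = 0" by simp
    then have "g x b b = 0" using ab by (simp add: inner_diff_left inner_not_same_Basis)
    then show False using g_zero_iff[OF x, of b] ab nonzero_Basis by blast
  qed
  have "K x = g x (Rm x a b b) a / ?d x" if x: "x \<in> U" for x
  proof -
    have "g x (Rm x a b b) a = K x * ?d x" by (simp add: R[OF x] g_diff[OF x] g_scale[OF x])
    then show ?thesis using nz[OF x] by simp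
  qed
  moreover have "continuous_on U (\<lambda>x. g x (Rm x a b b) a / ?d x)"
    by (intro continuous_intros continuous_on_g continuous_on_Rm) (use nz in auto)
  ultimately show ?thesis by (simp cong: continuous_on_cong)
qed

text \<open>Both sides of the curvature identity satisfy the same differential Bianchi relation, up to the derivative of \<open>K\<close>.\<close>

lemma bianchi_quadratic_terms:
  assumes x: "x \<in> U" and R: "\<And>u v w. Rm x u v w = k *\<^sub>R (g x v w *\<^sub>R u - g x u w *\<^sub>R v)"
  defines "Q' \<equiv> \<lambda>u v h z. D\<Gamma> x h u (\<Gamma> x v z) + \<Gamma> x u (D\<Gamma> x h v z) - D\<Gamma> x h v (\<Gamma> x u z) - \<Gamma> x v (D\<Gamma> x h u z)"
    and "T' \<equiv> \<lambda>u v h z. (g x (\<Gamma> x h v) z + g x v (\<Gamma> x h z)) *\<^sub>R u - (g x (\<Gamma> x h u) z + g x u (\<Gamma> x h z)) *\<^sub>R v"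
  shows "Q' a b c z + Q' b c a z + Q' c a b z = k *\<^sub>R (T' a b c z + T' b c a z + T' c a b z)"
proof -
  define Om where "Om u v w = k *\<^sub>R (g x v w *\<^sub>R u - g x u w *\<^sub>R v)" for u v w
  have D: "D\<Gamma> x u v w - D\<Gamma> x v u w = Om u v w - \<Gamma> x u (\<Gamma> x v w) + \<Gamma> x v (\<Gamma> x u w)" for u v w
    using R[of u v w] by (simp add: Rm_def Om_def algebra_simps)
  note \<Gamma>s = \<Gamma>_add[OF x] \<Gamma>_diff[OF x] \<Gamma>_scale[OF x]
  have "Q' a b c z + Q' b c a z + Q' c a b z =
      (D\<Gamma> x c a (\<Gamma> x b z) - D\<Gamma> x a c (\<Gamma> x b z)) + (D\<Gamma> x a b (\<Gamma> x c z) - D\<Gamma> x b a (\<Gamma> x c z)) + (D\<Gamma> x b c (\<Gamma> x a z) - D\<Gamma> x c b (\<Gamma> x a z))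
      - \<Gamma> x b (D\<Gamma> x c a z - D\<Gamma> x a c z) - \<Gamma> x c (D\<Gamma> x a b z - D\<Gamma> x b a z) - \<Gamma> x a (D\<Gamma> x b c z - D\<Gamma> x c b z)"
    unfolding Q'_def by (simp add: \<Gamma>s)
  also have "\<dots> = Om c a (\<Gamma> x b z) + Om a b (\<Gamma> x c z) + Om b c (\<Gamma> x a z) - \<Gamma> x b (Om c a z) - \<Gamma> x c (Om a b z) - \<Gamma> x a (Om b c z)"
    unfolding D by (simp add: \<Gamma>s)
  also have "\<dots> = k *\<^sub>R (T' a b c z + T' b c a z + T' c a b z)"
    unfolding Om_def T'_def
    using \<Gamma>_sym[OF x, of b a] \<Gamma>_sym[OF x, of c a] \<Gamma>_sym[OF x, of c b]
    by (simp add: \<Gamma>s algebra_simps)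
  finally show ?thesis .
qed

end

lemma sq_cong:
  assumes "in_square \<epsilon> y u v C" "\<And>x. x \<in> C \<Longrightarrow> f x = h x"
  shows "sq \<epsilon> y u v f = sq \<epsilon> y u v h"
  unfolding sq_def by (rule integral_cong) (use assms in auto)

context local_metric
begin

text \<open>The 1-form is \<gamma> w = \<langle>\<Gamma> w z, a\<rangle>, with a fixed component in
  direction \<open>a\<close>. By the hypothesis on \<open>Rm\<close> its exterior derivative is
  \<open>K * \<tau> - Q\<close>, where \<open>Q\<close> collects the terms quadratic in \<Gamma>.
  Its boundary integral over a cube vanishes, and so does the sum of the derivative terms; what
  remains are the weighted increments of \<open>K\<close>.\<close>

lemma curvature_factor_increment_weighted:
  fixes a b c z p :: 'e
  assumes \<rho>: "\<rho> > 0" "cball p \<rho> \<subseteq> U" and dim: "DIM('e) \<ge> 3"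
    and R: "\<And>x u v w. x \<in> U \<Longrightarrow> Rm x u v w = K x *\<^sub>R (g x v w *\<^sub>R u - g x u w *\<^sub>R v)"
    and abc: "norm a = 1" "norm b = 1" "norm c = 1" and \<mu>: "\<mu> > 0"
  defines "\<tau> \<equiv> \<lambda>u v x. (g x v z *\<^sub>R u - g x u z *\<^sub>R v) \<bullet> a"
    and "D \<equiv> \<lambda>\<epsilon> x u v w. sq \<epsilon> (x + \<epsilon> *\<^sub>R w) u v K - sq \<epsilon> x u v K"
  shows "\<exists>\<delta>>0. \<forall>x\<in>cball p (\<rho>/2). \<forall>\<epsilon>. 0 < \<epsilon> \<longrightarrow> \<epsilon> < \<delta> \<longrightarrow>
     \<bar>\<tau> a b x * D \<epsilon> x a b c + \<tau> b c x * D \<epsilon> x b c a + \<tau> c a x * D \<epsilon> x c a b\<bar> \<le> \<mu> * \<epsilon> * \<epsilon>\<^sup>2"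
proof -
  let ?C = "cball p \<rho>"
  define Q where "Q u v x = (\<Gamma> x u (\<Gamma> x v z) - \<Gamma> x v (\<Gamma> x u z)) \<bullet> a" for u v x
  define Q' where "Q' u v x h = (D\<Gamma> x h u (\<Gamma> x v z) + \<Gamma> x u (D\<Gamma> x h v z) - D\<Gamma> x h v (\<Gamma> x u z) - \<Gamma> x v (D\<Gamma> x h u z)) \<bullet> a" for u v x h
  define \<tau>' where "\<tau>' u v x h = ((g x (\<Gamma> x h v) z + g x v (\<Gamma> x h z)) *\<^sub>R u - (g x (\<Gamma> x h u) z + g x u (\<Gamma> x h z)) *\<^sub>R v) \<bullet> a" for u v x h
  define \<gamma> where "\<gamma> w x = \<Gamma> x w z \<bullet> a" for w x
  define \<gamma>' where "\<gamma>' w x h = D\<Gamma> x h w z \<bullet> a" for w x h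
  have inU: "x \<in> U" if "x \<in> ?C" for x using that \<rho> by blast
  have contK: "continuous_on ?C K" by (rule continuous_on_subset[OF curvature_factor_continuous[OF dim R] \<rho>(2)])
  have d\<tau>: "(\<tau> u v has_derivative \<tau>' u v x) (at x)" if "x \<in> ?C" for u v x
    unfolding \<tau>_def \<tau>'_def
    by (intro has_derivative_inner_left has_derivative_diff has_derivative_scaleR_left dg inU that)
  have c\<tau>: "continuous_on ?C (\<lambda>x. \<tau>' u v x h)" for u v h
    unfolding \<tau>'_def by (intro continuous_intros continuous_on_g continuous_on_\<Gamma> inU)
  have dGG: "((\<lambda>x. \<Gamma> x u (\<Gamma> x v z)) has_derivative (\<lambda>h. D\<Gamma> x h u (\<Gamma> x v z) + \<Gamma> x u (D\<Gamma> x h v z))) (at x)" if "x \<in> ?C" for u v x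
    using has_derivative_\<Gamma>[OF _ has_derivative_ident has_derivative_const[of u] d\<Gamma>[OF inU[OF that], of v z]] inU[OF that]
    by (simp add: \<Gamma>_zero)
  have dQ: "(Q u v has_derivative Q' u v x) (at x)" if "x \<in> ?C" for u v x
    using has_derivative_inner_left[OF has_derivative_diff[OF dGG[OF that, of u v] dGG[OF that, of v u]], of a]
    unfolding Q_def[abs_def] Q'_def[abs_def] by (simp add: algebra_simps)
  have cQ: "continuous_on ?C (\<lambda>x. Q' u v x h)" for u v h
    unfolding Q'_def by (intro continuous_intros continuous_on_\<Gamma> continuous_on_D\<Gamma> inU)
  have "\<mu> / 3 > 0" using \<mu> by simp
  note est = square_increment_estimate[OF \<rho>(1) _ _ _ contK d\<tau> c\<tau> dQ cQ this]
  obtain d1 where d1: "d1 > 0" "\<And>x \<epsilon>. x \<in> cball p (\<rho>/2) \<Longrightarrow> 0 < \<epsilon> \<Longrightarrow> \<epsilon> < d1 \<Longrightarrow>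
     \<bar>(sq \<epsilon> (x + \<epsilon> *\<^sub>R c) a b (\<lambda>y. K y * \<tau> a b y - Q a b y) - sq \<epsilon> x a b (\<lambda>y. K y * \<tau> a b y - Q a b y))
      - \<tau> a b x * (sq \<epsilon> (x + \<epsilon> *\<^sub>R c) a b K - sq \<epsilon> x a b K) - \<epsilon> * \<epsilon>\<^sup>2 * (K x * \<tau>' a b x c - Q' a b x c)\<bar> \<le> \<mu> / 3 * \<epsilon> * \<epsilon>\<^sup>2"
    using est[OF abc(1,2,3), of a b a b] by blast
  obtain d2 where d2: "d2 > 0" "\<And>x \<epsilon>. x \<in> cball p (\<rho>/2) \<Longrightarrow> 0 < \<epsilon> \<Longrightarrow> \<epsilon> < d2 \<Longrightarrow>
     \<bar>(sq \<epsilon> (x + \<epsilon> *\<^sub>R a) b c (\<lambda>y. K y * \<tau> b c y - Q b c y) - sq \<epsilon> x b c (\<lambda>y. K y * \<tau> b c y - Q b c y))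
      - \<tau> b c x * (sq \<epsilon> (x + \<epsilon> *\<^sub>R a) b c K - sq \<epsilon> x b c K) - \<epsilon> * \<epsilon>\<^sup>2 * (K x * \<tau>' b c x a - Q' b c x a)\<bar> \<le> \<mu> / 3 * \<epsilon> * \<epsilon>\<^sup>2"
    using est[OF abc(2,3,1), of b c b c] by blast
  obtain d3 where d3: "d3 > 0" "\<And>x \<epsilon>. x \<in> cball p (\<rho>/2) \<Longrightarrow> 0 < \<epsilon> \<Longrightarrow> \<epsilon> < d3 \<Longrightarrow>
     \<bar>(sq \<epsilon> (x + \<epsilon> *\<^sub>R b) c a (\<lambda>y. K y * \<tau> c a y - Q c a y) - sq \<epsilon> x c a (\<lambda>y. K y * \<tau> c a y - Q c a y))
      - \<tau> c a x * (sq \<epsilon> (x + \<epsilon> *\<^sub>R b) c a K - sq \<epsilon> x c a K) - \<epsilon> * \<epsilon>\<^sup>2 * (K x * \<tau>' c a x b - Q' c a x b)\<bar> \<le> \<mu> / 3 * \<epsilon> * \<epsilon>\<^sup>2"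
    using est[OF abc(3,1,2), of c a c a] by blast
  define \<delta> where "\<delta> = min (\<rho>/6) (min d1 (min d2 d3))"
  have del: "\<delta> > 0" "\<delta> \<le> \<rho>/6" "\<delta> \<le> d1" "\<delta> \<le> d2" "\<delta> \<le> d3"
    using \<rho> d1 d2 d3 by (simp_all add: \<delta>_def min_le_iff_disj)
  show ?thesis
  proof (intro exI[of _ \<delta>] conjI ballI allI impI del(1))
    fix x \<epsilon> assume x: "x \<in> cball p (\<rho>/2)" and e: "0 < \<epsilon>" "\<epsilon> < \<delta>"
    have xC: "x \<in> ?C" using x \<rho> by auto
    have cube: "x + r *\<^sub>R a + s *\<^sub>R b + t *\<^sub>R c \<in> ?C" if "r \<in> {0..\<epsilon>}" "s \<in> {0..\<epsilon>}" "t \<in> {0..\<epsilon>}" for r s t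
    proof -
      have "norm (r *\<^sub>R a + s *\<^sub>R b + t *\<^sub>R c) \<le> \<epsilon> + \<epsilon> + \<epsilon>"
        by (intro norm_triangle_le add_mono) (use that abc in auto)
      then have "dist (x + r *\<^sub>R a + s *\<^sub>R b + t *\<^sub>R c) x \<le> \<rho>/2" using e del by (simp add: dist_norm add.assoc)
      then show ?thesis using x dist_triangle[of p "x + r *\<^sub>R a + s *\<^sub>R b + t *\<^sub>R c" x] by (simp add: dist_commute)
    qed
    have z: "(0::real) \<in> {0..\<epsilon>}" "\<epsilon> \<in> {0..\<epsilon>}" using e by auto
    have W: "sq \<epsilon> y u v (\<lambda>x. \<gamma>' v x u - \<gamma>' u x v) = sq \<epsilon> y u v (\<lambda>y. K y * \<tau> u v y - Q u v y)" if "in_square \<epsilon> y u v ?C" for y u v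
    proof (rule sq_cong[OF that])
      fix x assume "x \<in> ?C"
      then have "Rm x u v z \<bullet> a = K x * \<tau> u v x" by (simp add: R inU \<tau>_def)
      then show "\<gamma>' v x u - \<gamma>' u x v = K x * \<tau> u v x - Q u v x"
        by (simp add: Rm_def \<gamma>'_def Q_def inner_add_left inner_diff_left)
    qed
    have bd: "(sq \<epsilon> (x + \<epsilon> *\<^sub>R c) a b (\<lambda>x. \<gamma>' b x a - \<gamma>' a x b) - sq \<epsilon> x a b (\<lambda>x. \<gamma>' b x a - \<gamma>' a x b))
      + (sq \<epsilon> (x + \<epsilon> *\<^sub>R a) b c (\<lambda>x. \<gamma>' c x b - \<gamma>' b x c) - sq \<epsilon> x b c (\<lambda>x. \<gamma>' c x b - \<gamma>' b x c))
      + (sq \<epsilon> (x + \<epsilon> *\<^sub>R b) c a (\<lambda>x. \<gamma>' a x c - \<gamma>' c x a) - sq \<epsilon> x c a (\<lambda>x. \<gamma>' a x c - \<gamma>' c x a)) = 0"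
    proof (rule closed_boundary_integral[of \<epsilon> x a b c ?C \<gamma> \<gamma>', OF _ cube])
      show "(\<gamma> w has_derivative \<gamma>' w x) (at x)" if "x \<in> ?C" for w x
        unfolding \<gamma>_def[abs_def] \<gamma>'_def[abs_def] by (intro has_derivative_inner_left d\<Gamma> inU that)
      show "continuous_on ?C (\<lambda>x. \<gamma>' w x v)" for w v
        unfolding \<gamma>'_def by (intro continuous_intros continuous_on_D\<Gamma> inU)
    qed (use e in auto)
    have c4: "in_square \<epsilon> (x + \<epsilon> *\<^sub>R c) a b ?C" "in_square \<epsilon> x a b ?C" "in_square \<epsilon> (x + \<epsilon> *\<^sub>R a) b c ?C"
      "in_square \<epsilon> x b c ?C" and c6: "in_square \<epsilon> (x + \<epsilon> *\<^sub>R b) a c ?C" "in_square \<epsilon> x a c ?C"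
    proof -
      show "in_square \<epsilon> (x + \<epsilon> *\<^sub>R c) a b ?C" using cube[OF _ _ z(2)] by (simp only: add.assoc add.left_commute add.commute) (simp add: add.commute add.left_commute)
      show "in_square \<epsilon> x a b ?C" using cube[OF _ _ z(1)] by simp
      show "in_square \<epsilon> (x + \<epsilon> *\<^sub>R a) b c ?C" using cube[OF z(2)] by simp
      show "in_square \<epsilon> x b c ?C" using cube[OF z(1)] by simp
      show "in_square \<epsilon> (x + \<epsilon> *\<^sub>R b) a c ?C" using cube[OF _ z(2)] by (simp only: add.assoc add.left_commute add.commute) (simp add: add.commute add.left_commute)
      show "in_square \<epsilon> x a c ?C" using cube[OF _ z(1)] by simp
    qed
    note c2 = in_square_swap[OF c6(1)] in_square_swap[OF c6(2)]
    \<comment> \<open>The three derivative terms of size \<epsilon>^3 cancel exactly, so only the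
      error terms bound the increments.\<close>
    have quad: "(K x * \<tau>' a b x c - Q' a b x c) + (K x * \<tau>' b c x a - Q' b c x a) + (K x * \<tau>' c a x b - Q' c a x b) = 0"
      using arg_cong[OF bianchi_quadratic_terms[OF inU[OF xC] R[OF inU[OF xC]], of a b c z], of "\<lambda>w. w \<bullet> a"]
      by (simp add: Q'_def \<tau>'_def inner_add_left algebra_simps)
    then have "\<epsilon> * \<epsilon>\<^sup>2 * (K x * \<tau>' a b x c - Q' a b x c) + \<epsilon> * \<epsilon>\<^sup>2 * (K x * \<tau>' b c x a - Q' b c x a) + \<epsilon> * \<epsilon>\<^sup>2 * (K x * \<tau>' c a x b - Q' c a x b) = 0"
      by (metis distrib_left mult_zero_right)
    then have "\<bar>\<tau> a b x * D \<epsilon> x a b c + \<tau> b c x * D \<epsilon> x b c a + \<tau> c a x * D \<epsilon> x c a b\<bar> \<le> 3 * (\<mu> / 3 * \<epsilon> * \<epsilon>\<^sup>2)"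
      using d1(2)[OF x e(1)] d2(2)[OF x e(1)] d3(2)[OF x e(1)] e(2) del(3,4,5) bd
      unfolding W[OF c4(1)] W[OF c4(2)] W[OF c4(3)] W[OF c4(4)] W[OF c2(1)] W[OF c2(2)] D_def
      by linarith
    then show "\<bar>\<tau> a b x * D \<epsilon> x a b c + \<tau> b c x * D \<epsilon> x b c a + \<tau> c a x * D \<epsilon> x c a b\<bar> \<le> \<mu> * \<epsilon> * \<epsilon>\<^sup>2" by simp
  qed
qed

text \<open>If \<open>z\<close> is dual to \<open>b\<close> with respect to \<open>g x\<close>, the
  weights of the three pairs of faces are 1, 0, 0 and a single increment is isolated. Such a
  \<open>z\<close> varies with \<open>x\<close>, whereas the weighted estimate holds for fixed
  \<open>z\<close>; it is therefore used for the basis vectors and combined linearly.\<close>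

lemma curvature_factor_increment:
  fixes a b c p :: 'e
  assumes \<rho>: "\<rho> > 0" "cball p \<rho> \<subseteq> U" and dim: "DIM('e) \<ge> 3"
    and R: "\<And>x u v w. x \<in> U \<Longrightarrow> Rm x u v w = K x *\<^sub>R (g x v w *\<^sub>R u - g x u w *\<^sub>R v)"
    and abc: "a \<in> Basis" "b \<in> Basis" "c \<in> Basis" "a \<noteq> b" "a \<noteq> c" "b \<noteq> c" and \<mu>: "\<mu> > 0"
  shows "\<exists>\<delta>>0. \<forall>x\<in>cball p (\<rho>/2). \<forall>\<epsilon>. 0 < \<epsilon> \<longrightarrow> \<epsilon> < \<delta> \<longrightarrow>
     \<bar>sq \<epsilon> (x + \<epsilon> *\<^sub>R c) a b K - sq \<epsilon> x a b K\<bar> \<le> \<mu> * \<epsilon> * \<epsilon>\<^sup>2"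
proof -
  let ?C = "cball p \<rho>"
  define D where "D \<epsilon> x u v w = sq \<epsilon> (x + \<epsilon> *\<^sub>R w) u v K - sq \<epsilon> x u v K" for \<epsilon> x u v w
  define \<tau> where "\<tau> z u v x = (g x v z *\<^sub>R u - g x u z *\<^sub>R v) \<bullet> a" for z u v x
  have "continuous_on (?C \<times> sphere 0 1) (\<lambda>q. g (fst q) (snd q) (snd q))"
    by (intro continuous_on_g continuous_intros) (use \<rho> in auto)
  from continuous_attains_inf[OF compact_Times[OF compact_cball compact_sphere] _ this]
  obtain q where q: "q \<in> ?C \<times> sphere 0 1"
    "\<And>w. w \<in> ?C \<times> sphere 0 1 \<Longrightarrow> g (fst q) (snd q) (snd q) \<le> g (fst w) (snd w) (snd w)"
    using \<rho> by (auto simp: less_imp_le)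
  \<comment> \<open>A lower bound of the metric on the whole compact ball; it bounds the dual
    vectors \<open>z\<close> by \<open>1 / l\<close> independently of \<open>x\<close>.\<close>
  define l where "l = g (fst q) (snd q) (snd q)"
  have l: "l > 0" unfolding l_def by (rule g_pos) (use q \<rho> in auto)
  have low: "l * (norm v)\<^sup>2 \<le> g x v v" if x: "x \<in> ?C" for x v
  proof (cases "v = 0")
    case False
    have "l \<le> g x ((1 / norm v) *\<^sub>R v) ((1 / norm v) *\<^sub>R v)"
      unfolding l_def using q(2)[of "(x, (1 / norm v) *\<^sub>R v)"] False x by simp
    also have "\<dots> = g x v v / (norm v)\<^sup>2" using x \<rho> by (simp add: g_scale subset_eq power2_eq_square)
    finally show ?thesis using False by (simp add: field_simps)
  qed (use x \<rho> in \<open>simp add: g_zero subset_eq\<close>)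
  \<comment> \<open>The combination has \<open>DIM('e)\<close> summands with coefficients of size at
    most \<open>norm z\<close>, and \<open>l * norm z\<close> is at most 1.\<close>
  define \<nu> where "\<nu> = \<mu> * l / DIM('e)"
  have nu: "\<nu> > 0" using \<mu> l by (simp add: \<nu>_def)
  have "\<forall>z\<in>Basis. \<exists>\<delta>. \<delta> > 0 \<and> (\<forall>x\<in>cball p (\<rho>/2). \<forall>\<epsilon>. 0 < \<epsilon> \<longrightarrow> \<epsilon> < \<delta> \<longrightarrow>
     \<bar>\<tau> z a b x * D \<epsilon> x a b c + \<tau> z b c x * D \<epsilon> x b c a + \<tau> z c a x * D \<epsilon> x c a b\<bar> \<le> \<nu> * \<epsilon> * \<epsilon>\<^sup>2)"
    unfolding \<tau>_def D_def using curvature_factor_increment_weighted[OF \<rho> dim R _ _ _ nu] abc(1-3) norm_Basis by blast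
  from bchoice[OF this] obtain d where d: "\<And>z. z \<in> Basis \<Longrightarrow> d z > 0" "\<And>z x \<epsilon>. z \<in> Basis \<Longrightarrow> x \<in> cball p (\<rho>/2) \<Longrightarrow> 0 < \<epsilon> \<Longrightarrow> \<epsilon> < d z \<Longrightarrow>
     \<bar>\<tau> z a b x * D \<epsilon> x a b c + \<tau> z b c x * D \<epsilon> x b c a + \<tau> z c a x * D \<epsilon> x c a b\<bar> \<le> \<nu> * \<epsilon> * \<epsilon>\<^sup>2"
    by blast
  define \<delta> where "\<delta> = Min (d ` Basis)"
  have del: "\<delta> > 0" "\<And>z. z \<in> Basis \<Longrightarrow> \<delta> \<le> d z" unfolding \<delta>_def using d(1) by (auto simp: Min_gr_iff)
  show ?thesis
  proof (intro exI[of _ \<delta>] conjI ballI allI impI del(1))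
    fix x \<epsilon> assume x: "x \<in> cball p (\<rho>/2)" and e: "0 < \<epsilon>" "\<epsilon> < \<delta>"
    have xC: "x \<in> ?C" and xU: "x \<in> U" using x \<rho> by auto
    have "linear (\<lambda>z. \<Sum>i\<in>Basis. g x i z *\<^sub>R i)"
      by (auto intro!: linearI simp: g_add[OF xU] g_scale[OF xU] scaleR_left_distrib sum.distrib scaleR_sum_right)
    moreover have "inj (\<lambda>z. \<Sum>i\<in>Basis. g x i z *\<^sub>R i)"
    proof (rule injI)
      fix z z' :: 'e assume eq: "(\<Sum>i\<in>Basis. g x i z *\<^sub>R i) = (\<Sum>i\<in>Basis. g x i z' *\<^sub>R i)"
      show "z = z'"
      proof (rule g_nondegenerate[OF xU])
        fix w
        show "g x z w = g x z' w"
          using arg_cong[OF eq, of "\<lambda>v. v \<bullet> w"] real_functional_inner[OF g_linear(2)[OF xU, of z], of w] real_functional_inner[OF g_linear(2)[OF xU, of z'], of w]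
            g_sym[OF xU] by metis
      qed
    qed
    ultimately have "surj (\<lambda>z. \<Sum>i\<in>Basis. g x i z *\<^sub>R i)" by (rule linear_injective_imp_surjective[OF _ _ refl])
    then obtain z where "b = (\<Sum>i\<in>Basis. g x i z *\<^sub>R i)" by blast
    then have z: "g x v z = v \<bullet> b" for v
      using real_functional_inner[OF g_linear(2)[OF xU, of z], of v] by (simp add: inner_commute)
    have "l * (norm z)\<^sup>2 \<le> g x z z" by (rule low[OF xC])
    also have "\<dots> \<le> norm z" using z[of z] Cauchy_Schwarz_ineq2[of z b] abc(2) by simp
    finally have nz: "l * norm z \<le> 1" by (cases "z = 0") (auto simp: power2_eq_square)
    \<comment> \<open>With this \<open>z\<close> the weight \<tau> of \<open>u\<close>,
      \<open>v\<close> is the coordinate minor \<open>(v \<bullet> b) * (u \<bullet> a) - (u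
      \<bullet> b) * (v \<bullet> a)\<close>.\<close>
    have t1: "\<tau> z a b x = 1" "\<tau> z b c x = 0" "\<tau> z c a x = 0"
      using abc by (simp_all add: \<tau>_def z inner_Basis inner_diff_left)
    have tl: "\<tau> z u v x = (\<Sum>i\<in>Basis. (z \<bullet> i) * \<tau> i u v x)" for u v
    proof -
      have "linear (\<lambda>z. \<tau> z u v x)"
        by (auto intro!: linearI simp: \<tau>_def g_add[OF xU] g_scale[OF xU] inner_diff_left algebra_simps)
      from linear_Basis_expand[OF this, of z] show ?thesis by simp
    qed
    have "D \<epsilon> x a b c = \<tau> z a b x * D \<epsilon> x a b c + \<tau> z b c x * D \<epsilon> x b c a + \<tau> z c a x * D \<epsilon> x c a b"
      by (simp add: t1)
    also have "\<dots> = (\<Sum>i\<in>Basis. (z \<bullet> i) * (\<tau> i a b x * D \<epsilon> x a b c + \<tau> i b c x * D \<epsilon> x b c a + \<tau> i c a x * D \<epsilon> x c a b))"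
      unfolding tl by (simp add: sum_distrib_right sum_distrib_left sum.distrib algebra_simps)
    finally have "\<bar>D \<epsilon> x a b c\<bar> = \<bar>\<Sum>i\<in>Basis. (z \<bullet> i) * (\<tau> i a b x * D \<epsilon> x a b c + \<tau> i b c x * D \<epsilon> x b c a + \<tau> i c a x * D \<epsilon> x c a b)\<bar>"
      by (rule arg_cong)
    also have "\<dots> \<le> (\<Sum>i\<in>(Basis::'e set). norm z * (\<nu> * \<epsilon> * \<epsilon>\<^sup>2))"
    proof (rule order_trans[OF sum_abs sum_mono])
      fix i :: 'e assume i: "i \<in> Basis"
      show "\<bar>(z \<bullet> i) * (\<tau> i a b x * D \<epsilon> x a b c + \<tau> i b c x * D \<epsilon> x b c a + \<tau> i c a x * D \<epsilon> x c a b)\<bar> \<le> norm z * (\<nu> * \<epsilon> * \<epsilon>\<^sup>2)"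
        unfolding abs_mult[of "z \<bullet> i"]
        by (intro mult_mono d(2)[OF i x e(1)] Basis_le_norm[OF i]) (use e del(2)[OF i] in auto)
    qed
    also have "\<dots> = (real DIM('e) * \<nu>) * (norm z * (\<epsilon> * \<epsilon>\<^sup>2))"
      by (simp only: sum_constant mult.assoc mult.left_commute mult.commute)
    also have "real DIM('e) * \<nu> = \<mu> * l" using DIM_positive[where 'a='e] by (simp add: \<nu>_def del: DIM_positive)
    also have "(\<mu> * l) * (norm z * (\<epsilon> * \<epsilon>\<^sup>2)) = (l * norm z) * (\<mu> * \<epsilon> * \<epsilon>\<^sup>2)"
      by (simp only: mult.assoc mult.left_commute mult.commute)
    also have "\<dots> \<le> 1 * (\<mu> * \<epsilon> * \<epsilon>\<^sup>2)" using nz \<mu> e by (intro mult_right_mono) auto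
    finally show "\<bar>sq \<epsilon> (x + \<epsilon> *\<^sub>R c) a b K - sq \<epsilon> x a b K\<bar> \<le> \<mu> * \<epsilon> * \<epsilon>\<^sup>2" by (simp add: D_def)
  qed
qed

text \<open>A small square in the directions \<open>a\<close>, \<open>b\<close> is pushed along
  \<open>c\<close> in steps of its own side length. The \<open>s / \<epsilon>\<close> increments of
  size \<mu> \<epsilon>^3 add up to \<mu> s \<epsilon>^2, which is small against the area
  \<epsilon>^2. Replacing the two mean values by the values of \<open>K\<close> costs \<mu> each,
  hence the factor \<open>s + 2\<close>.\<close>

lemma schur_axis:
  fixes a b c p :: 'e
  assumes \<rho>: "\<rho> > 0" "cball p \<rho> \<subseteq> U" and dim: "DIM('e) \<ge> 3"
    and R: "\<And>x u v w. x \<in> U \<Longrightarrow> Rm x u v w = K x *\<^sub>R (g x v w *\<^sub>R u - g x u w *\<^sub>R v)"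
    and abc: "a \<in> Basis" "b \<in> Basis" "c \<in> Basis" "a \<noteq> b" "a \<noteq> c" "b \<noteq> c"
    and x: "x \<in> cball p (\<rho>/2)" "x + s *\<^sub>R c \<in> cball p (\<rho>/2)" and s: "s > 0"
  shows "K (x + s *\<^sub>R c) = K x"
proof -
  let ?C = "cball p \<rho>"
  have contK: "continuous_on ?C K" by (rule continuous_on_subset[OF curvature_factor_continuous[OF dim R] \<rho>(2)])
  have "\<bar>K (x + s *\<^sub>R c) - K x\<bar> \<le> \<mu> * (s + 2)" if \<mu>: "\<mu> > 0" for \<mu>
  proof -
    obtain d1 where d1: "d1 > 0" "\<And>x y. x \<in> ?C \<Longrightarrow> y \<in> ?C \<Longrightarrow> dist x y < d1 \<Longrightarrow> \<bar>K x - K y\<bar> < \<mu>"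
      using compact_uniformly_continuous[OF contK compact_cball] \<mu> unfolding uniformly_continuous_on_def dist_real_def
      by metis
    obtain d2 where d2: "d2 > 0" "\<And>x \<epsilon>. x \<in> cball p (\<rho>/2) \<Longrightarrow> 0 < \<epsilon> \<Longrightarrow> \<epsilon> < d2 \<Longrightarrow>
        \<bar>sq \<epsilon> (x + \<epsilon> *\<^sub>R c) a b K - sq \<epsilon> x a b K\<bar> \<le> \<mu> * \<epsilon> * \<epsilon>\<^sup>2"
      using curvature_factor_increment[OF \<rho> dim R abc \<mu>] by blast
    define d where "d = min (\<rho>/6) (min (d1/3) d2)"
    have d: "d > 0" "d \<le> \<rho>/6" "d \<le> d1/3" "d \<le> d2" using \<rho> d1 d2 by (simp_all add: d_def min_le_iff_disj)
    obtain n :: nat where n: "n > s / d" using reals_Archimedean2 by blast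
    have n0: "real n > 0" using n s d by (smt (verit) divide_pos_pos)
    define \<epsilon> where "\<epsilon> = s / n"
    have e: "\<epsilon> > 0" "\<epsilon> < d" "n * \<epsilon> = s" using n n0 s d by (simp_all add: \<epsilon>_def field_simps)
    have pts: "x + (k * \<epsilon>) *\<^sub>R c \<in> cball p (\<rho>/2)" if "k \<le> n" for k :: nat
    proof -
      have "x + (k * \<epsilon>) *\<^sub>R c = (1 - k / n) *\<^sub>R x + (k / n) *\<^sub>R (x + s *\<^sub>R c)"
        using n0 by (simp add: \<epsilon>_def algebra_simps)
      moreover have "\<dots> \<in> cball p (\<rho>/2)"
        using convexD[OF convex_cball x, of "1 - k/n" "k/n"] that n0 by simp
      ultimately show ?thesis by simp
    qed
    have tel: "\<bar>sq \<epsilon> (x + (k * \<epsilon>) *\<^sub>R c) a b K - sq \<epsilon> x a b K\<bar> \<le> k * (\<mu> * \<epsilon> * \<epsilon>\<^sup>2)" if "k \<le> n" for k :: nat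
      using that
    proof (induction k)
      case (Suc k)
      have "\<bar>sq \<epsilon> (x + (k * \<epsilon>) *\<^sub>R c + \<epsilon> *\<^sub>R c) a b K - sq \<epsilon> (x + (k * \<epsilon>) *\<^sub>R c) a b K\<bar> \<le> \<mu> * \<epsilon> * \<epsilon>\<^sup>2"
        by (rule d2(2)[OF pts]) (use Suc e d in auto)
      moreover have "x + (Suc k * \<epsilon>) *\<^sub>R c = x + (k * \<epsilon>) *\<^sub>R c + \<epsilon> *\<^sub>R c" by (simp add: algebra_simps)
      ultimately show ?case using Suc by (simp add: algebra_simps)
    qed simp
    have avg: "\<bar>sq \<epsilon> y a b K - K y * \<epsilon>\<^sup>2\<bar> \<le> \<mu> * \<epsilon>\<^sup>2" if y: "y \<in> cball p (\<rho>/2)" for y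
    proof -
      have near: "y + s *\<^sub>R a + t *\<^sub>R b \<in> ?C \<and> dist (y + s *\<^sub>R a + t *\<^sub>R b) y < d1" if "s \<in> {0..\<epsilon>}" "t \<in> {0..\<epsilon>}" for s t
      proof -
        have "norm (s *\<^sub>R a + t *\<^sub>R b) \<le> \<epsilon> + \<epsilon>"
          by (intro norm_triangle_le add_mono) (use that abc in auto)
        then have "dist (y + s *\<^sub>R a + t *\<^sub>R b) y \<le> 2 * \<epsilon>" by (simp add: dist_norm add.assoc)
        then show ?thesis using y e d d1 \<rho> dist_triangle[of p "y + s *\<^sub>R a + t *\<^sub>R b" y] by (simp add: dist_commute)
      qed
      have S: "in_square \<epsilon> y a b ?C" using near by blast
      have "\<bar>sq \<epsilon> y a b (\<lambda>x. K x - K y)\<bar> \<le> \<mu> * \<epsilon>\<^sup>2"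
      proof (rule sq_bound[OF _ S])
        fix s t assume "s \<in> {0..\<epsilon>}" "t \<in> {0..\<epsilon>}"
        moreover have "y \<in> ?C" using y \<rho> by auto
        ultimately show "\<bar>K (y + s *\<^sub>R a + t *\<^sub>R b) - K y\<bar> \<le> \<mu>" using near d1(2) less_imp_le by blast
      qed (use e contK in \<open>auto intro!: continuous_intros\<close>)
      also have "sq \<epsilon> y a b (\<lambda>x. K x - K y) = sq \<epsilon> y a b K - K y * \<epsilon>\<^sup>2"
        using sq_diff[OF contK continuous_on_const S, of "K y"] e by (simp add: sq_const)
      finally show ?thesis .
    qed
    have "\<bar>sq \<epsilon> (x + s *\<^sub>R c) a b K - sq \<epsilon> x a b K\<bar> \<le> \<mu> * s * \<epsilon>\<^sup>2"
      using tel[of n] by (simp add: e(3)[symmetric] algebra_simps)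
    then have "\<bar>K (x + s *\<^sub>R c) * \<epsilon>\<^sup>2 - K x * \<epsilon>\<^sup>2\<bar> \<le> \<mu> * s * \<epsilon>\<^sup>2 + \<mu> * \<epsilon>\<^sup>2 + \<mu> * \<epsilon>\<^sup>2"
      using avg[OF x(1)] avg[OF x(2)] by linarith
    moreover have "\<bar>K (x + s *\<^sub>R c) - K x\<bar> * \<epsilon>\<^sup>2 = \<bar>K (x + s *\<^sub>R c) * \<epsilon>\<^sup>2 - K x * \<epsilon>\<^sup>2\<bar>"
      by (metis abs_mult abs_of_nonneg left_diff_distrib zero_le_power2)
    ultimately have "\<bar>K (x + s *\<^sub>R c) - K x\<bar> * \<epsilon>\<^sup>2 \<le> (\<mu> * (s + 2)) * \<epsilon>\<^sup>2"
      by (simp add: algebra_simps)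
    then show ?thesis using e by (simp add: mult_le_cancel_right)
  qed
  note est = this
  show ?thesis
  proof (rule ccontr)
    assume ne: "K (x + s *\<^sub>R c) \<noteq> K x"
    define X where "X = \<bar>K (x + s *\<^sub>R c) - K x\<bar>"
    have X: "X > 0" using ne by (simp add: X_def)
    \<comment> \<open>This \<mu> makes the bound half of the positive number
      \<open>X\<close>.\<close>
    have "X \<le> X / (2 * (s + 2)) * (s + 2)" using est[of "X / (2 * (s + 2))"] X s by (simp add: X_def)
    also have "\<dots> = X / 2" using s by (simp add: field_simps)
    finally show False using X by simp
  qed
qed

text \<open>Any point of the smaller ball is reached by changing one coordinate at a time. For each
  coordinate direction \<open>c\<close> the dimension supplies two further directions that span the
  square.\<close>

theorem schur:
  assumes dim: "DIM('e) \<ge> 3" and p: "p \<in> U"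
    and R: "\<And>x u v w. x \<in> U \<Longrightarrow> Rm x u v w = K x *\<^sub>R (g x v w *\<^sub>R u - g x u w *\<^sub>R v)"
  shows "\<exists>\<rho>>0. ball p \<rho> \<subseteq> U \<and> (\<forall>x\<in>ball p \<rho>. K x = K p)"
proof -
  obtain \<rho> where \<rho>: "\<rho> > 0" "cball p \<rho> \<subseteq> U" using open_U p open_contains_cball by blast
  have axis: "K (x + s *\<^sub>R c) = K x" if c: "c \<in> Basis" and x: "x \<in> cball p (\<rho>/2)" "x + s *\<^sub>R c \<in> cball p (\<rho>/2)" for x c s
  proof -
    have "2 \<le> card (Basis - {c} :: 'e set)" using dim c by simp
    then obtain S where "S \<subseteq> Basis - {c}" "card S = 2" by (metis ex_card)
    then obtain a b where "a \<in> Basis" "b \<in> Basis" "a \<noteq> b" "a \<noteq> c" "b \<noteq> c"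
      by (auto simp: card_2_iff)
    note ax = schur_axis[OF \<rho> dim R this(1,2) c this(3,4,5)]
    consider "s > 0" | "s = 0" | "s < 0" by linarith
    then show ?thesis
    proof cases
      case 1 then show ?thesis using ax x by blast
    next
      case 3 then show ?thesis using ax[of "x + s *\<^sub>R c" "-s"] x by simp
    qed simp
  qed
  have "K x = K p" if x: "x \<in> ball p (\<rho>/2)" for x
  proof -
    \<comment> \<open>The partial sums of an orthogonal expansion are no longer than the full sum,
      so the whole path stays in the ball.\<close>
    define q where "q A = p + (\<Sum>i\<in>A. ((x - p) \<bullet> i) *\<^sub>R i)" for A
    have qin: "q A \<in> cball p (\<rho>/2)" if "A \<subseteq> Basis" for A
    proof -
      have fin: "finite A" using that finite_Basis finite_subset by blast
      have "(norm (\<Sum>i\<in>A. ((x - p) \<bullet> i) *\<^sub>R i))\<^sup>2 = (\<Sum>i\<in>A. (norm (((x - p) \<bullet> i) *\<^sub>R i))\<^sup>2)"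
        by (rule norm_sum_Pythagorean[OF fin]) (use that in \<open>auto simp: pairwise_def orthogonal_def inner_Basis subset_eq\<close>)
      also have "\<dots> = (\<Sum>i\<in>A. ((x - p) \<bullet> i)\<^sup>2)" by (rule sum.cong) (use that in auto)
      also have "\<dots> \<le> (\<Sum>i\<in>Basis. ((x - p) \<bullet> i)\<^sup>2)" by (rule sum_mono2) (use that in auto)
      also have "\<dots> = (norm (x - p))\<^sup>2" unfolding power2_norm_eq_inner[of "x - p"] euclidean_inner[of "x - p" "x - p"] by (simp only: power2_eq_square)
      finally have "norm (\<Sum>i\<in>A. ((x - p) \<bullet> i) *\<^sub>R i) \<le> norm (x - p)" by (rule power2_le_imp_le) simp
      then have "dist (q A) p \<le> \<rho>/2" using x by (simp add: q_def dist_norm norm_minus_commute)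
      then show ?thesis by (simp add: dist_commute)
    qed
    have "K (q A) = K p" if "finite A" "A \<subseteq> Basis" for A
      using that
    proof (induction A rule: finite_induct)
      case (insert i A)
      have e: "q (insert i A) = q A + ((x - p) \<bullet> i) *\<^sub>R i"
        unfolding q_def sum.insert[OF insert(1,2)] by (simp only: add.commute add.left_commute)
      have "K (q A + ((x - p) \<bullet> i) *\<^sub>R i) = K (q A)"
        by (rule axis) (use insert qin[of A] qin[OF insert(4)] e in auto)
      moreover have "K (q A) = K p" by (rule insert(3)) (use insert(4) in simp)
      ultimately show ?case unfolding e by simp
    next
      case empty show ?case by (simp add: q_def)
    qed
    from this[OF finite_Basis order_refl] have "K (q Basis) = K p" .
    moreover have "q Basis = x" unfolding q_def euclidean_representation by simp
    ultimately show ?thesis by (simp only:)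
  qed
  moreover have "ball p (\<rho>/2) \<subseteq> U" using \<rho> by auto
  moreover have "\<rho>/2 > 0" using \<rho> by simp
  ultimately show ?thesis by blast
qed

end

section \<open>Change of coordinates\<close>

text \<open>Models a transition map between charts. The second derivative enters the transformation
  of \<Gamma>, and the third, obtained by differentiating that law, enters the transformation of the
  curvature; this is what class C^3 is for.\<close>

locale isometry = A: local_metric U g \<Gamma> D\<Gamma> + B: local_metric U' g' \<Gamma>' D\<Gamma>'
  for U :: "'e::euclidean_space set" and g \<Gamma> D\<Gamma> and U' :: "'e set" and g' \<Gamma>' D\<Gamma>' +
  fixes W :: "'e set" and \<phi> :: "'e \<Rightarrow> 'e" and \<phi>' :: "'e \<Rightarrow> 'e \<Rightarrow> 'e" and \<phi>'' :: "'e \<Rightarrow> 'e \<Rightarrow> 'e \<Rightarrow> 'e"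
    and \<phi>''' :: "'e \<Rightarrow> 'e \<Rightarrow> 'e \<Rightarrow> 'e \<Rightarrow> 'e"
  assumes open_W: "open W" and WU: "W \<subseteq> U" and W_U': "\<phi> ` W \<subseteq> U'"
    and d1: "x \<in> W \<Longrightarrow> (\<phi> has_derivative \<phi>' x) (at x)"
    and d2: "x \<in> W \<Longrightarrow> ((\<lambda>x. \<phi>' x u) has_derivative (\<lambda>h. \<phi>'' x h u)) (at x)"
    and d3: "x \<in> W \<Longrightarrow> ((\<lambda>x. \<phi>'' x v u) has_derivative (\<lambda>h. \<phi>''' x h v u)) (at x)"
    and c3: "continuous_on W (\<lambda>x. \<phi>''' x h v u)"
    and surj: "x \<in> W \<Longrightarrow> surj (\<phi>' x)"
    and isom: "x \<in> W \<Longrightarrow> g x u v = g' (\<phi> x) (\<phi>' x u) (\<phi>' x v)"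
begin

lemma lin1: "x \<in> W \<Longrightarrow> linear (\<phi>' x)"
  using d1 has_derivative_linear by blast

lemma c2: "continuous_on W (\<lambda>x. \<phi>'' x v u)"
  by (rule continuous_at_imp_continuous_on) (use has_derivative_continuous[OF d3] in blast)

lemma sym2: "x \<in> W \<Longrightarrow> \<phi>'' x u v = \<phi>'' x v u"
  by (rule second_derivative_symmetric[OF open_W _ d1 d2 d2]) (auto intro: c2)

lemma sym3: "x \<in> W \<Longrightarrow> \<phi>''' x u v w = \<phi>''' x v u w"
  by (rule second_derivative_symmetric[OF open_W _ d2 d3 d3]) (auto intro: c3)

text \<open>Uniqueness of the Levi-Civita connection: the defect \<open>b\<close> is symmetric in
  its arguments, while compatibility with the metrics makes \<beta> skew in its last two arguments.
  A trilinear form that is symmetric in the first pair and skew in the last pair vanishes.\<close>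

lemma gamma_transform:
  assumes x: "x \<in> W"
  shows "\<phi>' x (\<Gamma> x u v) = \<phi>'' x u v + \<Gamma>' (\<phi> x) (\<phi>' x u) (\<phi>' x v)"
proof -
  have xU: "x \<in> U" "\<phi> x \<in> U'" using x WU W_U' by auto
  define b where "b u v = \<phi>' x (\<Gamma> x u v) - \<phi>'' x u v - \<Gamma>' (\<phi> x) (\<phi>' x u) (\<phi>' x v)" for u v
  define \<beta> where "\<beta> u v w = g' (\<phi> x) (b u v) (\<phi>' x w)" for u v w
  have bs: "b u v = b v u" for u v
    unfolding b_def A.\<Gamma>_sym[OF xU(1), of u v] sym2[OF x, of u v] B.\<Gamma>_sym[OF xU(2), of "\<phi>' x u"] ..
  have comp: "\<beta> u v w + \<beta> u w v = 0" for u v w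
  proof -
    have "((\<lambda>x. g' (\<phi> x) (\<phi>' x v) (\<phi>' x w)) has_derivative
       (\<lambda>h. g' (\<phi> x) (\<phi>'' x h v + \<Gamma>' (\<phi> x) (\<phi>' x h) (\<phi>' x v)) (\<phi>' x w) + g' (\<phi> x) (\<phi>' x v) (\<phi>'' x h w + \<Gamma>' (\<phi> x) (\<phi>' x h) (\<phi>' x w)))) (at x)"
      by (rule B.has_derivative_g[OF xU(2) d1[OF x] d2[OF x] d2[OF x]]) simp
    then have "((\<lambda>x. g x v w) has_derivative
       (\<lambda>h. g' (\<phi> x) (\<phi>'' x h v + \<Gamma>' (\<phi> x) (\<phi>' x h) (\<phi>' x v)) (\<phi>' x w) + g' (\<phi> x) (\<phi>' x v) (\<phi>'' x h w + \<Gamma>' (\<phi> x) (\<phi>' x h) (\<phi>' x w)))) (at x)"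
      by (rule has_derivative_transform_within_open[OF _ open_W x]) (simp add: isom)
    from fun_cong[OF has_derivative_unique[OF this A.dg[OF xU(1)]], of u]
    have "g' (\<phi> x) (\<phi>'' x u v + \<Gamma>' (\<phi> x) (\<phi>' x u) (\<phi>' x v)) (\<phi>' x w) + g' (\<phi> x) (\<phi>' x v) (\<phi>'' x u w + \<Gamma>' (\<phi> x) (\<phi>' x u) (\<phi>' x w))
      = g' (\<phi> x) (\<phi>' x (\<Gamma> x u v)) (\<phi>' x w) + g' (\<phi> x) (\<phi>' x v) (\<phi>' x (\<Gamma> x u w))"
      by (simp add: isom[OF x])
    moreover have "\<beta> u w v = g' (\<phi> x) (\<phi>' x v) (b u w)" by (simp add: \<beta>_def B.g_sym[OF xU(2)])
    ultimately show ?thesis by (simp add: \<beta>_def b_def B.g_diff[OF xU(2)] B.g_add[OF xU(2)])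
  qed
  have \<beta>s: "\<beta> u v w = \<beta> v u w" for u v w by (simp add: \<beta>_def bs[of u v])
  have "\<beta> u v w = 0" for w
    using comp[of u v w] \<beta>s[of u w v] comp[of w u v] \<beta>s[of w v u] comp[of v w u] \<beta>s[of v u w] by linarith
  then have "g' (\<phi> x) (b u v) z = g' (\<phi> x) 0 z" for z
    using surjD[OF surj[OF x], of z] by (auto simp: \<beta>_def B.g_zero[OF xU(2)])
  then have "b u v = 0" by (rule B.g_nondegenerate[OF xU(2)])
  then show ?thesis by (simp add: b_def algebra_simps)
qed

text \<open>The transformation law of \<Gamma> is differentiated. Antisymmetrization removes the
  symmetric third derivative, and the second derivatives are eliminated by the law itself.\<close>

lemma curvature_transform:
  assumes x: "x \<in> W"
  shows "\<phi>' x (A.Rm x u v w) = B.Rm (\<phi> x) (\<phi>' x u) (\<phi>' x v) (\<phi>' x w)"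
proof -
  have xU: "x \<in> U" "\<phi> x \<in> U'" using x WU W_U' by auto
  have D: "\<phi>'' x h (\<Gamma> x u v) + \<phi>' x (D\<Gamma> x h u v) = \<phi>''' x h u v
     + (D\<Gamma>' (\<phi> x) (\<phi>' x h) (\<phi>' x u) (\<phi>' x v) + \<Gamma>' (\<phi> x) (\<phi>'' x h u) (\<phi>' x v) + \<Gamma>' (\<phi> x) (\<phi>' x u) (\<phi>'' x h v))" for h u v
  proof -
    have "((\<lambda>x. \<phi>' x (\<Gamma> x u v)) has_derivative (\<lambda>h. \<phi>'' x h (\<Gamma> x u v) + \<phi>' x (D\<Gamma> x h u v))) (at x)"
      by (rule has_derivative_linear_family[OF open_W x lin1 d2[OF x] has_derivative_ident A.d\<Gamma>[OF xU(1)]]) auto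
    moreover have "((\<lambda>x. \<phi>'' x u v + \<Gamma>' (\<phi> x) (\<phi>' x u) (\<phi>' x v)) has_derivative (\<lambda>h. \<phi>''' x h u v
       + (D\<Gamma>' (\<phi> x) (\<phi>' x h) (\<phi>' x u) (\<phi>' x v) + \<Gamma>' (\<phi> x) (\<phi>'' x h u) (\<phi>' x v) + \<Gamma>' (\<phi> x) (\<phi>' x u) (\<phi>'' x h v)))) (at x)"
      by (intro has_derivative_add d3[OF x] B.has_derivative_\<Gamma>[OF xU(2) d1[OF x] d2[OF x] d2[OF x]]) simp
    then have "((\<lambda>x. \<phi>' x (\<Gamma> x u v)) has_derivative (\<lambda>h. \<phi>''' x h u v
       + (D\<Gamma>' (\<phi> x) (\<phi>' x h) (\<phi>' x u) (\<phi>' x v) + \<Gamma>' (\<phi> x) (\<phi>'' x h u) (\<phi>' x v) + \<Gamma>' (\<phi> x) (\<phi>' x u) (\<phi>'' x h v)))) (at x)"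
      by (rule has_derivative_transform_within_open[OF _ open_W x]) (simp add: gamma_transform)
    ultimately show ?thesis by (rule has_derivative_unique[THEN fun_cong])
  qed
  have D': "\<phi>' x (D\<Gamma> x h u v) = \<phi>''' x h u v + D\<Gamma>' (\<phi> x) (\<phi>' x h) (\<phi>' x u) (\<phi>' x v)
     + \<Gamma>' (\<phi> x) (\<phi>'' x h u) (\<phi>' x v) + \<Gamma>' (\<phi> x) (\<phi>' x u) (\<phi>'' x h v) - \<phi>'' x h (\<Gamma> x u v)" for h u v
    using D[of h u v] by (simp add: algebra_simps)
  have q: "\<phi>'' x u v = \<phi>' x (\<Gamma> x u v) - \<Gamma>' (\<phi> x) (\<phi>' x u) (\<phi>' x v)" for u v
    using gamma_transform[OF x, of u v] by simp
  note l = linear_add[OF lin1[OF x]] linear_diff[OF lin1[OF x]]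
  show ?thesis
    unfolding A.Rm_def B.Rm_def
    by (simp add: l D' sym3[OF x, of v u] sym2[OF x, of v u] q
        A.\<Gamma>_sym[OF xU(1), of v u] B.\<Gamma>_sym[OF xU(2), of "\<phi>' x v" "\<phi>' x u"] B.\<Gamma>_diff[OF xU(2)] B.\<Gamma>_add[OF xU(2)] algebra_simps)
qed

end

section \<open>Charts and tangent vectors\<close>

locale riem_manifold =
  fixes M :: "('a, 'n::finite) riemannian"
  assumes riem: "riemannian_manifold M"
begin

abbreviation cdom :: "('a, 'n) chart \<Rightarrow> (real^'n) set" where "cdom c \<equiv> snd c ` fst c"
abbreviation overlap :: "('a, 'n) chart \<Rightarrow> ('a, 'n) chart \<Rightarrow> (real^'n) set" where
  "overlap c c' \<equiv> snd c ` (fst c \<inter> fst c')"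
abbreviation trans :: "('a, 'n) chart \<Rightarrow> ('a, 'n) chart \<Rightarrow> real^'n \<Rightarrow> real^'n" where
  "trans c c' \<equiv> snd c' \<circ> chart_inv c"

lemma chart_homeo: "c \<in> atlas M \<Longrightarrow> homeomorphic_map (subtopology (mtop M) (fst c)) (top_of_set (cdom c)) (snd c)"
  and chart_openin: "c \<in> atlas M \<Longrightarrow> openin (mtop M) (fst c)"
  and open_cdom: "c \<in> atlas M \<Longrightarrow> open (cdom c)"
  and trans_C3: "c \<in> atlas M \<Longrightarrow> c' \<in> atlas M \<Longrightarrow> Ck_on 3 (trans c c') (overlap c c')"
  and topspace_charts: "topspace (mtop M) = (\<Union>c\<in>atlas M. fst c)"
  using riem unfolding riemannian_manifold_def by blast+

lemma chart_subset: "c \<in> atlas M \<Longrightarrow> fst c \<subseteq> topspace (mtop M)"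
  using topspace_charts by blast

lemma chart_inj: "c \<in> atlas M \<Longrightarrow> inj_on (snd c) (fst c)"
  using homeomorphic_imp_injective_map[OF chart_homeo] chart_subset by (simp add: Int_absorb1)

lemma chart_inv_left [simp]: "c \<in> atlas M \<Longrightarrow> q \<in> fst c \<Longrightarrow> chart_inv c (snd c q) = q"
  unfolding chart_inv_def by (rule inv_into_f_f[OF chart_inj])

lemma chart_inv_right: "x \<in> cdom c \<Longrightarrow> snd c (chart_inv c x) = x"
  unfolding chart_inv_def by (simp add: f_inv_into_f)

lemma chart_inv_in: "x \<in> cdom c \<Longrightarrow> chart_inv c x \<in> fst c"
  unfolding chart_inv_def by (rule inv_into_into)

lemma openin_chart_image:
  assumes c: "c \<in> atlas M" and S: "openin (mtop M) S" "S \<subseteq> fst c"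
  shows "open (snd c ` S)"
proof -
  have "openin (subtopology (mtop M) (fst c)) S" using S by (auto simp: openin_subtopology)
  then have "openin (top_of_set (cdom c)) (snd c ` S)"
    using homeomorphic_imp_open_map[OF chart_homeo[OF c]] by (auto simp: open_map_def)
  then show ?thesis using open_cdom[OF c] openin_open_trans by blast
qed

lemma open_overlap: "c \<in> atlas M \<Longrightarrow> c' \<in> atlas M \<Longrightarrow> open (overlap c c')"
  by (rule openin_chart_image) (auto intro: openin_Int chart_openin)

lemma continuous_chart: "c \<in> atlas M \<Longrightarrow> continuous_map (subtopology (mtop M) (fst c)) (top_of_set (cdom c)) (snd c)"
  using chart_homeo homeomorphic_imp_continuous_map by blast

lemma openin_chart_preimage:
  assumes c: "c \<in> atlas M" and W: "open W"
  shows "openin (mtop M) {q\<in>fst c. snd c q \<in> W}"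
proof -
  have "openin (top_of_set (cdom c)) (cdom c \<inter> W)" using W by (auto simp: openin_open)
  from openin_continuous_map_preimage[OF continuous_chart[OF c] this]
  have "openin (subtopology (mtop M) (fst c)) {q \<in> topspace (subtopology (mtop M) (fst c)). snd c q \<in> cdom c \<inter> W}" .
  moreover have "{q \<in> topspace (subtopology (mtop M) (fst c)). snd c q \<in> cdom c \<inter> W} = {q\<in>fst c. snd c q \<in> W}"
    using chart_subset[OF c] by auto
  ultimately show ?thesis using chart_openin[OF c] by (simp add: openin_open_subtopology)
qed

lemma continuous_chart_inv:
  assumes c: "c \<in> atlas M" shows "continuous_map (top_of_set (cdom c)) (mtop M) (chart_inv c)"
  unfolding continuous_map_def
proof (intro conjI allI impI)
  show "chart_inv c \<in> topspace (top_of_set (cdom c)) \<rightarrow> topspace (mtop M)"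
  proof
    fix x assume "x \<in> topspace (top_of_set (cdom c))"
    then have "chart_inv c x \<in> fst c" by (intro chart_inv_in) simp
    then show "chart_inv c x \<in> topspace (mtop M)" using chart_subset[OF c] by blast
  qed
  fix S assume S: "openin (mtop M) S"
  have "openin (mtop M) (S \<inter> fst c)" using S chart_openin[OF c] by (rule openin_Int)
  then have o: "open (snd c ` (S \<inter> fst c))" by (rule openin_chart_image[OF c]) simp
  have "{x \<in> cdom c. chart_inv c x \<in> S} = snd c ` (S \<inter> fst c)"
  proof (intro set_eqI iffI)
    fix x assume "x \<in> {x \<in> cdom c. chart_inv c x \<in> S}"
    then have x: "x \<in> cdom c" "chart_inv c x \<in> S" by auto
    show "x \<in> snd c ` (S \<inter> fst c)"
      by (rule image_eqI[of _ _ "chart_inv c x"]) (use x chart_inv_in chart_inv_right[OF x(1)] in simp_all)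
  next
    fix x assume "x \<in> snd c ` (S \<inter> fst c)"
    then obtain q where "q \<in> S" "q \<in> fst c" "x = snd c q" by blast
    then show "x \<in> {x \<in> cdom c. chart_inv c x \<in> S}" by (simp add: c)
  qed
  moreover have "snd c ` (S \<inter> fst c) \<subseteq> cdom c" by blast
  ultimately show "openin (top_of_set (cdom c)) {x \<in> topspace (top_of_set (cdom c)). chart_inv c x \<in> S}"
    using o open_subset by simp
qed

definition dtrans :: "('a, 'n) chart \<Rightarrow> ('a, 'n) chart \<Rightarrow> real^'n \<Rightarrow> real^'n \<Rightarrow> real^'n" where
  "dtrans c c' x = frechet_derivative (trans c c') (at x)"

lemma has_derivative_trans:
  assumes "c \<in> atlas M" "c' \<in> atlas M" "x \<in> overlap c c'"
  shows "(trans c c' has_derivative dtrans c c' x) (at x)"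
proof -
  have "Ck_on (Suc 2) (trans c c') (overlap c c')" using trans_C3[OF assms(1,2)] by (simp add: numeral_3_eq_3 numeral_2_eq_2)
  then obtain f' where "\<And>x. x \<in> overlap c c' \<Longrightarrow> (trans c c' has_derivative f' x) (at x)"
    by (rule open_Ck_on_SucD[OF _ open_overlap[OF assms(1,2)]]) blast
  note d = this[OF assms(3)]
  show ?thesis unfolding dtrans_def using d frechet_derivative_at[OF d] by simp
qed

lemma linear_dtrans: "c \<in> atlas M \<Longrightarrow> c' \<in> atlas M \<Longrightarrow> x \<in> overlap c c' \<Longrightarrow> linear (dtrans c c' x)"
  using has_derivative_trans has_derivative_linear by blast

lemma Ck_dtrans:
  assumes "c \<in> atlas M" "c' \<in> atlas M" shows "Ck_on 2 (\<lambda>x. dtrans c c' x v) (overlap c c')"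
proof -
  have "Ck_on (Suc 2) (trans c c') (overlap c c')" using trans_C3[OF assms] by (simp add: numeral_3_eq_3 numeral_2_eq_2)
  then have "Ck_on 2 (\<lambda>x. frechet_derivative (trans c c') (at x within overlap c c') v) (overlap c c')" by (simp only: Ck_on.simps(2))
  then show ?thesis
    using Ck_on_cong[of "overlap c c'" "\<lambda>x. frechet_derivative (trans c c') (at x within overlap c c') v" "\<lambda>x. dtrans c c' x v" 2]
    by (simp add: dtrans_def at_within_open[OF _ open_overlap[OF assms]])
qed

lemma chart_vec_eq: "c' \<in> atlas M \<Longrightarrow> q \<in> fst c' \<Longrightarrow> chart_vec M c q u c' = dtrans c c' (snd c q) u"
  by (simp add: chart_vec_def dtrans_def)

lemma dtrans_id:
  assumes c: "c \<in> atlas M" "x \<in> cdom c" shows "dtrans c c x u = u"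
proof -
  have "(trans c c has_derivative (\<lambda>u. u)) (at x)"
    by (rule has_derivative_transform_within_open[OF has_derivative_ident open_cdom[OF c(1)] c(2)]) (simp add: chart_inv_right)
  from frechet_derivative_at[OF this] show ?thesis unfolding dtrans_def by (rule fun_cong[OF sym])
qed

lemma dtrans_cocycle:
  assumes c: "c \<in> atlas M" "c' \<in> atlas M" "c'' \<in> atlas M" and q: "q \<in> fst c" "q \<in> fst c'" "q \<in> fst c''"
  shows "dtrans c' c'' (snd c' q) (dtrans c c' (snd c q) u) = dtrans c c'' (snd c q) u"
proof -
  have x: "snd c q \<in> overlap c c'" "snd c' q \<in> overlap c' c''" "snd c q \<in> overlap c c''" "trans c c' (snd c q) = snd c' q"
    using q c by auto
  have "((\<lambda>y. trans c' c'' (trans c c' y)) has_derivative (\<lambda>u. dtrans c' c'' (snd c' q) (dtrans c c' (snd c q) u))) (at (snd c q))"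
    by (rule has_derivative_compose[OF has_derivative_trans[OF c(1,2) x(1)]]) (simp only: x(4) has_derivative_trans[OF c(2,3) x(2)])
  then have "(trans c c'' has_derivative (\<lambda>u. dtrans c' c'' (snd c' q) (dtrans c c' (snd c q) u))) (at (snd c q))"
    by (rule has_derivative_transform_within_open[OF _ open_overlap[OF c(1,2)] x(1)]) (use c in auto)
  from has_derivative_unique[OF this has_derivative_trans[OF c(1,3) x(3)]] show ?thesis by (rule fun_cong)
qed

lemma chart_vec_change:
  assumes c: "c \<in> atlas M" "c' \<in> atlas M" and q: "q \<in> fst c" "q \<in> fst c'"
  shows "chart_vec M c' q (dtrans c c' (snd c q) u) = chart_vec M c q u"
proof
  fix c''
  show "chart_vec M c' q (dtrans c c' (snd c q) u) c'' = chart_vec M c q u c''"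
  proof (cases "c'' \<in> atlas M \<and> q \<in> fst c''")
    case True then show ?thesis using dtrans_cocycle[OF c conjunct1[OF True] q conjunct2[OF True], of u] by (simp add: chart_vec_eq)
  qed (simp only: chart_vec_def if_False)
qed

lemma chart_vec_self: "c \<in> atlas M \<Longrightarrow> q \<in> fst c \<Longrightarrow> chart_vec M c q u c = u"
  by (simp add: chart_vec_eq dtrans_id)

text \<open>A tangent vector is recovered from its components in a single chart, so identities
  between tangent vectors may be checked in one chart.\<close>

lemma tangent_chart:
  assumes v: "v \<in> tangent_space M q" and c: "c \<in> atlas M" "q \<in> fst c"
  shows "chart_vec M c q (v c) = v"
proof -
  obtain c' u where c': "c' \<in> atlas M" "q \<in> fst c'" "v = chart_vec M c' q u"
    using v unfolding tangent_space_def by blast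
  then show ?thesis using chart_vec_change[OF c'(1) c(1) c'(2) c(2), of u] c by (simp add: chart_vec_eq)
qed

lemma chart_vec_tangent: "c \<in> atlas M \<Longrightarrow> q \<in> fst c \<Longrightarrow> chart_vec M c q u \<in> tangent_space M q"
  unfolding tangent_space_def by blast

lemma inn_chart:
  assumes "v \<in> tangent_space M q" "w \<in> tangent_space M q" "c \<in> atlas M" "q \<in> fst c"
  shows "inn M q v w = chart_inn M c (snd c q) (v c) (w c)"
  unfolding chart_inn_def using assms tangent_chart by simp

lemma linear_chart_vec:
  assumes c: "c \<in> atlas M" "q \<in> fst c"
  shows "chart_vec M c q (a *\<^sub>R u) = scale_vec a (chart_vec M c q u)"
    and "chart_vec M c q (\<Sum>i\<in>J. b i *\<^sub>R w i) = lin_comb J b (\<lambda>i. chart_vec M c q (w i))"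
proof -
  have l: "linear (dtrans c c' (snd c q))" if "c' \<in> atlas M" "q \<in> fst c'" for c'
    by (rule linear_dtrans) (use c that in auto)
  show "chart_vec M c q (a *\<^sub>R u) = scale_vec a (chart_vec M c q u)"
  proof
    fix c' show "chart_vec M c q (a *\<^sub>R u) c' = scale_vec a (chart_vec M c q u) c'"
    proof (cases "c' \<in> atlas M \<and> q \<in> fst c'")
      case True
      then show ?thesis by (simp add: scale_vec_def chart_vec_eq linear_scale[OF l])
    next
      case False
      then have "chart_vec M c q z c' = 0" for z by (auto simp: chart_vec_def)
      then show ?thesis by (simp add: scale_vec_def)
    qed
  qed
  show "chart_vec M c q (\<Sum>i\<in>J. b i *\<^sub>R w i) = lin_comb J b (\<lambda>i. chart_vec M c q (w i))"
  proof
    fix c' show "chart_vec M c q (\<Sum>i\<in>J. b i *\<^sub>R w i) c' = lin_comb J b (\<lambda>i. chart_vec M c q (w i)) c'"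
    proof (cases "c' \<in> atlas M \<and> q \<in> fst c'")
      case True
      then show ?thesis by (simp add: lin_comb_def chart_vec_eq linear_sum[OF l] linear_scale[OF l])
    next
      case False
      then have "chart_vec M c q z c' = 0" for z by (auto simp: chart_vec_def)
      then show ?thesis by (simp add: lin_comb_def)
    qed
  qed
qed

end

section \<open>Christoffel symbols and curvature of a chart\<close>

lemma sum_axis [simp]:
  "(\<Sum>i\<in>UNIV. f i * axis a (1::real) $ i) = f a" "(\<Sum>i\<in>UNIV. axis a (1::real) $ i * f i) = f a"
  by (simp_all add: axis_def if_distrib[of "\<lambda>x. _ * x"] if_distrib[of "\<lambda>x. x * _"] cong: if_cong)

lemma sum2_axis:
  "(\<Sum>i\<in>UNIV. \<Sum>j\<in>UNIV. f i j * axis a (1::real) $ i * z $ j) = (\<Sum>j\<in>UNIV. f a j * z $ j)"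
proof -
  have "(\<Sum>i\<in>UNIV. \<Sum>j\<in>UNIV. f i j * axis a (1::real) $ i * z $ j) = (\<Sum>i\<in>UNIV. (\<Sum>j\<in>UNIV. f i j * z $ j) * axis a 1 $ i)"
    unfolding sum_distrib_right by (intro sum.cong refl) (simp only: mult.assoc mult.commute mult.left_commute)
  then show ?thesis by simp
qed

lemma trilinear_eq:
  fixes f h :: "'a::euclidean_space \<Rightarrow> 'b::euclidean_space \<Rightarrow> 'c::euclidean_space \<Rightarrow> 'd::real_vector"
  assumes f: "\<And>v w. linear (\<lambda>u. f u v w)" "\<And>u w. linear (\<lambda>v. f u v w)" "\<And>u v. linear (\<lambda>w. f u v w)"
    and h: "\<And>v w. linear (\<lambda>u. h u v w)" "\<And>u w. linear (\<lambda>v. h u v w)" "\<And>u v. linear (\<lambda>w. h u v w)"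
    and eq: "\<And>u v w. u \<in> Basis \<Longrightarrow> v \<in> Basis \<Longrightarrow> w \<in> Basis \<Longrightarrow> f u v w = h u v w"
  shows "f u v w = h u v w"
proof -
  have 1: "f u v w = h u v w" if "u \<in> Basis" "v \<in> Basis" for u v w
    using linear_eq_stdbasis[OF f(3) h(3), of u v u v] eq[OF that] by (metis (no_types))
  have 2: "f u v w = h u v w" if "u \<in> Basis" for u v w
    using linear_eq_stdbasis[OF f(2) h(2), of u w u w] 1[OF that] by (metis (no_types))
  show ?thesis
    using linear_eq_stdbasis[OF f(1) h(1), of v w v w] 2 by (metis (no_types))
qed

lemma Ck_on_det:
  fixes A :: "'a::euclidean_space \<Rightarrow> real^'n^'n"
  assumes "rich S" "\<And>i j. Ck_on k (\<lambda>x. A x $ i $ j) S"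
  shows "Ck_on k (\<lambda>x. det (A x)) S"
  unfolding det_def by (intro Ck_on_sum Ck_on_mult Ck_on_prod Ck_on_const assms)

lemma matrix_inv_right:
  fixes A :: "real^'n^'n"
  assumes "det A \<noteq> 0" shows "A ** matrix_inv A = mat 1"
proof -
  have "\<exists>A'. A ** A' = mat 1 \<and> A' ** A = mat 1" using assms invertible_det_nz[of A] by (simp add: invertible_def)
  then show ?thesis unfolding matrix_inv_def by (rule someI2_ex) simp
qed

text \<open>Cramer's rule: the inverse is rational in the entries of \<open>A\<close> and therefore
  inherits their differentiability class.\<close>

lemma matrix_inv_entry:
  fixes A :: "real^'n^'n"
  assumes "det A \<noteq> 0"
  shows "matrix_inv A $ k $ l = det (\<chi> i j. if j = k then axis l 1 $ i else A $ i $ j) * inverse (det A)"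
proof -
  have "A *v (matrix_inv A *v axis l 1) = axis l 1" by (simp add: matrix_vector_mul_assoc matrix_inv_right[OF assms])
  then have "matrix_inv A *v axis l 1 = (\<chi> k. det (\<chi> i j. if j = k then axis l 1 $ i else A $ i $ j) / det A)"
    using cramer[OF assms] by blast
  then have "(matrix_inv A *v axis l 1) $ k = det (\<chi> i j. if j = k then axis l 1 $ i else A $ i $ j) / det A" by simp
  then show ?thesis by (simp add: matrix_vector_mult_def divide_inverse)
qed

lemma Ck_on_matrix_inv:
  fixes A :: "'a::euclidean_space \<Rightarrow> real^'n^'n"
  assumes S: "rich S" and A: "\<And>i j. Ck_on k (\<lambda>x. A x $ i $ j) S" and nz: "\<And>x. x \<in> S \<Longrightarrow> det (A x) \<noteq> 0"
  shows "Ck_on k (\<lambda>x. matrix_inv (A x) $ a $ b) S"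
proof -
  have "Ck_on k (\<lambda>x. (\<chi> i j. if j = a then axis b 1 $ i else A x $ i $ j) $ i $ j) S" for i j :: 'n
    by (cases "j = a") (auto intro: Ck_on_const S A)
  then have "Ck_on k (\<lambda>x. det (\<chi> i j. if j = a then axis b 1 $ i else A x $ i $ j) * inverse (det (A x))) S"
    by (intro Ck_on_mult Ck_on_det Ck_on_inverse S A nz)
  then show ?thesis
    using Ck_on_cong[of S "\<lambda>x. det (\<chi> i j. if j = a then axis b 1 $ i else A x $ i $ j) * inverse (det (A x))" "\<lambda>x. matrix_inv (A x) $ a $ b" k]
      matrix_inv_entry[OF nz] by simp
qed

context riem_manifold
begin

definition Gam :: "('a, 'n) chart \<Rightarrow> real^'n \<Rightarrow> real^'n \<Rightarrow> real^'n \<Rightarrow> real^'n" where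
  "Gam c x u v = (\<Sum>k\<in>UNIV. (\<Sum>i\<in>UNIV. \<Sum>j\<in>UNIV. christoffel M c k i j x * u $ i * v $ j) *\<^sub>R axis k 1)"

definition DGam :: "('a, 'n) chart \<Rightarrow> real^'n \<Rightarrow> real^'n \<Rightarrow> real^'n \<Rightarrow> real^'n \<Rightarrow> real^'n" where
  "DGam c x h u v = (\<Sum>k\<in>UNIV. (\<Sum>i\<in>UNIV. \<Sum>j\<in>UNIV.
     frechet_derivative (christoffel M c k i j) (at x) h * u $ i * v $ j) *\<^sub>R axis k 1)"

lemma sum_scale_axis_nth: "(\<Sum>k\<in>UNIV. f k *\<^sub>R axis k (1::real)) $ l = (f l :: real)"
  by (simp add: axis_def if_distrib[of "\<lambda>x. _ * x"] cong: if_cong)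

lemma Gam_nth: "Gam c x u v $ k = (\<Sum>i\<in>UNIV. \<Sum>j\<in>UNIV. christoffel M c k i j x * u $ i * v $ j)"
  unfolding Gam_def by (rule sum_scale_axis_nth)

lemma DGam_nth: "DGam c x h u v $ k = (\<Sum>i\<in>UNIV. \<Sum>j\<in>UNIV. frechet_derivative (christoffel M c k i j) (at x) h * u $ i * v $ j)"
  unfolding DGam_def by (rule sum_scale_axis_nth)

lemma Gam_bilinear: "bilinear (Gam c x)"
  unfolding bilinear_def Gam_def
  by (auto intro!: linearI simp: scaleR_left_distrib sum.distrib scaleR_sum_right sum_distrib_left algebra_simps)

lemma chart_inn_bilinear: "c \<in> atlas M \<Longrightarrow> x \<in> cdom c \<Longrightarrow> bilinear (chart_inn M c x)"
  and chart_inn_sym: "c \<in> atlas M \<Longrightarrow> x \<in> cdom c \<Longrightarrow> chart_inn M c x u v = chart_inn M c x v u"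
  and chart_inn_pos: "c \<in> atlas M \<Longrightarrow> x \<in> cdom c \<Longrightarrow> u \<noteq> 0 \<Longrightarrow> chart_inn M c x u u > 0"
  and chart_inn_C2: "c \<in> atlas M \<Longrightarrow> Ck_on 2 (\<lambda>x. chart_inn M c x u v) (cdom c)"
  using riem unfolding riemannian_manifold_def by blast+

lemma gram_nth: "gram M c x $ i $ j = chart_inn M c x (axis i 1) (axis j 1)"
  by (simp add: gram_def)

lemma det_gram:
  assumes c: "c \<in> atlas M" "x \<in> cdom c" shows "det (gram M c x) \<noteq> 0"
proof
  assume "det (gram M c x) = 0"
  then obtain u where u: "u \<noteq> 0" "gram M c x *v u = 0"
    using invertible_det_nz matrix_left_invertible_ker[of "gram M c x"] invertible_left_inverse by blast
  note b = chart_inn_bilinear[OF c]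
  have "chart_inn M c x (axis i 1) u = (gram M c x *v u) $ i" for i
  proof -
    have "linear (chart_inn M c x (axis i 1))" using b by (simp add: bilinear_def)
    from linear_sum[OF this, of "\<lambda>j. (u $ j) *\<^sub>R axis j 1" UNIV] show ?thesis
      unfolding matrix_vector_mult_def
      by (simp add: basis_expansion[of u, unfolded scalar_mult_eq_scaleR] linear_scale[OF \<open>linear _\<close>] gram_nth mult.commute)
  qed
  then have z: "chart_inn M c x (axis i 1) u = 0" for i using u by simp
  have l: "linear (\<lambda>w. chart_inn M c x w u)" using b by (simp add: bilinear_def)
  have "chart_inn M c x u u = 0"
    using linear_sum[OF l, of "\<lambda>j. (u $ j) *\<^sub>R axis j 1" UNIV]
    by (simp add: basis_expansion[of u, unfolded scalar_mult_eq_scaleR] linear_scale[OF l] z)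
  then show False using chart_inn_pos[OF c u(1)] by simp
qed

definition dinn :: "('a, 'n) chart \<Rightarrow> real^'n \<Rightarrow> real^'n \<Rightarrow> real^'n \<Rightarrow> real^'n \<Rightarrow> real" where
  "dinn c x h u v = frechet_derivative (\<lambda>x. chart_inn M c x u v) (at x) h"

lemma has_derivative_chart_inn:
  assumes c: "c \<in> atlas M" "x \<in> cdom c"
  shows "((\<lambda>x. chart_inn M c x u v) has_derivative (\<lambda>h. dinn c x h u v)) (at x)"
proof -
  have "Ck_on (Suc 1) (\<lambda>x. chart_inn M c x u v) (cdom c)" using chart_inn_C2[OF c(1)] by (simp add: numeral_2_eq_2)
  then obtain f' where "\<And>x. x \<in> cdom c \<Longrightarrow> ((\<lambda>x. chart_inn M c x u v) has_derivative f' x) (at x)"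
    by (rule open_Ck_on_SucD[OF _ open_cdom[OF c(1)]]) blast
  note d = this[OF c(2)]
  show ?thesis unfolding dinn_def using d frechet_derivative_at[OF d] by simp
qed

lemma dinn_Ck1:
  assumes c: "c \<in> atlas M" shows "Ck_on 1 (\<lambda>x. dinn c x h u v) (cdom c)"
proof -
  have "Ck_on (Suc 1) (\<lambda>x. chart_inn M c x u v) (cdom c)" using chart_inn_C2[OF c] by (simp add: numeral_2_eq_2)
  then have "Ck_on 1 (\<lambda>x. frechet_derivative (\<lambda>x. chart_inn M c x u v) (at x within cdom c) h) (cdom c)"
    by (simp only: Ck_on.simps(2))
  then show ?thesis
    using Ck_on_cong[of "cdom c" "\<lambda>x. frechet_derivative (\<lambda>x. chart_inn M c x u v) (at x within cdom c) h" "\<lambda>x. dinn c x h u v" 1]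
    by (simp only: dinn_def at_within_open[OF _ open_cdom[OF c]])
qed

lemma dinn_eqI:
  assumes c: "c \<in> atlas M" "x \<in> cdom c" and eq: "\<And>y. y \<in> cdom c \<Longrightarrow> chart_inn M c y u v = G y" and G: "(G has_derivative G') (at x)"
  shows "dinn c x h u v = G' h"
proof -
  have "((\<lambda>y. chart_inn M c y u v) has_derivative G') (at x)"
    by (rule has_derivative_transform_within_open[OF G open_cdom[OF c(1)] c(2)]) (simp add: eq)
  from has_derivative_unique[OF has_derivative_chart_inn[OF c] this] show ?thesis by (rule fun_cong)
qed

lemma dinn_linear:
  assumes c: "c \<in> atlas M" "x \<in> cdom c"
  shows "linear (\<lambda>h. dinn c x h u v)" "linear (\<lambda>u. dinn c x h u v)" "linear (\<lambda>v. dinn c x h u v)"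
proof -
  show "linear (\<lambda>h. dinn c x h u v)" by (rule has_derivative_linear[OF has_derivative_chart_inn[OF c]])
  note b = chart_inn_bilinear[OF c(1)] and d = has_derivative_chart_inn[OF c]
  show "linear (\<lambda>u. dinn c x h u v)"
  proof
    fix a b' :: "real^'n" and r :: real
    show "dinn c x h (a + b') v = dinn c x h a v + dinn c x h b' v"
      by (rule dinn_eqI[OF c _ has_derivative_add[OF d d]]) (simp add: bilinear_ladd[OF b])
    show "dinn c x h (r *\<^sub>R a) v = r *\<^sub>R dinn c x h a v"
      by (rule dinn_eqI[OF c _ has_derivative_scaleR_right[OF d]]) (simp add: bilinear_lmul[OF b])
  qed
  show "linear (\<lambda>v. dinn c x h u v)"
  proof
    fix a b' :: "real^'n" and r :: real
    show "dinn c x h u (a + b') = dinn c x h u a + dinn c x h u b'"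
      by (rule dinn_eqI[OF c _ has_derivative_add[OF d d]]) (simp add: bilinear_radd[OF b])
    show "dinn c x h u (r *\<^sub>R a) = r *\<^sub>R dinn c x h u a"
      by (rule dinn_eqI[OF c _ has_derivative_scaleR_right[OF d]]) (simp add: bilinear_rmul[OF b])
  qed
qed

lemma dinn_sym: "c \<in> atlas M \<Longrightarrow> x \<in> cdom c \<Longrightarrow> dinn c x h u v = dinn c x h v u"
  by (rule dinn_eqI[OF _ _ _ has_derivative_chart_inn]) (auto intro: chart_inn_sym)

lemma partial_gram: "partial i (\<lambda>y. gram M c y $ j $ l) x = dinn c x (axis i 1) (axis j 1) (axis l 1)"
  by (simp add: partial_def gram_nth dinn_def)

lemma christoffel_eq: "christoffel M c k i j x = (1/2) * (\<Sum>l\<in>UNIV. matrix_inv (gram M c x) $ k $ l *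
     (dinn c x (axis i 1) (axis j 1) (axis l 1) + dinn c x (axis j 1) (axis i 1) (axis l 1) - dinn c x (axis l 1) (axis i 1) (axis j 1)))"
  unfolding christoffel_def partial_gram ..

lemma christoffel_Ck1:
  assumes c: "c \<in> atlas M" shows "Ck_on 1 (christoffel M c k i j) (cdom c)"
proof -
  note S = rich_open[OF open_cdom[OF c]]
  have "Ck_on 1 (\<lambda>x. gram M c x $ a $ b) (cdom c)" for a b
  proof -
    have "Ck_on (Suc 1) (\<lambda>x. chart_inn M c x (axis a 1) (axis b 1)) (cdom c)"
      using chart_inn_C2[OF c] by (simp add: numeral_2_eq_2)
    from Ck_on_Suc_lower[OF this] show ?thesis unfolding gram_nth .
  qed
  then show ?thesis unfolding christoffel_eq[abs_def]
    by (intro Ck_on_mult Ck_on_sum Ck_on_add Ck_on_diff Ck_on_const Ck_on_matrix_inv dinn_Ck1 det_gram c S)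
qed

text \<open>The Koszul formula, verified on basis vectors, where the inverse Gram matrix in the
  Christoffel symbols cancels. Both symmetry and compatibility with the metric follow from it
  without further index calculation.\<close>

lemma koszul:
  assumes c: "c \<in> atlas M" "x \<in> cdom c"
  shows "chart_inn M c x (Gam c x u v) w = (1/2) * (dinn c x u v w + dinn c x v u w - dinn c x w u v)"
proof (rule trilinear_eq[of "\<lambda>u v w. chart_inn M c x (Gam c x u v) w" "\<lambda>u v w. (1/2) * (dinn c x u v w + dinn c x v u w - dinn c x w u v)"])
  note b = chart_inn_bilinear[OF c] and gb = Gam_bilinear[of c x]
  have l: "linear (\<lambda>v. chart_inn M c x v w)" "linear (\<lambda>v. chart_inn M c x w v)" "linear (Gam c x u)" "linear (\<lambda>v. Gam c x v u)" for w u
    using b gb unfolding bilinear_def by auto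
  show "linear (\<lambda>u. chart_inn M c x (Gam c x u v) w)" for v w using linear_compose[OF l(4) l(1)] by (simp add: o_def)
  show "linear (\<lambda>v. chart_inn M c x (Gam c x u v) w)" for u w using linear_compose[OF l(3) l(1)] by (simp add: o_def)
  show "linear (\<lambda>w. chart_inn M c x (Gam c x u v) w)" for u v using l(2) by simp
  note d = dinn_linear[OF c]
  note da = d[THEN linear_add] and ds = d[THEN linear_scale]
  show "linear (\<lambda>u. (1/2) * (dinn c x u v w + dinn c x v u w - dinn c x w u v))" for v w
    by (auto intro!: linearI simp: da ds field_simps)
  show "linear (\<lambda>v. (1/2) * (dinn c x u v w + dinn c x v u w - dinn c x w u v))" for u w
    by (auto intro!: linearI simp: da ds field_simps)
  show "linear (\<lambda>w. (1/2) * (dinn c x u v w + dinn c x v u w - dinn c x w u v))" for u v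
    by (auto intro!: linearI simp: da ds field_simps)
  fix u v w :: "real^'n" assume "u \<in> Basis" "v \<in> Basis" "w \<in> Basis"
  then obtain i j l' where ax: "u = axis i 1" "v = axis j 1" "w = axis l' 1" by (auto simp: Basis_vec_def)
  define T where "T m = dinn c x (axis i 1) (axis j 1) (axis m 1) + dinn c x (axis j 1) (axis i 1) (axis m 1) - dinn c x (axis m 1) (axis i 1) (axis j 1)" for m
  have inv: "(\<Sum>k\<in>UNIV. gram M c x $ k $ l' * matrix_inv (gram M c x) $ k $ m) = (if l' = m then 1 else 0)" for m
  proof -
    have "gram M c x ** matrix_inv (gram M c x) = mat 1"
      by (rule matrix_inv_right[OF det_gram[OF c]])
    then have "(gram M c x ** matrix_inv (gram M c x)) $ l' $ m = mat 1 $ l' $ m" by simp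
    moreover have "gram M c x $ k $ l' = gram M c x $ l' $ k" for k unfolding gram_nth by (rule chart_inn_sym[OF c])
    ultimately show ?thesis by (simp add: matrix_matrix_mult_def mat_def)
  qed
  have "chart_inn M c x (Gam c x u v) w = (\<Sum>k\<in>UNIV. christoffel M c k i j x * gram M c x $ k $ l')"
    unfolding Gam_def ax linear_sum[OF l(1)] linear_scale[OF l(1)] sum2_axis by (simp add: gram_nth)
  also have "\<dots> = (\<Sum>k\<in>UNIV. \<Sum>m\<in>UNIV. (1/2) * T m * (gram M c x $ k $ l' * matrix_inv (gram M c x) $ k $ m))"
    unfolding christoffel_eq T_def[symmetric] by (simp add: sum_distrib_left sum_distrib_right algebra_simps)
  also have "\<dots> = (\<Sum>m\<in>UNIV. (1/2) * T m * (if l' = m then 1 else 0))"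
    by (subst sum.swap) (simp only: sum_distrib_left[symmetric] inv)
  also have "\<dots> = (1/2) * T l'" by (simp add: if_distrib[of "\<lambda>x. _ * x"] cong: if_cong)
  finally show "chart_inn M c x (Gam c x u v) w = (1/2) * (dinn c x u v w + dinn c x v u w - dinn c x w u v)"
    by (simp add: T_def ax)
qed

lemma frechet_christoffel:
  assumes c: "c \<in> atlas M"
  shows "x \<in> cdom c \<Longrightarrow> (christoffel M c k i j has_derivative frechet_derivative (christoffel M c k i j) (at x)) (at x)"
    and "continuous_on (cdom c) (\<lambda>x. frechet_derivative (christoffel M c k i j) (at x) h)"
proof -
  have C: "Ck_on (Suc 0) (christoffel M c k i j) (cdom c)" using christoffel_Ck1[OF c] by simp
  obtain f' where f': "\<And>x. x \<in> cdom c \<Longrightarrow> (christoffel M c k i j has_derivative f' x) (at x)" "\<And>v. Ck_on 0 (\<lambda>x. f' x v) (cdom c)"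
    by (rule open_Ck_on_SucD[OF C open_cdom[OF c]]) blast
  have e: "frechet_derivative (christoffel M c k i j) (at x) = f' x" if "x \<in> cdom c" for x
    using frechet_derivative_at[OF f'(1)[OF that]] by simp
  show "x \<in> cdom c \<Longrightarrow> (christoffel M c k i j has_derivative frechet_derivative (christoffel M c k i j) (at x)) (at x)"
    using f'(1) e by simp
  show "continuous_on (cdom c) (\<lambda>x. frechet_derivative (christoffel M c k i j) (at x) h)"
    using f'(2)[of h] e by (simp cong: continuous_on_cong)
qed

lemma local_metric_chart:
  assumes c: "c \<in> atlas M"
  shows "local_metric (cdom c) (chart_inn M c) (Gam c) (DGam c)"
proof
  show "open (cdom c)" by (rule open_cdom[OF c])
  fix x u v assume x: "x \<in> cdom c"
  show "bilinear (chart_inn M c x)" by (rule chart_inn_bilinear[OF c x])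
  show sym: "chart_inn M c x u v = chart_inn M c x v u" for u v by (rule chart_inn_sym[OF c x])
  show "u \<noteq> 0 \<Longrightarrow> 0 < chart_inn M c x u u" by (rule chart_inn_pos[OF c x])
  show "bilinear (Gam c x)" by (rule Gam_bilinear)
  show "Gam c x u v = Gam c x v u"
  proof (rule ccontr)
    assume "Gam c x u v \<noteq> Gam c x v u"
    then have "chart_inn M c x (Gam c x u v - Gam c x v u) (Gam c x u v - Gam c x v u) > 0" by (intro chart_inn_pos[OF c x]) simp
    then show False
      unfolding bilinear_lsub[OF chart_inn_bilinear[OF c x]] koszul[OF c x]
      using dinn_sym[OF c x, of _ u v] by simp
  qed
  have "dinn c x h u v = chart_inn M c x (Gam c x h u) v + chart_inn M c x u (Gam c x h v)" for h
    unfolding sym[of u] koszul[OF c x] using dinn_sym[OF c x, of h u v] dinn_sym[OF c x, of u h v] dinn_sym[OF c x, of v h u] by (simp add: field_simps)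
  then show "((\<lambda>x. chart_inn M c x u v) has_derivative (\<lambda>h. chart_inn M c x (Gam c x h u) v + chart_inn M c x u (Gam c x h v))) (at x)"
    using has_derivative_chart_inn[OF c x, of u v] by simp
  show "((\<lambda>x. Gam c x u v) has_derivative (\<lambda>h. DGam c x h u v)) (at x)"
    unfolding Gam_def DGam_def
    by (intro has_derivative_sum has_derivative_scaleR_left has_derivative_mult_left frechet_christoffel(1)[OF c x])
next
  show "continuous_on (cdom c) (\<lambda>x. DGam c x h u v)" for h u v
    unfolding DGam_def by (intro continuous_intros frechet_christoffel(2)[OF c])
qed

text \<open>Both sides are trilinear, so equality on basis vectors suffices; there the sums collapse
  to a single component \<open>riem\<close>.\<close>

lemma Rm_chart:
  assumes c: "c \<in> atlas M" "x \<in> cdom c"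
  shows "local_metric.Rm (Gam c) (DGam c) x u v w $ l = (\<Sum>i\<in>UNIV. \<Sum>j\<in>UNIV. \<Sum>k\<in>UNIV. riem M c l i j k x * u $ i * v $ j * w $ k)"
proof -
  interpret L: local_metric "cdom c" "chart_inn M c" "Gam c" "DGam c" by (rule local_metric_chart[OF c(1)])
  show ?thesis
  proof (rule trilinear_eq[of "\<lambda>u v w. L.Rm x u v w $ l" "\<lambda>u v w. \<Sum>i\<in>UNIV. \<Sum>j\<in>UNIV. \<Sum>k\<in>UNIV. riem M c l i j k x * u $ i * v $ j * w $ k"])
    have nl: "linear (\<lambda>v::real^'n. v $ l)" by (auto intro!: linearI)
    note R = L.Rm_linear[OF c(2)]
    show "linear (\<lambda>u. L.Rm x u v w $ l)" for v w using linear_compose[OF R(1) nl] by (simp add: o_def)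
    show "linear (\<lambda>v. L.Rm x u v w $ l)" for u w using linear_compose[OF R(2) nl] by (simp add: o_def)
    show "linear (\<lambda>w. L.Rm x u v w $ l)" for u v using linear_compose[OF R(3) nl] by (simp add: o_def)
    show "linear (\<lambda>u. \<Sum>i\<in>UNIV. \<Sum>j\<in>UNIV. \<Sum>k\<in>UNIV. riem M c l i j k x * u $ i * v $ j * w $ k)" for v w
      by (auto intro!: linearI simp: sum.distrib sum_distrib_left algebra_simps)
    show "linear (\<lambda>v. \<Sum>i\<in>UNIV. \<Sum>j\<in>UNIV. \<Sum>k\<in>UNIV. riem M c l i j k x * u $ i * v $ j * w $ k)" for u w
      by (auto intro!: linearI simp: sum.distrib sum_distrib_left algebra_simps)
    show "linear (\<lambda>w. \<Sum>i\<in>UNIV. \<Sum>j\<in>UNIV. \<Sum>k\<in>UNIV. riem M c l i j k x * u $ i * v $ j * w $ k)" for u v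
      by (auto intro!: linearI simp: sum.distrib sum_distrib_left algebra_simps)
    fix u v w :: "real^'n" assume "u \<in> Basis" "v \<in> Basis" "w \<in> Basis"
    then obtain a b d where ax: "u = axis a 1" "v = axis b 1" "w = axis d 1" by (auto simp: Basis_vec_def)
    have "(\<Sum>i\<in>UNIV. \<Sum>j\<in>UNIV. \<Sum>k\<in>UNIV. riem M c l i j k x * u $ i * v $ j * w $ k) = riem M c l a b d x"
    proof -
      have "(\<Sum>i\<in>UNIV. \<Sum>j\<in>UNIV. \<Sum>k\<in>UNIV. riem M c l i j k x * u $ i * v $ j * w $ k)
         = (\<Sum>i\<in>UNIV. (\<Sum>j\<in>UNIV. (\<Sum>k\<in>UNIV. riem M c l i j k x * w $ k) * v $ j) * u $ i)"
        by (simp add: sum_distrib_left sum_distrib_right algebra_simps)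
      then show ?thesis by (simp add: ax)
    qed
    moreover have D: "DGam c x (axis p 1) (axis q 1) (axis d 1) $ l = partial p (christoffel M c l q d) x" for p q
    proof -
      have "DGam c x (axis p 1) (axis q 1) (axis d 1) $ l
         = (\<Sum>i\<in>UNIV. (\<Sum>j\<in>UNIV. frechet_derivative (christoffel M c l i j) (at x) (axis p 1) * axis d 1 $ j) * axis q 1 $ i)"
        unfolding DGam_nth by (simp add: sum_distrib_right algebra_simps)
      then show ?thesis by (simp add: partial_def)
    qed
    moreover have G: "Gam c x (axis p 1) z $ r = (\<Sum>q\<in>UNIV. christoffel M c r p q x * z $ q)" for p r z
      unfolding Gam_nth by (rule sum2_axis)
    ultimately show "L.Rm x u v w $ l = (\<Sum>i\<in>UNIV. \<Sum>j\<in>UNIV. \<Sum>k\<in>UNIV. riem M c l i j k x * u $ i * v $ j * w $ k)"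
      unfolding L.Rm_def riem_def ax by (simp add: sum_subtractf)
  qed
qed

end

section \<open>Curves, covariant derivatives and geodesics read in charts\<close>

lemma Ck_on_mono: "j \<le> k \<Longrightarrow> Ck_on k f S \<Longrightarrow> Ck_on j f S"
proof (induction k)
  case (Suc k)
  then show ?case using Ck_on_Suc_lower[of k f S] by (cases "j = Suc k") auto
qed simp

lemma rich_not_bot:
  fixes S :: "real set"
  assumes "rich S" "x \<in> S" shows "at x within S \<noteq> bot"
proof -
  have "x islimpt S" unfolding islimpt_approachable
  proof (intro allI impI)
    fix e :: real assume "e > 0"
    then obtain d where "0 < \<bar>d\<bar>" "\<bar>d\<bar> < e" "x + d *\<^sub>R 1 \<in> S" using assms unfolding rich_def by (metis Basis_real_def insertI1)
    then show "\<exists>x'\<in>S. x' \<noteq> x \<and> dist x' x < e" by (intro bexI[of _ "x + d"]) (auto simp: dist_real_def)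
  qed
  then show ?thesis by (simp add: trivial_limit_within)
qed

lemma rich_interval: "is_interval I \<Longrightarrow> a \<in> I \<Longrightarrow> b \<in> I \<Longrightarrow> a < b \<Longrightarrow> rich (I::real set)"
  using rich_interval_Int[of I a b UNIV] by simp

context riem_manifold
begin

definition d2trans :: "('a, 'n) chart \<Rightarrow> ('a, 'n) chart \<Rightarrow> real^'n \<Rightarrow> real^'n \<Rightarrow> real^'n \<Rightarrow> real^'n" where
  "d2trans c c' x h u = frechet_derivative (\<lambda>x. dtrans c c' x u) (at x) h"

definition d3trans :: "('a, 'n) chart \<Rightarrow> ('a, 'n) chart \<Rightarrow> real^'n \<Rightarrow> real^'n \<Rightarrow> real^'n \<Rightarrow> real^'n \<Rightarrow> real^'n" where
  "d3trans c c' x h v u = frechet_derivative (\<lambda>x. d2trans c c' x v u) (at x) h"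

lemma Ck_on_frechet:
  fixes f :: "real^'m \<Rightarrow> 'b::real_normed_vector"
  assumes S: "open S" and f: "Ck_on (Suc k) f S"
  shows "x \<in> S \<Longrightarrow> (f has_derivative frechet_derivative f (at x)) (at x)"
    and "Ck_on k (\<lambda>x. frechet_derivative f (at x) h) S"
proof -
  obtain f' where f': "\<And>x. x \<in> S \<Longrightarrow> (f has_derivative f' x) (at x)" "\<And>v. Ck_on k (\<lambda>x. f' x v) S"
    by (rule open_Ck_on_SucD[OF f S]) blast
  have e: "frechet_derivative f (at x) = f' x" if "x \<in> S" for x
    using frechet_derivative_at[OF f'(1)[OF that]] by simp
  show "x \<in> S \<Longrightarrow> (f has_derivative frechet_derivative f (at x)) (at x)" using f'(1) e by simp
  show "Ck_on k (\<lambda>x. frechet_derivative f (at x) h) S"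
    using f'(2)[of h] Ck_on_cong[of S "\<lambda>x. f' x h" "\<lambda>x. frechet_derivative f (at x) h" k] e by simp
qed

lemma isometry_trans:
  assumes c: "c \<in> atlas M" and c': "c' \<in> atlas M"
  shows "isometry (cdom c) (chart_inn M c) (Gam c) (DGam c) (cdom c') (chart_inn M c') (Gam c') (DGam c')
     (overlap c c') (trans c c') (dtrans c c') (d2trans c c') (d3trans c c')"
proof -
  note O = open_overlap[OF c c']
  have C2: "Ck_on (Suc (Suc 0)) (\<lambda>x. dtrans c c' x v) (overlap c c')" for v
    using Ck_dtrans[OF c c', of v] by (simp add: numeral_2_eq_2)
  have D2: "((\<lambda>x. dtrans c c' x u) has_derivative (\<lambda>h. d2trans c c' x h u)) (at x)" if "x \<in> overlap c c'" for x u
    unfolding d2trans_def using Ck_on_frechet(1)[OF O C2 that] by simp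
  have C1: "Ck_on (Suc 0) (\<lambda>x. d2trans c c' x h u) (overlap c c')" for h u
    unfolding d2trans_def by (rule Ck_on_frechet(2)[OF O C2])
  have D3: "((\<lambda>x. d2trans c c' x v u) has_derivative (\<lambda>h. d3trans c c' x h v u)) (at x)" if "x \<in> overlap c c'" for x v u
    unfolding d3trans_def using Ck_on_frechet(1)[OF O C1 that] by simp
  have C0: "continuous_on (overlap c c') (\<lambda>x. d3trans c c' x h v u)" for h v u
    unfolding d3trans_def using Ck_on_frechet(2)[OF O C1[of v u], of h] by simp
  have q: "chart_inv c x \<in> fst c \<and> chart_inv c x \<in> fst c' \<and> snd c (chart_inv c x) = x" if "x \<in> overlap c c'" for x
    using that c by auto
  interpret A: local_metric "cdom c" "chart_inn M c" "Gam c" "DGam c" by (rule local_metric_chart[OF c])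
  interpret B: local_metric "cdom c'" "chart_inn M c'" "Gam c'" "DGam c'" by (rule local_metric_chart[OF c'])
  show ?thesis
  proof (unfold_locales)
    fix x assume x: "x \<in> overlap c c'"
    show "surj (dtrans c c' x)"
    proof (rule surjI)
      fix w
      have "chart_inv c x \<in> fst c" "chart_inv c x \<in> fst c'" "snd c (chart_inv c x) = x" using q[OF x] by auto
      then show "dtrans c c' x (dtrans c' c (trans c c' x) w) = w"
        using dtrans_cocycle[OF c' c c', of "chart_inv c x" w] dtrans_id[OF c', of "trans c c' x" w] by simp
    qed
    show "chart_inn M c x u v = chart_inn M c' (trans c c' x) (dtrans c c' x u) (dtrans c c' x v)" for u v
      unfolding chart_inn_def using q[OF x] chart_vec_change[OF c c', of "chart_inv c x"] c c' by simp
  next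
    show "trans c c' ` overlap c c' \<subseteq> cdom c'" using q by auto
  qed (use O D2 D3 C0 has_derivative_trans[OF c c'] in auto)
qed

text \<open>The families of components produced by \<open>curvature\<close> in the various charts
  form one tangent vector, because transition maps carry curvature to curvature.\<close>

lemma curvature_chart:
  assumes c: "c \<in> atlas M" "q \<in> fst c" and t: "u \<in> tangent_space M q" "v \<in> tangent_space M q" "w \<in> tangent_space M q"
  shows "curvature M q u v w = chart_vec M c q (local_metric.Rm (Gam c) (DGam c) (snd c q) (u c) (v c) (w c))"
proof
  fix c'
  show "curvature M q u v w c' = chart_vec M c q (local_metric.Rm (Gam c) (DGam c) (snd c q) (u c) (v c) (w c)) c'"
  proof (cases "c' \<in> atlas M \<and> q \<in> fst c'")
    case True
    then have c': "c' \<in> atlas M" "q \<in> fst c'" by auto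
    interpret I: isometry "cdom c" "chart_inn M c" "Gam c" "DGam c" "cdom c'" "chart_inn M c'" "Gam c'" "DGam c'"
       "overlap c c'" "trans c c'" "dtrans c c'" "d2trans c c'" "d3trans c c'"
      by (rule isometry_trans[OF c(1) c'(1)])
    have x: "snd c q \<in> overlap c c'" using c c' by auto
    have e: "z c' = dtrans c c' (snd c q) (z c)" if "z \<in> tangent_space M q" for z
      using tangent_chart[OF that c] chart_vec_eq[OF c'] by metis
    have x': "snd c' q \<in> cdom c'" using c' by auto
    have "curvature M q u v w c' = I.B.Rm (snd c' q) (u c') (v c') (w c')"
      using c' by (simp add: curvature_def vec_eq_iff Rm_chart[OF c'(1) x'])
    also have "\<dots> = dtrans c c' (snd c q) (I.A.Rm (snd c q) (u c) (v c) (w c))"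
      using I.curvature_transform[OF x, of "u c" "v c" "w c"] c e[OF t(1)] e[OF t(2)] e[OF t(3)] by simp
    finally show ?thesis by (simp add: chart_vec_eq[OF c'])
  next
    case False
    then have "chart_vec M c q z c' = 0" "curvature M q u v w c' = 0" for z by (auto simp: chart_vec_def curvature_def)
    then show ?thesis by simp
  qed
qed

lemma curve_near:
  assumes cont: "continuous_map (top_of_set I) (mtop M) \<alpha>" and s: "s \<in> I" and S: "openin (mtop M) S" "\<alpha> s \<in> S"
  shows "\<forall>\<^sub>F t in at s within I. \<alpha> t \<in> S"
proof -
  have "openin (top_of_set I) {t \<in> I. \<alpha> t \<in> S}"
    using openin_continuous_map_preimage[OF cont S(1)] by simp
  then obtain Q where Q: "open Q" "{t \<in> I. \<alpha> t \<in> S} = I \<inter> Q" by (auto simp: openin_open)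
  then have "s \<in> Q" using s S by blast
  then show ?thesis unfolding eventually_at_topological using Q by blast
qed

lemma velocity_chart:
  assumes c: "c \<in> atlas M" "\<alpha> s \<in> fst c" and cont: "continuous_map (top_of_set I) (mtop M) \<alpha>" and s: "s \<in> I" "at s within I \<noteq> bot"
    and dx: "((\<lambda>t. snd c (\<alpha> t)) has_vector_derivative x') (at s within I)"
  shows "velocity M I \<alpha> s = chart_vec M c (\<alpha> s) x'"
    and "c' \<in> atlas M \<Longrightarrow> \<alpha> s \<in> fst c' \<Longrightarrow> ((\<lambda>t. snd c' (\<alpha> t)) has_vector_derivative dtrans c c' (snd c (\<alpha> s)) x') (at s within I)"
proof -
  show D: "((\<lambda>t. snd c' (\<alpha> t)) has_vector_derivative dtrans c c' (snd c (\<alpha> s)) x') (at s within I)"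
    if c': "c' \<in> atlas M" "\<alpha> s \<in> fst c'" for c'
  proof -
    have x: "snd c (\<alpha> s) \<in> overlap c c'" using c c' by auto
    have "((\<lambda>t. trans c c' (snd c (\<alpha> t))) has_derivative (\<lambda>h. h *\<^sub>R dtrans c c' (snd c (\<alpha> s)) x')) (at s within I)"
      by (rule has_vector_derivative_chain[OF has_derivative_trans[OF c(1) c'(1) x] dx, unfolded has_vector_derivative_def])
    then have "((\<lambda>t. snd c' (\<alpha> t)) has_derivative (\<lambda>h. h *\<^sub>R dtrans c c' (snd c (\<alpha> s)) x')) (at s within I)"
    proof (rule has_derivative_transform_eventually)
      show "\<forall>\<^sub>F t in at s within I. trans c c' (snd c (\<alpha> t)) = snd c' (\<alpha> t)"
        using curve_near[OF cont s(1) chart_openin[OF c(1)] c(2)] by eventually_elim (simp add: c)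
    qed (use c s in auto)
    then show ?thesis by (simp add: has_vector_derivative_def)
  qed
  show "velocity M I \<alpha> s = chart_vec M c (\<alpha> s) x'"
  proof
    fix c'
    show "velocity M I \<alpha> s c' = chart_vec M c (\<alpha> s) x' c'"
    proof (cases "c' \<in> atlas M \<and> \<alpha> s \<in> fst c'")
      case True
      then show ?thesis using vector_derivative_within[OF s(2) D] by (simp add: velocity_def chart_vec_eq)
    next
      case False
      then show ?thesis by (auto simp: velocity_def chart_vec_def)
    qed
  qed
qed

text \<open>The derivative of the components in a second chart contains the second derivative of the
  transition map; the transformation law of \<Gamma> absorbs it, so the covariant derivative is one
  tangent vector and may be computed in any chart.\<close>

lemma cov_deriv_chart:
  assumes c: "c \<in> atlas M" "\<alpha> s \<in> fst c" and cont: "continuous_map (top_of_set I) (mtop M) \<alpha>" and s: "s \<in> I" "at s within I \<noteq> bot"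
    and dx: "((\<lambda>t. snd c (\<alpha> t)) has_vector_derivative x') (at s within I)"
    and X: "\<And>t. t \<in> I \<Longrightarrow> X t \<in> tangent_space M (\<alpha> t)"
    and dX: "((\<lambda>t. X t c) has_vector_derivative X') (at s within I)"
  shows "cov_deriv M I \<alpha> X s = chart_vec M c (\<alpha> s) (X' + Gam c (snd c (\<alpha> s)) x' (X s c))"
proof
  fix c'
  show "cov_deriv M I \<alpha> X s c' = chart_vec M c (\<alpha> s) (X' + Gam c (snd c (\<alpha> s)) x' (X s c)) c'"
  proof (cases "c' \<in> atlas M \<and> \<alpha> s \<in> fst c'")
    case True
    then have c': "c' \<in> atlas M" "\<alpha> s \<in> fst c'" by auto
    interpret I: isometry "cdom c" "chart_inn M c" "Gam c" "DGam c" "cdom c'" "chart_inn M c'" "Gam c'" "DGam c'"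
       "overlap c c'" "trans c c'" "dtrans c c'" "d2trans c c'" "d3trans c c'"
      by (rule isometry_trans[OF c(1) c'(1)])
    let ?x = "snd c (\<alpha> s)"
    have x: "?x \<in> overlap c c'" using c c' by auto
    have e: "X t c' = dtrans c c' (snd c (\<alpha> t)) (X t c)" if "t \<in> I" "\<alpha> t \<in> fst c" "\<alpha> t \<in> fst c'" for t
      using tangent_chart[OF X[OF that(1)] c(1) that(2)] chart_vec_eq[OF c'(1) that(3)] by metis
    have "((\<lambda>t. dtrans c c' (snd c (\<alpha> t)) (X t c)) has_derivative
       (\<lambda>h. d2trans c c' ?x (h *\<^sub>R x') (X s c) + dtrans c c' ?x (h *\<^sub>R X'))) (at s within I)"
      by (rule has_derivative_linear_family[OF I.open_W _ I.lin1 I.d2[OF x] dx[unfolded has_vector_derivative_def] dX[unfolded has_vector_derivative_def] s(1)])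
         (use x in auto)
    then have "((\<lambda>t. dtrans c c' (snd c (\<alpha> t)) (X t c)) has_vector_derivative
       d2trans c c' ?x x' (X s c) + dtrans c c' ?x X') (at s within I)"
      unfolding has_vector_derivative_def
      by (simp add: linear_scale[OF I.lin1[OF x]] linear_scale[OF has_derivative_linear[OF I.d2[OF x]]] scaleR_add_right)
    then have "((\<lambda>t. X t c') has_vector_derivative d2trans c c' ?x x' (X s c) + dtrans c c' ?x X') (at s within I)"
      unfolding has_vector_derivative_def
    proof (rule has_derivative_transform_eventually)
      have "\<forall>\<^sub>F t in at s within I. t \<in> I" by (simp add: eventually_at_filter)
      then show "\<forall>\<^sub>F t in at s within I. dtrans c c' (snd c (\<alpha> t)) (X t c) = X t c'"
        using curve_near[OF cont s(1) chart_openin[OF c(1)] c(2)] curve_near[OF cont s(1) chart_openin[OF c'(1)] c'(2)]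
        by eventually_elim (simp add: e)
    qed (use e[OF s(1) c(2) c'(2)] s in auto)
    from vector_derivative_within[OF s(2) this]
    have vd: "vector_derivative (\<lambda>t. X t c') (at s within I) = d2trans c c' ?x x' (X s c) + dtrans c c' ?x X'" .
    have vel: "velocity M I \<alpha> s c' = dtrans c c' ?x x'"
      using velocity_chart(1)[OF c cont s dx] chart_vec_eq[OF c'] by simp
    have "cov_deriv M I \<alpha> X s c' = vector_derivative (\<lambda>t. X t c') (at s within I) + Gam c' (snd c' (\<alpha> s)) (velocity M I \<alpha> s c') (X s c')"
      using c' by (simp add: cov_deriv_def vec_eq_iff Gam_nth)
    also have "\<dots> = dtrans c c' ?x X' + (d2trans c c' ?x x' (X s c) + Gam c' (trans c c' ?x) (dtrans c c' ?x x') (dtrans c c' ?x (X s c)))"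
      unfolding vd vel e[OF s(1) c(2) c'(2)] using c by simp
    also have "\<dots> = dtrans c c' ?x (X' + Gam c ?x x' (X s c))"
      using I.gamma_transform[OF x, of x' "X s c"] linear_add[OF I.lin1[OF x]] by simp
    finally show ?thesis by (simp add: chart_vec_eq[OF c'])
  next
    case False
    then show ?thesis by (auto simp: cov_deriv_def chart_vec_def)
  qed
qed

text \<open>The times at which the curve lies in a second chart form a relatively open subset of the
  interval. Such sets are \<open>rich\<close>, as the closure properties of \<open>Ck_on\<close>
  require.\<close>

lemma chart_curve_overlap:
  fixes I :: "real set"
  assumes c: "c \<in> atlas M" "c' \<in> atlas M" and I: "is_interval I" "a \<in> I" "b \<in> I" "a < b"
    and x: "continuous_on I x" "x ` I \<subseteq> cdom c"
  shows "rich {t\<in>I. chart_inv c (x t) \<in> fst c'}" "x ` {t\<in>I. chart_inv c (x t) \<in> fst c'} \<subseteq> overlap c c'"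
proof -
  have e: "chart_inv c (x t) \<in> fst c' \<longleftrightarrow> x t \<in> overlap c c'" if "t \<in> I" for t
  proof -
    have "x t \<in> cdom c" using x that by auto
    then obtain q where q: "q \<in> fst c" "x t = snd c q" by auto
    then show ?thesis using c inj_onD[OF chart_inj[OF c(1)]] by auto
  qed
  obtain Q where Q: "open Q" "Q \<inter> I = x -` overlap c c' \<inter> I"
    using x(1) open_overlap[OF c] unfolding continuous_on_open_invariant by blast
  have "{t\<in>I. chart_inv c (x t) \<in> fst c'} = I \<inter> Q" using e Q(2) by (simp add: set_eq_iff) blast
  then show "rich {t\<in>I. chart_inv c (x t) \<in> fst c'}" using rich_interval_Int[OF I Q(1)] by simp
  show "x ` {t\<in>I. chart_inv c (x t) \<in> fst c'} \<subseteq> overlap c c'" using e by (simp only: image_subset_iff mem_Collect_eq) blast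
qed

lemma chart_curve_continuous:
  fixes I :: "real set"
  assumes c: "c \<in> atlas M" and x: "continuous_on I x" "x ` I \<subseteq> cdom c"
  shows "continuous_map (top_of_set I) (mtop M) (\<lambda>t. chart_inv c (x t))"
proof -
  have "continuous_map (top_of_set I) (top_of_set (cdom c)) x" using x by (auto simp: continuous_map_subtopology_eu)
  from continuous_map_compose[OF this continuous_chart_inv[OF c]] show ?thesis by (simp add: o_def)
qed

lemma Ck_curve_chart:
  fixes I :: "real set"
  assumes c: "c \<in> atlas M" and I: "is_interval I" "a \<in> I" "b \<in> I" "a < b" and k: "k \<le> 3"
    and x: "Ck_on k x I" "x ` I \<subseteq> cdom c"
  shows "Ck_curve M k I (\<lambda>t. chart_inv c (x t))"
  unfolding Ck_curve_def
proof (intro conjI ballI)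
  have cx: "continuous_on I x" using Ck_on_mono[of 0 k x I] x by simp
  show "continuous_map (top_of_set I) (mtop M) (\<lambda>t. chart_inv c (x t))" by (rule chart_curve_continuous[OF c cx x(2)])
  fix c' assume c': "c' \<in> atlas M"
  let ?S = "{t \<in> I. chart_inv c (x t) \<in> fst c'}"
  note S = chart_curve_overlap[OF c c' I cx x(2)]
  have "Ck_on k (\<lambda>t. trans c c' (x t)) ?S"
    by (rule Ck_on_compose[OF S(1) open_overlap[OF c c'] S(2) Ck_on_mono[OF k trans_C3[OF c c']] Ck_on_subset[OF S(1) _ x(1)]]) auto
  then show "Ck_on k (\<lambda>t. snd c' (chart_inv c (x t))) ?S" by simp
qed (use I in auto)

lemma C1_field_chart:
  fixes I :: "real set"
  assumes c: "c \<in> atlas M" and I: "is_interval I" "a \<in> I" "b \<in> I" "a < b"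
    and x: "Ck_on 1 x I" "x ` I \<subseteq> cdom c" and X: "Ck_on 1 X I"
  shows "C1_field_along M I (\<lambda>t. chart_inv c (x t)) (\<lambda>t. chart_vec M c (chart_inv c (x t)) (X t))"
  unfolding C1_field_along_def
proof (intro conjI ballI)
  have cx: "continuous_on I x" using Ck_on_mono[of 0 1 x I] x by simp
  show "chart_vec M c (chart_inv c (x s)) (X s) \<in> tangent_space M (chart_inv c (x s))" if "s \<in> I" for s
    by (rule chart_vec_tangent[OF c chart_inv_in]) (use x that in auto)
  fix c' assume c': "c' \<in> atlas M"
  let ?S = "{t \<in> I. chart_inv c (x t) \<in> fst c'}"
  note S = chart_curve_overlap[OF c c' I cx x(2)]
  have sub: "?S \<subseteq> I" by auto
  have "Ck_on 1 (\<lambda>t. \<Sum>i\<in>Basis. (X t \<bullet> i) *\<^sub>R dtrans c c' (x t) i) ?S"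
    by (intro Ck_on_sum Ck_on_scaleR Ck_on_inner_left Ck_on_subset[OF S(1) sub X] S(1)
        Ck_on_compose[OF S(1) open_overlap[OF c c'] S(2) Ck_on_mono[OF _ Ck_dtrans[OF c c']] Ck_on_subset[OF S(1) sub x(1)]]) auto
  moreover have "(\<Sum>i\<in>Basis. (X t \<bullet> i) *\<^sub>R dtrans c c' (x t) i) = chart_vec M c (chart_inv c (x t)) (X t) c'" if t: "t \<in> ?S" for t
  proof -
    have o: "x t \<in> overlap c c'" using S(2) t by auto
    have "snd c (chart_inv c (x t)) = x t" by (rule chart_inv_right) (use x t in auto)
    then show ?thesis using linear_Basis_expand[OF linear_dtrans[OF c c' o], of "X t"] chart_vec_eq[OF c', of "chart_inv c (x t)" c] t by simp
  qed
  ultimately show "Ck_on 1 (\<lambda>t. chart_vec M c (chart_inv c (x t)) (X t) c') ?S"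
    using Ck_on_cong[of ?S "\<lambda>t. \<Sum>i\<in>Basis. (X t \<bullet> i) *\<^sub>R dtrans c c' (x t) i" "\<lambda>t. chart_vec M c (chart_inv c (x t)) (X t) c'" 1] by blast
qed

end

context riem_manifold
begin

lemma curve_preimage:
  fixes I :: "real set"
  assumes cont: "continuous_map (top_of_set I) (mtop M) \<alpha>" and c: "c \<in> atlas M"
  obtains Q where "open Q" "{t \<in> I. \<alpha> t \<in> fst c} = I \<inter> Q"
proof -
  have "openin (top_of_set I) {t \<in> I. \<alpha> t \<in> fst c}"
    using openin_continuous_map_preimage[OF cont chart_openin[OF c]] by simp
  then show ?thesis using that by (auto simp: openin_open)
qed

text \<open>Velocities are derivatives within \<open>I\<close>, whereas \<open>Ck_on\<close> speaks
  of derivatives within the preimage of the chart. The preimage is relatively open, so the two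
  agree.\<close>

lemma curve_at_within:
  fixes I :: "real set"
  assumes cont: "continuous_map (top_of_set I) (mtop M) \<alpha>" and s: "s \<in> I" and c: "c \<in> atlas M" "\<alpha> s \<in> fst c"
  shows "at s within {t\<in>I. \<alpha> t \<in> fst c} = at s within I"
proof -
  obtain Q where Q: "open Q" "{t \<in> I. \<alpha> t \<in> fst c} = I \<inter> Q" by (rule curve_preimage[OF cont c(1)]) blast
  have "s \<in> I \<inter> Q" unfolding Q(2)[symmetric] using s c by simp
  then show ?thesis unfolding Q(2) by (intro at_within_nhd[of s Q]) (use Q(1) in auto)
qed

lemma Ck_curveD:
  assumes "Ck_curve M k I \<alpha>"
  shows "is_interval I" "continuous_map (top_of_set I) (mtop M) \<alpha>" "s \<in> I \<Longrightarrow> at s within I \<noteq> bot"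
    and "c \<in> atlas M \<Longrightarrow> Ck_on k (\<lambda>t. snd c (\<alpha> t)) {t\<in>I. \<alpha> t \<in> fst c}"
    and "s \<in> I \<Longrightarrow> \<exists>c\<in>atlas M. \<alpha> s \<in> fst c"
proof -
  show I: "is_interval I" and cont: "continuous_map (top_of_set I) (mtop M) \<alpha>"
   and "c \<in> atlas M \<Longrightarrow> Ck_on k (\<lambda>t. snd c (\<alpha> t)) {t\<in>I. \<alpha> t \<in> fst c}"
    using assms unfolding Ck_curve_def by auto
  obtain a b where ab: "a \<in> I" "b \<in> I" "a < b" using assms unfolding Ck_curve_def by auto
  show "at s within I \<noteq> bot" if "s \<in> I" by (rule rich_not_bot[OF rich_interval[OF I ab] that])
  assume "s \<in> I"
  then have "\<alpha> s \<in> topspace (mtop M)" using cont unfolding continuous_map_def by auto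
  then show "\<exists>c\<in>atlas M. \<alpha> s \<in> fst c" using topspace_charts by blast
qed

lemma curve_derivative:
  assumes C: "Ck_curve M k I \<alpha>" and k: "1 \<le> k" and s: "s \<in> I" and c: "c \<in> atlas M" "\<alpha> s \<in> fst c"
  shows "((\<lambda>t. snd c (\<alpha> t)) has_vector_derivative velocity M I \<alpha> s c) (at s within I)"
proof -
  have "Ck_on (Suc 0) (\<lambda>t. snd c (\<alpha> t)) {t\<in>I. \<alpha> t \<in> fst c}" by (rule Ck_on_mono[OF _ Ck_curveD(4)[OF C c(1)]]) (use k in simp)
  then obtain f' where "\<And>t. t \<in> {t\<in>I. \<alpha> t \<in> fst c} \<Longrightarrow> ((\<lambda>t. snd c (\<alpha> t)) has_vector_derivative f' t) (at t within {t\<in>I. \<alpha> t \<in> fst c})"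
    by (rule Ck_on_vector_SucD) blast
  from this[of s] have d: "((\<lambda>t. snd c (\<alpha> t)) has_vector_derivative f' s) (at s within I)"
    using s c curve_at_within[OF Ck_curveD(2)[OF C] s c] by simp
  then show ?thesis using vector_derivative_within[OF Ck_curveD(3)[OF C s] d] c by (simp add: velocity_def)
qed

lemma curve_velocity:
  assumes C: "Ck_curve M k I \<alpha>" and k: "1 \<le> k" and s: "s \<in> I"
  shows "velocity M I \<alpha> s \<in> tangent_space M (\<alpha> s)"
proof -
  obtain c where c: "c \<in> atlas M" "\<alpha> s \<in> fst c" using Ck_curveD(5)[OF C s] by blast
  show ?thesis
    by (rule ssubst[where P="\<lambda>v. v \<in> tangent_space M (\<alpha> s)", OF velocity_chart(1)[where c=c and \<alpha>=\<alpha>, OF c Ck_curveD(2)[OF C] s Ck_curveD(3)[OF C s] curve_derivative[OF C k s c]] chart_vec_tangent[OF c]])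
qed

lemma field_derivative:
  assumes C: "Ck_curve M k I \<alpha>" and X: "C1_field_along M I \<alpha> X" and s: "s \<in> I" and c: "c \<in> atlas M" "\<alpha> s \<in> fst c"
  shows "\<exists>X'. ((\<lambda>t. X t c) has_vector_derivative X') (at s within I)"
proof -
  have "Ck_on (Suc 0) (\<lambda>t. X t c) {t\<in>I. \<alpha> t \<in> fst c}" using X c unfolding C1_field_along_def by simp
  then obtain f' where "\<And>t. t \<in> {t\<in>I. \<alpha> t \<in> fst c} \<Longrightarrow> ((\<lambda>t. X t c) has_vector_derivative f' t) (at t within {t\<in>I. \<alpha> t \<in> fst c})"
    by (rule Ck_on_vector_SucD) blast
  from this[of s] have "((\<lambda>t. X t c) has_vector_derivative f' s) (at s within I)"
    using s c curve_at_within[OF Ck_curveD(2)[OF C] s c] by simp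
  then show ?thesis by blast
qed

lemma velocity_C1_field:
  assumes C: "Ck_curve M 2 I \<alpha>"
  shows "C1_field_along M I \<alpha> (velocity M I \<alpha>)"
  unfolding C1_field_along_def
proof (intro conjI ballI)
  show "velocity M I \<alpha> s \<in> tangent_space M (\<alpha> s)" if "s \<in> I" for s by (rule curve_velocity[OF C _ that]) simp
  fix c assume c: "c \<in> atlas M"
  let ?S = "{t\<in>I. \<alpha> t \<in> fst c}"
  have "Ck_on (Suc 1) (\<lambda>t. snd c (\<alpha> t)) ?S" using Ck_curveD(4)[OF C c] by (simp add: numeral_2_eq_2)
  then obtain f' where f': "\<And>t. t \<in> ?S \<Longrightarrow> ((\<lambda>t. snd c (\<alpha> t)) has_vector_derivative f' t) (at t within ?S)" "Ck_on 1 f' ?S"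
    by (rule Ck_on_vector_SucD) blast
  have "f' t = velocity M I \<alpha> t c" if t: "t \<in> ?S" for t
  proof -
    have t': "t \<in> I" "\<alpha> t \<in> fst c" using t by auto
    have "((\<lambda>t. snd c (\<alpha> t)) has_vector_derivative f' t) (at t within I)"
      using f'(1)[OF t] curve_at_within[OF Ck_curveD(2)[OF C] t'(1) c t'(2)] by simp
    then show ?thesis using vector_derivative_within[OF Ck_curveD(3)[OF C t'(1)], of "\<lambda>t. snd c (\<alpha> t)"] c t' by (simp add: velocity_def)
  qed
  then show "Ck_on 1 (\<lambda>t. velocity M I \<alpha> t c) ?S"
    using f'(2) Ck_on_cong[of ?S f' "\<lambda>t. velocity M I \<alpha> t c" 1] by blast
qed

lemma geodesic_chart:
  assumes G: "geodesic M I \<gamma>" and s: "s \<in> I" and c: "c \<in> atlas M" "\<gamma> s \<in> fst c"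
  shows "((\<lambda>t. velocity M I \<gamma> t c) has_vector_derivative
     - Gam c (snd c (\<gamma> s)) (velocity M I \<gamma> s c) (velocity M I \<gamma> s c)) (at s within I)"
proof -
  have C: "Ck_curve M 2 I \<gamma>" and z: "cov_deriv M I \<gamma> (velocity M I \<gamma>) s = zero_vec" using G s by (auto simp: geodesic_def)
  obtain X' where X': "((\<lambda>t. velocity M I \<gamma> t c) has_vector_derivative X') (at s within I)"
    using field_derivative[OF C velocity_C1_field[OF C] s c] by blast
  have "cov_deriv M I \<gamma> (velocity M I \<gamma>) s = chart_vec M c (\<gamma> s) (X' + Gam c (snd c (\<gamma> s)) (velocity M I \<gamma> s c) (velocity M I \<gamma> s c))"
    by (rule cov_deriv_chart[where \<alpha>=\<gamma>, OF c Ck_curveD(2)[OF C] s Ck_curveD(3)[OF C s]])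
       (use curve_velocity[OF C] curve_derivative[OF C _ s c] X' in simp_all)
  then have "zero_vec c = chart_vec M c (\<gamma> s) (X' + Gam c (snd c (\<gamma> s)) (velocity M I \<gamma> s c) (velocity M I \<gamma> s c)) c"
    using z by simp
  then have "X' + Gam c (snd c (\<gamma> s)) (velocity M I \<gamma> s c) (velocity M I \<gamma> s c) = 0"
    by (simp add: chart_vec_self[OF c] zero_vec_def)
  then have "X' = - Gam c (snd c (\<gamma> s)) (velocity M I \<gamma> s c) (velocity M I \<gamma> s c)" by (simp add: add_eq_0_iff2)
  then show ?thesis using X' by simp
qed

text \<open>Continuation to the supremum of the times up to which the geodesics agree. Agreement at
  the supremum follows from the Hausdorff property, agreement beyond it from local uniqueness in a
  chart around that point.\<close>

lemma geodesic_unique: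
  assumes G: "geodesic M {0..1} \<gamma>" "geodesic M {0..1} \<gamma>'"
    and i: "\<gamma>' 0 = \<gamma> 0" "velocity M {0..1} \<gamma>' 0 = velocity M {0..1} \<gamma> 0" and t: "t \<in> {0..1}"
  shows "\<gamma>' t = \<gamma> t"
proof -
  have C: "Ck_curve M 2 {0..1} \<gamma>" and C': "Ck_curve M 2 {0..1} \<gamma>'" using G by (auto simp: geodesic_def)
  define A where "A = {t\<in>{0..1}. \<forall>s\<in>{0..t}. \<gamma>' s = \<gamma> s}"
  define T where "T = Sup A"
  have A0: "0 \<in> A" using i by (auto simp: A_def)
  have bdd: "bdd_above A" by (rule bdd_aboveI[of _ 1]) (auto simp: A_def)
  have T: "0 \<le> T" "T \<le> 1"
  proof -
    show "0 \<le> T" unfolding T_def by (rule cSup_upper[OF A0 bdd])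
    show "T \<le> 1" unfolding T_def
    proof (rule cSup_least)
      show "A \<noteq> {}" using A0 by blast
    qed (simp add: A_def)
  qed
  have lt: "\<gamma>' s = \<gamma> s" if "s \<in> {0..<T}" for s
  proof -
    have "s < Sup A" using that by (simp add: T_def)
    then obtain t where "t \<in> A" "s < t" using less_cSup_iff[of A s] A0 bdd by blast
    then show ?thesis using that by (auto simp: A_def)
  qed
  have eqT: "\<gamma>' T = \<gamma> T"
  proof (cases "T = 0")
    case False
    have "closedin (top_of_set {0..1}) {t \<in> topspace (top_of_set {0..1}). \<gamma>' t = \<gamma> t}"
      by (rule closedin_continuous_maps_eq[OF _ Ck_curveD(2)[OF C'] Ck_curveD(2)[OF C]])
         (use riem in \<open>simp add: riemannian_manifold_def\<close>)
    then have "closed {t \<in> topspace (top_of_set {0..1}). \<gamma>' t = \<gamma> t}" by (rule closedin_closed_trans) simp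
    then have "closed {t \<in> {0..1}. \<gamma>' t = \<gamma> t}" by simp
    moreover have "{0..<T} \<subseteq> {t \<in> {0..1}. \<gamma>' t = \<gamma> t}" using lt T by auto
    ultimately have "closure {0..<T} \<subseteq> {t \<in> {0..1}. \<gamma>' t = \<gamma> t}" by (rule closure_minimal[rotated])
    moreover have "T \<in> closure {0..<T}" using False T by simp
    ultimately show ?thesis by blast
  qed (simp add: i)
  have le: "\<gamma>' s = \<gamma> s" if "s \<in> {0..T}" for s using lt[of s] eqT that by (cases "s = T") auto
  have T01: "T \<in> {0..1}" using T by auto
  obtain c where c: "c \<in> atlas M" "\<gamma> T \<in> fst c" using Ck_curveD(5)[OF C T01] by blast
  have c': "\<gamma>' T \<in> fst c" using c eqT by simp
  note D = curve_derivative[OF C _ _ c(1)] and D' = curve_derivative[OF C' _ _ c(1)]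
  \<comment> \<open>Local uniqueness also needs equal velocities at \<open>T\<close>. For positive
    \<open>T\<close> both are the derivative from the left of the same curve; for
    \<open>T = 0\<close> they are given.\<close>
  have vT: "velocity M {0..1} \<gamma>' T c = velocity M {0..1} \<gamma> T c"
  proof (cases "T = 0")
    case False
    have sub: "{0..T} \<subseteq> {0..1}" using T by auto
    have "((\<lambda>t. snd c (\<gamma> t)) has_vector_derivative velocity M {0..1} \<gamma> T c) (at T within {0..T})"
      by (rule has_vector_derivative_within_subset[OF D sub]) (use T01 c in auto)
    moreover have "((\<lambda>t. snd c (\<gamma>' t)) has_vector_derivative velocity M {0..1} \<gamma>' T c) (at T within {0..T})"
      by (rule has_vector_derivative_within_subset[OF D' sub]) (use T01 c' in auto)
    then have "((\<lambda>t. snd c (\<gamma> t)) has_vector_derivative velocity M {0..1} \<gamma>' T c) (at T within {0..T})"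
      by (rule has_vector_derivative_transform[rotated 2]) (use le T in auto)
    ultimately show ?thesis
      by (rule vector_derivative_unique_within[OF rich_not_bot[OF rich_interval[of "{0..T}" 0 T]], symmetric, rotated 5])
        (use T False in \<open>auto simp: is_interval_cc\<close>)
  qed (simp add: i)
  have "T = 1"
  proof (rule ccontr)
    assume "T \<noteq> 1"
    then have T1: "T < 1" using T by simp
    have "\<forall>\<^sub>F t in at T within {0..1}. \<gamma> t \<in> fst c \<and> \<gamma>' t \<in> fst c"
      using curve_near[OF Ck_curveD(2)[OF C] T01 chart_openin[OF c(1)] c(2)]
        curve_near[OF Ck_curveD(2)[OF C'] T01 chart_openin[OF c(1)] c'] by eventually_elim simp
    then obtain d where d: "d > 0" "\<And>t. t \<in> {0..1} \<Longrightarrow> t \<noteq> T \<Longrightarrow> dist t T < d \<Longrightarrow> \<gamma> t \<in> fst c \<and> \<gamma>' t \<in> fst c"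
      unfolding eventually_at by blast
    define b where "b = min 1 (T + d/2)"
    have b: "T < b" "b \<le> 1" "b < T + d" using T1 d by (auto simp: b_def)
    have sub: "{T..b} \<subseteq> {0..1}" using T b by auto
    have in': "\<gamma> t \<in> fst c \<and> \<gamma>' t \<in> fst c" if "t \<in> {T..b}" for t
      using d(2)[of t] c c' that b sub by (cases "t = T") (auto simp: dist_real_def)
    interpret L: local_metric "cdom c" "chart_inn M c" "Gam c" "DGam c" by (rule local_metric_chart[OF c(1)])
    have "\<exists>e>0. T + e \<le> b \<and> (\<forall>t\<in>{T..T+e}. snd c (\<gamma> t) = snd c (\<gamma>' t))"
    proof (rule L.geodesic_locally_unique[of T b "\<lambda>t. snd c (\<gamma> t)" "\<lambda>t. snd c (\<gamma>' t)"
          "\<lambda>t. velocity M {0..1} \<gamma>' t c" "\<lambda>t. velocity M {0..1} \<gamma> t c"])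
      show "snd c (\<gamma>' T) = snd c (\<gamma> T)" by (simp add: eqT)
      show "snd c (\<gamma> T) \<in> cdom c" using c by simp
      show "((\<lambda>t. snd c (\<gamma> t)) has_vector_derivative velocity M {0..1} \<gamma> t c) (at t within {T..b})" if t: "t \<in> {T..b}" for t
        by (rule has_vector_derivative_within_subset[OF D sub]) (use t in' sub in auto)
      show "((\<lambda>t. snd c (\<gamma>' t)) has_vector_derivative velocity M {0..1} \<gamma>' t c) (at t within {T..b})" if t: "t \<in> {T..b}" for t
        by (rule has_vector_derivative_within_subset[OF D' sub]) (use t in' sub in auto)
      show "((\<lambda>t. velocity M {0..1} \<gamma> t c) has_vector_derivative
         - Gam c (snd c (\<gamma> t)) (velocity M {0..1} \<gamma> t c) (velocity M {0..1} \<gamma> t c)) (at t within {T..b})" if t: "t \<in> {T..b}" for t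
        by (rule has_vector_derivative_within_subset[OF geodesic_chart[OF G(1) _ c(1)] sub]) (use t in' sub in auto)
      show "((\<lambda>t. velocity M {0..1} \<gamma>' t c) has_vector_derivative
         - Gam c (snd c (\<gamma>' t)) (velocity M {0..1} \<gamma>' t c) (velocity M {0..1} \<gamma>' t c)) (at t within {T..b})" if t: "t \<in> {T..b}" for t
        by (rule has_vector_derivative_within_subset[OF geodesic_chart[OF G(2) _ c(1)] sub]) (use t in' sub in auto)
    next
      fix e assume "e > 0" "T + e \<le> b" "\<And>t. t \<in> {T..T + e} \<Longrightarrow> snd c (\<gamma> t) = snd c (\<gamma>' t) \<and> velocity M {0..1} \<gamma> t c = velocity M {0..1} \<gamma>' t c"
      then show "\<exists>e>0. T + e \<le> b \<and> (\<forall>t\<in>{T..T+e}. snd c (\<gamma> t) = snd c (\<gamma>' t))" by blast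
    qed (fact b(1), fact vT)
    then obtain e where e: "e > 0" "T + e \<le> b" "\<And>t. t \<in> {T..T+e} \<Longrightarrow> snd c (\<gamma> t) = snd c (\<gamma>' t)" by blast
    have eq: "\<gamma>' s = \<gamma> s" if "s \<in> {0..T+e}" for s
    proof (cases "s \<le> T")
      case False
      then have "snd c (\<gamma> s) = snd c (\<gamma>' s)" "s \<in> {T..b}" using e that by auto
      then show ?thesis using inj_onD[OF chart_inj[OF c(1)], of "\<gamma>' s" "\<gamma> s"] in'[of s] by simp
    qed (use le that in auto)
    then have "T + e \<in> A" using T e b by (auto simp: A_def)
    then have "T + e \<le> T" unfolding T_def by (rule cSup_upper[OF _ bdd])
    then show False using e by simp
  qed
  then show ?thesis using le t by simp
qed

lemma exp_map_eq:
  assumes "geodesic M {0..1} \<gamma>"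
  shows "exp_map M (\<gamma> 0) (velocity M {0..1} \<gamma> 0) = \<gamma> 1"
  unfolding exp_map_def
proof (rule the_equality)
  show "\<exists>\<gamma>'. geodesic M {0..1} \<gamma>' \<and> \<gamma>' 0 = \<gamma> 0 \<and> velocity M {0..1} \<gamma>' 0 = velocity M {0..1} \<gamma> 0 \<and> \<gamma>' 1 = \<gamma> 1"
    using assms by blast
  fix q assume "\<exists>\<gamma>'. geodesic M {0..1} \<gamma>' \<and> \<gamma>' 0 = \<gamma> 0 \<and> velocity M {0..1} \<gamma>' 0 = velocity M {0..1} \<gamma> 0 \<and> \<gamma>' 1 = q"
  then obtain \<gamma>' where g: "geodesic M {0..1} \<gamma>'" "\<gamma>' 0 = \<gamma> 0" "velocity M {0..1} \<gamma>' 0 = velocity M {0..1} \<gamma> 0" "\<gamma>' 1 = q" by blast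
  show "q = \<gamma> 1" using geodesic_unique[OF assms g(1-3), of 1] g(4) by simp
qed

end

context riem_manifold
begin

lemma chart_curve_velocity:
  fixes I :: "real set"
  assumes c: "c \<in> atlas M" and I: "is_interval I" "a \<in> I" "b \<in> I" "a < b"
    and x: "continuous_on I x" "x ` I \<subseteq> cdom c" and s: "s \<in> I" and d: "(x has_vector_derivative x') (at s within I)"
  shows "velocity M I (\<lambda>t. chart_inv c (x t)) s = chart_vec M c (chart_inv c (x s)) x'"
proof (rule velocity_chart(1))
  have xs: "x t \<in> cdom c" if "t \<in> I" for t using x that by auto
  show "continuous_map (top_of_set I) (mtop M) (\<lambda>t. chart_inv c (x t))" by (rule chart_curve_continuous[OF c x])
  show "at s within I \<noteq> bot" by (rule rich_not_bot[OF rich_interval[OF I] s])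
  show "((\<lambda>t. snd c (chart_inv c (x t))) has_vector_derivative x') (at s within I)"
    by (rule has_vector_derivative_transform[OF s _ d]) (simp add: chart_inv_right xs)
  show "chart_inv c (x s) \<in> fst c" by (rule chart_inv_in[OF xs[OF s]])
qed (use c s in auto)

lemma chart_curve_cov_deriv:
  fixes I :: "real set"
  assumes c: "c \<in> atlas M" and I: "is_interval I" "a \<in> I" "b \<in> I" "a < b"
    and x: "continuous_on I x" "x ` I \<subseteq> cdom c" and s: "s \<in> I" and d: "(x has_vector_derivative x') (at s within I)"
    and X: "\<And>t. t \<in> I \<Longrightarrow> Y t = chart_vec M c (chart_inv c (x t)) (X t)"
    and dX: "(X has_vector_derivative X') (at s within I)"
  shows "cov_deriv M I (\<lambda>t. chart_inv c (x t)) Y s = chart_vec M c (chart_inv c (x s)) (X' + Gam c (x s) x' (X s))"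
proof -
  have xs: "x t \<in> cdom c" "chart_inv c (x t) \<in> fst c" if "t \<in> I" for t using x(2) chart_inv_in[of "x t" c] that by blast+
  have Yc: "Y t c = X t" if "t \<in> I" for t by (simp add: X that chart_vec_self[OF c xs(2)])
  have "cov_deriv M I (\<lambda>t. chart_inv c (x t)) Y s
     = chart_vec M c (chart_inv c (x s)) (X' + Gam c (snd c (chart_inv c (x s))) x' (Y s c))"
  proof (rule cov_deriv_chart[OF c xs(2)[OF s] chart_curve_continuous[OF c x] s rich_not_bot[OF rich_interval[OF I] s]])
    show "((\<lambda>t. snd c (chart_inv c (x t))) has_vector_derivative x') (at s within I)"
      by (rule has_vector_derivative_transform[OF s _ d]) (simp add: chart_inv_right xs)
    show "((\<lambda>t. Y t c) has_vector_derivative X') (at s within I)"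
      by (rule has_vector_derivative_transform[OF s _ dX]) (simp add: Yc)
    show "Y t \<in> tangent_space M (chart_inv c (x t))" if "t \<in> I" for t
      unfolding X[OF that] by (rule chart_vec_tangent[OF c xs(2)[OF that]])
  qed
  then show ?thesis by (simp add: chart_inv_right xs s Yc)
qed

lemma inn_chart_vec:
  "c \<in> atlas M \<Longrightarrow> q \<in> fst c \<Longrightarrow> inn M q (chart_vec M c q u) (chart_vec M c q v) = chart_inn M c (snd c q) u v"
  by (simp add: inn_chart[of _ q _ c] chart_vec_tangent chart_vec_self)

end

section \<open>Geodesic spheres\<close>

locale chart_ball = riem_manifold M + exp_ball "snd c ` fst c" "chart_inn M c" "riem_manifold.Gam M c" "riem_manifold.DGam M c"
    p E V F E' V' F' vel \<eta> r
  for M :: "('a, 'n::finite) riemannian" and c p E V F E' V' F' vel \<eta> r +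
  assumes c: "c \<in> atlas M"
begin

abbreviation pt :: "real^'n \<Rightarrow> 'a" where "pt \<equiv> chart_inv c"
abbreviation g :: "real^'n \<Rightarrow> real^'n \<Rightarrow> real^'n \<Rightarrow> real" where "g \<equiv> chart_inn M c"
abbreviation W :: "(real^'n) set" where "W \<equiv> E ` ball 0 r"

lemma W_dom: "x \<in> W \<Longrightarrow> x \<in> cdom c"
  using E_U by auto

lemma pt_in: "x \<in> cdom c \<Longrightarrow> pt x \<in> fst c" and pt_right: "x \<in> cdom c \<Longrightarrow> snd c (pt x) = x"
  by (auto simp: chart_inv_in chart_inv_right)

text \<open>The radial curve of the ball is a geodesic of \<open>M\<close> with the prescribed
  initial velocity, so uniqueness identifies its end point with the value of
  \<open>exp_map\<close>.\<close>

lemma exp_chart: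
  assumes y: "y \<in> ball 0 r"
  shows "exp_map M (pt p) (chart_vec M c (pt p) y) = pt (E y)"
proof -
  let ?I = "{0..1::real}"
  let ?x = "\<lambda>t. E (t *\<^sub>R y)"
  have I: "is_interval ?I" "0 \<in> ?I" "1 \<in> ?I" "(0::real) < 1" by (auto simp: is_interval_cc)
  note R = rich_interval[OF I]
  have U: "?x t \<in> cdom c" if "t \<in> ?I" for t by (rule Et_U[OF y that])
  have im: "?x ` ?I \<subseteq> cdom c" using U by blast
  have cx: "continuous_on ?I ?x" by (rule continuous_on_vector_derivative[OF geo_x[OF y]])
  have cv: "continuous_on ?I (vel y)" by (rule continuous_on_vector_derivative[OF geo_v[OF y]])
  have "Ck_on (Suc 0) (vel y) ?I"
  proof (rule Ck_on_vector_SucI[OF R geo_v[OF y]])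
    show "Ck_on 0 (\<lambda>t. - Gam c (?x t) (vel y t) (vel y t)) ?I"
      using continuous_on_minus[OF continuous_on_\<Gamma>[OF cx cv cv U]] by simp
  qed
  then have "Ck_on (Suc (Suc 0)) ?x ?I" by (rule Ck_on_vector_SucI[OF R geo_x[OF y], rotated])
  then have C: "Ck_curve M 2 ?I (\<lambda>t. pt (?x t))"
    by (intro Ck_curve_chart[OF c I _ _ im]) (simp_all add: numeral_2_eq_2)
  have vel: "velocity M ?I (\<lambda>t. pt (?x t)) t = chart_vec M c (pt (?x t)) (vel y t)" if "t \<in> ?I" for t
    by (rule chart_curve_velocity[OF c I cx im that geo_x[OF y that]])
  have "geodesic M ?I (\<lambda>t. pt (?x t))"
    unfolding geodesic_def
  proof (intro conjI C ballI)
    fix t assume t: "t \<in> ?I"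
    have "cov_deriv M ?I (\<lambda>t. pt (?x t)) (velocity M ?I (\<lambda>t. pt (?x t))) t
       = chart_vec M c (pt (?x t)) (- Gam c (?x t) (vel y t) (vel y t) + Gam c (?x t) (vel y t) (vel y t))"
      by (rule chart_curve_cov_deriv[OF c I cx im t geo_x[OF y t] vel geo_v[OF y t]])
    also have "\<dots> = zero_vec"
      using linear_chart_vec(1)[OF c pt_in[OF U[OF t]], of 0 0] by (simp add: scale_vec_def zero_vec_def)
    finally show "cov_deriv M ?I (\<lambda>t. pt (?x t)) (velocity M ?I (\<lambda>t. pt (?x t))) t = zero_vec" .
  qed
  from exp_map_eq[OF this] show ?thesis using vel[of 0] vel_0[OF y] E_0 by simp
qed

definition \<rho> :: "real^'n \<Rightarrow> real" where "\<rho> x = g p (F x) (F x)"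

lemma d\<rho>: "x \<in> W \<Longrightarrow> (\<rho> has_derivative (\<lambda>h. 2 * g x (N x) h)) (at x)"
  using d_radius unfolding \<rho>_def[abs_def] .

lemma cont_N: "continuous_on W N"
  by (rule continuous_at_imp_continuous_on) (use has_derivative_continuous[OF dN] in blast)

lemma C1_N: "Ck_on 1 N W"
proof -
  have "Ck_on (Suc 0) N W" by (rule open_Ck_on_SucI[OF open_E dN]) (simp_all add: cont_N')
  then show ?thesis by simp
qed

text \<open>The squared radius is defined through \<open>F\<close>, which is only C^1, but its
  derivative is \<open>2 * g x (N x) h\<close> and \<open>N\<close> is C^1. Thus geodesic spheres
  have the class C^2 that \<open>hypersurface\<close> demands.\<close>

lemma C2_\<rho>: "Ck_on 2 \<rho> W"
proof -
  have lN: "linear (N' x)" if "x \<in> W" for x using has_derivative_linear[OF dN[OF that]] .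
  have C1: "Ck_on (Suc 0) (\<lambda>x. 2 * g x (N x) h) W" for h
  proof (rule open_Ck_on_SucI[OF open_E])
    fix x assume x: "x \<in> W"
    have "((\<lambda>x. g x (N x) h) has_derivative (\<lambda>k. g x (N' x k + Gam c x k (N x)) h + g x (N x) (0 + Gam c x k h))) (at x within UNIV)"
      by (rule has_derivative_g[where x="\<lambda>x. x" and u=N and v="\<lambda>_. h"])
         (use W_dom[OF x] dN[OF x] in \<open>auto intro: has_derivative_ident has_derivative_const\<close>)
    then show "((\<lambda>x. 2 * g x (N x) h) has_derivative (\<lambda>k. 2 * (g x (N' x k + Gam c x k (N x)) h + g x (N x) (Gam c x k h)))) (at x)"
      by (intro has_derivative_mult_right) simp
  next
    fix k
    have "continuous_on W (\<lambda>x. 2 * (g x (N' x k + Gam c x k (N x)) h + g x (N x) (Gam c x k h)))"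
      by (intro continuous_intros continuous_on_g continuous_on_\<Gamma> cont_N' cont_N W_dom)
    then show "Ck_on 0 (\<lambda>x. 2 * (g x (N' x k + Gam c x k (N x)) h + g x (N x) (Gam c x k h))) W" by simp
  qed
  have "Ck_on (Suc (Suc 0)) \<rho> W" by (rule open_Ck_on_SucI[OF open_E d\<rho> C1])
  then show ?thesis by (simp add: numeral_2_eq_2)
qed

end

locale sphere_ball = chart_ball M c p E V F E' V' F' vel \<eta> r
  for M :: "('a, 'n::finite) riemannian" and c p E V F E' V' F' vel \<eta> r +
  fixes R :: real
  assumes R: "R > 0" and small: "g p y y \<le> R\<^sup>2 \<Longrightarrow> y \<in> ball 0 r"
begin

abbreviation S :: "'a set" where "S \<equiv> geodesic_sphere M (pt p) R"

lemma sphere_eq: "S = (\<lambda>y. pt (E y)) ` {y. g p y y = R\<^sup>2}"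
proof (intro equalityI subsetI)
  note pp = pt_in[OF p_U] pt_right[OF p_U]
  fix q assume "q \<in> S"
  then obtain v where v: "v \<in> tangent_space M (pt p)" "inn M (pt p) v v = 1" "q = exp_map M (pt p) (scale_vec R v)"
    unfolding geodesic_sphere_def by blast
  let ?u = "v c"
  have u: "chart_vec M c (pt p) ?u = v" by (rule tangent_chart[OF v(1) c pp(1)])
  have n: "g p ?u ?u = 1" using v(2) inn_chart[OF v(1,1) c pp(1)] pp by simp
  then have n': "g p (R *\<^sub>R ?u) (R *\<^sub>R ?u) = R\<^sup>2" by (simp add: g_scale[OF p_U] power2_eq_square)
  have "q = exp_map M (pt p) (chart_vec M c (pt p) (R *\<^sub>R ?u))"
    using v(3) linear_chart_vec(1)[OF c pp(1), of R ?u] u by simp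
  also have "\<dots> = pt (E (R *\<^sub>R ?u))" by (rule exp_chart[OF small]) (simp add: n')
  finally show "q \<in> (\<lambda>y. pt (E y)) ` {y. g p y y = R\<^sup>2}" using n' by blast
next
  note pp = pt_in[OF p_U] pt_right[OF p_U]
  fix q assume "q \<in> (\<lambda>y. pt (E y)) ` {y. g p y y = R\<^sup>2}"
  then obtain y where y: "q = pt (E y)" "g p y y = R\<^sup>2" by blast
  let ?v = "chart_vec M c (pt p) (y /\<^sub>R R)"
  have "scale_vec R ?v = chart_vec M c (pt p) y"
    using linear_chart_vec(1)[OF c pp(1), of R "y /\<^sub>R R"] R by simp
  then have "q = exp_map M (pt p) (scale_vec R ?v)" using exp_chart[of y] small[of y] y by simp
  moreover have "inn M (pt p) ?v ?v = 1"
    using y R pp by (simp add: inn_chart_vec[OF c pp(1)] g_scale[OF p_U] power2_eq_square field_simps)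
  ultimately show "q \<in> S" unfolding geodesic_sphere_def using chart_vec_tangent[OF c pp(1)] by blast
qed

lemma sphere_level: "S = pt ` {x \<in> W. \<rho> x = R\<^sup>2}"
proof -
  have "E ` {y. g p y y = R\<^sup>2} = {x \<in> W. \<rho> x = R\<^sup>2}"
  proof (intro equalityI subsetI)
    fix x assume "x \<in> E ` {y. g p y y = R\<^sup>2}"
    then obtain y where y: "x = E y" "g p y y = R\<^sup>2" by blast
    then have "y \<in> ball 0 r" using small[of y] by simp
    then show "x \<in> {x \<in> W. \<rho> x = R\<^sup>2}" using y by (simp add: \<rho>_def F_E)
  next
    fix x assume x: "x \<in> {x \<in> W. \<rho> x = R\<^sup>2}"
    then have "E (F x) = x" "g p (F x) (F x) = R\<^sup>2" using F_range[of x] by (auto simp: \<rho>_def)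
    then show "x \<in> E ` {y. g p y y = R\<^sup>2}" by force
  qed
  then show ?thesis unfolding sphere_eq by (metis image_image)
qed

lemma sphereD:
  assumes "q \<in> S"
  shows "q \<in> fst c" "snd c q \<in> W" "snd c q \<in> cdom c" "\<rho> (snd c q) = R\<^sup>2" "pt (snd c q) = q" "g (snd c q) (N (snd c q)) (N (snd c q)) = R\<^sup>2"
proof -
  obtain x where x: "q = pt x" "x \<in> W" "\<rho> x = R\<^sup>2" using assms unfolding sphere_level by blast
  show 1: "q \<in> fst c" "snd c q \<in> W" "\<rho> (snd c q) = R\<^sup>2"
    using x pt_in[OF W_dom[OF x(2)]] pt_right[OF W_dom[OF x(2)]] by auto
  show "snd c q \<in> cdom c" "pt (snd c q) = q" using 1 c by auto
  show "g (snd c q) (N (snd c q)) (N (snd c q)) = R\<^sup>2" using N_norm[OF 1(2)] 1(3) by (simp add: \<rho>_def)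
qed

lemma sphere_hypersurface: "hypersurface M S"
  unfolding hypersurface_def
proof (intro conjI ballI)
  show "S \<subseteq> topspace (mtop M)" using sphereD(1) chart_subset[OF c] by blast
  fix q assume q: "q \<in> S"
  \<comment> \<open>The gradient \<open>2 * N\<close> of \<rho> vanishes at the centre and nowhere
    else, so the centre is removed.\<close>
  let ?W = "W - {p}"
  let ?f = "\<lambda>x. \<rho> x - R\<^sup>2"
  have opn: "open ?W" using open_E by blast
  have "p \<in> W" using E_0 r by force
  then have "\<rho> p = 0" using F_E[of 0] E_0 r by (simp add: \<rho>_def g_zero[OF p_U])
  then have sp: "x \<noteq> p" if "\<rho> x = R\<^sup>2" for x using that R by auto
  have "Ck_on 2 ?f ?W"
    by (rule Ck_on_subset[OF rich_open[OF opn] _ Ck_on_diff[OF rich_open[OF open_E] C2_\<rho> Ck_on_const[OF rich_open[OF open_E]]]]) auto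
  moreover have "\<exists>u. frechet_derivative ?f (at x) u \<noteq> 0" if x: "x \<in> ?W" for x
  proof -
    have xW: "x \<in> W" using x by auto
    have "(?f has_derivative (\<lambda>h. 2 * g x (N x) h - 0)) (at x)"
      by (rule has_derivative_diff[OF d\<rho>[OF xW] has_derivative_const])
    then have "frechet_derivative ?f (at x) (N x) = 2 * g x (N x) (N x)"
      using frechet_derivative_at[of ?f "\<lambda>h. 2 * g x (N x) h - 0" x] by (simp add: fun_eq_iff)
    moreover have "F x \<noteq> 0" using F_range[OF xW] x E_0 by auto
    then have "g x (N x) (N x) > 0" unfolding N_norm[OF xW] by (rule g_pos[OF p_U])
    ultimately show ?thesis by (intro exI[of _ "N x"]) simp
  qed
  moreover have "snd c ` (S \<inter> fst c) \<inter> ?W = {x \<in> ?W. ?f x = 0}"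
  proof (intro equalityI subsetI)
    fix x assume "x \<in> snd c ` (S \<inter> fst c) \<inter> ?W"
    then obtain q' where "q' \<in> S" "x = snd c q'" "x \<in> ?W" by blast
    then show "x \<in> {x \<in> ?W. ?f x = 0}" using sphereD(4)[of q'] by simp
  next
    fix x assume x: "x \<in> {x \<in> ?W. ?f x = 0}"
    then have xW: "x \<in> W" "\<rho> x = R\<^sup>2" by auto
    then have "pt x \<in> S" unfolding sphere_level by blast
    then have "snd c (pt x) \<in> snd c ` (S \<inter> fst c)" using sphereD(1)[of "pt x"] by blast
    then show "x \<in> snd c ` (S \<inter> fst c) \<inter> ?W" using x pt_right[OF W_dom[OF xW(1)]] by simp
  qed
  moreover have "snd c q \<in> ?W" "?W \<subseteq> cdom c" using sphereD[OF q] sp W_dom by auto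
  ultimately show "\<exists>c\<in>atlas M. q \<in> fst c \<and> (\<exists>W F. open W \<and> snd c q \<in> W \<and> W \<subseteq> snd c ` fst c \<and> Ck_on 2 (F :: real^'n \<Rightarrow> real) W \<and>
           (\<forall>x\<in>W. \<exists>u. frechet_derivative F (at x) u \<noteq> 0) \<and> snd c ` (S \<inter> fst c) \<inter> W = {x\<in>W. F x = 0})"
    using sphereD(1)[OF q] c opn by blast
qed

lemma curve_in_sphere:
  assumes C: "Ck_curve M k I \<beta>" and k: "1 \<le> k" and S: "\<beta> ` I \<subseteq> S" and s: "s \<in> I"
  shows "g (snd c (\<beta> s)) (N (snd c (\<beta> s))) (velocity M I \<beta> s c) = 0"
proof -
  have q: "\<beta> t \<in> S" if "t \<in> I" for t using S that by auto
  note D = curve_derivative[OF C k s c sphereD(1)[OF q[OF s]]]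
  have "((\<lambda>t. \<rho> (snd c (\<beta> t))) has_vector_derivative 2 * g (snd c (\<beta> s)) (N (snd c (\<beta> s))) (velocity M I \<beta> s c)) (at s within I)"
    by (rule has_vector_derivative_chain[OF d\<rho>[OF sphereD(2)[OF q[OF s]]] D])
  moreover have "((\<lambda>t. \<rho> (snd c (\<beta> t))) has_vector_derivative 0) (at s within I)"
    by (rule has_vector_derivative_transform[OF s _ has_vector_derivative_const[of "R\<^sup>2"]]) (simp add: sphereD(4) q)
  ultimately show ?thesis using vector_derivative_unique_within[OF Ck_curveD(3)[OF C s]] by fastforce
qed

end

section \<open>Tangent spaces, unit normals and shape operators of geodesic spheres\<close>

context sphere_ball
begin

text \<open>The curve is the image under \<open>E\<close> of a great circle on the sphere of radius
  \<open>R\<close> in the tangent space at the centre, which stays on the sphere of that radius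
  exactly.\<close>

lemma tangent_curve:
  assumes q: "q \<in> S" and h: "g (snd c q) (N (snd c q)) h = 0"
  shows "\<exists>\<beta>. curve_in_through M S q (chart_vec M c q h) 1 \<beta>"
proof -
  let ?I = "{-1<..<1::real}"
  define x where "x = snd c q"
  define y where "y = F x"
  define u where "u = F' x h"
  have xW: "x \<in> W" "pt x = q" "\<rho> x = R\<^sup>2" using sphereD[OF q] by (simp_all add: x_def)
  have y: "y \<in> ball 0 r" "E y = x" using F_range[OF xW(1)] by (simp_all add: y_def)
  have nn: "g p y y = R\<^sup>2" "g p y u = 0" using xW gauss_N[OF xW(1), of h] h by (simp_all add: \<rho>_def y_def u_def x_def)
  \<comment> \<open>By the Gauss lemma \<open>u\<close> is orthogonal to \<open>y\<close>; with its
    length written as \<omega> R, the combination of \<open>y\<close> and \<open>u\<close> with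
    coefficients cos and sin / \<omega> keeps length \<open>R\<close>.\<close>
  define \<omega> where "\<omega> = sqrt (g p u u) / R"
  have om: "g p u u = \<omega>\<^sup>2 * R\<^sup>2" using g_nonneg[OF p_U, of u] R by (simp add: \<omega>_def power_divide)
  have om0: "\<omega> = 0 \<Longrightarrow> u = 0" using R g_zero_iff[OF p_U, of u] by (simp add: \<omega>_def)
  \<comment> \<open>For \<omega> = 0 the quotient has the default value 0. Then \<open>u = 0\<close>
    and the curve is constant, as it should be.\<close>
  obtain k where k: "k = 1 / \<omega>" by blast
  define Y where "Y t = cos (\<omega> * t) *\<^sub>R y + (k * sin (\<omega> * t)) *\<^sub>R u" for t
  define Y' where "Y' t = (- \<omega> * sin (\<omega> * t)) *\<^sub>R y + (k * (cos (\<omega> * t) * \<omega>)) *\<^sub>R u" for t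
  have dY: "(Y has_vector_derivative Y' t) (at t within ?I)" for t
    unfolding Y_def[abs_def] Y'_def has_vector_derivative_def
    by (rule derivative_eq_intros refl | simp)+ (simp add: fun_eq_iff algebra_simps)
  have Yn: "g p (Y t) (Y t) = R\<^sup>2" for t
  proof (cases "\<omega> = 0")
    case True then show ?thesis using om0 nn by (simp add: Y_def)
  next
    case False
    have e: "(k * sin (\<omega> * t))\<^sup>2 * (\<omega>\<^sup>2 * R\<^sup>2) = (sin (\<omega> * t))\<^sup>2 * R\<^sup>2"
      using False by (simp add: power_mult_distrib power_divide k)
    have "g p (Y t) (Y t) = (cos (\<omega> * t))\<^sup>2 * R\<^sup>2 + (k * sin (\<omega> * t))\<^sup>2 * (\<omega>\<^sup>2 * R\<^sup>2)"
      using nn g_sym[OF p_U, of u y] by (simp add: Y_def g_add[OF p_U] g_scale[OF p_U] om power2_eq_square)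
    also have "\<dots> = ((cos (\<omega> * t))\<^sup>2 + (sin (\<omega> * t))\<^sup>2) * R\<^sup>2" by (simp only: e distrib_right)
    finally show ?thesis by simp
  qed
  have Yb: "Y t \<in> ball 0 r" for t by (rule small) (simp add: Yn)
  have Y0: "Y 0 = y" "E' y (Y' 0) = h"
  proof -
    show Y0: "Y 0 = y" by (simp add: Y_def)
    have "Y' 0 = u" using om0 by (cases "\<omega> = 0") (simp_all add: Y'_def k)
    then show "E' y (Y' 0) = h" using F'_E'(2)[OF y(1)] y(2) by (simp add: u_def)
  qed
  have I: "is_interval ?I" "0 \<in> ?I" "1/2 \<in> ?I" "(0::real) < 1/2" by (auto simp: is_interval_oo)
  have dx: "((\<lambda>t. E (Y t)) has_vector_derivative E' (Y t) (Y' t)) (at t within ?I)" for t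
    by (rule has_vector_derivative_chain[OF dE[OF Yb] dY])
  have cY: "continuous_on ?I Y" by (rule continuous_on_vector_derivative[OF dY])
  have cx: "continuous_on ?I (\<lambda>t. E (Y t))" by (rule continuous_on_vector_derivative[OF dx])
  have cY': "continuous_on ?I Y'" unfolding Y'_def by (intro continuous_intros)
  have im: "(\<lambda>t. E (Y t)) ` ?I \<subseteq> cdom c" using E_U[OF Yb] by blast
  have "Ck_on (Suc 0) (\<lambda>t. E (Y t)) ?I"
  proof (rule Ck_on_vector_SucI[OF rich_interval[OF I] dx])
    have "continuous_on ?I (\<lambda>t. E' (Y t) (Y' t))"
      by (rule continuous_on_linear_family[OF continuous_on_compose2[OF cont_E' cY] cY' E'_linear[OF Yb]]) (use Yb in blast)
    then show "Ck_on 0 (\<lambda>t. E' (Y t) (Y' t)) ?I" by simp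
  qed
  then have "Ck_curve M 1 ?I (\<lambda>t. pt (E (Y t)))" by (intro Ck_curve_chart[OF c I _ _ im]) simp_all
  moreover have "velocity M ?I (\<lambda>t. pt (E (Y t))) 0 = chart_vec M c q h"
    using chart_curve_velocity[OF c I cx im I(2) dx] Y0 y xW by simp
  moreover have "(\<lambda>t. pt (E (Y t))) ` ?I \<subseteq> S" unfolding sphere_eq using Yn by blast
  ultimately show ?thesis unfolding curve_in_through_def using Y0 y xW by (intro exI[of _ "\<lambda>t. pt (E (Y t))"]) simp
qed

lemma sphere_tangent:
  assumes q: "q \<in> S"
  shows "tangent_space_of M S q = {chart_vec M c q h | h. g (snd c q) (N (snd c q)) h = 0}"
proof (intro equalityI subsetI)
  fix v assume "v \<in> tangent_space_of M S q"
  then obtain e \<beta> where b: "e > 0" "Ck_curve M 1 {-e<..<e} \<beta>" "\<beta> ` {-e<..<e} \<subseteq> S" "\<beta> 0 = q" "velocity M {-e<..<e} \<beta> 0 = v"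
    unfolding tangent_space_of_def curve_in_through_def by blast
  have 0: "0 \<in> {-e<..<e}" using b by simp
  have "v \<in> tangent_space M q" using curve_velocity[OF b(2) _ 0] b by simp
  then have "v = chart_vec M c q (v c)" using tangent_chart[OF _ c sphereD(1)[OF q]] by simp
  moreover have "g (snd c q) (N (snd c q)) (v c) = 0" using curve_in_sphere[OF b(2) _ b(3) 0] b by simp
  ultimately show "v \<in> {chart_vec M c q h | h. g (snd c q) (N (snd c q)) h = 0}" by blast
next
  fix v assume "v \<in> {chart_vec M c q h | h. g (snd c q) (N (snd c q)) h = 0}"
  then obtain h where h: "v = chart_vec M c q h" "g (snd c q) (N (snd c q)) h = 0" by blast
  then show "v \<in> tangent_space_of M S q" unfolding tangent_space_of_def using tangent_curve[OF q h(2)] by blast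
qed

lemma radial_unit_normal: "unit_normal_field M S (\<lambda>q. chart_vec M c q (N (snd c q) /\<^sub>R R))"
  unfolding unit_normal_field_def
proof (intro conjI ballI)
  fix q assume q: "q \<in> S"
  note s = sphereD[OF q]
  show "chart_vec M c q (N (snd c q) /\<^sub>R R) \<in> tangent_space M q" by (rule chart_vec_tangent[OF c s(1)])
  show "inn M q (chart_vec M c q (N (snd c q) /\<^sub>R R)) (chart_vec M c q (N (snd c q) /\<^sub>R R)) = 1"
    using R s by (simp add: inn_chart_vec[OF c] g_scale power2_eq_square field_simps)
  fix v assume "v \<in> tangent_space_of M S q"
  then obtain h where h: "v = chart_vec M c q h" "g (snd c q) (N (snd c q)) h = 0" unfolding sphere_tangent[OF q] by blast
  then show "inn M q (chart_vec M c q (N (snd c q) /\<^sub>R R)) v = 0"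
    using s by (simp add: inn_chart_vec[OF c] g_scale)
next
  fix c' q assume c': "c' \<in> atlas M" and q: "q \<in> S \<inter> fst c'"
  let ?O = "overlap c c'" and ?O' = "overlap c' c"
  let ?V = "W \<inter> ?O"
  \<comment> \<open>The components in the chart \<open>c'\<close> of the normalized radial field, as
    a function of the coordinates of \<open>c\<close>. It is C^1 on an open set and not just on the
    sphere, which provides the local extension required of a normal field.\<close>
  let ?G = "\<lambda>x. \<Sum>i\<in>Basis. ((N x /\<^sub>R R) \<bullet> i) *\<^sub>R dtrans c c' x i"
  have oV: "open ?V" using open_E open_overlap[OF c c'] by blast
  note rV = rich_open[OF oV]
  have G1: "Ck_on 1 ?G ?V"
    by (intro Ck_on_sum Ck_on_scaleR Ck_on_inner_left Ck_on_scaleR_right rV Ck_on_subset[OF rV _ C1_N]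
       Ck_on_subset[OF rV _ Ck_on_mono[OF _ Ck_dtrans[OF c c']]]) auto
  have T1: "Ck_on 1 (trans c' c) ?O'" by (rule Ck_on_mono[OF _ trans_C3[OF c' c]]) simp
  define Q where "Q = {z\<in>?O'. trans c' c z \<in> ?V}"
  have cont: "continuous_on ?O' (trans c' c)" using Ck_on_mono[of 0, OF _ T1] by simp
  have oQ: "open Q"
  proof -
    have "open (trans c' c -` ?V \<inter> ?O')" using cont oV open_overlap[OF c' c] continuous_on_open_vimage by blast
    moreover have "Q = trans c' c -` ?V \<inter> ?O'" unfolding Q_def by blast
    ultimately show ?thesis by simp
  qed
  have "Ck_on 1 (\<lambda>z. ?G (trans c' c z)) Q"
  proof (rule Ck_on_compose[OF rich_open[OF oQ] oV _ G1 Ck_on_subset[OF rich_open[OF oQ] _ T1]])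
    show "trans c' c ` Q \<subseteq> ?V" unfolding Q_def by blast
    show "Q \<subseteq> ?O'" unfolding Q_def by blast
  qed
  moreover have qq: "snd c' q' \<in> Q \<and> chart_vec M c q' (N (snd c q') /\<^sub>R R) c' = ?G (trans c' c (snd c' q'))" if "q' \<in> S \<inter> fst c'" for q'
  proof -
    have m: "q' \<in> fst c" "snd c q' \<in> W" "q' \<in> fst c'" using that sphereD[of q'] by auto
    have o: "snd c q' \<in> ?O" using m by blast
    have t: "trans c' c (snd c' q') = snd c q'" using m c' by simp
    show ?thesis
      unfolding Q_def using t o m linear_Basis_expand[OF linear_dtrans[OF c c' o], of "N (snd c q') /\<^sub>R R"] chart_vec_eq[OF c' m(3)] by simp
  qed
  ultimately show "\<exists>W F. open W \<and> snd c' q \<in> W \<and> Ck_on 1 F W \<and>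
        (\<forall>q'\<in>S \<inter> fst c'. snd c' q' \<in> W \<longrightarrow> chart_vec M c q' (N (snd c q') /\<^sub>R R) c' = F (snd c' q'))"
    using oQ qq[OF q] by (intro exI[of _ Q] exI[of _ "\<lambda>z. ?G (trans c' c z)"]) blast
qed

text \<open>The part of \<xi> orthogonal to \<open>N\<close> is itself tangent to the sphere, hence
  orthogonal to \<xi> and to itself. So \<xi> is a multiple of \<open>N\<close>, and its length
  fixes the factor up to sign.\<close>

lemma unit_normal_cases:
  assumes \<xi>: "unit_normal_field M S \<xi>" and q: "q \<in> S"
  shows "\<exists>\<sigma>\<in>{1,-1}. \<xi> q = chart_vec M c q ((\<sigma> / R) *\<^sub>R N (snd c q))"
proof -
  let ?x = "snd c q" and ?X = "\<xi> q c"
  note s = sphereD[OF q]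
  have X: "\<xi> q \<in> tangent_space M q" "inn M q (\<xi> q) (\<xi> q) = 1" "\<And>v. v \<in> tangent_space_of M S q \<Longrightarrow> inn M q (\<xi> q) v = 0"
    using \<xi> q unfolding unit_normal_field_def by auto
  have e: "\<xi> q = chart_vec M c q ?X" using tangent_chart[OF X(1) c s(1)] by simp
  have n1: "g ?x ?X ?X = 1" using X(2) by (simp add: inn_chart[OF X(1,1) c s(1)])
  have o: "g ?x ?X h = 0" if "g ?x (N ?x) h = 0" for h
  proof -
    have "chart_vec M c q h \<in> tangent_space_of M S q" unfolding sphere_tangent[OF q] using that by blast
    then show ?thesis using X(3)[of "chart_vec M c q h"] e inn_chart_vec[OF c s(1), of ?X h] by simp
  qed
  define a where "a = g ?x (N ?x) ?X / R\<^sup>2"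
  have "g ?x (N ?x) (?X - a *\<^sub>R N ?x) = 0" using s R by (simp add: a_def g_diff g_scale)
  then have "g ?x (?X - a *\<^sub>R N ?x) (?X - a *\<^sub>R N ?x) = 0"
    using o[of "?X - a *\<^sub>R N ?x"] s(3) g_diff(1)[OF s(3), of ?X "a *\<^sub>R N ?x" "?X - a *\<^sub>R N ?x"] by (simp add: g_scale)
  then have Xa: "?X = a *\<^sub>R N ?x" using g_zero_iff[OF s(3)] by simp
  then have "a\<^sup>2 * R\<^sup>2 = 1" using n1 s by (simp add: g_scale power2_eq_square)
  then have "(a * R)\<^sup>2 = 1" by (simp add: power_mult_distrib)
  then have "a * R = 1 \<or> a * R = -1" by (simp add: power2_eq_1_iff)
  then have "a = 1 / R \<or> a = -1 / R" using R by (simp add: field_simps)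
  then show ?thesis using e Xa by auto
qed

lemma chart_curve_on_sphere:
  fixes I :: "real set"
  assumes cont: "continuous_map (top_of_set I) (mtop M) \<alpha>" and S: "\<alpha> ` I \<subseteq> S"
  shows "continuous_on I (\<lambda>t. snd c (\<alpha> t))"
proof -
  have "\<alpha> ` I \<subseteq> fst c" using S sphereD(1) by blast
  then have "continuous_map (top_of_set I) (subtopology (mtop M) (fst c)) \<alpha>"
    using cont by (auto simp: continuous_map_in_subtopology)
  from continuous_map_compose[OF this continuous_chart[OF c]] show ?thesis
    by (simp add: o_def continuous_map_in_subtopology continuous_map_iff_continuous)
qed

text \<open>The product \<open>f\<close> of \<xi> with \<open>N\<close> is continuous along the
  curve and takes only the values \<open>R\<close> and \<open>-R\<close>. A change of sign would
  force the value 0 by connectedness of the interval.\<close>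

lemma unit_normal_along:
  fixes I :: "real set"
  assumes \<xi>: "unit_normal_field M S \<xi>" and cont: "continuous_map (top_of_set I) (mtop M) \<alpha>" and S: "\<alpha> ` I \<subseteq> S"
    and I: "is_interval I"
  obtains \<sigma> where "\<sigma> \<in> {1,-1}" "\<And>t. t \<in> I \<Longrightarrow> \<xi> (\<alpha> t) = chart_vec M c (\<alpha> t) ((\<sigma> / R) *\<^sub>R N (snd c (\<alpha> t)))"
proof -
  have q: "\<alpha> t \<in> S" if "t \<in> I" for t using S that by auto
  note cx = chart_curve_on_sphere[OF cont S]
  define f where "f t = g (snd c (\<alpha> t)) (\<xi> (\<alpha> t) c) (N (snd c (\<alpha> t)))" for t
  have fR: "\<xi> (\<alpha> t) = chart_vec M c (\<alpha> t) ((\<sigma> / R) *\<^sub>R N (snd c (\<alpha> t))) \<Longrightarrow> f t = \<sigma> * R" if "t \<in> I" for t \<sigma>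
    using sphereD[OF q[OF that]] R by (simp add: f_def chart_vec_self[OF c] g_scale power2_eq_square)
  have "continuous_on I (\<lambda>t. \<xi> (\<alpha> t) c)"
    unfolding continuous_on_def
  proof
    fix t assume t: "t \<in> I"
    obtain W' G where W': "open W'" "snd c (\<alpha> t) \<in> W'" "Ck_on 1 G W'" "\<And>q'. q' \<in> S \<inter> fst c \<Longrightarrow> snd c q' \<in> W' \<Longrightarrow> \<xi> q' c = G (snd c q')"
    proof -
      have "\<forall>c\<in>atlas M. \<forall>q\<in>S \<inter> fst c. \<exists>W F. open W \<and> snd c q \<in> W \<and> Ck_on 1 F W \<and>
          (\<forall>q'\<in>S \<inter> fst c. snd c q' \<in> W \<longrightarrow> \<xi> q' c = F (snd c q'))"
        using \<xi> unfolding unit_normal_field_def by (rule conjunct2)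
      from bspec[OF bspec[OF this c], of "\<alpha> t"] show ?thesis using q[OF t] sphereD(1)[OF q[OF t]] that by blast
    qed
    have "continuous_on W' G" using Ck_on_mono[of 0, OF _ W'(3)] by simp
    then have "isCont G (snd c (\<alpha> t))" using W' by (simp add: continuous_on_eq_continuous_at)
    moreover have lim: "((\<lambda>t. snd c (\<alpha> t)) \<longlongrightarrow> snd c (\<alpha> t)) (at t within I)" using cx t by (simp add: continuous_on_def)
    ultimately have "((\<lambda>t. G (snd c (\<alpha> t))) \<longlongrightarrow> G (snd c (\<alpha> t))) (at t within I)" by (rule isCont_tendsto_compose)
    moreover have "G (snd c (\<alpha> t)) = \<xi> (\<alpha> t) c" using W'(2,4) q[OF t] sphereD(1)[OF q[OF t]] by simp
    moreover have "\<forall>\<^sub>F s in at t within I. G (snd c (\<alpha> s)) = \<xi> (\<alpha> s) c"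
    proof -
      have "\<forall>\<^sub>F s in at t within I. snd c (\<alpha> s) \<in> W'" using topological_tendstoD[OF lim W'(1,2)] .
      moreover have "\<forall>\<^sub>F s in at t within I. s \<in> I" by (simp add: eventually_at_filter)
      ultimately show ?thesis
      proof eventually_elim
        case (elim s)
        then show ?case using W'(4)[of "\<alpha> s"] q[OF elim(2)] sphereD(1)[OF q[OF elim(2)]] by simp
      qed
    qed
    ultimately show "((\<lambda>t. \<xi> (\<alpha> t) c) \<longlongrightarrow> \<xi> (\<alpha> t) c) (at t within I)" using tendsto_cong[of "\<lambda>t. G (snd c (\<alpha> t))" "\<lambda>t. \<xi> (\<alpha> t) c" "at t within I"] by simp
  qed
  then have "continuous_on I f" unfolding f_def
  proof (intro continuous_on_g cx continuous_on_compose2[OF cont_N cx])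
    show "(\<lambda>t. snd c (\<alpha> t)) ` I \<subseteq> W" using sphereD(2)[OF q] by (rule image_subsetI)
    show "snd c (\<alpha> t) \<in> cdom c" if "t \<in> I" for t by (rule sphereD(3)[OF q[OF that]])
  qed
  then have conn: "connected (f ` I)" using I is_interval_connected connected_continuous_image by blast
  show ?thesis
  proof (cases "I = {}")
    case False
    then obtain s where s: "s \<in> I" by blast
    obtain \<sigma> where sg: "\<sigma> \<in> {1,-1}" "\<xi> (\<alpha> s) = chart_vec M c (\<alpha> s) ((\<sigma> / R) *\<^sub>R N (snd c (\<alpha> s)))"
      using unit_normal_cases[OF \<xi> q[OF s]] by blast
    have "\<xi> (\<alpha> t) = chart_vec M c (\<alpha> t) ((\<sigma> / R) *\<^sub>R N (snd c (\<alpha> t)))" if t: "t \<in> I" for t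
    proof -
      obtain \<tau> where ta: "\<tau> \<in> {1,-1}" "\<xi> (\<alpha> t) = chart_vec M c (\<alpha> t) ((\<tau> / R) *\<^sub>R N (snd c (\<alpha> t)))"
        using unit_normal_cases[OF \<xi> q[OF t]] by blast
      have "\<sigma> = \<tau>"
      proof (rule ccontr)
        assume "\<sigma> \<noteq> \<tau>"
        then have "f s = R \<and> f t = - R \<or> f s = - R \<and> f t = R"
          using fR[OF s sg(2)] fR[OF t ta(2)] sg(1) ta(1) by auto
        then have "R \<in> f ` I" "- R \<in> f ` I" using imageI[OF s, of f] imageI[OF t, of f] by auto
        then have "0 \<in> f ` I" using connectedD_interval[OF conn, of "-R" R 0] R by simp
        then obtain w where w: "0 = f w" "w \<in> I" by (rule imageE)
        obtain \<upsilon> where "\<upsilon> \<in> {1,-1}" "\<xi> (\<alpha> w) = chart_vec M c (\<alpha> w) ((\<upsilon> / R) *\<^sub>R N (snd c (\<alpha> w)))"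
          using unit_normal_cases[OF \<xi> q[OF w(2)]] by blast
        then show False using fR[OF w(2), of \<upsilon>] w(1) R by auto
      qed
      then show ?thesis using ta by simp
    qed
    then show ?thesis by (rule that[OF sg(1)])
  next
    case True
    then show ?thesis by (intro that[of 1]) simp_all
  qed
qed

lemma cov_deriv_radial:
  assumes C: "Ck_curve M k I \<beta>" and k: "1 \<le> k" and S: "\<beta> ` I \<subseteq> S" and s: "s \<in> I"
    and X: "\<And>t. t \<in> I \<Longrightarrow> X t = chart_vec M c (\<beta> t) (a *\<^sub>R N (snd c (\<beta> t)))"
  shows "cov_deriv M I \<beta> X s = chart_vec M c (\<beta> s) (a *\<^sub>R Sh (F (snd c (\<beta> s))) (F' (snd c (\<beta> s)) (velocity M I \<beta> s c)))"
proof -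
  have q: "\<beta> t \<in> S" if "t \<in> I" for t using S that by auto
  note sp = sphereD[OF q[OF s]]
  let ?x = "snd c (\<beta> s)" and ?v = "velocity M I \<beta> s c"
  have Xc: "X t c = a *\<^sub>R N (snd c (\<beta> t))" if "t \<in> I" for t
    using X[OF that] chart_vec_self[OF c sphereD(1)[OF q[OF that]]] by simp
  note D = curve_derivative[OF C k s c sp(1)]
  have "((\<lambda>t. a *\<^sub>R N (snd c (\<beta> t))) has_vector_derivative a *\<^sub>R N' ?x ?v) (at s within I)"
    by (rule bounded_linear.has_vector_derivative[OF bounded_linear_scaleR_right has_vector_derivative_chain[OF dN[OF sp(2)] D]])
  then have dX: "((\<lambda>t. X t c) has_vector_derivative a *\<^sub>R N' ?x ?v) (at s within I)"
    by (rule has_vector_derivative_transform[OF s, rotated]) (simp add: Xc)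
  have "cov_deriv M I \<beta> X s = chart_vec M c (\<beta> s) (a *\<^sub>R N' ?x ?v + Gam c ?x ?v (X s c))"
  proof (rule cov_deriv_chart[where \<alpha>=\<beta> and X=X, OF c sp(1) Ck_curveD(2)[OF C] s Ck_curveD(3)[OF C s] D _ dX])
    show "X t \<in> tangent_space M (\<beta> t)" if "t \<in> I" for t
      unfolding X[OF that] by (rule chart_vec_tangent[OF c sphereD(1)[OF q[OF that]]])
  qed
  also have "a *\<^sub>R N' ?x ?v + Gam c ?x ?v (X s c) = a *\<^sub>R (N' ?x ?v + Gam c ?x ?v (N ?x))"
    by (simp add: Xc[OF s] \<Gamma>_scale[OF sp(3)] scaleR_add_right)
  finally show ?thesis by (simp only: cov_N[OF sp(2)])
qed

text \<open>The description by \<open>THE\<close> is meaningful because every curve through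
  \<open>q\<close> with the given velocity yields the same value \<open>?Y\<close>, and
  \<open>tangent_curve\<close> provides one such curve.\<close>

lemma shape_operator_radial:
  assumes \<xi>: "unit_normal_field M S \<xi>" and q: "q \<in> S" and h: "g (snd c q) (N (snd c q)) h = 0"
    and a: "\<xi> q = chart_vec M c q (a *\<^sub>R N (snd c q))"
  shows "shape_operator M S \<xi> q (chart_vec M c q h) = chart_vec M c q (- a *\<^sub>R Sh (F (snd c q)) (F' (snd c q) h))"
proof -
  let ?Y = "chart_vec M c q (- a *\<^sub>R Sh (F (snd c q)) (F' (snd c q) h))"
  have val: "scale_vec (-1) (cov_deriv M {-e<..<e} \<beta> (\<lambda>t. \<xi> (\<beta> t)) 0) = ?Y" if \<beta>: "curve_in_through M S q (chart_vec M c q h) e \<beta>" for e \<beta>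
  proof -
    have b: "e > 0" "Ck_curve M 1 {-e<..<e} \<beta>" "\<beta> ` {-e<..<e} \<subseteq> S" "\<beta> 0 = q" "velocity M {-e<..<e} \<beta> 0 = chart_vec M c q h"
      using \<beta> unfolding curve_in_through_def by auto
    have 0: "0 \<in> {-e<..<e}" using b by simp
    obtain \<sigma> where sg: "\<And>t. t \<in> {-e<..<e} \<Longrightarrow> \<xi> (\<beta> t) = chart_vec M c (\<beta> t) ((\<sigma> / R) *\<^sub>R N (snd c (\<beta> t)))"
      by (rule unit_normal_along[OF \<xi> Ck_curveD(2)[OF b(2)] b(3) Ck_curveD(1)[OF b(2)]]) blast
    have "(\<sigma> / R) *\<^sub>R N (snd c q) = a *\<^sub>R N (snd c q)"
      using sg[OF 0] a b(4) chart_vec_self[OF c sphereD(1)[OF q], of "(\<sigma> / R) *\<^sub>R N (snd c q)"]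
        chart_vec_self[OF c sphereD(1)[OF q], of "a *\<^sub>R N (snd c q)"] by simp
    moreover have "N (snd c q) \<noteq> 0" using sphereD(3,6)[OF q] R by (auto simp: g_zero)
    ultimately have "\<sigma> / R = a" by simp
    then have "cov_deriv M {-e<..<e} \<beta> (\<lambda>t. \<xi> (\<beta> t)) 0 = chart_vec M c q (a *\<^sub>R Sh (F (snd c q)) (F' (snd c q) h))"
      using cov_deriv_radial[OF b(2) _ b(3) 0 sg] b chart_vec_self[OF c sphereD(1)[OF q]] by simp
    then show ?thesis
      using linear_chart_vec(1)[OF c sphereD(1)[OF q], of "-1" "a *\<^sub>R Sh (F (snd c q)) (F' (snd c q) h)"] by simp
  qed
  obtain \<beta> where "curve_in_through M S q (chart_vec M c q h) 1 \<beta>" using tangent_curve[OF q h] by blast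
  then show ?thesis unfolding shape_operator_def using val
  proof (intro the_equality)
    fix Y assume "\<exists>e \<beta>. curve_in_through M S q (chart_vec M c q h) e \<beta> \<and> Y = scale_vec (-1) (cov_deriv M {-e<..<e} \<beta> (\<lambda>t. \<xi> (\<beta> t)) 0)"
    then show "Y = ?Y" using val by blast
  next
    assume "curve_in_through M S q (chart_vec M c q h) 1 \<beta>"
    then show "\<exists>e \<beta>. curve_in_through M S q (chart_vec M c q h) e \<beta> \<and> ?Y = scale_vec (-1) (cov_deriv M {-e<..<e} \<beta> (\<lambda>t. \<xi> (\<beta> t)) 0)"
      using val[of 1 \<beta>] by (intro exI[of _ 1] exI[of _ \<beta>]) simp
  qed
qed

end

section \<open>Orthonormal systems and plane areas for a single scalar product\<close>

context local_metric
begin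

lemma ortho_exists:
  assumes x: "x \<in> U" and A: "finite A" "card A < DIM('e)"
  shows "\<exists>u. u \<noteq> 0 \<and> (\<forall>a\<in>A. g x u a = 0)"
proof -
  let ?a = "\<lambda>v. \<Sum>i\<in>Basis. g x v i *\<^sub>R i"
  have "dim (?a ` A) \<le> card (?a ` A)" by (rule dim_le_card') (use A in simp)
  also have "\<dots> \<le> card A" by (rule card_image_le[OF A(1)])
  finally have "dim (?a ` A) < DIM('e)" using A by simp
  then obtain u where u: "u \<noteq> 0" "\<And>y. y \<in> span (?a ` A) \<Longrightarrow> orthogonal u y"
    using orthogonal_to_subspace_exists by blast
  have "g x u a = 0" if "a \<in> A" for a
  proof -
    have "u \<bullet> ?a a = 0" using u(2)[OF span_base[of "?a a"]] that by (simp add: orthogonal_def)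
    then show ?thesis using real_functional_inner[OF g_linear(1)[OF x], of a u] g_sym[OF x, of u a] by (simp add: inner_commute)
  qed
  then show ?thesis using u(1) by blast
qed

lemma ortho_card:
  fixes f :: "'i \<Rightarrow> 'e"
  assumes x: "x \<in> U" and J: "finite J" and o: "\<And>i j. i \<in> J \<Longrightarrow> j \<in> J \<Longrightarrow> i \<noteq> j \<Longrightarrow> g x (f i) (f j) = 0"
    and nz: "\<And>i. i \<in> J \<Longrightarrow> f i \<noteq> 0"
  shows "card J \<le> DIM('e)"
proof -
  have inj: "inj_on f J"
    by (rule inj_onI) (use o nz g_zero_iff[OF x] in metis)
  have "independent (f ` J)"
  proof
    assume "dependent (f ` J)"
    then obtain a where a: "a \<in> f ` J" "a \<in> span (f ` J - {a})" unfolding dependent_def by blast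
    then obtain i where i: "i \<in> J" "a = f i" by blast
    have "subspace {w. g x a w = 0}" by (rule subspaceI) (simp_all add: g_zero[OF x] g_add[OF x] g_scale[OF x])
    moreover have "f ` J - {a} \<subseteq> {w. g x a w = 0}" using o i by blast
    ultimately have "a \<in> {w. g x a w = 0}" using a(2) span_minimal by blast
    then show False using g_zero_iff[OF x] nz i by simp
  qed
  then have "card (f ` J) \<le> DIM('e)" using independent_bound by blast
  then show ?thesis by (simp add: card_image[OF inj])
qed

lemma orthonormal_exists:
  assumes x: "x \<in> U"
  shows "k < DIM('e) \<Longrightarrow> \<exists>e::nat \<Rightarrow> 'e. (\<forall>i\<in>{1..k}. g x v (e i) = 0) \<and>
     (\<forall>i\<in>{1..k}. \<forall>j\<in>{1..k}. g x (e i) (e j) = (if i = j then 1 else 0))"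
proof (induction k)
  case (Suc k)
  then obtain e :: "nat \<Rightarrow> 'e" where "(\<forall>i\<in>{1..k}. g x v (e i) = 0) \<and>
     (\<forall>i\<in>{1..k}. \<forall>j\<in>{1..k}. g x (e i) (e j) = (if i = j then 1 else 0))" by (meson Suc_lessD)
  then have e: "\<And>i. i \<in> {1..k} \<Longrightarrow> g x v (e i) = 0"
    "\<And>i j. i \<in> {1..k} \<Longrightarrow> j \<in> {1..k} \<Longrightarrow> g x (e i) (e j) = (if i = j then 1 else 0)" by blast+
  have "card (insert v (e ` {1..k})) \<le> Suc (card (e ` {1..k}))" by (rule card_insert_le_m1) simp_all
  also have "\<dots> \<le> Suc k" using card_image_le[of "{1..k}" e] by simp
  finally obtain u where u: "u \<noteq> 0" "\<And>a. a \<in> insert v (e ` {1..k}) \<Longrightarrow> g x u a = 0"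
    using ortho_exists[OF x, of "insert v (e ` {1..k})"] Suc.prems by auto
  define w where "w = u /\<^sub>R sqrt (g x u u)"
  have p: "g x u u > 0" by (rule g_pos[OF x u(1)])
  have w: "g x w w = 1" using p by (simp add: w_def g_scale[OF x] field_simps)
  have wo: "g x w a = 0" "g x a w = 0" if "a \<in> insert v (e ` {1..k})" for a
    using u(2)[OF that] g_sym[OF x, of a u] by (simp_all add: w_def g_scale[OF x])
  show ?case
    by (rule exI[of _ "e(Suc k := w)"]) (use e w wo in \<open>auto simp: le_Suc_eq\<close>)
qed simp

text \<open>A nonzero remainder \<open>z\<close> would complete \<open>v\<close> and the
  \<open>m\<close> vectors \<open>e i\<close> to \<open>m + 2\<close> nonzero, pairwise orthogonal
  vectors in dimension \<open>m + 1\<close>.\<close>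

lemma orthonormal_expand:
  assumes x: "x \<in> U" and m: "DIM('e) = m + 1" and v: "v \<noteq> 0"
    and ev: "\<And>i. i \<in> {1..m} \<Longrightarrow> g x (e i) v = 0"
    and ee: "\<And>i j. i \<in> {1..m} \<Longrightarrow> j \<in> {1..m} \<Longrightarrow> g x (e i) (e j) = (if i = j then 1 else 0)"
  shows "w = (g x w v / g x v v) *\<^sub>R v + (\<Sum>i=1..m. g x w (e i) *\<^sub>R e i)"
proof (rule ccontr)
  define z where "z = w - (g x w v / g x v v) *\<^sub>R v - (\<Sum>i=1..m. g x w (e i) *\<^sub>R e i)"
  assume "w \<noteq> (g x w v / g x v v) *\<^sub>R v + (\<Sum>i=1..m. g x w (e i) *\<^sub>R e i)"
  then have z: "z \<noteq> 0" by (simp add: z_def algebra_simps)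
  have ve: "g x v (e i) = 0" if "i \<in> {1..m}" for i using ev[OF that] g_sym[OF x] by metis
  have zv: "g x z v = 0" using g_pos[OF x v] ev by (simp add: z_def g_diff[OF x] g_scale[OF x] g_sum[OF x])
  have ze: "g x z (e j) = 0" if j: "j \<in> {1..m}" for j
  proof -
    have "(\<Sum>i=1..m. g x w (e i) * g x (e i) (e j)) = (\<Sum>i=1..m. if i = j then g x w (e j) else 0)"
      by (rule sum.cong) (use ee j in auto)
    also have "\<dots> = g x w (e j)" using j by simp
    finally show ?thesis using ve[OF j] by (simp add: z_def g_diff[OF x] g_scale[OF x] g_sum[OF x])
  qed
  \<comment> \<open>One family indexed by \<open>{0..m+1}\<close>: \<open>v\<close> sits at 0,
    \<open>z\<close> at \<open>m + 1\<close>, and the given vectors keep their indices between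
    them.\<close>
  define f where "f i = (if i = 0 then v else if i = m + 1 then z else e i)" for i
  have fi: "f i = e i \<and> i \<in> {1..m}" if "i \<noteq> 0" "i \<noteq> m + 1" "i \<in> {0..m+1}" for i using that by (auto simp: f_def)
  have f0: "f 0 = v" "f (m + 1) = z" by (simp_all add: f_def)
  have half: "g x (f i) (f j) = 0" if "i \<in> {0..m+1}" "j \<in> {0..m+1}" "i < j" for i j
  proof (cases "j = m + 1")
    case True
    show ?thesis
    proof (cases "i = 0")
      case True
      then show ?thesis using \<open>j = m + 1\<close> zv f0 g_sym[OF x, of v z] by simp
    next
      case False
      then show ?thesis using \<open>j = m + 1\<close> fi[of i] that f0 ze[of i] g_sym[OF x, of "e i" z] by simp
    qed
  next
    case False
    then show ?thesis using that fi[of j] fi[of i] ee[of i j] ve[of j] f0 by (cases "i = 0") auto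
  qed
  have "card {0..m+1} \<le> DIM('e)"
  proof (rule ortho_card[OF x, of _ f])
    show "g x (f i) (f j) = 0" if "i \<in> {0..m+1}" "j \<in> {0..m+1}" "i \<noteq> j" for i j
      using half[of i j] half[of j i] that g_sym[OF x, of "f i" "f j"] by (cases "i < j") auto
    show "f i \<noteq> 0" if i: "i \<in> {0..m+1}" for i
    proof -
      consider "i = 0" | "i = m + 1" | "i \<noteq> 0" "i \<noteq> m + 1" by blast
      then show ?thesis
      proof cases
        case 3
        then show ?thesis using fi[OF 3 i] ee[of i i] g_zero(1)[OF x] by auto
      qed (use f0 v z in auto)
    qed
  qed simp
  then show False using m by simp
qed

lemma gram_det_pos:
  assumes x: "x \<in> U" and ind: "\<And>a b. a *\<^sub>R u + b *\<^sub>R v = 0 \<Longrightarrow> a = 0 \<and> b = 0"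
  shows "g x u u * g x v v - (g x u v)\<^sup>2 > 0"
proof -
  have v: "v \<noteq> 0" using ind[of 0 1] by auto
  \<comment> \<open>Up to the factor \<open>g x v v\<close> this is the component of
    \<open>u\<close> orthogonal to \<open>v\<close>; its squared length is that factor times the
    Gram determinant.\<close>
  define w where "w = g x v v *\<^sub>R u - g x u v *\<^sub>R v"
  have vv: "g x v v > 0" by (rule g_pos[OF x v])
  have "w \<noteq> 0" using ind[of "g x v v" "- g x u v"] vv by (auto simp: w_def)
  then have "g x w w > 0" by (rule g_pos[OF x])
  also have "g x w w = g x v v * (g x u u * g x v v - (g x u v)\<^sup>2)"
    by (simp add: w_def g_diff[OF x] g_scale[OF x] g_sym[OF x, of v u] power2_eq_square algebra_simps)
  finally show ?thesis using vv by (simp add: zero_less_mult_iff)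
qed

lemma sectional_imp_constant_curvature:
  assumes x: "x \<in> U" and sec: "\<And>u v. (\<And>a b. a *\<^sub>R u + b *\<^sub>R v = 0 \<Longrightarrow> a = 0 \<and> b = 0) \<Longrightarrow>
     g x (Rm x u v v) u / (g x u u * g x v v - (g x u v)\<^sup>2) = K"
  shows "Rm x u v w = K *\<^sub>R (g x v w *\<^sub>R u - g x u w *\<^sub>R v)"
proof (rule constant_curvature_polarize[OF x])
  fix u v
  show "g x (Rm x u v v) u = K * (g x u u * g x v v - (g x u v)\<^sup>2)"
  proof (cases "\<forall>a b. a *\<^sub>R u + b *\<^sub>R v = 0 \<longrightarrow> a = 0 \<and> b = 0")
    case True
    then have ind: "\<And>a b. a *\<^sub>R u + b *\<^sub>R v = 0 \<Longrightarrow> a = 0 \<and> b = 0" by blast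
    have "g x (Rm x u v v) u / (g x u u * g x v v - (g x u v)\<^sup>2) = K" by (rule sec) (rule ind)
    moreover have "g x u u * g x v v - (g x u v)\<^sup>2 > 0" by (rule gram_det_pos[OF x]) (rule ind)
    ultimately show ?thesis by (simp add: field_simps)
  next
    case False
    then obtain a b where ab: "a *\<^sub>R u + b *\<^sub>R v = 0" "a \<noteq> 0 \<or> b \<noteq> 0" by blast
    have self: "Rm x z z z' = 0" for z z' by (simp add: Rm_def)
    have "(\<exists>k. u = k *\<^sub>R v) \<or> (\<exists>k. v = k *\<^sub>R u)"
    proof (cases "a = 0")
      case True then show ?thesis using ab by (auto intro!: exI[of _ 0])
    next
      case False
      have "u = (- b / a) *\<^sub>R v"
      proof -
        have "a *\<^sub>R u = (- b) *\<^sub>R v" using ab(1) by (simp add: add_eq_0_iff2)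
        then have "(1/a) *\<^sub>R (a *\<^sub>R u) = (1/a) *\<^sub>R ((- b) *\<^sub>R v)" by simp
        then show ?thesis using False by simp
      qed
      then show ?thesis by blast
    qed
    then show ?thesis
    proof (elim disjE exE)
      fix k assume "u = k *\<^sub>R v"
      then show ?thesis by (simp add: linear_scale[OF Rm_linear(1)[OF x]] self g_scale[OF x] g_zero[OF x] power2_eq_square)
    next
      fix k assume "v = k *\<^sub>R u"
      then show ?thesis by (simp add: linear_scale[OF Rm_linear(2)[OF x]] self g_scale[OF x] g_zero[OF x] power2_eq_square)
    qed
  qed
qed

end

text \<open>The bound on \<open>k\<close> keeps the sine in the case \<open>k > 0\<close> away from its zero at \<open>pi\<close>.\<close>

lemma profile_function:
  assumes k: "k < 1"
  obtains f f' :: "real \<Rightarrow> real" where "f 0 = 0" "f 1 \<noteq> 0"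
    "\<And>t. (f has_vector_derivative f' t) (at t within {0..1})" "\<And>t. (f' has_vector_derivative - k * f t) (at t within {0..1})"
proof -
  consider "k = 0" | "k > 0" | "k < 0" by linarith
  then show ?thesis
  proof cases
    case 1
    show ?thesis by (rule that[of "\<lambda>t. t" "\<lambda>t. 1"]) (use 1 in \<open>auto intro!: derivative_eq_intros\<close>)
  next
    case 2
    define w where "w = sqrt k"
    have w: "w > 0" "w < 1" "w * w = k" using 2 k by (auto simp: w_def)
    have "sin w > 0" by (rule sin_gt_zero) (use w pi_gt3 in auto)
    then show ?thesis
      by (intro that[of "\<lambda>t. sin (w * t)" "\<lambda>t. w * cos (w * t)"])
         (auto simp: w(3)[symmetric] has_real_derivative_iff_has_vector_derivative[symmetric] intro!: derivative_eq_intros)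
  next
    case 3
    define w where "w = sqrt (- k)"
    have w: "w > 0" "w * w = - k" using 3 by (auto simp: w_def)
    then have kw: "- k = w * w" by simp
    show ?thesis
      by (rule that[of "\<lambda>t. sinh (w * t)" "\<lambda>t. w * cosh (w * t)"])
         (use w(1) in \<open>auto simp: kw has_real_derivative_iff_has_vector_derivative[symmetric] intro!: derivative_eq_intros\<close>)
  qed
qed

context sphere_ball
begin

text \<open>The profile function depends on \<open>K * R\<^sup>2\<close> only, the same number for
  all radial geodesics of length \<open>R\<close>. So one factor \<open>l\<close> serves the whole
  sphere.\<close>

lemma constant_curvature_sphere_umbilic:
  assumes K: "\<And>x u v w. x \<in> cdom c \<Longrightarrow> Rm x u v w = K *\<^sub>R (g x v w *\<^sub>R u - g x u w *\<^sub>R v)" and k: "K * R\<^sup>2 < 1"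
  obtains l where "\<And>y u. g p y y = R\<^sup>2 \<Longrightarrow> g p y u = 0 \<Longrightarrow> Sh y u = l *\<^sub>R E' y u"
proof -
  obtain f f' where f: "f 0 = 0" "f 1 \<noteq> 0"
    "\<And>t. (f has_vector_derivative f' t) (at t within {0..1})" "\<And>t. (f' has_vector_derivative - (K * R\<^sup>2) * f t) (at t within {0..1})"
    by (rule profile_function[OF k], rule that)
  have "Sh y u = (f' 1 / f 1) *\<^sub>R E' y u" if y: "g p y y = R\<^sup>2" "g p y u = 0" for y u
  proof -
    have "f 1 *\<^sub>R Sh y u = f' 1 *\<^sub>R E' y u"
      by (rule constant_curvature_umbilic[OF K small y(2) f(1,3)]) (use y f(4) in auto)
    then have "(1 / f 1) *\<^sub>R (f 1 *\<^sub>R Sh y u) = (1 / f 1) *\<^sub>R (f' 1 *\<^sub>R E' y u)" by simp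
    then show ?thesis using f(2) by simp
  qed
  then show ?thesis by (rule that)
qed

lemma umbilic_radial:
  assumes l: "\<And>y u. g p y y = R\<^sup>2 \<Longrightarrow> g p y u = 0 \<Longrightarrow> Sh y u = l *\<^sub>R E' y u"
    and q: "q \<in> S" and h: "g (snd c q) (N (snd c q)) h = 0"
  shows "Sh (F (snd c q)) (F' (snd c q) h) = l *\<^sub>R h"
proof -
  note s = sphereD[OF q]
  have "Sh (F (snd c q)) (F' (snd c q) h) = l *\<^sub>R E' (F (snd c q)) (F' (snd c q) h)"
  proof (rule l)
    show "g p (F (snd c q)) (F (snd c q)) = R\<^sup>2" using s(4) by (simp add: \<rho>_def)
    show "g p (F (snd c q)) (F' (snd c q) h) = 0" using gauss_N[OF s(2), of h] h by simp
  qed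
  then show ?thesis using F_range[OF s(2)] F'_E'(2)[of "F (snd c q)" h] by simp
qed

text \<open>For an umbilic sphere every diagonal entry of the shape operator is
  \<open>- a * l\<close>, whichever orthonormal basis \<open>SOME\<close> selects. It remains to
  show that such a basis exists.\<close>

lemma mean_curvature_umbilic:
  assumes l: "\<And>y u. g p y y = R\<^sup>2 \<Longrightarrow> g p y u = 0 \<Longrightarrow> Sh y u = l *\<^sub>R E' y u"
    and q: "q \<in> S" and \<xi>: "unit_normal_field M S \<xi>" and a: "\<xi> q = chart_vec M c q (a *\<^sub>R N (snd c q))"
    and m: "CARD('n) = m + 1" "m \<ge> 1"
  shows "mean_curvature M S \<xi> q = - a * l"
proof -
  note s = sphereD[OF q]
  let ?x = "snd c q" and ?T = "tangent_space_of M S q"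
  have "m < DIM(real^'n)" using m by simp
  from orthonormal_exists[OF s(3) this, of "N ?x"]
  obtain e :: "nat \<Rightarrow> real^'n" where "(\<forall>i\<in>{1..m}. g ?x (N ?x) (e i) = 0) \<and>
     (\<forall>i\<in>{1..m}. \<forall>j\<in>{1..m}. g ?x (e i) (e j) = (if i = j then 1 else 0))" ..
  then have e: "\<And>i. i \<in> {1..m} \<Longrightarrow> g ?x (N ?x) (e i) = 0"
     "\<And>i j. i \<in> {1..m} \<Longrightarrow> j \<in> {1..m} \<Longrightarrow> g ?x (e i) (e j) = (if i = j then 1 else 0)" by blast+
  have N0: "N ?x \<noteq> 0"
  proof
    assume "N ?x = 0"
    then show False using s(6) g_zero(1)[OF s(3), of 0] R by simp
  qed
  have ex: "orthonormal_basis M q ?T m (\<lambda>i. chart_vec M c q (e i))"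
    unfolding orthonormal_basis_def
  proof (intro conjI ballI)
    show "chart_vec M c q (e i) \<in> ?T" if "i \<in> {1..m}" for i unfolding sphere_tangent[OF q] using e(1)[OF that] by blast
    show "inn M q (chart_vec M c q (e i)) (chart_vec M c q (e j)) = (if i = j then 1 else 0)" if "i \<in> {1..m}" "j \<in> {1..m}" for i j
      using e(2)[OF that] by (simp add: inn_chart_vec[OF c s(1)])
    fix v assume "v \<in> ?T"
    then obtain h where h: "v = chart_vec M c q h" "g ?x (N ?x) h = 0" unfolding sphere_tangent[OF q] by blast
    have "h = (g ?x h (N ?x) / g ?x (N ?x) (N ?x)) *\<^sub>R N ?x + (\<Sum>i=1..m. g ?x h (e i) *\<^sub>R e i)"
    proof (rule orthonormal_expand[OF s(3) _ N0 _ e(2)])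
      show "g ?x (e i) (N ?x) = 0" if "i \<in> {1..m}" for i using e(1)[OF that] g_sym[OF s(3), of "N ?x" "e i"] by simp
    qed (use m in simp)
    then have "h = (\<Sum>i=1..m. g ?x h (e i) *\<^sub>R e i)" using h(2) g_sym[OF s(3), of "N ?x" h] by simp
    then have "v = lin_comb {1..m} (\<lambda>i. g ?x h (e i)) (\<lambda>i. chart_vec M c q (e i))"
      using h(1) linear_chart_vec(2)[OF c s(1), of "\<lambda>i. g ?x h (e i)" e "{1..m}"] by simp
    then show "\<exists>a. v = lin_comb {1..m} a (\<lambda>i. chart_vec M c q (e i))" by blast
  qed
  define b where "b = (SOME e. orthonormal_basis M q ?T m e)"
  have b: "orthonormal_basis M q ?T m b" unfolding b_def by (rule someI[of "orthonormal_basis M q ?T m", OF ex])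
  have "inn M q (shape_operator M S \<xi> q (b i)) (b i) = - a * l" if i: "i \<in> {1..m}" for i
  proof -
    have bi: "b i \<in> ?T" "inn M q (b i) (b i) = 1" using b i unfolding orthonormal_basis_def by simp_all
    then obtain h where h: "b i = chart_vec M c q h" "g ?x (N ?x) h = 0" unfolding sphere_tangent[OF q] by blast
    have um: "Sh (F ?x) (F' ?x h) = l *\<^sub>R h" by (rule umbilic_radial[OF _ q h(2)]) (rule l)
    have "shape_operator M S \<xi> q (b i) = chart_vec M c q (- a *\<^sub>R Sh (F ?x) (F' ?x h))"
      unfolding h(1) by (rule shape_operator_radial[OF \<xi> q h(2) a])
    then have "inn M q (shape_operator M S \<xi> q (b i)) (b i) = - a * l * g ?x h h"
      unfolding um h(1) by (simp add: inn_chart_vec[OF c s(1)] g_scale[OF s(3)] g_minus[OF s(3)])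
    also have "g ?x h h = 1" using bi(2) h(1) by (simp add: inn_chart_vec[OF c s(1)])
    finally show ?thesis by simp
  qed
  then have "(\<Sum>i=1..m. inn M q (shape_operator M S \<xi> q (b i)) (b i)) = (\<Sum>i=1..m. - a * l)" by (rule sum.cong[OF refl])
  moreover have "mean_curvature M S \<xi> q = (1 / real m) * (\<Sum>i=1..m. inn M q (shape_operator M S \<xi> q (b i)) (b i))"
    unfolding mean_curvature_def Let_def b_def m(1) diff_add_inverse2 by (rule refl)
  ultimately show ?thesis using m(2) by simp
qed

end

section \<open>Umbilic spheres satisfy the frame condition\<close>

context sphere_ball
begin

lemma umbilic_RM:
  assumes l: "\<And>y u. g p y y = R\<^sup>2 \<Longrightarrow> g p y u = 0 \<Longrightarrow> Sh y u = l *\<^sub>R E' y u"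
    and m: "CARD('n) = m + 1" "m \<ge> 1"
    and \<xi>: "unit_normal_field M S \<xi>" and \<alpha>: "unit_speed_C2_curve M I \<alpha>" "\<alpha> ` I \<subseteq> S"
    and n: "RM_frame M m I \<alpha> n" and \<kappa>: "RM_curvatures M m I \<alpha> n \<kappa>"
  shows "\<exists>a :: nat \<Rightarrow> real. \<forall>s\<in>I. (\<Sum>i=1..m. a i * \<kappa> i s) = mean_curvature M S \<xi> (\<alpha> s) \<and>
             \<xi> (\<alpha> s) = lin_comb {1..m} a (\<lambda>i. n i s)"
proof -
  have C: "Ck_curve M 2 I \<alpha>" and unit: "\<And>s. s \<in> I \<Longrightarrow> inn M (\<alpha> s) (velocity M I \<alpha> s) (velocity M I \<alpha> s) = 1"
    using \<alpha>(1) unfolding unit_speed_C2_curve_def by auto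
  have q: "\<alpha> t \<in> S" if "t \<in> I" for t using \<alpha>(2) that by auto
  note f = sphereD(1)[OF q]
  obtain \<sigma> where sg: "\<And>t. t \<in> I \<Longrightarrow> \<xi> (\<alpha> t) = chart_vec M c (\<alpha> t) ((\<sigma> / R) *\<^sub>R N (snd c (\<alpha> t)))"
    by (rule unit_normal_along[OF \<xi> Ck_curveD(2)[OF C] \<alpha>(2) Ck_curveD(1)[OF C]]) (rule that)
  define a0 where "a0 = \<sigma> / R"
  note sg = sg[folded a0_def]
  define x where "x t = snd c (\<alpha> t)" for t
  define v where "v t = velocity M I \<alpha> t c" for t
  define \<nu> where "\<nu> i t = n i t c" for i t
  have U: "x t \<in> cdom c" if "t \<in> I" for t using sphereD(3)[OF q[OF that]] by (simp add: x_def)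
  have vT: "velocity M I \<alpha> t \<in> tangent_space M (\<alpha> t)" if "t \<in> I" for t by (rule curve_velocity[OF C _ that]) simp
  have nC: "C1_field_along M I \<alpha> (n i)" if "i \<in> {1..m}" for i using n that unfolding RM_frame_def RM_field_def by blast
  have nT: "n i t \<in> tangent_space M (\<alpha> t)" if "i \<in> {1..m}" "t \<in> I" for i t using nC[OF that(1)] that(2) unfolding C1_field_along_def by blast
  have n\<nu>: "n i t = chart_vec M c (\<alpha> t) (\<nu> i t)" if "i \<in> {1..m}" "t \<in> I" for i t
    using tangent_chart[OF nT[OF that] c f[OF that(2)]] by (simp add: \<nu>_def)
  have vv: "g (x t) (v t) (v t) = 1" if "t \<in> I" for t
    using unit[OF that] inn_chart[OF vT[OF that] vT[OF that] c f[OF that]] by (simp add: x_def v_def)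
  have nv: "g (x t) (\<nu> i t) (v t) = 0" if "i \<in> {1..m}" "t \<in> I" for i t
  proof -
    have "inn M (\<alpha> t) (n i t) (velocity M I \<alpha> t) = 0" using n that unfolding RM_frame_def RM_field_def by blast
    then show ?thesis using inn_chart[OF nT[OF that] vT[OF that(2)] c f[OF that(2)]] by (simp add: x_def v_def \<nu>_def)
  qed
  have nn: "g (x t) (\<nu> i t) (\<nu> j t) = (if i = j then 1 else 0)" if "i \<in> {1..m}" "j \<in> {1..m}" "t \<in> I" for i j t
  proof -
    have "inn M (\<alpha> t) (n i t) (n j t) = (if i = j then 1 else 0)" using n that unfolding RM_frame_def RM_field_def by auto
    then show ?thesis using inn_chart[OF nT[OF that(1,3)] nT[OF that(2,3)] c f[OF that(3)]] by (simp add: x_def \<nu>_def)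
  qed
  have Nv: "g (x t) (N (x t)) (v t) = 0" if "t \<in> I" for t
    using curve_in_sphere[OF C _ \<alpha>(2) that] by (simp add: x_def v_def)
  have dx: "(x has_vector_derivative v t) (at t within I)" if "t \<in> I" for t
    using curve_derivative[OF C _ that c f[OF that]] unfolding x_def[abs_def] v_def by simp
  have dN: "((\<lambda>t. a0 *\<^sub>R N (x t)) has_vector_derivative a0 *\<^sub>R N' (x t) (v t)) (at t within I)" if "t \<in> I" for t
  proof -
    have W: "x t \<in> W" using sphereD(2)[OF q[OF that]] by (simp add: x_def)
    show ?thesis
      by (rule bounded_linear.has_vector_derivative[OF bounded_linear_scaleR_right has_vector_derivative_chain[OF dN[OF W] dx[OF that]]])
  qed
  have covN: "a0 *\<^sub>R N' (x t) (v t) + Gam c (x t) (v t) (a0 *\<^sub>R N (x t)) = (a0 * l) *\<^sub>R v t" if "t \<in> I" for t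
  proof -
    have W: "x t \<in> W" using sphereD(2)[OF q[OF that]] by (simp add: x_def)
    have "Sh (F (x t)) (F' (x t) (v t)) = l *\<^sub>R v t"
      unfolding x_def by (rule umbilic_radial[OF _ q[OF that]], rule l) (use Nv[OF that] in \<open>simp_all add: x_def\<close>)
    then show ?thesis using cov_N[OF W, of "v t"] \<Gamma>_scale(2)[OF U[OF that]] by (simp flip: scaleR_add_right)
  qed
  have dcov: "\<exists>X'. ((\<lambda>t. X t c) has_vector_derivative X') (at t within I) \<and>
       cov_deriv M I \<alpha> X t c = X' + Gam c (x t) (v t) (X t c)" if X: "C1_field_along M I \<alpha> X" and t: "t \<in> I" for X t
  proof -
    obtain X' where X': "((\<lambda>t. X t c) has_vector_derivative X') (at t within I)"
      using field_derivative[OF C X t c f[OF t]] by blast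
    have "cov_deriv M I \<alpha> X t = chart_vec M c (\<alpha> t) (X' + Gam c (snd c (\<alpha> t)) (velocity M I \<alpha> t c) (X t c))"
    proof (rule cov_deriv_chart[where \<alpha>=\<alpha> and X=X, OF c f[OF t] Ck_curveD(2)[OF C] t Ck_curveD(3)[OF C t] _ _ X'])
      show "((\<lambda>t. snd c (\<alpha> t)) has_vector_derivative velocity M I \<alpha> t c) (at t within I)"
        by (rule curve_derivative[OF C _ t c f[OF t]]) simp
      show "X t \<in> tangent_space M (\<alpha> t)" if "t \<in> I" for t using X that unfolding C1_field_along_def by blast
    qed
    then show ?thesis using X' chart_vec_self[OF c f[OF t]] unfolding x_def v_def by (intro exI[of _ X']) simp
  qed
  define b where "b i t = g (x t) (a0 *\<^sub>R N (x t)) (\<nu> i t)" for i t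
  \<comment> \<open>Both covariant derivatives involved are multiples of the velocity, which is
    orthogonal to \<xi> and to \<nu> i; both terms of the product rule vanish.\<close>
  have db: "(b i has_vector_derivative 0) (at t within I)" if i: "i \<in> {1..m}" and t: "t \<in> I" for i t
  proof -
    obtain X' where X': "(\<nu> i has_vector_derivative X') (at t within I)"
      "cov_deriv M I \<alpha> (n i) t c = X' + Gam c (x t) (v t) (\<nu> i t)"
      using dcov[OF nC[OF i] t] unfolding \<nu>_def[abs_def] by blast
    have "cov_deriv M I \<alpha> (n i) t = scale_vec (- \<kappa> i t) (velocity M I \<alpha> t)"
      using \<kappa> i t unfolding RM_curvatures_def by blast
    then have e: "X' + Gam c (x t) (v t) (\<nu> i t) = (- \<kappa> i t) *\<^sub>R v t" using X'(2) by (simp add: scale_vec_def v_def)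
    have "(b i has_vector_derivative g (x t) (a0 *\<^sub>R N' (x t) (v t) + Gam c (x t) (v t) (a0 *\<^sub>R N (x t))) (\<nu> i t)
        + g (x t) (a0 *\<^sub>R N (x t)) (X' + Gam c (x t) (v t) (\<nu> i t))) (at t within I)"
      unfolding b_def[abs_def] by (rule has_vector_derivative_g[OF U[OF t] dx[OF t] dN[OF t] X'(1) t])
    moreover have "g (x t) (v t) (\<nu> i t) = 0" using nv[OF i t] g_sym[OF U[OF t], of "v t" "\<nu> i t"] by simp
    ultimately show ?thesis
      unfolding covN[OF t] e using Nv[OF t] by (simp add: g_scale[OF U[OF t]] g_minus[OF U[OF t]])
  qed
  obtain s0 where s0: "s0 \<in> I" using C unfolding Ck_curve_def by blast
  have conv: "convex I" using Ck_curveD(1)[OF C] is_interval_convex by blast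
  have bc: "b i t = b i s0" if "i \<in> {1..m}" "t \<in> I" for i t
  proof -
    note d = db[OF that(1)]
    obtain k where "\<And>t. t \<in> I \<Longrightarrow> b i t = k"
      by (rule has_vector_derivative_zero_constant[OF conv d], assumption, rule that)
    then show ?thesis using that(2) s0 by simp
  qed
  have expand: "a0 *\<^sub>R N (x t) = (\<Sum>i=1..m. b i t *\<^sub>R \<nu> i t)" if t: "t \<in> I" for t
  proof -
    have "a0 *\<^sub>R N (x t) = (g (x t) (a0 *\<^sub>R N (x t)) (v t) / g (x t) (v t) (v t)) *\<^sub>R v t + (\<Sum>i=1..m. g (x t) (a0 *\<^sub>R N (x t)) (\<nu> i t) *\<^sub>R \<nu> i t)"
    proof (rule orthonormal_expand[OF U[OF t] _ _ nv[OF _ t] nn[OF _ _ t]])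
      show "v t \<noteq> 0" using vv[OF t] g_zero[OF U[OF t]] by auto
    qed (use m in simp)
    also have "\<dots> = (\<Sum>i=1..m. b i t *\<^sub>R \<nu> i t)" using Nv[OF t] by (simp add: b_def g_scale(1)[OF U[OF t], of a0 "N (x t)" "v t"])
    finally show ?thesis .
  qed
  \<comment> \<open>Differentiating \<langle>\<xi>, \<alpha>'\<rangle> = 0 pairs the umbilic factor
    \<open>a0 * l\<close> with the acceleration, whose coefficients are the \<kappa> i. Minus that
    factor is the mean curvature.\<close>
  have main: "(\<Sum>i=1..m. b i t * \<kappa> i t) = - a0 * l" if t: "t \<in> I" for t
  proof -
    obtain X' where X': "(v has_vector_derivative X') (at t within I)"
      "cov_deriv M I \<alpha> (velocity M I \<alpha>) t c = X' + Gam c (x t) (v t) (v t)"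
      using dcov[OF velocity_C1_field[OF C] t] unfolding v_def[abs_def] by blast
    have "cov_deriv M I \<alpha> (velocity M I \<alpha>) t = lin_comb {1..m} (\<lambda>i. \<kappa> i t) (\<lambda>i. n i t)"
      using \<kappa> t unfolding RM_curvatures_def by blast
    then have e: "X' + Gam c (x t) (v t) (v t) = (\<Sum>i=1..m. \<kappa> i t *\<^sub>R \<nu> i t)" using X'(2) by (simp add: lin_comb_def \<nu>_def)
    have "((\<lambda>t. g (x t) (a0 *\<^sub>R N (x t)) (v t)) has_vector_derivative
        g (x t) (a0 *\<^sub>R N' (x t) (v t) + Gam c (x t) (v t) (a0 *\<^sub>R N (x t))) (v t)
        + g (x t) (a0 *\<^sub>R N (x t)) (X' + Gam c (x t) (v t) (v t))) (at t within I)"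
      by (rule has_vector_derivative_g[OF U[OF t] dx[OF t] dN[OF t] X'(1) t])
    then have 1: "((\<lambda>t. g (x t) (a0 *\<^sub>R N (x t)) (v t)) has_vector_derivative
        a0 * l + (\<Sum>i=1..m. b i t * \<kappa> i t)) (at t within I)"
      unfolding covN[OF t] e using vv[OF t] by (simp add: g_scale(1)[OF U[OF t], of "a0 * l"] g_sum[OF U[OF t]] g_scale(2)[OF U[OF t]] b_def mult.commute)
    have "((\<lambda>t. g (x t) (a0 *\<^sub>R N (x t)) (v t)) has_vector_derivative 0) (at t within I)"
      by (rule has_vector_derivative_transform[OF t _ has_vector_derivative_const[of 0]]) (simp add: g_scale(1)[OF U] Nv)
    from vector_derivative_unique_within[OF Ck_curveD(3)[OF C t] 1 this] show ?thesis by simp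
  qed
  show ?thesis
  \<comment> \<open>The constants are the products \<langle>\<xi>, n i\<rangle> at an arbitrary base
    point of the interval.\<close>
  proof (rule exI[of _ "\<lambda>i. b i s0"], intro ballI conjI)
    fix s assume s: "s \<in> I"
    have bs: "b i s0 = b i s" if "i \<in> {1..m}" for i using bc[OF that s] by simp
    have "mean_curvature M S \<xi> (\<alpha> s) = - a0 * l"
      by (rule mean_curvature_umbilic[OF _ q[OF s] \<xi> sg[OF s] m]) (rule l)
    moreover have "(\<Sum>i=1..m. b i s0 * \<kappa> i s) = (\<Sum>i=1..m. b i s * \<kappa> i s)" by (rule sum.cong) (simp_all add: bs)
    ultimately show "(\<Sum>i=1..m. b i s0 * \<kappa> i s) = mean_curvature M S \<xi> (\<alpha> s)" using main[OF s] by simp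
    have "\<xi> (\<alpha> s) = chart_vec M c (\<alpha> s) (\<Sum>i=1..m. b i s *\<^sub>R \<nu> i s)" using sg[OF s] expand[OF s] by (simp add: x_def)
    also have "\<dots> = lin_comb {1..m} (\<lambda>i. b i s) (\<lambda>i. chart_vec M c (\<alpha> s) (\<nu> i s))" by (rule linear_chart_vec(2)[OF c f[OF s]])
    also have "\<dots> = lin_comb {1..m} (\<lambda>i. b i s0) (\<lambda>i. n i s)"
      unfolding lin_comb_def by (intro ext sum.cong refl) (simp add: bs n\<nu>[OF _ s])
    finally show "\<xi> (\<alpha> s) = lin_comb {1..m} (\<lambda>i. b i s0) (\<lambda>i. n i s)" .
  qed
qed

end

section \<open>From constant curvature to the frame condition on the manifold\<close>

context riem_manifold
begin

lemma constant_curvature_chart: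
  assumes K: "\<And>p u v. p \<in> topspace (mtop M) \<Longrightarrow> u \<in> tangent_space M p \<Longrightarrow> v \<in> tangent_space M p \<Longrightarrow>
        (\<forall>a b. (\<forall>c. a *\<^sub>R u c + b *\<^sub>R v c = 0) \<longrightarrow> a = 0 \<and> b = 0) \<Longrightarrow> sectional_curvature M p u v = K"
    and c: "c \<in> atlas M" and x: "x \<in> cdom c"
  shows "local_metric.Rm (Gam c) (DGam c) x u v w = K *\<^sub>R (chart_inn M c x v w *\<^sub>R u - chart_inn M c x u w *\<^sub>R v)"
proof -
  interpret L: local_metric "cdom c" "chart_inn M c" "Gam c" "DGam c" by (rule local_metric_chart[OF c])
  have q: "chart_inv c x \<in> fst c" "snd c (chart_inv c x) = x" by (rule chart_inv_in[OF x], rule chart_inv_right[OF x])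
  let ?q = "chart_inv c x"
  have "L.Rm x u v w = K *\<^sub>R (chart_inn M c x v w *\<^sub>R u - chart_inn M c x u w *\<^sub>R v)" for u v w
  proof (rule L.sectional_imp_constant_curvature[OF x])
    fix u v :: "real^'n" assume ind: "\<And>a b. a *\<^sub>R u + b *\<^sub>R v = 0 \<Longrightarrow> a = 0 \<and> b = 0"
    let ?u = "chart_vec M c ?q u" and ?v = "chart_vec M c ?q v"
    have t: "?u \<in> tangent_space M ?q" "?v \<in> tangent_space M ?q" using chart_vec_tangent[OF c q(1)] by auto
    have s: "?u c = u" "?v c = v" using chart_vec_self[OF c q(1)] by auto
    have "a = 0 \<and> b = 0" if "\<forall>c. a *\<^sub>R ?u c + b *\<^sub>R ?v c = 0" for a b
      using that[rule_format, of c] ind[of a b] by (simp add: s)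
    then have "sectional_curvature M ?q ?u ?v = K"
      by (intro K t) (use q(1) chart_subset[OF c] in blast)+
    then show "chart_inn M c x (L.Rm x u v v) u / (chart_inn M c x u u * chart_inn M c x v v - (chart_inn M c x u v)\<^sup>2) = K"
      unfolding sectional_curvature_def curvature_chart[OF c q(1) t t(2)] s q(2) inn_chart_vec[OF c q(1)] .
  qed
  then show ?thesis .
qed

text \<open>A single normal ball serves all small radii about \<open>p\<close>. The converse needs
  this, since it follows one radial geodesic through the spheres of all smaller radii down to the
  centre.\<close>

lemma sphere_ball_exists:
  assumes c: "c \<in> atlas M" "p \<in> fst c"
  obtains E V F E' V' F' vel \<eta> r R0 where "R0 > 0"
    "chart_ball M c (snd c p) E V F E' V' F' vel \<eta> r"
    "\<And>R. 0 < R \<Longrightarrow> R < R0 \<Longrightarrow> sphere_ball M c (snd c p) E V F E' V' F' vel \<eta> r R"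
proof -
  interpret L: local_metric "cdom c" "chart_inn M c" "Gam c" "DGam c" by (rule local_metric_chart[OF c(1)])
  have "snd c p \<in> cdom c" using c by blast
  from L.exp_ball_exists[OF this] obtain E V F E' V' F' vel \<eta> r where
    "exp_ball (cdom c) (chart_inn M c) (Gam c) (DGam c) (snd c p) E V F E' V' F' vel \<eta> r" by blast
  then interpret exp_ball "cdom c" "chart_inn M c" "Gam c" "DGam c" "snd c p" E V F E' V' F' vel \<eta> r .
  have cb: "chart_ball M c (snd c p) E V F E' V' F' vel \<eta> r"
    by (intro chart_ball.intro chart_ball_axioms.intro riem_manifold_axioms exp_ball_axioms c(1))
  obtain R0 where R0: "R0 > 0" "\<And>R y. R < R0 \<Longrightarrow> 0 \<le> R \<Longrightarrow> chart_inn M c (snd c p) y y \<le> R\<^sup>2 \<Longrightarrow> y \<in> ball 0 r"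
    using small_radius by blast
  have "sphere_ball M c (snd c p) E V F E' V' F' vel \<eta> r R" if "0 < R" "R < R0" for R
  proof (intro sphere_ball.intro sphere_ball_axioms.intro cb that(1))
    show "y \<in> ball 0 r" if "chart_inn M c (snd c p) y y \<le> R\<^sup>2" for y
      by (rule R0(2)[OF \<open>R < R0\<close> _ that]) (use \<open>0 < R\<close> in simp)
  qed
  from that[OF R0(1) cb this] show ?thesis .
qed

text \<open>The condition on a single sphere, worded as in the theorem so that the equivalence can
  be folded into statements about \<open>p\<close> and \<open>R\<close>.\<close>

definition RM_property :: "nat \<Rightarrow> 'a \<Rightarrow> real \<Rightarrow> bool" where
  "RM_property m p R \<longleftrightarrow> (\<forall>\<xi> I \<alpha> n \<kappa>.
          unit_normal_field M (geodesic_sphere M p R) \<xi> \<and>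
          unit_speed_C2_curve M I \<alpha> \<and> \<alpha> ` I \<subseteq> geodesic_sphere M p R \<and>
          RM_frame M m I \<alpha> n \<and> RM_curvatures M m I \<alpha> n \<kappa> \<longrightarrow>
          (\<exists>a :: nat \<Rightarrow> real. \<forall>s\<in>I.
             (\<Sum>i=1..m. a i * \<kappa> i s) = mean_curvature M (geodesic_sphere M p R) \<xi> (\<alpha> s) \<and>
             \<xi> (\<alpha> s) = lin_comb {1..m} a (\<lambda>i. n i s)))"

lemma constant_curvature_imp_RM:
  assumes cs: "constant_sectional_curvature M" and m: "CARD('n) = m + 1" "m \<ge> 1" and p: "p \<in> topspace (mtop M)"
  shows "\<exists>R\<^sub>0>0. \<forall>R. 0 < R \<and> R < R\<^sub>0 \<longrightarrow> hypersurface M (geodesic_sphere M p R) \<and> RM_property m p R"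
proof -
  obtain K where K: "\<And>p u v. p \<in> topspace (mtop M) \<Longrightarrow> u \<in> tangent_space M p \<Longrightarrow> v \<in> tangent_space M p \<Longrightarrow>
        (\<forall>a b. (\<forall>c. a *\<^sub>R u c + b *\<^sub>R v c = 0) \<longrightarrow> a = 0 \<and> b = 0) \<Longrightarrow> sectional_curvature M p u v = K"
    using cs unfolding constant_sectional_curvature_def Ball_def by (elim exE) (rule that, simp)
  obtain c where cc: "c \<in> atlas M" "p \<in> fst c" using p topspace_charts by blast
  obtain E V F E' V' F' vel \<eta> r R1 where R1: "R1 > 0"
    and sb: "\<And>R. 0 < R \<Longrightarrow> R < R1 \<Longrightarrow> sphere_ball M c (snd c p) E V F E' V' F' vel \<eta> r R"
    by (rule sphere_ball_exists[OF cc]) (rule that)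
  \<comment> \<open>The second bound gives \<open>K * R\<^sup>2 < 1\<close>, which
    \<open>profile_function\<close> needs; the summand 1 covers \<open>K = 0\<close>.\<close>
  define R0 where "R0 = min R1 (1 / sqrt (\<bar>K\<bar> + 1))"
  have R0: "R0 > 0" using R1 by (simp add: R0_def)
  have small_K: "K * R\<^sup>2 < 1" if "0 < R" "R < R0" for R
  proof -
    have "R < 1 / sqrt (\<bar>K\<bar> + 1)" using that by (simp add: R0_def)
    then have "R\<^sup>2 < (1 / sqrt (\<bar>K\<bar> + 1))\<^sup>2" using that by (intro power_strict_mono) auto
    then have "R\<^sup>2 * (\<bar>K\<bar> + 1) < 1" by (simp add: power_divide field_simps)
    moreover have "K * R\<^sup>2 \<le> R\<^sup>2 * (\<bar>K\<bar> + 1)"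
      using mult_right_mono[of K "\<bar>K\<bar> + 1" "R\<^sup>2"] by (simp add: mult.commute)
    ultimately show ?thesis by linarith
  qed
  show ?thesis
  proof (intro exI[of _ R0] conjI R0 allI impI)
    fix R assume "0 < R \<and> R < R0"
    then have Rb: "0 < R" "R < R0" "R < R1" by (auto simp: R0_def)
    interpret sphere_ball M c "snd c p" E V F E' V' F' vel \<eta> r R by (rule sb[OF Rb(1,3)])
    have pp: "chart_inv c (snd c p) = p" by (rule chart_inv_left[OF cc])
    show "hypersurface M (geodesic_sphere M p R)" using sphere_hypersurface unfolding pp .
    obtain l where l: "\<And>y u. g (snd c p) y y = R\<^sup>2 \<Longrightarrow> g (snd c p) y u = 0 \<Longrightarrow> Sh y u = l *\<^sub>R E' y u"
    proof (rule constant_curvature_sphere_umbilic[where K=K])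
      show "Rm x u v w = K *\<^sub>R (g x v w *\<^sub>R u - g x u w *\<^sub>R v)" if "x \<in> cdom c" for x u v w
        by (rule constant_curvature_chart[OF _ cc(1) that]) (rule K)
    qed (rule small_K[OF Rb(1,2)], rule that)
    have um: "Sh y u = l *\<^sub>R E' y u" if "g (snd c p) y y = R\<^sup>2" "g (snd c p) y u = 0" for y u by (rule l[OF that])
    show "RM_property m p R" unfolding RM_property_def
      by (intro allI impI, elim conjE) (rule umbilic_RM[unfolded pp, OF um m])
  qed
qed

end

section \<open>Curves with rotation minimizing frames on a given sphere\<close>

lemma Ck_on_sqrt: "Ck_on 1 sqrt {0<..}"
proof -
  have "Ck_on (Suc 0) sqrt {0<..}"
  proof (rule Ck_on_vector_SucI[OF rich_open])
    show "(sqrt has_vector_derivative inverse (sqrt x) / 2) (at x within {0<..})" if "x \<in> {0<..}" for x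
      using DERIV_real_sqrt[of x] that
      by (simp add: has_real_derivative_iff_has_vector_derivative[symmetric] has_field_derivative_at_within)
    have "continuous_on {0<..} (\<lambda>x. inverse (sqrt x) / 2)" by (intro continuous_intros) auto
    then show "Ck_on 0 (\<lambda>x. inverse (sqrt x) / 2) {0<..}" by simp
  qed simp
  then show ?thesis by simp
qed

context riem_manifold
begin

lemma Ck_on_chart_inn:
  assumes c: "c \<in> atlas M" and S: "rich S" "S \<subseteq> cdom c" and a: "Ck_on 1 a S" "Ck_on 1 b S"
  shows "Ck_on 1 (\<lambda>x. chart_inn M c x (a x) (b x)) S"
proof -
  have "Ck_on 1 (\<lambda>x. \<Sum>i\<in>Basis. (a x \<bullet> i) *\<^sub>R (\<Sum>j\<in>Basis. (b x \<bullet> j) *\<^sub>R chart_inn M c x i j)) S"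
    by (intro Ck_on_sum Ck_on_scaleR Ck_on_inner_left S(1) a Ck_on_subset[OF S(1,2)] Ck_on_mono[OF _ chart_inn_C2[OF c], of 1]) simp
  moreover have "(\<Sum>i\<in>Basis. (a x \<bullet> i) *\<^sub>R (\<Sum>j\<in>Basis. (b x \<bullet> j) *\<^sub>R chart_inn M c x i j)) = chart_inn M c x (a x) (b x)" if "x \<in> S" for x
  proof -
    have "bilinear (chart_inn M c x)" using chart_inn_bilinear[OF c] that S(2) by blast
    then have l: "linear (chart_inn M c x u)" "linear (\<lambda>u. chart_inn M c x u v)" for u v unfolding bilinear_def by auto
    have "chart_inn M c x (a x) (b x) = (\<Sum>i\<in>Basis. (a x \<bullet> i) *\<^sub>R chart_inn M c x i (b x))" by (rule linear_Basis_expand[OF l(2)])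
    also have "\<dots> = (\<Sum>i\<in>Basis. (a x \<bullet> i) *\<^sub>R (\<Sum>j\<in>Basis. (b x \<bullet> j) *\<^sub>R chart_inn M c x i j))"
      by (rule sum.cong[OF refl]) (subst linear_Basis_expand[OF l(1), of _ "b x"], rule refl)
    finally show ?thesis by (rule sym)
  qed
  ultimately show ?thesis
    using Ck_on_cong[of S "\<lambda>x. \<Sum>i\<in>Basis. (a x \<bullet> i) *\<^sub>R (\<Sum>j\<in>Basis. (b x \<bullet> j) *\<^sub>R chart_inn M c x i j)" "\<lambda>x. chart_inn M c x (a x) (b x)" 1] by blast
qed

end

context sphere_ball
begin

text \<open>The unit vector field is the normalized projection of a constant field to the tangent spaces of the spheres.\<close>

lemma tangential_unit_field:
  assumes x0: "x0 \<in> W" "\<rho> x0 = R\<^sup>2" and w0: "g x0 (N x0) w0 = 0" "w0 \<noteq> 0"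
  obtains D X where "open D" "D \<subseteq> W" "x0 \<in> D" "Ck_on 1 X D" "\<And>x. x \<in> D \<Longrightarrow> g x (X x) (X x) = 1"
    "\<And>x. x \<in> D \<Longrightarrow> g x (N x) (X x) = 0" "X x0 = w0 /\<^sub>R sqrt (g x0 w0 w0)"
proof -
  have x0U: "x0 \<in> cdom c" by (rule W_dom[OF x0(1)])
  define D1 where "D1 = {x\<in>W. \<rho> x \<in> - {0}}"
  have oD1: "open D1"
  proof -
    have "continuous_on W \<rho>" using Ck_on_mono[OF _ C2_\<rho>, of 0] by simp
    then have "open (\<rho> -` (- {0}) \<inter> W)" using open_E continuous_on_open_vimage by blast
    moreover have "D1 = \<rho> -` (- {0}) \<inter> W" unfolding D1_def by blast
    ultimately show ?thesis by simp
  qed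
  note r1 = rich_open[OF oD1]
  have D1W: "D1 \<subseteq> W" unfolding D1_def by blast
  have D1U: "D1 \<subseteq> cdom c" using D1W W_dom by blast
  \<comment> \<open>On \<open>W\<close> the squared length of \<open>N\<close> is \<rho>, so
    division by \<rho> gives the orthogonal projection along \<open>N\<close>; \<open>D1\<close>
    leaves out the centre, where \<rho> vanishes.\<close>
  define X0 where "X0 x = w0 - (g x w0 (N x) * inverse (\<rho> x)) *\<^sub>R N x" for x
  note CN = Ck_on_subset[OF r1 D1W C1_N]
  have C\<rho>: "Ck_on 1 \<rho> D1" by (rule Ck_on_subset[OF r1 D1W Ck_on_mono[OF _ C2_\<rho>]]) simp
  have CX0: "Ck_on 1 X0 D1" unfolding X0_def[abs_def]
    by (intro Ck_on_diff Ck_on_const Ck_on_scaleR Ck_on_mult Ck_on_inverse Ck_on_chart_inn[OF c] r1 D1U CN C\<rho>)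
       (simp add: D1_def)
  define n2 where "n2 x = g x (X0 x) (X0 x)" for x
  have Cn2: "Ck_on 1 n2 D1" unfolding n2_def[abs_def] by (rule Ck_on_chart_inn[OF c r1 D1U CX0 CX0])
  define D where "D = {x\<in>D1. n2 x \<in> {0<..}}"
  have oD: "open D"
  proof -
    have "continuous_on D1 n2" using Ck_on_mono[OF _ Cn2, of 0] by simp
    then have "open (n2 -` {0<..} \<inter> D1)" using oD1 continuous_on_open_vimage open_greaterThan by blast
    moreover have "D = n2 -` {0<..} \<inter> D1" unfolding D_def by blast
    ultimately show ?thesis by simp
  qed
  note rD = rich_open[OF oD]
  have DD1: "D \<subseteq> D1" unfolding D_def by blast
  define X where "X x = inverse (sqrt (n2 x)) *\<^sub>R X0 x" for x
  have "Ck_on 1 (\<lambda>x. sqrt (n2 x)) D"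
    by (rule Ck_on_compose[OF rD open_greaterThan _ Ck_on_sqrt Ck_on_subset[OF rD DD1 Cn2]]) (auto simp: D_def)
  then have CX: "Ck_on 1 X D" unfolding X_def[abs_def]
    by (intro Ck_on_scaleR Ck_on_inverse rD Ck_on_subset[OF rD DD1 CX0]) (auto simp: D_def)
  have "X0 x0 = w0" using w0 g_sym[OF x0U, of w0 "N x0"] by (simp add: X0_def)
  then have n0: "n2 x0 = g x0 w0 w0" and X: "X x0 = w0 /\<^sub>R sqrt (g x0 w0 w0)" by (simp_all add: n2_def X_def)
  have "g x0 w0 w0 > 0" by (rule g_pos[OF x0U w0(2)])
  then have "x0 \<in> D" using x0 R n0 by (simp add: D_def D1_def)
  moreover have "g x (X x) (X x) = 1" if "x \<in> D" for x
  proof -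
    have U: "x \<in> cdom c" and p: "n2 x > 0" using that D1U by (auto simp: D_def)
    have "g x (X x) (X x) = inverse (sqrt (n2 x)) * (inverse (sqrt (n2 x)) * n2 x)" by (simp add: X_def n2_def g_scale[OF U])
    also have "\<dots> = 1" using p real_sqrt_mult_self[of "n2 x"] by (simp add: field_simps)
    finally show ?thesis .
  qed
  moreover have "g x (N x) (X x) = 0" if "x \<in> D" for x
  proof -
    have xW: "x \<in> W" "\<rho> x \<noteq> 0" using that by (auto simp: D_def D1_def)
    have U: "x \<in> cdom c" by (rule W_dom[OF xW(1)])
    have "g x (N x) (X0 x) = g x (N x) w0 - g x w0 (N x) * inverse (\<rho> x) * \<rho> x"
      using N_norm[OF xW(1)] by (simp add: X0_def g_diff[OF U] g_scale[OF U] \<rho>_def)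
    also have "\<dots> = 0" using xW(2) g_sym[OF U, of w0 "N x"] by simp
    finally show ?thesis by (simp add: X_def g_scale[OF U])
  qed
  moreover have "D \<subseteq> W" using DD1 D1W by blast
  ultimately show ?thesis using that[OF oD _ _ CX _ _ X] by blast
qed

text \<open>An integral curve of the unit field. The field is tangent to all nearby spheres, so
  \<rho> stays constant along the curve; the field is C^1, so the curve is C^2. The prescribed point
  is the end point 0, where derivatives are one-sided.\<close>

lemma tangential_curve:
  assumes x0: "x0 \<in> W" "\<rho> x0 = R\<^sup>2" and w0: "g x0 (N x0) w0 = 0" "w0 \<noteq> 0"
  obtains T x v v' where "T > 0" "x 0 = x0" "v 0 = w0 /\<^sub>R sqrt (g x0 w0 w0)"
    "\<And>t. t \<in> {0..T} \<Longrightarrow> x t \<in> W" "\<And>t. t \<in> {0..T} \<Longrightarrow> \<rho> (x t) = R\<^sup>2"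
    "\<And>t. t \<in> {0..T} \<Longrightarrow> (x has_vector_derivative v t) (at t within {0..T})"
    "\<And>t. t \<in> {0..T} \<Longrightarrow> (v has_vector_derivative v' t) (at t within {0..T})"
    "continuous_on {0..T} v'" "\<And>t. t \<in> {0..T} \<Longrightarrow> g (x t) (v t) (v t) = 1"
proof -
  obtain D X where D: "open D" "D \<subseteq> W" "x0 \<in> D" "Ck_on 1 X D" "\<And>x. x \<in> D \<Longrightarrow> g x (X x) (X x) = 1"
    "\<And>x. x \<in> D \<Longrightarrow> g x (N x) (X x) = 0" "X x0 = w0 /\<^sub>R sqrt (g x0 w0 w0)"
    by (rule tangential_unit_field[OF x0 w0], rule that)
  have "Ck_on (Suc 0) X D" using D(4) by simp
  then obtain X' where X': "\<And>x. x \<in> D \<Longrightarrow> (X has_derivative X' x) (at x)" "\<And>v. Ck_on 0 (\<lambda>x. X' x v) D"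
    by (rule open_Ck_on_SucD[OF _ D(1)]) (rule that)
  have cX': "continuous_on D (\<lambda>z. X' z v)" for v using X'(2) by simp
  obtain T x where T: "T > 0" "x 0 = x0" "\<And>t. t \<in> {0..T} \<Longrightarrow> x t \<in> D"
    "\<And>t. t \<in> {0..T} \<Longrightarrow> (x has_vector_derivative X (x t)) (at t within {0..T})"
    by (rule integral_curve_exists[OF D(1,3) X'(1) cX'], assumption, rule that)
  have xW: "x t \<in> W" if "t \<in> {0..T}" for t using T(3)[OF that] D(2) by blast
  have linX': "linear (X' (x t))" if "t \<in> {0..T}" for t by (rule has_derivative_linear[OF X'(1)[OF T(3)[OF that]]])
  have d\<rho>x: "((\<lambda>t. \<rho> (x t)) has_vector_derivative 0) (at t within {0..T})" if t: "t \<in> {0..T}" for t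
  proof -
    show ?thesis using has_vector_derivative_chain[OF d\<rho>[OF xW[OF t]] T(4)[OF t]] D(6)[OF T(3)[OF t]] by simp
  qed
  have "\<exists>k. \<forall>t\<in>{0..T}. \<rho> (x t) = k"
    by (rule has_vector_derivative_zero_constant[OF _ d\<rho>x]) auto
  then obtain k where k: "\<And>t. t \<in> {0..T} \<Longrightarrow> \<rho> (x t) = k" by blast
  have \<rho>R: "\<rho> (x t) = R\<^sup>2" if "t \<in> {0..T}" for t using k[OF that] k[of 0] T x0 by simp
  have dv: "((\<lambda>t. X (x t)) has_vector_derivative X' (x t) (X (x t))) (at t within {0..T})" if t: "t \<in> {0..T}" for t
    by (rule has_vector_derivative_chain[OF X'(1)[OF T(3)[OF t]] T(4)[OF t]])
  have cx: "continuous_on {0..T} x" by (rule continuous_on_vector_derivative[OF T(4)])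
  have cv: "continuous_on {0..T} (\<lambda>t. X (x t))" by (rule continuous_on_vector_derivative[OF dv])
  have "continuous_on {0..T} (\<lambda>t. X' (x t) (X (x t)))"
    by (rule continuous_on_linear_family[OF continuous_on_compose2[OF cX' cx] cv linX']) (use T(3) in auto)
  then show ?thesis
    using that[of T x "\<lambda>t. X (x t)" "\<lambda>t. X' (x t) (X (x t))", OF T(1,2) _ xW \<rho>R T(4) dv] D(5)[OF T(3)] D(7) T(2) by simp
qed

end

context local_metric
begin

text \<open>The frame solves the linear equation \<open>\<nabla>w = - \<langle>A, w\<rangle> v\<close>, where \<open>A\<close> is the acceleration; its flow preserves
  inner products and orthogonality to the velocity \<open>v\<close>.\<close>

lemma rotation_minimizing_frame:
  assumes T: "T > 0" and x: "\<And>t. t \<in> {0..T} \<Longrightarrow> x t \<in> U"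
    "\<And>t. t \<in> {0..T} \<Longrightarrow> (x has_vector_derivative v t) (at t within {0..T})"
    "\<And>t. t \<in> {0..T} \<Longrightarrow> (v has_vector_derivative v' t) (at t within {0..T})" "continuous_on {0..T} v'"
    and unit: "\<And>t. t \<in> {0..T} \<Longrightarrow> g (x t) (v t) (v t) = 1" and m: "DIM('e) = m + 1"
  obtains e and \<nu> :: "nat \<Rightarrow> real \<Rightarrow> 'e" and \<kappa> where "0 < e" "e \<le> T"
    "\<And>i t. i \<in> {1..m} \<Longrightarrow> t \<in> {0..e} \<Longrightarrow>
       (\<nu> i has_vector_derivative - \<Gamma> (x t) (v t) (\<nu> i t) - \<kappa> i t *\<^sub>R v t) (at t within {0..e})"
    "\<And>i. i \<in> {1..m} \<Longrightarrow> continuous_on {0..e} (\<lambda>t. - \<Gamma> (x t) (v t) (\<nu> i t) - \<kappa> i t *\<^sub>R v t)"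
    "\<And>i t. i \<in> {1..m} \<Longrightarrow> t \<in> {0..e} \<Longrightarrow> g (x t) (\<nu> i t) (v t) = 0"
    "\<And>i j t. i \<in> {1..m} \<Longrightarrow> j \<in> {1..m} \<Longrightarrow> t \<in> {0..e} \<Longrightarrow> g (x t) (\<nu> i t) (\<nu> j t) = (if i = j then 1 else 0)"
    "\<And>t. t \<in> {0..e} \<Longrightarrow> v' t + \<Gamma> (x t) (v t) (v t) = (\<Sum>i=1..m. \<kappa> i t *\<^sub>R \<nu> i t)"
proof -
  define A where "A t = v' t + \<Gamma> (x t) (v t) (v t)" for t
  define L where "L t w = - \<Gamma> (x t) (v t) w - g (x t) (A t) w *\<^sub>R v t" for t w
  have cx: "continuous_on {0..T} x" by (rule continuous_on_vector_derivative[OF x(2)])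
  have cv: "continuous_on {0..T} v" by (rule continuous_on_vector_derivative[OF x(3)])
  have cA: "continuous_on {0..T} A" unfolding A_def by (intro continuous_on_add x(4) continuous_on_\<Gamma> cx cv x(1))
  have cL: "continuous_on S (\<lambda>t. L t (w t))" if "S \<subseteq> {0..T}" "continuous_on S w" for w S
    unfolding L_def
    by (intro continuous_on_diff continuous_on_minus continuous_on_scaleR continuous_on_\<Gamma> continuous_on_g that(2)
        continuous_on_subset[OF cx that(1)] continuous_on_subset[OF cv that(1)] continuous_on_subset[OF cA that(1)] x(1)) (use that(1) in blast)+
  have linL: "linear (L t)" if "t \<in> {0..T}" for t
    unfolding L_def
    by (rule linearI) (simp_all add: \<Gamma>_add[OF x(1)[OF that]] \<Gamma>_scale[OF x(1)[OF that]] g_add[OF x(1)[OF that]] g_scale[OF x(1)[OF that]] algebra_simps)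
  obtain e where e: "0 < e" "e \<le> T" "\<And>h. \<exists>w. w 0 = h \<and> (\<forall>t\<in>{0..e}. (w has_vector_derivative L t (w t)) (at t within {0..e}))"
    by (rule linear_ode_exists[OF T linL cL[OF subset_refl continuous_on_const]], assumption, rule that)
  have sub: "{0..e} \<subseteq> {0..T}" using e by auto
  then have eT: "t \<in> {0..T}" if "t \<in> {0..e}" for t using that by blast
  note U = x(1)[OF eT]
  note dx = has_vector_derivative_within_subset[OF x(2)[OF eT] sub] and dv = has_vector_derivative_within_subset[OF x(3)[OF eT] sub]
  have "m < DIM('e)" using m by simp
  moreover have T0: "0 \<in> {0..T}" using T by simp
  ultimately obtain h :: "nat \<Rightarrow> 'e" where "(\<forall>i\<in>{1..m}. g (x 0) (v 0) (h i) = 0) \<and>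
     (\<forall>i\<in>{1..m}. \<forall>j\<in>{1..m}. g (x 0) (h i) (h j) = (if i = j then 1 else 0))"
    using orthonormal_exists[OF x(1)[OF T0], of m "v 0"] by blast
  then have h: "\<And>i. i \<in> {1..m} \<Longrightarrow> g (x 0) (v 0) (h i) = 0"
    "\<And>i j. i \<in> {1..m} \<Longrightarrow> j \<in> {1..m} \<Longrightarrow> g (x 0) (h i) (h j) = (if i = j then 1 else 0)" by blast+
  obtain \<nu> where "\<forall>i. \<nu> i 0 = h i \<and> (\<forall>t\<in>{0..e}. (\<nu> i has_vector_derivative L t (\<nu> i t)) (at t within {0..e}))"
    using choice[of "\<lambda>i w. w 0 = h i \<and> (\<forall>t\<in>{0..e}. (w has_vector_derivative L t (w t)) (at t within {0..e}))"] e(3) by blast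
  then have \<nu>: "\<And>i. \<nu> i 0 = h i" "\<And>i t. t \<in> {0..e} \<Longrightarrow> (\<nu> i has_vector_derivative L t (\<nu> i t)) (at t within {0..e})" by blast+
  have const: "f t = f 0" if "\<And>t. t \<in> {0..e} \<Longrightarrow> (f has_vector_derivative 0) (at t within {0..e})" "t \<in> {0..e}" for f :: "real \<Rightarrow> real" and t
  proof -
    note d = that(1)
    have "\<exists>k. \<forall>t\<in>{0..e}. f t = k" by (rule has_vector_derivative_zero_constant[OF _ d]) auto
    then show ?thesis using that(2) e(1) by force
  qed
  have LG: "L t w + \<Gamma> (x t) (v t) w = - (g (x t) (A t) w *\<^sub>R v t)" for t w by (simp add: L_def)
  have vp: "g (x t) (\<nu> i t) (v t) = 0" if i: "i \<in> {1..m}" and t: "t \<in> {0..e}" for i t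
  proof -
    have "((\<lambda>t. g (x t) (\<nu> i t) (v t)) has_vector_derivative 0) (at t within {0..e})" if t: "t \<in> {0..e}" for t
    proof -
      have "((\<lambda>t. g (x t) (\<nu> i t) (v t)) has_vector_derivative
         g (x t) (L t (\<nu> i t) + \<Gamma> (x t) (v t) (\<nu> i t)) (v t) + g (x t) (\<nu> i t) (v' t + \<Gamma> (x t) (v t) (v t))) (at t within {0..e})"
        by (rule has_vector_derivative_g[OF U[OF t] dx[OF t] \<nu>(2)[OF t] dv[OF t] t])
      then show ?thesis
        unfolding LG A_def[symmetric] using unit[OF eT[OF t]] g_sym[OF U[OF t], of "A t" "\<nu> i t"]
        by (simp add: g_minus[OF U[OF t]] g_scale[OF U[OF t]])
    qed
    from const[OF this t] show ?thesis using h(1)[OF i] \<nu>(1) g_sym[OF x(1)[OF T0], of "v 0" "h i"] by simp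
  qed
  have on: "g (x t) (\<nu> i t) (\<nu> j t) = (if i = j then 1 else 0)" if i: "i \<in> {1..m}" "j \<in> {1..m}" and t: "t \<in> {0..e}" for i j t
  proof -
    have "((\<lambda>t. g (x t) (\<nu> i t) (\<nu> j t)) has_vector_derivative 0) (at t within {0..e})" if t: "t \<in> {0..e}" for t
    proof -
      have "((\<lambda>t. g (x t) (\<nu> i t) (\<nu> j t)) has_vector_derivative
         g (x t) (L t (\<nu> i t) + \<Gamma> (x t) (v t) (\<nu> i t)) (\<nu> j t) + g (x t) (\<nu> i t) (L t (\<nu> j t) + \<Gamma> (x t) (v t) (\<nu> j t))) (at t within {0..e})"
        by (rule has_vector_derivative_g[OF U[OF t] dx[OF t] \<nu>(2)[OF t] \<nu>(2)[OF t] t])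
      moreover have "g (x t) (v t) (\<nu> j t) = 0" using vp[OF i(2) t] g_sym[OF U[OF t], of "v t" "\<nu> j t"] by simp
      ultimately show ?thesis
        unfolding LG using vp[OF i(1) t] by (simp add: g_minus[OF U[OF t]] g_scale[OF U[OF t]])
    qed
    from const[OF this t] show ?thesis using h(2)[OF i] \<nu>(1) by simp
  qed
  define \<kappa> where "\<kappa> i t = g (x t) (A t) (\<nu> i t)" for i t
  \<comment> \<open>The velocity has constant length, so the acceleration is orthogonal to it and
    expands in the \<nu> i alone. The coefficients \<kappa> i are thus the same in the equations for
    \<nu> i and for the acceleration.\<close>
  have acc: "A t = (\<Sum>i=1..m. \<kappa> i t *\<^sub>R \<nu> i t)" if t: "t \<in> {0..e}" for t
  proof -
    have "((\<lambda>t. g (x t) (v t) (v t)) has_vector_derivative g (x t) (A t) (v t) + g (x t) (v t) (A t)) (at t within {0..e})"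
      unfolding A_def by (rule has_vector_derivative_g[OF U[OF t] dx[OF t] dv[OF t] dv[OF t] t])
    moreover have "((\<lambda>t. g (x t) (v t) (v t)) has_vector_derivative 0) (at t within {0..e})"
      by (rule has_vector_derivative_transform[OF t _ has_vector_derivative_const[of 1]]) (rule unit[OF eT])
    ultimately have "g (x t) (A t) (v t) + g (x t) (v t) (A t) = 0"
      by (rule vector_derivative_unique_within[rotated])
         (rule rich_not_bot[OF rich_interval[OF is_interval_cc, of 0 0 e e] t], use e in auto)
    then have Av: "g (x t) (A t) (v t) = 0" using g_sym[OF U[OF t], of "v t" "A t"] by simp
    have "A t = (g (x t) (A t) (v t) / g (x t) (v t) (v t)) *\<^sub>R v t + (\<Sum>i=1..m. g (x t) (A t) (\<nu> i t) *\<^sub>R \<nu> i t)"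
    proof (rule orthonormal_expand[OF U[OF t] m _ vp[OF _ t] on[OF _ _ t]])
      show "v t \<noteq> 0" using unit[OF eT[OF t]] g_zero[OF U[OF t]] by auto
    qed
    then show ?thesis unfolding Av \<kappa>_def by simp
  qed
  have L\<kappa>: "L t (\<nu> i t) = - \<Gamma> (x t) (v t) (\<nu> i t) - \<kappa> i t *\<^sub>R v t" for i t by (simp add: L_def \<kappa>_def)
  show ?thesis
  proof (rule that[OF e(1,2) _ _ vp on])
    show "(\<nu> i has_vector_derivative - \<Gamma> (x t) (v t) (\<nu> i t) - \<kappa> i t *\<^sub>R v t) (at t within {0..e})" if "t \<in> {0..e}" for i t
      using \<nu>(2)[OF that, of i] unfolding L\<kappa> .
    have "continuous_on {0..e} (\<nu> i)" for i
      by (rule continuous_on_vector_derivative[OF \<nu>(2)])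
    from cL[OF sub this] show "continuous_on {0..e} (\<lambda>t. - \<Gamma> (x t) (v t) (\<nu> i t) - \<kappa> i t *\<^sub>R v t)" for i unfolding L\<kappa> .
    show "v' t + \<Gamma> (x t) (v t) (v t) = (\<Sum>i=1..m. \<kappa> i t *\<^sub>R \<nu> i t)" if "t \<in> {0..e}" for t
      using acc[OF that] unfolding A_def .
  qed
qed

end

section \<open>The frame condition makes spheres umbilic\<close>

context sphere_ball
begin

text \<open>The hypothesis is applied to the radial unit normal and to a curve that starts at
  \<open>E y\<close> in direction \<open>E' y u\<close>. The derivative at the starting time is
  enough, because \<open>y\<close> and \<open>u\<close> are arbitrary.\<close>

lemma RM_imp_parallel:
  assumes m: "CARD('n) = m + 1"
    and H: "\<And>\<xi> I \<alpha> n \<kappa>. unit_normal_field M S \<xi> \<Longrightarrow> unit_speed_C2_curve M I \<alpha> \<Longrightarrow> \<alpha> ` I \<subseteq> S \<Longrightarrow>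
          RM_frame M m I \<alpha> n \<Longrightarrow> RM_curvatures M m I \<alpha> n \<kappa> \<Longrightarrow>
          \<exists>a :: nat \<Rightarrow> real. \<forall>s\<in>I. \<xi> (\<alpha> s) = lin_comb {1..m} a (\<lambda>i. n i s)"
    and y: "g p y y = R\<^sup>2" and u: "g p y u = 0"
  shows "\<exists>h. Sh y u = h *\<^sub>R E' y u"
proof (cases "u = 0")
  case True
  have yb: "y \<in> ball 0 r" by (rule small) (simp add: y)
  have "linear (V' y)" by (rule has_derivative_linear[OF dV[OF yb]])
  then have "Sh y u = 0" using linear_0 linear_0[OF E'_linear[OF yb]] by (simp add: Sh_def True \<Gamma>_zero[OF E_U[OF yb]])
  then show ?thesis by (intro exI[of _ 0]) simp
next
  case False
  have yb: "y \<in> ball 0 r" by (rule small) (simp add: y)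
  define x0 where "x0 = E y"
  define w0 where "w0 = E' y u"
  have x0: "x0 \<in> W" "\<rho> x0 = R\<^sup>2" "F x0 = y" using yb y by (simp_all add: x0_def \<rho>_def F_E)
  have w0: "F' x0 w0 = u" "g x0 (N x0) w0 = 0" "w0 \<noteq> 0"
  proof -
    show 1: "F' x0 w0 = u" unfolding x0_def w0_def by (rule F'_E'(1)[OF yb])
    show "g x0 (N x0) w0 = 0" unfolding gauss_N[OF x0(1)] 1 x0(3) by (rule u)
    show "w0 \<noteq> 0" using 1 False linear_0[OF has_derivative_linear[OF dF[OF x0(1)]]] by auto
  qed
  obtain T x v v' where T: "T > 0" and i: "x 0 = x0" "v 0 = w0 /\<^sub>R sqrt (g x0 w0 w0)"
    and xW: "\<And>t. t \<in> {0..T} \<Longrightarrow> x t \<in> W" and x\<rho>: "\<And>t. t \<in> {0..T} \<Longrightarrow> \<rho> (x t) = R\<^sup>2"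
    and dx: "\<And>t. t \<in> {0..T} \<Longrightarrow> (x has_vector_derivative v t) (at t within {0..T})"
    and dv: "\<And>t. t \<in> {0..T} \<Longrightarrow> (v has_vector_derivative v' t) (at t within {0..T})"
    and cv': "continuous_on {0..T} v'" and unit: "\<And>t. t \<in> {0..T} \<Longrightarrow> g (x t) (v t) (v t) = 1"
    by (rule tangential_curve[OF x0(1,2) w0(2,3)], rule that)
  have mD: "DIM(real^'n) = m + 1" using m by simp
  obtain e \<nu> \<kappa> where e: "0 < e" "e \<le> T"
    and d\<nu>: "\<And>i t. i \<in> {1..m} \<Longrightarrow> t \<in> {0..e} \<Longrightarrow>
       (\<nu> i has_vector_derivative - Gam c (x t) (v t) (\<nu> i t) - \<kappa> i t *\<^sub>R v t) (at t within {0..e})"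
    and cd\<nu>: "\<And>i. i \<in> {1..m} \<Longrightarrow> continuous_on {0..e} (\<lambda>t. - Gam c (x t) (v t) (\<nu> i t) - \<kappa> i t *\<^sub>R v t)"
    and vp: "\<And>i t. i \<in> {1..m} \<Longrightarrow> t \<in> {0..e} \<Longrightarrow> g (x t) (\<nu> i t) (v t) = 0"
    and on: "\<And>i j t. i \<in> {1..m} \<Longrightarrow> j \<in> {1..m} \<Longrightarrow> t \<in> {0..e} \<Longrightarrow> g (x t) (\<nu> i t) (\<nu> j t) = (if i = j then 1 else 0)"
    and acc: "\<And>t. t \<in> {0..e} \<Longrightarrow> v' t + Gam c (x t) (v t) (v t) = (\<Sum>i=1..m. \<kappa> i t *\<^sub>R \<nu> i t)"
    by (rule rotation_minimizing_frame[OF T W_dom[OF xW] dx dv cv' unit mD], assumption+, rule that)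
  let ?I = "{0..e}"
  have I: "is_interval ?I" "0 \<in> ?I" "e \<in> ?I" "0 < e" using e by (auto simp: is_interval_cc)
  note R = rich_interval[OF I]
  have sub: "?I \<subseteq> {0..T}" using e by auto
  then have eT: "t \<in> {0..T}" if "t \<in> ?I" for t using that by blast
  note dx = has_vector_derivative_within_subset[OF dx[OF eT] sub] and dv = has_vector_derivative_within_subset[OF dv[OF eT] sub]
  note xW = xW[OF eT] and x\<rho> = x\<rho>[OF eT] and unit = unit[OF eT]
  note xU = W_dom[OF xW]
  note pin = pt_in[OF xU] and pright = pt_right[OF xU]
  have im: "x ` ?I \<subseteq> cdom c" using xU by blast
  have cx: "continuous_on ?I x" by (rule continuous_on_vector_derivative[OF dx])
  have "Ck_on 0 v' ?I" using continuous_on_subset[OF cv' sub] by simp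
  then have "Ck_on (Suc 0) v ?I" by (rule Ck_on_vector_SucI[OF R dv, rotated])
  then have Cx: "Ck_on (Suc (Suc 0)) x ?I" by (rule Ck_on_vector_SucI[OF R dx, rotated])
  then have Cx1: "Ck_on 1 x ?I" using Ck_on_Suc_lower[OF Cx] by (simp only: One_nat_def)
  define \<alpha> where "\<alpha> t = pt (x t)" for t
  define n where "n i t = chart_vec M c (\<alpha> t) (\<nu> i t)" for i t
  have C: "Ck_curve M 2 ?I \<alpha>"
    unfolding \<alpha>_def[abs_def] using Ck_curve_chart[OF c I, of 2 x] Cx im by (simp add: numeral_2_eq_2)
  have vel: "velocity M ?I \<alpha> t = chart_vec M c (\<alpha> t) (v t)" if "t \<in> ?I" for t
    unfolding \<alpha>_def[abs_def] by (rule chart_curve_velocity[OF c I cx im that dx[OF that]])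
  have inn: "inn M (\<alpha> t) (chart_vec M c (\<alpha> t) a) (chart_vec M c (\<alpha> t) b) = g (x t) a b" if "t \<in> ?I" for t a b
    unfolding \<alpha>_def by (simp add: inn_chart_vec[OF c pin[OF that]] pright[OF that])
  have cov: "cov_deriv M ?I \<alpha> Y t = chart_vec M c (\<alpha> t) (X' + Gam c (x t) (v t) (X t))"
    if "t \<in> ?I" "\<And>t. t \<in> ?I \<Longrightarrow> Y t = chart_vec M c (\<alpha> t) (X t)" "(X has_vector_derivative X') (at t within ?I)" for t X Y X'
    using chart_curve_cov_deriv[OF c I cx im that(1) dx[OF that(1)] _ that(3), of Y] that(2) unfolding \<alpha>_def[abs_def] by simp
  have covn: "cov_deriv M ?I \<alpha> (n i) t = scale_vec (- \<kappa> i t) (velocity M ?I \<alpha> t)" if i: "i \<in> {1..m}" and t: "t \<in> ?I" for i t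
  proof -
    have "cov_deriv M ?I \<alpha> (n i) t = chart_vec M c (\<alpha> t) (- Gam c (x t) (v t) (\<nu> i t) - \<kappa> i t *\<^sub>R v t + Gam c (x t) (v t) (\<nu> i t))"
      by (rule cov[OF t _ d\<nu>[OF i t]]) (simp add: n_def)
    also have "\<dots> = chart_vec M c (\<alpha> t) ((- \<kappa> i t) *\<^sub>R v t)" by simp
    also have "\<dots> = scale_vec (- \<kappa> i t) (chart_vec M c (\<alpha> t) (v t))"
      unfolding \<alpha>_def by (rule linear_chart_vec(1)[OF c pin[OF t]])
    finally show ?thesis unfolding vel[OF t] .
  qed
  have "RM_frame M m ?I \<alpha> n"
    unfolding RM_frame_def RM_field_def
  proof (intro conjI ballI impI)
    fix i assume i: "i \<in> {1..m}"
    have "Ck_on 0 (\<lambda>t. - Gam c (x t) (v t) (\<nu> i t) - \<kappa> i t *\<^sub>R v t) ?I" using cd\<nu>[OF i] by simp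
    then have "Ck_on (Suc 0) (\<nu> i) ?I" by (rule Ck_on_vector_SucI[OF R d\<nu>[OF i], rotated])
    then have "Ck_on 1 (\<nu> i) ?I" by (simp only: One_nat_def)
    from C1_field_chart[OF c I Cx1 im this] show "C1_field_along M ?I \<alpha> (n i)" unfolding \<alpha>_def n_def .
    fix s assume s: "s \<in> ?I"
    show "inn M (\<alpha> s) (n i s) (n i s) = 1" using on[OF i i s] by (simp add: n_def inn[OF s])
    show "inn M (\<alpha> s) (n i s) (velocity M ?I \<alpha> s) = 0" using vp[OF i s] by (simp add: n_def vel[OF s] inn[OF s])
  next
    fix i assume i: "i \<in> {1..m}"
    show "\<exists>l. \<forall>s\<in>?I. cov_deriv M ?I \<alpha> (n i) s = scale_vec (l s) (velocity M ?I \<alpha> s)"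
      by (rule exI[of _ "\<lambda>s. - \<kappa> i s"]) (use covn[OF i] in simp)
  next
    fix s i j assume "s \<in> ?I" "i \<in> {1..m}" "j \<in> {1..m}" "i \<noteq> j"
    then show "inn M (\<alpha> s) (n i s) (n j s) = 0" using on[of i j s] by (simp add: n_def inn)
  qed
  moreover have "RM_curvatures M m ?I \<alpha> n \<kappa>"
    unfolding RM_curvatures_def
  proof (intro conjI ballI covn)
    fix s assume s: "s \<in> ?I"
    have "cov_deriv M ?I \<alpha> (velocity M ?I \<alpha>) s = chart_vec M c (\<alpha> s) (\<Sum>i=1..m. \<kappa> i s *\<^sub>R \<nu> i s)"
      unfolding acc[OF s, symmetric] by (rule cov[OF s vel dv[OF s]])
    also have "\<dots> = lin_comb {1..m} (\<lambda>i. \<kappa> i s) (\<lambda>i. n i s)"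
      unfolding n_def \<alpha>_def by (rule linear_chart_vec(2)[OF c pin[OF s]])
    finally show "cov_deriv M ?I \<alpha> (velocity M ?I \<alpha>) s = lin_comb {1..m} (\<lambda>i. \<kappa> i s) (\<lambda>i. n i s)" .
  qed
  moreover have "unit_speed_C2_curve M ?I \<alpha>"
    unfolding unit_speed_C2_curve_def using C by (auto simp: vel inn unit)
  moreover have "\<alpha> ` ?I \<subseteq> S" unfolding sphere_level \<alpha>_def using xW x\<rho> by blast
  ultimately obtain a :: "nat \<Rightarrow> real" where
    a: "\<And>s. s \<in> ?I \<Longrightarrow> chart_vec M c (\<alpha> s) (N (snd c (\<alpha> s)) /\<^sub>R R) = lin_comb {1..m} a (\<lambda>i. n i s)"
    using H[OF radial_unit_normal, of ?I \<alpha> n \<kappa>] by blast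
  have Na: "N (x s) /\<^sub>R R = (\<Sum>i=1..m. a i *\<^sub>R \<nu> i s)" if s: "s \<in> ?I" for s
  proof -
    have "chart_vec M c (\<alpha> s) (N (x s) /\<^sub>R R) = chart_vec M c (\<alpha> s) (\<Sum>i=1..m. a i *\<^sub>R \<nu> i s)"
      using a[OF s] linear_chart_vec(2)[OF c pin[OF s], of a "\<lambda>i. \<nu> i s" "{1..m}"] unfolding n_def \<alpha>_def pright[OF s] by simp
    from fun_cong[OF this, of c] show ?thesis unfolding \<alpha>_def chart_vec_self[OF c pin[OF s]] .
  qed
  have 0: "0 \<in> ?I" by (rule I(2))
  let ?k = "\<Sum>i=1..m. a i * \<kappa> i 0"
  have x0W: "x 0 \<in> W" "x 0 \<in> cdom c" using x0 i W_dom by auto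
  have D1: "((\<lambda>t. N (x t) /\<^sub>R R) has_vector_derivative N' (x 0) (v 0) /\<^sub>R R) (at 0 within ?I)"
    by (rule bounded_linear.has_vector_derivative[OF bounded_linear_scaleR_right has_vector_derivative_chain[OF dN[OF x0W(1)] dx[OF 0]]])
  have "((\<lambda>t. \<Sum>i=1..m. a i *\<^sub>R \<nu> i t) has_vector_derivative (\<Sum>i=1..m. a i *\<^sub>R (- Gam c (x 0) (v 0) (\<nu> i 0) - \<kappa> i 0 *\<^sub>R v 0))) (at 0 within ?I)"
    by (intro has_vector_derivative_sum bounded_linear.has_vector_derivative[OF bounded_linear_scaleR_right] d\<nu> 0) simp
  \<comment> \<open>The coefficients \<open>a i\<close> are constant, so the derivative of the
    normal involves only the derivatives of the frame. Their covariant parts are multiples of the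
    velocity.\<close>
  then have D2: "((\<lambda>t. N (x t) /\<^sub>R R) has_vector_derivative (\<Sum>i=1..m. a i *\<^sub>R (- Gam c (x 0) (v 0) (\<nu> i 0) - \<kappa> i 0 *\<^sub>R v 0))) (at 0 within ?I)"
    by (rule has_vector_derivative_transform[OF 0, rotated]) (simp add: Na)
  have lG: "linear (Gam c (x 0) (v 0))" using \<Gamma>_bil[OF x0W(2)] unfolding bilinear_def by blast
  have "N' (x 0) (v 0) /\<^sub>R R = (\<Sum>i=1..m. a i *\<^sub>R (- Gam c (x 0) (v 0) (\<nu> i 0) - \<kappa> i 0 *\<^sub>R v 0))"
    by (rule vector_derivative_unique_within[OF rich_not_bot[OF R 0] D1 D2])
  also have "\<dots> = - Gam c (x 0) (v 0) (\<Sum>i=1..m. a i *\<^sub>R \<nu> i 0) - ?k *\<^sub>R v 0"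
    by (simp add: linear_sum[OF lG] linear_scale[OF lG] scaleR_diff_right sum_subtractf sum_negf scaleR_left.sum)
  also have "(\<Sum>i=1..m. a i *\<^sub>R \<nu> i 0) = N (x 0) /\<^sub>R R" using Na[OF 0] by simp
  finally have "N' (x 0) (v 0) /\<^sub>R R + Gam c (x 0) (v 0) (N (x 0)) /\<^sub>R R = - (?k *\<^sub>R v 0)"
    by (simp add: linear_scale[OF lG])
  then have "(N' (x 0) (v 0) + Gam c (x 0) (v 0) (N (x 0))) /\<^sub>R R = - (?k *\<^sub>R v 0)" by (simp add: scaleR_add_right)
  then have "Sh (F (x 0)) (F' (x 0) (v 0)) /\<^sub>R R = - (?k *\<^sub>R v 0)" unfolding cov_N[OF x0W(1)] .
  then have "R *\<^sub>R (Sh (F (x 0)) (F' (x 0) (v 0)) /\<^sub>R R) = R *\<^sub>R (- (?k *\<^sub>R v 0))" by simp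
  then have S0: "Sh y (F' x0 (v 0)) = (- (R * ?k)) *\<^sub>R v 0" using sphere_ball.R[OF sphere_ball_axioms] i(1) x0(3) by simp
  \<comment> \<open>The velocity at the starting point is \<open>E' y u\<close> divided by this
    length; linearity of \<open>Sh y\<close> removes the normalization.\<close>
  define q where "q = sqrt (g x0 w0 w0)"
  have qp: "q > 0" using g_pos[OF W_dom[OF x0(1)] w0(3)] by (simp add: q_def)
  have "F' x0 (v 0) = u /\<^sub>R q"
    unfolding i(2) q_def[symmetric] linear_scale[OF has_derivative_linear[OF dF[OF x0(1)]]] w0(1) ..
  moreover have lS: "linear (Sh y)"
    unfolding Sh_def using has_derivative_linear[OF dV[OF yb]] E'_linear[OF yb] E_U[OF yb]
    by (intro linearI) (simp_all add: linear_add linear_scale \<Gamma>_add \<Gamma>_scale algebra_simps)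
  ultimately have "Sh y u /\<^sub>R q = (- (R * ?k)) *\<^sub>R (w0 /\<^sub>R q)"
    using S0 unfolding i(2) q_def[symmetric] by (simp only: linear_scale[OF lS])
  then have "q *\<^sub>R (Sh y u /\<^sub>R q) = q *\<^sub>R ((- (R * ?k)) *\<^sub>R (w0 /\<^sub>R q))" by simp
  then have "Sh y u = (- (R * ?k)) *\<^sub>R E' y u" using qp unfolding w0_def[symmetric] by simp
  then show ?thesis by blast
qed

end

section \<open>Isotropy at every point and its globalization\<close>

context riem_manifold
begin

definition isotropic :: "('a, 'n) chart \<Rightarrow> 'a \<Rightarrow> real \<Rightarrow> bool" where
  "isotropic c q k \<longleftrightarrow> (\<forall>u v w. local_metric.Rm (Gam c) (DGam c) (snd c q) u v w
     = k *\<^sub>R (chart_inn M c (snd c q) v w *\<^sub>R u - chart_inn M c (snd c q) u w *\<^sub>R v))"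

lemma RM_imp_isotropic:
  assumes m: "CARD('n) = m + 1" "m \<ge> 2" and c: "c \<in> atlas M" "q \<in> fst c"
    and H: "R0 > 0" "\<And>R. 0 < R \<Longrightarrow> R < R0 \<Longrightarrow> RM_property m q R"
  shows "\<exists>k. isotropic c q k"
proof -
  obtain E V F E' V' F' vel \<eta> r R1 where R1: "R1 > 0"
    and cb: "chart_ball M c (snd c q) E V F E' V' F' vel \<eta> r"
    and sb: "\<And>R. 0 < R \<Longrightarrow> R < R1 \<Longrightarrow> sphere_ball M c (snd c q) E V F E' V' F' vel \<eta> r R"
    by (rule sphere_ball_exists[OF c]) (rule that)
  interpret B: chart_ball M c "snd c q" E V F E' V' F' vel \<eta> r by (rule cb)
  let ?p = "snd c q" and ?g = "chart_inn M c (snd c q)"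
  have pq: "chart_inv c ?p = q" by (rule chart_inv_left[OF c])
  have par: "\<exists>h. B.Sh y u = h *\<^sub>R E' y u" if R: "0 < R" "R < R0" "R < R1" and y: "?g y y = R\<^sup>2" "?g y u = 0" for R y u
  proof (rule sphere_ball.RM_imp_parallel[OF sb[OF R(1,3)] m(1) _ y], unfold pq)
    fix \<xi> I \<alpha> n \<kappa>
    assume A: "unit_normal_field M (geodesic_sphere M q R) \<xi>" "unit_speed_C2_curve M I \<alpha>" "\<alpha> ` I \<subseteq> geodesic_sphere M q R"
      "RM_frame M m I \<alpha> n" "RM_curvatures M m I \<alpha> n \<kappa>"
    have "\<exists>a :: nat \<Rightarrow> real. \<forall>s\<in>I. (\<Sum>i=1..m. a i * \<kappa> i s) = mean_curvature M (geodesic_sphere M q R) \<xi> (\<alpha> s) \<and>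
        \<xi> (\<alpha> s) = lin_comb {1..m} a (\<lambda>i. n i s)"
      by (rule H(2)[OF R(1,2), unfolded RM_property_def, THEN spec, THEN spec, THEN spec, THEN spec, THEN spec, THEN mp])
         (intro conjI, (rule A)+)
    then show "\<exists>a :: nat \<Rightarrow> real. \<forall>s\<in>I. \<xi> (\<alpha> s) = lin_comb {1..m} a (\<lambda>i. n i s)" by (elim exE) (rule exI, blast)
  qed
  have dim: "DIM(real^'n) \<ge> 3" using m by simp
  have "\<exists>K. \<forall>u v w. B.Rm ?p u v w = K *\<^sub>R (?g v w *\<^sub>R u - ?g u w *\<^sub>R v)"
  proof (rule B.isotropic_constant[OF B.p_U dim])
    fix y u b1 b2 :: "real^'n"
    assume yu: "?g y u = 0" and b: "b1 \<in> Basis" "b2 \<in> Basis"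
    show "(B.Rm ?p y u y \<bullet> b1) * (u \<bullet> b2) = (B.Rm ?p y u y \<bullet> b2) * (u \<bullet> b1)"
    proof (cases "y = 0")
      case True
      then show ?thesis using linear_0[OF B.Rm_linear(1)[OF B.p_U]] by simp
    next
      case False
      \<comment> \<open>Any radius below both bounds will do. The vector \<open>y\<close> is scaled
        to length \<mu>, so that the radial geodesic crosses the spheres of the radii t \<mu>, all
        of them admissible. Both sides of the claim are quadratic in \<open>y\<close>, so the
        scaling can be undone.\<close>
      define \<mu> where "\<mu> = min R0 R1 / 2"
      define s where "s = \<mu> / sqrt (?g y y)"
      have yy: "?g y y > 0" by (rule B.g_pos[OF B.p_U False])
      have mu: "0 < \<mu>" "\<mu> < R0" "\<mu> < R1" using H(1) R1 by (auto simp: \<mu>_def)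
      have s: "s > 0" using mu yy by (simp add: s_def)
      have n: "?g (s *\<^sub>R y) (s *\<^sub>R y) = \<mu>\<^sup>2" using yy by (simp add: s_def B.g_scale[OF B.p_U] power2_eq_square)
      have sy: "s *\<^sub>R y \<in> ball 0 r" by (rule sphere_ball.small[OF sb[OF mu(1,3)]]) (simp only: n order_refl)
      have "(B.Rm ?p (s *\<^sub>R y) u (s *\<^sub>R y) \<bullet> b1) * (u \<bullet> b2) = (B.Rm ?p (s *\<^sub>R y) u (s *\<^sub>R y) \<bullet> b2) * (u \<bullet> b1)"
      proof (rule B.umbilic_curvature[OF sy _ b])
        fix t :: real assume t: "t \<in> {0<..1}"
        have t\<mu>: "0 < t * \<mu>" "t * \<mu> < R0" "t * \<mu> < R1"
        proof -
          have "t * \<mu> \<le> \<mu>" using mult_right_mono[of t 1 \<mu>] t mu by simp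
          then show "t * \<mu> < R0" "t * \<mu> < R1" using mu by linarith+
          show "0 < t * \<mu>" using t mu by simp
        qed
        show "\<exists>h. B.Sh (t *\<^sub>R s *\<^sub>R y) u = h *\<^sub>R E' (t *\<^sub>R s *\<^sub>R y) u"
        proof (rule par[OF t\<mu>])
          have "?g (t *\<^sub>R s *\<^sub>R y) (t *\<^sub>R s *\<^sub>R y) = t\<^sup>2 * ?g (s *\<^sub>R y) (s *\<^sub>R y)"
            by (simp only: B.g_scale[OF B.p_U] power2_eq_square mult.assoc mult.left_commute)
          then show "?g (t *\<^sub>R s *\<^sub>R y) (t *\<^sub>R s *\<^sub>R y) = (t * \<mu>)\<^sup>2" unfolding n by (simp add: power_mult_distrib)
          show "?g (t *\<^sub>R s *\<^sub>R y) u = 0" by (simp only: B.g_scale[OF B.p_U] yu mult_zero_right)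
        qed
      qed
      then show ?thesis
        using s by (simp add: linear_scale[OF B.Rm_linear(1)[OF B.p_U]] linear_scale[OF B.Rm_linear(3)[OF B.p_U]])
    qed
  qed
  then show ?thesis unfolding isotropic_def .
qed

lemma isotropic_chart_change:
  assumes c: "c \<in> atlas M" "q \<in> fst c" and c': "c' \<in> atlas M" "q \<in> fst c'" and k: "isotropic c q k"
  shows "isotropic c' q k"
  unfolding isotropic_def
proof (intro allI)
  fix u' v' w' :: "real^'n"
  interpret I: isometry "cdom c" "chart_inn M c" "Gam c" "DGam c" "cdom c'" "chart_inn M c'" "Gam c'" "DGam c'"
     "overlap c c'" "trans c c'" "dtrans c c'" "d2trans c c'" "d3trans c c'"
    by (rule isometry_trans[OF c(1) c'(1)])
  let ?x = "snd c q"
  have x: "?x \<in> overlap c c'" using c c' by auto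
  have t: "trans c c' ?x = snd c' q" using c by simp
  obtain u v w where uvw: "u' = dtrans c c' ?x u" "v' = dtrans c c' ?x v" "w' = dtrans c c' ?x w"
    using I.surj[OF x] unfolding surj_def by blast
  have "I.B.Rm (snd c' q) u' v' w' = dtrans c c' ?x (I.A.Rm ?x u v w)"
    unfolding uvw using I.curvature_transform[OF x, of u v w] t by simp
  also have "I.A.Rm ?x u v w = k *\<^sub>R (chart_inn M c ?x v w *\<^sub>R u - chart_inn M c ?x u w *\<^sub>R v)"
    using k unfolding isotropic_def by blast
  also have "dtrans c c' ?x \<dots> = k *\<^sub>R (chart_inn M c ?x v w *\<^sub>R u' - chart_inn M c ?x u w *\<^sub>R v')"
    unfolding uvw by (simp only: linear_scale[OF I.lin1[OF x]] linear_diff[OF I.lin1[OF x]])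
  finally show "I.B.Rm (snd c' q) u' v' w' = k *\<^sub>R (chart_inn M c' (snd c' q) v' w' *\<^sub>R u' - chart_inn M c' (snd c' q) u' w' *\<^sub>R v')"
    unfolding I.isom[OF x] t uvw .
qed

lemma isotropic_sectional:
  assumes c: "c \<in> atlas M" "q \<in> fst c" and k: "isotropic c q k"
    and uv: "u \<in> tangent_space M q" "v \<in> tangent_space M q"
    and ind: "\<And>a b. (\<forall>c. a *\<^sub>R u c + b *\<^sub>R v c = 0) \<Longrightarrow> a = 0 \<and> b = 0"
  shows "sectional_curvature M q u v = k"
proof -
  interpret L: local_metric "cdom c" "chart_inn M c" "Gam c" "DGam c" by (rule local_metric_chart[OF c(1)])
  let ?x = "snd c q" and ?g = "chart_inn M c (snd c q)"
  have x: "?x \<in> cdom c" using c by blast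
  have "a = 0 \<and> b = 0" if z: "a *\<^sub>R u c + b *\<^sub>R v c = 0" for a b
  proof (rule ind, rule allI)
    fix c'
    show "a *\<^sub>R u c' + b *\<^sub>R v c' = 0"
    proof (cases "c' \<in> atlas M \<and> q \<in> fst c'")
      case True
      have "?x \<in> overlap c c'" using c True by blast
      note l = linear_dtrans[OF c(1) conjunct1[OF True] this]
      have e: "z c' = dtrans c c' ?x (z c)" if "z \<in> tangent_space M q" for z
        using fun_cong[OF tangent_chart[OF that c], of c'] chart_vec_eq[of c' q c "z c"] True by simp
      have "a *\<^sub>R u c' + b *\<^sub>R v c' = dtrans c c' ?x (a *\<^sub>R u c + b *\<^sub>R v c)"
        unfolding e[OF uv(1)] e[OF uv(2)] by (simp only: linear_add[OF l] linear_scale[OF l])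
      then show ?thesis unfolding z linear_0[OF l] .
    next
      case False
      have "z c' = 0" if "z \<in> tangent_space M q" for z
        using fun_cong[OF tangent_chart[OF that c], of c'] False by (auto simp: chart_vec_def)
      from this[OF uv(1)] this[OF uv(2)] show ?thesis by simp
    qed
  qed
  then have det: "?g (u c) (u c) * ?g (v c) (v c) - (?g (u c) (v c))\<^sup>2 > 0" by (rule L.gram_det_pos[OF x])
  have "inn M q (curvature M q u v v) u = ?g (L.Rm ?x (u c) (v c) (v c)) (u c)"
    unfolding curvature_chart[OF c uv uv(2)] inn_chart[OF chart_vec_tangent[OF c] uv(1) c] chart_vec_self[OF c] ..
  also have "L.Rm ?x (u c) (v c) (v c) = k *\<^sub>R (?g (v c) (v c) *\<^sub>R u c - ?g (u c) (v c) *\<^sub>R v c)"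
    using k unfolding isotropic_def by blast
  also have "?g \<dots> (u c) = k * (?g (u c) (u c) * ?g (v c) (v c) - (?g (u c) (v c))\<^sup>2)"
    by (simp add: L.g_scale[OF x] L.g_diff[OF x] L.g_sym[OF x, of "v c" "u c"] power2_eq_square algebra_simps)
  finally show ?thesis
    unfolding sectional_curvature_def inn_chart[OF uv(1,1) c] inn_chart[OF uv(2,2) c] inn_chart[OF uv c] using det by simp
qed

text \<open>Schur's lemma makes the pointwise factor locally constant; its level sets are then open
  and closed, and connectedness leaves only one.\<close>

lemma isotropic_imp_constant:
  assumes conn: "connected_space (mtop M)" and dim: "CARD('n) \<ge> 3"
    and iso: "\<And>c q. c \<in> atlas M \<Longrightarrow> q \<in> fst c \<Longrightarrow> \<exists>k. isotropic c q k"
  shows "constant_sectional_curvature M"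
proof -
  \<comment> \<open>The factor must be common to all charts around a point to become a function on
    the manifold; for points outside all charts the claim is void.\<close>
  have "\<exists>k. \<forall>c\<in>atlas M. q \<in> fst c \<longrightarrow> isotropic c q k" for q
  proof (cases "\<exists>c\<in>atlas M. q \<in> fst c")
    case True
    then obtain c where c: "c \<in> atlas M" "q \<in> fst c" by blast
    then obtain k where "isotropic c q k" using iso by blast
    then show ?thesis using isotropic_chart_change[OF c] by blast
  qed blast
  then obtain K where K: "\<And>c q. c \<in> atlas M \<Longrightarrow> q \<in> fst c \<Longrightarrow> isotropic c q (K q)"
    using choice[of "\<lambda>q k. \<forall>c\<in>atlas M. q \<in> fst c \<longrightarrow> isotropic c q k"] by blast
  have loc: "\<exists>Q. openin (mtop M) Q \<and> q \<in> Q \<and> (\<forall>q'\<in>Q. K q' = K q)" if q: "q \<in> topspace (mtop M)" for q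
  proof -
    obtain c where c: "c \<in> atlas M" "q \<in> fst c" using q topspace_charts by blast
    interpret L: local_metric "cdom c" "chart_inn M c" "Gam c" "DGam c" by (rule local_metric_chart[OF c(1)])
    have x: "snd c q \<in> cdom c" using c by blast
    have "\<exists>\<rho>>0. ball (snd c q) \<rho> \<subseteq> cdom c \<and> (\<forall>x\<in>ball (snd c q) \<rho>. K (chart_inv c x) = K (chart_inv c (snd c q)))"
    proof (rule L.schur[where K="\<lambda>x. K (chart_inv c x)", OF _ x])
      show "DIM(real^'n) \<ge> 3" using dim by simp
      fix x u v w assume "x \<in> cdom c"
      then obtain q' where q': "x = snd c q'" "q' \<in> fst c" by (rule imageE)
      show "L.Rm x u v w = K (chart_inv c x) *\<^sub>R (chart_inn M c x v w *\<^sub>R u - chart_inn M c x u w *\<^sub>R v)"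
        using K[OF c(1) q'(2), unfolded isotropic_def, rule_format, of u v w] unfolding q'(1) chart_inv_left[OF c(1) q'(2)] .
    qed
    then obtain \<rho> where \<rho>: "\<rho> > 0" "\<forall>x\<in>ball (snd c q) \<rho>. K (chart_inv c x) = K (chart_inv c (snd c q))"
      by (elim exE conjE) (rule that)
    show ?thesis
    proof (intro exI[of _ "{q'\<in>fst c. snd c q' \<in> ball (snd c q) \<rho>}"] conjI ballI)
      show "openin (mtop M) {q'\<in>fst c. snd c q' \<in> ball (snd c q) \<rho>}" by (rule openin_chart_preimage[OF c(1) open_ball])
      show "q \<in> {q'\<in>fst c. snd c q' \<in> ball (snd c q) \<rho>}" using c(2) \<rho>(1) by simp
      fix q' assume "q' \<in> {q'\<in>fst c. snd c q' \<in> ball (snd c q) \<rho>}"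
      then have q': "q' \<in> fst c" "snd c q' \<in> ball (snd c q) \<rho>" by simp_all
      show "K q' = K q" using bspec[OF \<rho>(2) q'(2)] unfolding chart_inv_left[OF c(1) q'(1)] chart_inv_left[OF c] .
    qed
  qed
  have const: "\<exists>k. \<forall>q\<in>topspace (mtop M). K q = k"
  proof (cases "topspace (mtop M) = {}")
    case False
    then obtain q0 where q0: "q0 \<in> topspace (mtop M)" by blast
    let ?A = "{q\<in>topspace (mtop M). K q = K q0}"
    \<comment> \<open>Stated for an arbitrary property of the value of \<open>K\<close>, so that it
      yields both that the level set of \<open>K q0\<close> is open and that its complement
      is.\<close>
    have op: "openin (mtop M) {q\<in>topspace (mtop M). P (K q)}" for P
    proof (subst openin_subopen, intro ballI)
      fix q assume q: "q \<in> {q\<in>topspace (mtop M). P (K q)}"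
      then have q': "q \<in> topspace (mtop M)" "P (K q)" by simp_all
      from loc[OF q'(1)] obtain Q where Q: "openin (mtop M) Q" "q \<in> Q" "\<forall>q'\<in>Q. K q' = K q" by (elim exE conjE) (rule that)
      have "Q \<subseteq> {q\<in>topspace (mtop M). P (K q)}" using openin_subset[OF Q(1)] Q(3) q'(2) by auto
      then show "\<exists>T. openin (mtop M) T \<and> q \<in> T \<and> T \<subseteq> {q\<in>topspace (mtop M). P (K q)}" using Q(1,2) by blast
    qed
    have "closedin (mtop M) ?A"
    proof -
      have "topspace (mtop M) - ?A = {q\<in>topspace (mtop M). K q \<noteq> K q0}" by blast
      then show ?thesis using op[of "\<lambda>k. k \<noteq> K q0"] unfolding closedin_def by simp
    qed
    then have "?A = {} \<or> ?A = topspace (mtop M)"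
      using conn[unfolded connected_space_clopen_in, rule_format, of ?A] op[of "\<lambda>k. k = K q0"] by simp
    moreover have "q0 \<in> ?A" using q0 by simp
    ultimately have "?A = topspace (mtop M)" by blast
    then show ?thesis by (intro exI[of _ "K q0"]) blast
  qed blast
  then obtain k where k: "\<forall>q\<in>topspace (mtop M). K q = k" ..
  show ?thesis
    unfolding constant_sectional_curvature_def
  proof (intro exI[of _ k] ballI impI)
    fix q u v
    assume q: "q \<in> topspace (mtop M)" and uv: "u \<in> tangent_space M q" "v \<in> tangent_space M q"
      and ind: "\<forall>a b. (\<forall>c. a *\<^sub>R u c + b *\<^sub>R v c = 0) \<longrightarrow> a = 0 \<and> b = 0"
    obtain c where c: "c \<in> atlas M" "q \<in> fst c" using q topspace_charts by blast
    have "isotropic c q k" using K[OF c] bspec[OF k q] by simp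
    then show "sectional_curvature M q u v = k" by (rule isotropic_sectional[OF c _ uv]) (rule ind[THEN spec, THEN spec, THEN mp])
  qed
qed

end

theorem theorem3:
  fixes M :: "('a, 'n::finite) riemannian" and m :: nat
  assumes "riemannian_manifold M" and "connected_space (mtop M)"
    and "CARD('n) = m + 1" and "m \<ge> 2"
  shows "constant_sectional_curvature M \<longleftrightarrow>
    (\<forall>p\<in>topspace (mtop M). \<exists>R\<^sub>0>0. \<forall>R. 0 < R \<and> R < R\<^sub>0 \<longrightarrow>
       hypersurface M (geodesic_sphere M p R) \<and>
       (\<forall>\<xi> I \<alpha> n \<kappa>.
          unit_normal_field M (geodesic_sphere M p R) \<xi> \<and>
          unit_speed_C2_curve M I \<alpha> \<and> \<alpha> ` I \<subseteq> geodesic_sphere M p R \<and>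
          RM_frame M m I \<alpha> n \<and> RM_curvatures M m I \<alpha> n \<kappa> \<longrightarrow>
          (\<exists>a :: nat \<Rightarrow> real. \<forall>s\<in>I.
             (\<Sum>i=1..m. a i * \<kappa> i s) = mean_curvature M (geodesic_sphere M p R) \<xi> (\<alpha> s) \<and>
             \<xi> (\<alpha> s) = lin_comb {1..m} a (\<lambda>i. n i s))))"
proof -
  interpret riem_manifold M by (rule riem_manifold.intro[OF assms(1)])
  have m1: "m \<ge> 1" using assms(4) by simp
  show ?thesis
    unfolding RM_property_def[symmetric]
  proof
    assume "constant_sectional_curvature M"
    then show "\<forall>p\<in>topspace (mtop M). \<exists>R\<^sub>0>0. \<forall>R. 0 < R \<and> R < R\<^sub>0 \<longrightarrow>
       hypersurface M (geodesic_sphere M p R) \<and> RM_property m p R"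
      by (intro ballI constant_curvature_imp_RM[OF _ assms(3) m1])
  next
    assume H: "\<forall>p\<in>topspace (mtop M). \<exists>R\<^sub>0>0. \<forall>R. 0 < R \<and> R < R\<^sub>0 \<longrightarrow>
       hypersurface M (geodesic_sphere M p R) \<and> RM_property m p R"
    show "constant_sectional_curvature M"
    proof (rule isotropic_imp_constant[OF assms(2)])
      show "CARD('n) \<ge> 3" using assms(3,4) by simp
      fix c q assume c: "c \<in> atlas M" "q \<in> fst c"
      then have "q \<in> topspace (mtop M)" using chart_subset by blast
      then obtain R0 where "R0 > 0" "\<And>R. 0 < R \<Longrightarrow> R < R0 \<Longrightarrow> RM_property m q R" using H by blast
      then show "\<exists>k. isotropic c q k" by (rule RM_imp_isotropic[OF assms(3,4) c])
    qed
  qed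
qed

end
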